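(* Let $n\ge3$, $1\le j\le n-1$, and let $P$ and $Q$ be origin-symmetric convex bodies with non-empty interior in $\mathbb{R}^n$ such that $P$ is the $j$-projection body of $Q$. Then $$S_j(P,\mathbb{S}^{n-1}\cap E)=\frac{\kappa_{n-j}}{\kappa_j}\,S_{n-j}(Q,\mathbb{S}^{n-1}\cap E^\perp)\qquad\text{for every } E\in\mathrm{Gr}_{n-j,n}.$$ Moreover, if $P$ is a polytope, then $Q$ is a polytope, and for every $F\in\mathrm{Gr}_{j,n}$, $P$ has a $j$-dimensional face whose affine hull is parallel to $F$ if and only if $Q$ has an $(n-j)$-dimensional face whose affine hull is parallel to $F^\perp$.
   Context: $K$ is called the $j$-projection body of $L$ if $\mathrm{vol}_j(K|E^\perp)=\mathrm{vol}_{n-j}(L|E)$ for every $E\in\mathrm{Gr}_{n-j,n}$, the Grassmannian of $(n-j)$-dimensional linear subspaces ($K|E$ orthogonal projection). $\kappa_m$ is the volume of the $m$-dimensional unit ball. $S_i(K,\cdot)$ is the area measure of order $i$, defined by $S_{n-1}(K+rB,\cdot)=\sum_{i=0}^{n-1}r^{n-1-i}\binom{n-1}{i}S_i(K,\cdot)$ for $r\ge0$, with $S_{n-1}$ the surface area measure and $B$ the unit ball. *)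

theory Defs
  imports "HOL-Analysis.Analysis"
begin

definition grassmannian :: "nat \<Rightarrow> 'a::euclidean_space set set" where
  "grassmannian k = {E. subspace E \<and> dim E = k}"

definition proj_set :: "'a::euclidean_space set \<Rightarrow> 'a set \<Rightarrow> 'a set" where
  "proj_set K E = {y \<in> E. \<exists>x\<in>K. \<forall>z\<in>E. inner (x - y) z = 0}"

text \<open>k-dimensional Lebesgue measure of a subset S of a k-dimensional linear subspace E:
  Lebesgue measure of the coordinate image of S with respect to an orthonormal basis of E.\<close>
definition subspace_vol :: "nat \<Rightarrow> 'a::euclidean_space set \<Rightarrow> 'a set \<Rightarrow> real" where
  "subspace_vol k E S =
     (let b = (SOME b :: nat \<Rightarrow> 'a. (\<forall>i<k. norm (b i) = 1) \<and>
                 (\<forall>i<k. \<forall>i'<k. i \<noteq> i' \<longrightarrow> inner (b i) (b i') = 0) \<and>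
                 span (b ` {..<k}) = E)
      in measure (Pi\<^sub>M {..<k} (\<lambda>_. lborel))
                 ((\<lambda>x. restrict (\<lambda>i. inner x (b i)) {..<k}) ` S))"

definition convex_body :: "'a::euclidean_space set \<Rightarrow> bool" where
  "convex_body K \<longleftrightarrow> compact K \<and> convex K \<and> K \<noteq> {}"

definition origin_symmetric :: "'a::euclidean_space set \<Rightarrow> bool" where
  "origin_symmetric K \<longleftrightarrow> (\<forall>x\<in>K. - x \<in> K)"

definition is_j_projection_body :: "nat \<Rightarrow> 'a::euclidean_space set \<Rightarrow> 'a set \<Rightarrow> bool" where
  "is_j_projection_body j K L \<longleftrightarrow>
     (\<forall>E\<in>grassmannian (DIM('a) - j).
        subspace_vol j (orthogonal_comp E) (proj_set K (orthogonal_comp E)) =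
        subspace_vol (DIM('a) - j) E (proj_set L E))"

definition hausdorff_pre :: "nat \<Rightarrow> real \<Rightarrow> 'a::euclidean_space set \<Rightarrow> ennreal" where
  "hausdorff_pre s \<delta> A =
     (INF C \<in> {C :: nat \<Rightarrow> 'a set. A \<subseteq> (\<Union>i. C i) \<and> (\<forall>i. bounded (C i) \<and> diameter (C i) \<le> \<delta>)}.
        (\<Sum>i. ennreal (unit_ball_vol (real s) * (diameter (C i) / 2) ^ s)))"

definition hausdorff_measure :: "nat \<Rightarrow> 'a::euclidean_space set \<Rightarrow> ennreal" where
  "hausdorff_measure s A = (SUP \<delta> \<in> {0<..}. hausdorff_pre s \<delta> A)"

definition rev_spherical_image :: "'a::euclidean_space set \<Rightarrow> 'a set \<Rightarrow> 'a set" where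
  "rev_spherical_image K \<omega> =
     {x \<in> frontier K. \<exists>u\<in>\<omega>. norm u = 1 \<and> (\<forall>y\<in>K. inner (y - x) u \<le> 0)}"

definition surface_area_measure :: "'a::euclidean_space set \<Rightarrow> 'a set \<Rightarrow> real" where
  "surface_area_measure K \<omega> =
     enn2real (hausdorff_measure (DIM('a) - 1) (rev_spherical_image K \<omega>))"

definition parallel_body :: "'a::euclidean_space set \<Rightarrow> real \<Rightarrow> 'a set" where
  "parallel_body K r = {x + r *\<^sub>R b | x b. x \<in> K \<and> b \<in> cball 0 1}"

text \<open>Area measures S_i(K, .), i = 0..n-1, defined as the (unique) coefficients in
  S_{n-1}(K + rB, \<omega>) = sum_i r^(n-1-i) (n-1 choose i) S_i(K, \<omega>) for all r \<ge> 0.\<close>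
definition area_measure :: "nat \<Rightarrow> 'a::euclidean_space set \<Rightarrow> 'a set \<Rightarrow> real" where
  "area_measure i K \<omega> =
     (THE c :: nat \<Rightarrow> real. (\<forall>m\<ge>DIM('a). c m = 0) \<and>
        (\<forall>r\<ge>0. surface_area_measure (parallel_body K r) \<omega> =
            (\<Sum>m<DIM('a). r ^ (DIM('a) - 1 - m) * real (DIM('a) - 1 choose m) * c m))) i"

end

theory Submission
  imports Defs "HOL-Computational_Algebra.Polynomial"
begin

text \<open>
  Let \<open>E\<close> be spanned by \<open>B\<close> and its complement by \<open>C\<close>. A local Steiner formula shows that the area measure of
  \<open>P\<close> on the sphere of \<open>E\<close> is, up to universal constants, the volume of \<open>suppset P B C\<close>: the average over
  the unit ball of \<open>E\<close> of the volumes of the support sets of \<open>P\<close>, projected to the complement of \<open>E\<close>.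

  Slicing expresses the volumes of the projections of \<open>P\<close> and \<open>Q\<close> to a rotating pair of complementary subspaces
  as integrals of support functions of sections. A second difference of these integrals in the rotation
  parameter isolates the points of \<open>P\<close> which maximize a direction \<open>u\<close> of \<open>E\<close> along a line parallel to \<open>b\<close>. For
  almost every point there is only one supergradient, so averaging over \<open>b\<close> leaves just the global maximizers,
  and the two averaged support sets agree up to the factor given by the unit balls.

  If \<open>P\<close> is a polytope, its planar sections are polygons with finitely many edge normals, which makes the support
  functions of sections of \<open>P\<close>, hence of \<open>Q\<close>, additive on small cones. This is impossible near a boundary
  point of \<open>Q\<close> touched by an inner ball unless its normal projects into one of finitely many lines; so there
  are finitely many such normals, and their halfspaces cut out \<open>Q\<close>. Faces parallel to a subspace are those
  for which the averaged support set has positive volume.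
\<close>

section \<open>Translation invariant measures\<close>

text \<open>The area measures rest on Hausdorff measure, but its normalisation is never computed: on
  every hyperplane it is the same multiple of Lebesgue measure, and that multiple cancels between
  \<open>P\<close> and \<open>Q\<close>. The second difference is
  \<open>2 h(b + s u) - h(b + 2 s u)\<close>, with \<open>h\<close> the support function of a
  section. As \<open>s\<close> grows it tends to the largest value of \<open>b\<close> on the face
  of the section in direction \<open>u\<close>. On the other body the rotation lets
  \<open>- b\<close> grow and keeps \<open>u\<close>, so the pair \<open>(u, b)\<close> for
  \<open>P\<close> corresponds to \<open>(- b, u)\<close> for \<open>Q\<close>. The obstacle is that
  the set measured in this way also contains points maximal only along one line. The height of
  \<open>P\<close> over its projection is concave, and at such a point it has a nonzero
  supergradient orthogonal to \<open>b\<close>; only uniqueness of this supergradient confines the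
  bad \<open>b\<close> to a null set. Hence both vectors must range over full unit balls: one ball
  is absorbed into \<open>suppset\<close>, the other survives as a constant. Inner balls enter for
  polytopes because near a touching point the boundary of \<open>Q\<close> leaves its tangent
  hyperplane only to second order, while additivity on a cone would require a deviation of first
  order.\<close>

lemma translation_invariant_emeasure:
  fixes M :: "'a::euclidean_space measure"
  assumes sets[measurable_cong]: "sets M = sets borel"
    and inv: "\<And>a. distr M borel (\<lambda>x. x + a) = M"
    and fin: "\<And>r. emeasure M (cball 0 r) < \<infinity>"
    and A[measurable]: "A \<in> sets borel"
  shows "emeasure M A = emeasure M (uminus -` cbox 0 One) * emeasure lborel A"
proof -
  have sp: "space M = UNIV" using sets by (metis sets_eq_imp_space_eq space_borel)
  interpret M: sigma_finite_measure M
  proof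
    show "\<exists>A. countable A \<and> A \<subseteq> sets M \<and> \<Union> A = space M \<and> (\<forall>a\<in>A. emeasure M a \<noteq> \<infinity>)"
    proof (intro exI[of _ "range (\<lambda>n::nat. cball 0 (real n))"] conjI)
      show "\<Union> (range (\<lambda>n::nat. cball (0::'a) (real n))) = space M"
        using real_arch_simple by (auto simp: sp)
      show "\<forall>a\<in>range (\<lambda>n::nat. cball (0::'a) (real n)). emeasure M a \<noteq> \<infinity>"
        using fin by (auto simp: less_top[symmetric])
    qed (auto simp: sets)
  qed
  interpret P: pair_sigma_finite M "lborel :: 'a measure" ..
  let ?T = "cbox (0::'a) One"
  have T[measurable]: "?T \<in> sets borel" by simp
  have shiftl: "(\<integral>\<^sup>+y. f (y + a) \<partial>lborel) = (\<integral>\<^sup>+y. f y \<partial>lborel)" if [measurable]: "f \<in> borel_measurable borel" for f and a :: 'a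
    by (subst (2) lborel_distr_plus[symmetric, of a]) (simp add: nn_integral_distr add.commute)
  have shiftm: "(\<integral>\<^sup>+x. f (x + a) \<partial>M) = (\<integral>\<^sup>+x. f x \<partial>M)" if [measurable]: "f \<in> borel_measurable borel" for f and a :: 'a
    by (subst (2) inv[symmetric, of a]) (simp add: nn_integral_distr)
  have one: "emeasure lborel ?T = 1"
    by (simp add: emeasure_lborel_cbox_eq)
  \<comment> \<open>Inserting the unit mass of a translated cube couples the two measures; after
    shifting \<open>x\<close> by \<open>y\<close> under \<open>M\<close> and exchanging the
    integrals the variables separate.\<close>
  have "emeasure M A = (\<integral>\<^sup>+x. indicator A x * (\<integral>\<^sup>+y. indicator ?T y \<partial>lborel) \<partial>M)"
    by (simp add: one)
  also have "\<dots> = (\<integral>\<^sup>+x. (\<integral>\<^sup>+y. indicator A x * indicator ?T (y - x) \<partial>lborel) \<partial>M)"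
    using shiftl[of "indicator ?T" "- _"] by (subst nn_integral_cmult) (auto intro!: nn_integral_cong)
  also have "\<dots> = (\<integral>\<^sup>+y. (\<integral>\<^sup>+x. indicator A x * indicator ?T (y - x) \<partial>M) \<partial>lborel)"
    by (rule P.Fubini'[symmetric]) measurable
  also have "\<dots> = (\<integral>\<^sup>+y. (\<integral>\<^sup>+x. indicator A (x + y) * indicator ?T (- x) \<partial>M) \<partial>lborel)"
  proof (rule nn_integral_cong)
    fix y :: 'a
    have [measurable]: "(\<lambda>x. indicator A x * indicator ?T (y - x) :: ennreal) \<in> borel_measurable borel" by measurable
    show "(\<integral>\<^sup>+x. indicator A x * indicator ?T (y - x) \<partial>M) = (\<integral>\<^sup>+x. indicator A (x + y) * indicator ?T (- x) \<partial>M)"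
      using shiftm[of "\<lambda>x. indicator A x * indicator ?T (y - x)" y] by simp
  qed
  also have "\<dots> = (\<integral>\<^sup>+x. (\<integral>\<^sup>+y. indicator A (x + y) * indicator ?T (- x) \<partial>lborel) \<partial>M)"
    by (rule P.Fubini') measurable
  also have "\<dots> = (\<integral>\<^sup>+x. indicator ?T (- x) * (\<integral>\<^sup>+y. indicator A (y + x) \<partial>lborel) \<partial>M)"
    by (intro nn_integral_cong, subst nn_integral_cmult[symmetric]) (auto simp: add.commute mult.commute)
  also have "\<dots> = (\<integral>\<^sup>+x. indicator (uminus -` ?T) x * emeasure lborel A \<partial>M)"
    by (intro nn_integral_cong) (simp add: shiftl indicator_vimage)
  also have "\<dots> = emeasure M (uminus -` ?T) * emeasure lborel A"
  proof -
    have "uminus -` ?T \<in> sets M"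
      using measurable_sets_borel[of uminus borel ?T] by (simp add: sets)
    then show ?thesis by (subst nn_integral_multc) auto
  qed
  finally show ?thesis .
qed

text \<open>A single test set of positive finite measure fixes the factor in the preceding
  proportionality.\<close>

lemma translation_invariant_eq_lborel:
  fixes M :: "'a::euclidean_space measure"
  assumes sets: "sets M = sets borel"
    and inv: "\<And>a. distr M borel (\<lambda>x. x + a) = M"
    and fin: "\<And>r. emeasure M (cball 0 r) < \<infinity>"
    and S: "S \<in> sets borel" "emeasure M S = emeasure lborel S" "emeasure lborel S \<noteq> 0" "emeasure lborel S \<noteq> \<infinity>"
  shows "M = lborel"
proof (rule measure_eqI)
  fix A assume "A \<in> sets M"
  then have A: "A \<in> sets borel" by (simp add: sets)
  note * = translation_invariant_emeasure[OF sets inv fin]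
  let ?c = "emeasure M (uminus -` cbox 0 One)"
  have "?c * emeasure lborel S = 1 * emeasure lborel S" using *[OF S(1)] S(2) by simp
  then have "?c = 1" using S(3,4)
    by (metis ennreal_mult_cancel_left infinity_ennreal_def mult.commute)
  with *[OF A] show "emeasure M A = emeasure lborel A" by simp
qed (simp add: sets)

text \<open>The image measure is translation invariant because \<open>U\<close> is linear and onto;
  the test set is the unit ball, which \<open>U\<close> preserves.\<close>

lemma lborel_distr_orthogonal:
  fixes U :: "'a::euclidean_space \<Rightarrow> 'a"
  assumes U: "orthogonal_transformation U"
  shows "distr lborel borel U = lborel"
proof (rule translation_invariant_eq_lborel)
  have lin: "linear U" using U by (rule orthogonal_transformation_linear)
  have [measurable]: "U \<in> borel_measurable borel"
    using lin by (intro borel_measurable_continuous_onI linear_continuous_on linear_conv_bounded_linear[THEN iffD1])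
  have vb: "U -` cball 0 r = cball 0 r" for r
    using U by (auto simp: orthogonal_transformation_norm)
  have emb: "emeasure (distr lborel borel U) (cball 0 r) = emeasure lborel (cball (0::'a) r)" for r
    by (simp add: emeasure_distr vb)
  show "emeasure (distr lborel borel U) (cball 0 r) < \<infinity>" for r
    using emb emeasure_lborel_cball_finite by metis
  show "emeasure (distr lborel borel U) (cball 0 1) = emeasure lborel (cball (0::'a) 1)" by (rule emb)
  show "emeasure lborel (cball (0::'a) 1) \<noteq> \<infinity>" using emeasure_lborel_cball_finite[of "0::'a" 1] by auto
  show "emeasure lborel (cball (0::'a) 1) \<noteq> 0"
    using unit_ball_vol_pos[of "real DIM('a)"] by (simp add: emeasure_cball less_imp_neq[symmetric] del: unit_ball_vol_pos)
  show "distr (distr lborel borel U) borel (\<lambda>x. x + a) = distr lborel borel U" for a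
  proof -
    obtain b where b: "a = U b" using U orthogonal_transformation_surj by (metis surjD)
    have "distr (distr lborel borel U) borel (\<lambda>x. x + a) = distr (distr lborel borel ((+) b)) borel U"
      by (subst (1 2) distr_distr) (auto simp: o_def b linear_add[OF lin] add.commute)
    then show ?thesis by (simp add: lborel_distr_plus)
  qed
qed auto

section \<open>Orthonormal sets and Lebesgue measure on subspaces\<close>

definition orthonormal :: "'a::euclidean_space set \<Rightarrow> bool" where
  "orthonormal B \<longleftrightarrow> pairwise orthogonal B \<and> (\<forall>v\<in>B. norm v = 1)"

text \<open>Orthogonal projection onto \<open>span B\<close> when \<open>B\<close> is orthonormal.
  The coordinate formula is linear and continuous for every \<open>B\<close>, so those facts need no
  side condition.\<close>

definition pr :: "'a::euclidean_space set \<Rightarrow> 'a \<Rightarrow> 'a" where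
  "pr B x = (\<Sum>v\<in>B. (x \<bullet> v) *\<^sub>R v)"

lemma orthonormal_independent: "orthonormal B \<Longrightarrow> independent B"
  by (metis norm_zero orthonormal_def pairwise_orthogonal_independent zero_neq_one)

lemma orthonormal_finite: "orthonormal B \<Longrightarrow> finite B"
  using independent_imp_finite orthonormal_independent by blast

lemma orthonormal_subset: "orthonormal B \<Longrightarrow> C \<subseteq> B \<Longrightarrow> orthonormal C"
  unfolding orthonormal_def by (meson pairwise_subset subsetD)

lemma orthonormal_inner: "orthonormal B \<Longrightarrow> v \<in> B \<Longrightarrow> w \<in> B \<Longrightarrow> v \<bullet> w = (if v = w then 1 else 0)"
  unfolding orthonormal_def pairwise_def orthogonal_def by (auto simp: norm_eq_1)

lemma orthonormal_inner_sum:
  assumes "orthonormal B" "C \<subseteq> B" "v \<in> B"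
  shows "(\<Sum>w\<in>C. f w *\<^sub>R w) \<bullet> v = (if v \<in> C then f v else 0)"
proof -
  have "(\<Sum>w\<in>C. f w *\<^sub>R w) \<bullet> v = (\<Sum>w\<in>C. if w = v then f w else 0)"
    using assms orthonormal_inner[OF assms(1)] by (auto simp: inner_sum_left intro!: sum.cong)
  also have "\<dots> = (if v \<in> C then f v else 0)"
    using finite_subset[OF assms(2) orthonormal_finite[OF assms(1)]] by (simp add: sum.delta')
  finally show ?thesis .
qed

lemma linear_pr [simp]: "linear (pr B)"
  unfolding pr_def by (intro linear_compose_sum ballI) (auto intro!: linearI simp: inner_add_left scaleR_add_left)

lemmas pr_add = linear_add[OF linear_pr]
lemmas pr_diff = linear_diff[OF linear_pr]
lemmas pr_scaleR = linear_scale[OF linear_pr]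
lemmas pr_minus = linear_neg[OF linear_pr]

lemma pr_0 [simp]: "pr B 0 = 0" by (simp add: pr_def)

lemma continuous_on_pr [continuous_intros]: "continuous_on S f \<Longrightarrow> continuous_on S (\<lambda>x. pr B (f x))"
  unfolding pr_def by (intro continuous_intros)

lemma tendsto_pr [tendsto_intros]: "(f \<longlongrightarrow> l) F \<Longrightarrow> ((\<lambda>x. pr B (f x)) \<longlongrightarrow> pr B l) F"
  unfolding pr_def by (intro tendsto_intros)

lemma borel_measurable_pr [measurable]: "pr B \<in> borel_measurable borel"
  by (intro borel_measurable_continuous_onI continuous_intros)

lemma pr_in_span [simp]: "pr B x \<in> span B"
  unfolding pr_def by (intro span_sum span_scale span_base)

lemma pr_inner: "orthonormal B \<Longrightarrow> v \<in> B \<Longrightarrow> pr B x \<bullet> v = x \<bullet> v"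
  unfolding pr_def by (subst orthonormal_inner_sum) auto

lemma pr_inner_span: "orthonormal B \<Longrightarrow> v \<in> span B \<Longrightarrow> pr B x \<bullet> v = x \<bullet> v"
  using orthogonal_to_span[of v B "pr B x - x"] pr_inner[of B _ x]
  by (auto simp: orthogonal_def inner_diff_left inner_commute inner_diff_right)

lemma pr_eqI:
  assumes B: "orthonormal B" and y: "y \<in> span B" and "\<And>v. v \<in> B \<Longrightarrow> x \<bullet> v = y \<bullet> v"
  shows "pr B x = y"
proof -
  have *: "(pr B x - y) \<bullet> v = 0" if "v \<in> B" for v
    using assms(3)[OF that] by (simp add: inner_diff_left pr_inner[OF B that])
  have "orthogonal (pr B x - y) (pr B x - y)"
    by (rule orthogonal_to_span[OF span_diff[OF pr_in_span y]]) (simp add: orthogonal_def *)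
  then show ?thesis by (simp add: orthogonal_def)
qed

lemma pr_id: "orthonormal B \<Longrightarrow> y \<in> span B \<Longrightarrow> pr B y = y"
  by (rule pr_eqI) auto

lemma pr_span_eq: "orthonormal B \<Longrightarrow> orthonormal B' \<Longrightarrow> span B = span B' \<Longrightarrow> pr B x = pr B' x"
  by (rule pr_eqI) (metis pr_in_span pr_inner_span span_base)+

lemma pr_eq_0: "(\<And>v. v \<in> B \<Longrightarrow> x \<bullet> v = 0) \<Longrightarrow> pr B x = 0"
  by (simp add: pr_def)

lemma pr_Un: "finite B \<Longrightarrow> finite C \<Longrightarrow> B \<inter> C = {} \<Longrightarrow> pr (B \<union> C) x = pr B x + pr C x"
  unfolding pr_def by (rule sum.union_disjoint)

lemma pr_insert: "finite B \<Longrightarrow> v \<notin> B \<Longrightarrow> pr (insert v B) x = (x \<bullet> v) *\<^sub>R v + pr B x"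
  by (simp add: pr_def)

lemma norm_pr_le: assumes "orthonormal B" shows "norm (pr B x) \<le> norm x"
proof -
  have "(norm (pr B x))\<^sup>2 = x \<bullet> pr B x" by (simp add: power2_norm_eq_inner pr_inner_span assms)
  also have "\<dots> \<le> norm x * norm (pr B x)" by (rule norm_cauchy_schwarz)
  finally show ?thesis by (simp add: power2_eq_square mult_le_cancel_right) (metis norm_ge_zero le_zero_eq less_eq_real_def norm_le_zero_iff order.trans)
qed

lemma span_orthogonal:
  assumes "orthonormal (B \<union> C)" "B \<inter> C = {}" "x \<in> span B" "y \<in> span C"
  shows "x \<bullet> y = 0"
proof -
  have "orthogonal x y"
  proof (rule orthogonal_to_span[OF assms(4)])
    fix c assume c: "c \<in> C"
    have "orthogonal c x"
      by (rule orthogonal_to_span[OF assms(3)]) (use assms(1,2) c orthonormal_inner[OF assms(1)] in \<open>auto simp: orthogonal_def\<close>)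
    then show "orthogonal x c" by (simp add: orthogonal_commute)
  qed
  then show ?thesis by (simp add: orthogonal_def)
qed

lemma pr_pr_orth:
  assumes "orthonormal (B \<union> C)" "B \<inter> C = {}" "x \<in> span B" shows "pr C x = 0"
  by (rule pr_eq_0) (use span_orthogonal[OF assms] span_base in blast)

lemma orthonormal_Un:
  assumes "orthonormal A" "orthonormal B" "\<And>a b. a \<in> A \<Longrightarrow> b \<in> B \<Longrightarrow> a \<bullet> b = 0"
  shows "orthonormal (A \<union> B)" "A \<inter> B = {}"
proof -
  have "b \<bullet> a = 0" if "a \<in> A" "b \<in> B" for a b using assms(3)[OF that] by (simp add: inner_commute)
  then show "orthonormal (A \<union> B)"
    using assms unfolding orthonormal_def pairwise_def orthogonal_def by auto
  show "A \<inter> B = {}"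
  proof (rule ccontr)
    assume "A \<inter> B \<noteq> {}"
    then obtain v where "v \<in> A" "v \<in> B" by blast
    then show False using assms(1) assms(3)[of v v] by (auto simp: orthonormal_def)
  qed
qed

lemma pr_decomp:
  assumes "orthonormal (B \<union> C)" "B \<inter> C = {}" "span (B \<union> C) = UNIV"
  shows "pr B x + pr C x = x"
  using pr_Un[of B C x] pr_id[OF assms(1), of x] assms(2,3) orthonormal_finite[OF assms(1)] by simp

lemma pr_split:
  assumes BC: "orthonormal (B \<union> C)" "B \<inter> C = {}" and "b \<in> span B" "w \<in> span C"
  shows "pr B (b + w) = b" "pr C (b + w) = w"
proof -
  have "orthonormal B" "orthonormal C" using BC orthonormal_subset by blast+
  then show "pr B (b + w) = b" "pr C (b + w) = w"
    using assms pr_pr_orth[OF BC, of b] pr_pr_orth[of C B w] by (simp_all add: pr_id pr_add Un_commute Int_commute)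
qed

lemma orthonormal_basis_of:
  fixes E :: "'a::euclidean_space set" assumes "subspace E"
  obtains B where "orthonormal B" "span B = E" "card B = dim E"
  using orthonormal_basis_subspace[OF assms] unfolding orthonormal_def by metis

lemma orthonormal_card: "orthonormal B \<Longrightarrow> card B = dim (span B)"
  by (simp add: dim_eq_card_independent orthonormal_independent)

lemma orthonormal_full: "orthonormal B \<Longrightarrow> span B = (UNIV::'a::euclidean_space set) \<Longrightarrow> card B = DIM('a)"
  using orthonormal_card[of B] by simp

lemma orthonormal_extend:
  fixes B :: "'a::euclidean_space set"
  assumes B: "orthonormal B"
  obtains C where "orthonormal (B \<union> C)" "B \<inter> C = {}" "span (B \<union> C) = UNIV" "span C = orthogonal_comp (span B)" "card C = DIM('a) - card B"
proof -
  obtain C where C: "orthonormal C" "span C = orthogonal_comp (span B)"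
    using orthonormal_basis_of[OF subspace_orthogonal_comp] by metis
  have orth: "b \<bullet> c = 0" if "b \<in> B" "c \<in> C" for b c
    using that C(2) span_base[of c C] span_base[of b B] by (auto simp: orthogonal_comp_def orthogonal_def)
  note BC = orthonormal_Un(1)[OF B C(1) orth] and dis = orthonormal_Un(2)[OF B C(1) orth]
  have full: "span (B \<union> C) = UNIV"
    using subspace_sum_orthogonal_comp[OF subspace_span[of B]] C(2)
    by (simp add: span_Un set_plus_def set_eq_iff) metis
  have "card (B \<union> C) = DIM('a)" by (rule orthonormal_full[OF BC full])
  then have "card C = DIM('a) - card B"
    using card_Un_disjoint[OF orthonormal_finite[OF B] orthonormal_finite[OF C(1)] dis] by simp
  with BC dis full C(2) show ?thesis by (intro that)
qed

text \<open>Lebesgue measure of \<open>span B\<close> for orthonormal \<open>B\<close>, carried by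
  the ambient space so that functions on the whole space can be integrated over sums
  \<open>y + z\<close>. For empty \<open>B\<close> it is the point mass at 0.\<close>

definition lam :: "'a::euclidean_space set \<Rightarrow> 'a measure" where
  "lam B = distr (Pi\<^sub>M B (\<lambda>_. lborel)) borel (\<lambda>f. \<Sum>v\<in>B. f v *\<^sub>R v)"

lemma sets_lam [simp, measurable_cong]: "sets (lam B) = sets borel"
  and space_lam [simp]: "space (lam B) = UNIV"
  by (simp_all add: lam_def)

lemma measurable_lam_sum [measurable]:
  "(\<lambda>f. \<Sum>v\<in>(B::'a::euclidean_space set). f v *\<^sub>R v) \<in> Pi\<^sub>M B (\<lambda>_. lborel) \<rightarrow>\<^sub>M borel"
proof (rule borel_measurable_sum)
  fix v assume "v \<in> B"
  then have "(\<lambda>f. f v) \<in> borel_measurable (Pi\<^sub>M B (\<lambda>_. lborel))"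
    using measurable_component_singleton[of v B "\<lambda>_. lborel"] by simp
  then show "(\<lambda>f. f v *\<^sub>R v) \<in> borel_measurable (Pi\<^sub>M B (\<lambda>_. lborel))"
    by (intro borel_measurable_scaleR) auto
qed

interpretation PL: product_sigma_finite "\<lambda>_. lborel :: real measure" by standard

lemma nn_integral_lam_empty: "f \<in> borel_measurable borel \<Longrightarrow> (\<integral>\<^sup>+x. f x \<partial>lam {}) = f 0"
  by (simp add: lam_def nn_integral_distr PiM_empty nn_integral_count_space_finite)

lemma nn_integral_lam_insert:
  assumes B: "finite B" "v \<notin> B" and [measurable]: "f \<in> borel_measurable borel"
  shows "(\<integral>\<^sup>+x. f x \<partial>lam (insert v B)) = (\<integral>\<^sup>+y. (\<integral>\<^sup>+t. f (y + t *\<^sub>R v) \<partial>lborel) \<partial>lam B)"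
proof -
  have [simp]: "(\<Sum>a\<in>B. (x(v := t)) a *\<^sub>R a) = (\<Sum>a\<in>B. x a *\<^sub>R a)" for x :: "'a \<Rightarrow> real" and t
    using B by (intro sum.cong) auto
  have "(\<integral>\<^sup>+x. f x \<partial>lam (insert v B)) = (\<integral>\<^sup>+g. f (\<Sum>a\<in>insert v B. g a *\<^sub>R a) \<partial>Pi\<^sub>M (insert v B) (\<lambda>_. lborel))"
    unfolding lam_def by (rule nn_integral_distr) measurable
  also have "\<dots> = (\<integral>\<^sup>+g. (\<integral>\<^sup>+t. f (\<Sum>a\<in>insert v B. (g(v := t)) a *\<^sub>R a) \<partial>lborel) \<partial>Pi\<^sub>M B (\<lambda>_. lborel))"
    by (rule PL.product_nn_integral_insert[OF B]) measurable
  also have "\<dots> = (\<integral>\<^sup>+g. (\<integral>\<^sup>+t. f ((\<Sum>a\<in>B. g a *\<^sub>R a) + t *\<^sub>R v) \<partial>lborel) \<partial>Pi\<^sub>M B (\<lambda>_. lborel))"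
    using B by (simp add: add.commute del: fun_upd_apply) (simp add: add.commute)
  also have "\<dots> = (\<integral>\<^sup>+y. (\<integral>\<^sup>+t. f (y + t *\<^sub>R v) \<partial>lborel) \<partial>lam B)"
    unfolding lam_def by (rule nn_integral_distr[symmetric]) measurable
  finally show ?thesis .
qed

lemma nn_integral_lam_Un:
  assumes B: "finite B" and C: "finite C" and "B \<inter> C = {}" and [measurable]: "f \<in> borel_measurable borel"
  shows "(\<integral>\<^sup>+x. f x \<partial>lam (B \<union> C)) = (\<integral>\<^sup>+y. (\<integral>\<^sup>+z. f (y + z) \<partial>lam C) \<partial>lam B)"
  using C assms(3,4)
proof (induction C arbitrary: f rule: finite_induct)
  case empty
  then show ?case by (simp add: nn_integral_lam_empty)
next
  case (insert v C)
  note [measurable] = insert.prems(2)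
  have "(\<integral>\<^sup>+x. f x \<partial>lam (B \<union> insert v C)) = (\<integral>\<^sup>+x. (\<integral>\<^sup>+t. f (x + t *\<^sub>R v) \<partial>lborel) \<partial>lam (B \<union> C))"
    using insert B by (simp add: nn_integral_lam_insert)
  also have "\<dots> = (\<integral>\<^sup>+y. (\<integral>\<^sup>+z. (\<integral>\<^sup>+t. f (y + z + t *\<^sub>R v) \<partial>lborel) \<partial>lam C) \<partial>lam B)"
    using insert by (subst insert.IH) (auto simp: add_ac)
  also have "\<dots> = (\<integral>\<^sup>+y. (\<integral>\<^sup>+z. f (y + z) \<partial>lam (insert v C)) \<partial>lam B)"
    using insert by (simp add: nn_integral_lam_insert add_ac)
  finally show ?case .
qed

lemma norm_orthonormal_sum:
  assumes "orthonormal B" shows "norm (\<Sum>v\<in>B. f v *\<^sub>R v) = sqrt (\<Sum>v\<in>B. (f v)\<^sup>2)"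
proof -
  have "(\<Sum>v\<in>B. f v *\<^sub>R v) \<bullet> (\<Sum>v\<in>B. f v *\<^sub>R v) = (\<Sum>v\<in>B. f v * ((\<Sum>w\<in>B. f w *\<^sub>R w) \<bullet> v))"
    by (simp add: inner_sum_right)
  also have "\<dots> = (\<Sum>v\<in>B. (f v)\<^sup>2)"
    using assms by (intro sum.cong) (auto simp: orthonormal_inner_sum power2_eq_square)
  finally show ?thesis by (simp add: norm_eq_sqrt_inner)
qed

lemma emeasure_lam_cball:
  assumes "orthonormal B" "r > 0"
  shows "emeasure (lam B) (cball 0 r) = ennreal (unit_ball_vol (real (card B)) * r ^ card B)"
proof -
  have "emeasure (lam B) (cball 0 r) = emeasure (Pi\<^sub>M B (\<lambda>_. lborel))
             ({f. sqrt (\<Sum>i\<in>B. (f i)\<^sup>2) \<le> r} \<inter> space (Pi\<^sub>M B (\<lambda>_. lborel)))"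
    unfolding lam_def using assms
    by (subst emeasure_distr) (auto simp: norm_orthonormal_sum vimage_def intro!: arg_cong2[where f=emeasure])
  also have "\<dots> = ennreal (unit_ball_vol (real (card B)) * r ^ card B)"
    by (rule emeasure_cball_aux[OF orthonormal_finite[OF assms(1)] assms(2)])
  finally show ?thesis .
qed

lemma emeasure_lam_bounded:
  assumes "orthonormal B" "bounded S" shows "emeasure (lam B) S < \<infinity>"
proof -
  obtain r where "r > 0" "S \<subseteq> cball 0 r" using assms(2)  by (metis bounded_subset_ballD ball_subset_cball subset_trans)
  then have "emeasure (lam B) S \<le> emeasure (lam B) (cball 0 r)" by (intro emeasure_mono) auto
  then show ?thesis using emeasure_lam_cball[OF assms(1) \<open>r > 0\<close>] by (auto simp: le_less_trans)
qed

lemma sigma_finite_if_cball_finite: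
  fixes M :: "'a::euclidean_space measure"
  assumes M: "sets M = sets borel" "\<And>r. emeasure M (cball 0 r) < \<infinity>"
  shows "sigma_finite_measure M"
proof
  show "\<exists>A. countable A \<and> A \<subseteq> sets M \<and> \<Union> A = space M \<and> (\<forall>a\<in>A. emeasure M a \<noteq> \<infinity>)"
    using M real_arch_simple sets_eq_imp_space_eq[OF M(1)]
    by (intro exI[of _ "range (\<lambda>n::nat. cball 0 (real n))"]) (auto simp: less_top[symmetric])
qed

lemma sigma_finite_lam: assumes "orthonormal B" shows "sigma_finite_measure (lam B)"
  using emeasure_lam_bounded[OF assms bounded_cball] by (intro sigma_finite_if_cball_finite) auto

text \<open>In coordinates the translation shifts every factor separately, and each factor is
  Lebesgue measure on the line.\<close>

lemma distr_lam_translate: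
  assumes B: "orthonormal B" and a: "a \<in> span B"
  shows "distr (lam B) borel (\<lambda>x. x + a) = lam B"
proof -
  let ?M = "Pi\<^sub>M B (\<lambda>_. lborel :: real measure)"
  have fin: "finite B" using B by (rule orthonormal_finite)
  let ?t = "\<lambda>f. \<lambda>v\<in>B. f v + a \<bullet> v"
  have t[measurable]: "?t \<in> ?M \<rightarrow>\<^sub>M ?M"
    by measurable
  have eq: "distr ?M ?M ?t = ?M"
  proof (rule PL.PiM_eqI[OF fin])
    fix A assume A: "\<And>i. i \<in> B \<Longrightarrow> A i \<in> sets (lborel :: real measure)"
    have m: "(\<lambda>x. x + a \<bullet> i) -` A i \<in> sets lborel" if "i \<in> B" for i
      using measurable_sets_borel[of "\<lambda>x::real. x + a \<bullet> i" borel "A i"] A[OF that] by simp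
    have "Pi\<^sub>E B A \<in> sets ?M" using fin A by (rule sets_PiM_I_finite)
    then have "emeasure (distr ?M ?M ?t) (Pi\<^sub>E B A)
      = emeasure ?M (Pi\<^sub>E B (\<lambda>i. (\<lambda>x. x + a \<bullet> i) -` A i))"
      by (subst emeasure_distr[OF t]) (auto intro!: arg_cong2[where f=emeasure] simp: space_PiM PiE_def Pi_def)
    also have "\<dots> = (\<Prod>i\<in>B. emeasure lborel ((\<lambda>x. x + a \<bullet> i) -` A i))"
      by (rule PL.emeasure_PiM[OF fin m])
    also have "\<dots> = (\<Prod>i\<in>B. emeasure lborel (A i))"
    proof (rule prod.cong[OF refl])
      fix i assume "i \<in> B"
      have "emeasure lborel (A i) = emeasure (distr lborel borel ((+) (a \<bullet> i))) (A i)" by (simp add: lborel_distr_plus)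
      also have "\<dots> = emeasure lborel ((\<lambda>x. x + a \<bullet> i) -` A i)"
        using A[OF \<open>i \<in> B\<close>] by (subst emeasure_distr) (auto simp: vimage_def add.commute)
      finally show "emeasure lborel ((\<lambda>x. x + a \<bullet> i) -` A i) = emeasure lborel (A i)" ..
    qed
    finally show "emeasure (distr ?M ?M ?t) (Pi\<^sub>E B A) = (\<Prod>i\<in>B. emeasure lborel (A i))" .
  qed simp
  have "distr (lam B) borel (\<lambda>x. x + a) = distr ?M borel (\<lambda>f. (\<Sum>v\<in>B. f v *\<^sub>R v) + a)"
    unfolding lam_def by (subst distr_distr) (auto simp: o_def)
  also have "\<dots> = distr (distr ?M ?M ?t) borel (\<lambda>f. \<Sum>v\<in>B. f v *\<^sub>R v)"
    using pr_id[OF B a] by (subst distr_distr) (auto simp: o_def scaleR_add_left sum.distrib pr_def intro!: distr_cong)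
  also have "\<dots> = lam B" by (simp add: eq lam_def)
  finally show ?thesis .
qed

lemma lam_full:
  fixes B :: "'a::euclidean_space set"
  assumes B: "orthonormal B" and full: "span B = UNIV"
  shows "lam B = lborel"
proof (rule translation_invariant_eq_lborel)
  show "distr (lam B) borel (\<lambda>x. x + a) = lam B" for a using B full by (intro distr_lam_translate) auto
  show "emeasure (lam B) (cball 0 r) < \<infinity>" for r using B by (intro emeasure_lam_bounded) auto
  show "emeasure (lam B) (cball 0 1) = emeasure lborel (cball (0::'a) 1)"
    using B orthonormal_full[OF B full] by (simp add: emeasure_lam_cball emeasure_cball)
  show "emeasure lborel (cball (0::'a) 1) \<noteq> \<infinity>" using emeasure_lborel_cball_finite[of "0::'a" 1] by auto
  show "emeasure lborel (cball (0::'a) 1) \<noteq> 0"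
    using unit_ball_vol_pos[of "real DIM('a)"] by (simp add: emeasure_cball less_imp_neq[symmetric] del: unit_ball_vol_pos)
qed auto

lemma AE_lam_span: "AE x in lam B. x \<in> span B"
proof -
  have "(\<Sum>v\<in>B. f v *\<^sub>R v) \<in> span B" for f by (intro span_sum span_scale span_base)
  moreover have "{x \<in> space borel. x \<in> span B} \<in> sets borel"
    using closed_subspace[OF subspace_span[of B]] by (simp add: borel_closed)
  ultimately show ?thesis unfolding lam_def by (subst AE_distr_iff) auto
qed

lemma nn_integral_lborel_split:
  assumes "orthonormal (B \<union> C)" "B \<inter> C = {}" "span (B \<union> C) = UNIV" and [measurable]: "f \<in> borel_measurable borel"
  shows "(\<integral>\<^sup>+x. f x \<partial>lborel) = (\<integral>\<^sup>+y. (\<integral>\<^sup>+z. f (y + z) \<partial>lam C) \<partial>lam B)"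
  using nn_integral_lam_Un[of B C f] assms lam_full[OF assms(1,3)] orthonormal_finite[OF assms(1)] by simp

lemma emeasure_lborel_pr_prod:
  assumes BC: "orthonormal (B \<union> C)" "B \<inter> C = {}" "span (B \<union> C) = UNIV"
    and S[measurable]: "S \<in> sets borel" and T[measurable]: "T \<in> sets borel"
  shows "emeasure lborel {x. pr B x \<in> S \<and> pr C x \<in> T} = emeasure (lam B) S * emeasure (lam C) T"
proof -
  let ?X = "{x. pr B x \<in> S \<and> pr C x \<in> T}"
  have B: "orthonormal B" and C: "orthonormal C" using BC orthonormal_subset by blast+
  have m: "?X \<in> sets borel"
    using measurable_sets_borel[OF borel_measurable_pr S] measurable_sets_borel[OF borel_measurable_pr T]
    by (simp add: vimage_def Collect_conj_eq sets.Int)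
  have "emeasure lborel ?X = (\<integral>\<^sup>+x. indicator ?X x \<partial>lborel)"
    using m by simp
  also have "\<dots> = (\<integral>\<^sup>+y. (\<integral>\<^sup>+z. indicator ?X (y + z) \<partial>lam C) \<partial>lam B)"
    using m by (intro nn_integral_lborel_split BC) auto
  also have "\<dots> = (\<integral>\<^sup>+y. (\<integral>\<^sup>+z. indicator S y * indicator T z \<partial>lam C) \<partial>lam B)"
  proof (rule nn_integral_cong_AE, use AE_lam_span[of B] in eventually_elim)
    fix y assume y: "y \<in> span B"
    show "(\<integral>\<^sup>+z. indicator ?X (y + z) \<partial>lam C) = (\<integral>\<^sup>+z. indicator S y * indicator T z \<partial>lam C)"
    proof (rule nn_integral_cong_AE, use AE_lam_span[of C] in eventually_elim)
      fix z assume z: "z \<in> span C"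
      show "indicator ?X (y + z) = (indicator S y * indicator T z :: ennreal)"
        by (simp add: indicator_def pr_split[OF BC(1,2) y z])
    qed
  qed
  also have "\<dots> = emeasure (lam B) S * emeasure (lam C) T"
    by (simp add: nn_integral_cmult nn_integral_multc)
  finally show ?thesis .
qed

text \<open>Both bases are completed by the same \<open>C\<close>. The product formula gives equal
  products, and the positive finite factor from the unit ball of \<open>span C\<close> cancels. This
  independence makes the arbitrary basis inside \<open>subspace_vol\<close> harmless.\<close>

lemma lam_span_eq:
  assumes B: "orthonormal B" and B': "orthonormal B'" and eq: "span B = span B'"
  shows "lam B = lam B'"
proof (rule measure_eqI)
  fix S assume "S \<in> sets (lam B)" then have S: "S \<in> sets borel" by simp
  obtain C where C: "orthonormal (B \<union> C)" "B \<inter> C = {}" "span (B \<union> C) = UNIV" "span C = orthogonal_comp (span B)"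
    using orthonormal_extend[OF B] by metis
  have onC: "orthonormal C" using C(1) orthonormal_subset by blast
  have orth: "b \<bullet> c = 0" if "b \<in> B'" "c \<in> C" for b c
    using that C(4) span_base[of c C] span_base[of b B'] eq by (auto simp: orthogonal_comp_def orthogonal_def)
  note BC = orthonormal_Un(1)[OF B' onC orth] and dis = orthonormal_Un(2)[OF B' onC orth]
  have full: "span (B' \<union> C) = UNIV" using C(3) eq by (simp add: span_Un)
  have "emeasure (lam B) S * emeasure (lam C) (cball 0 1) = emeasure (lam B') S * emeasure (lam C) (cball 0 1)"
    using emeasure_lborel_pr_prod[OF C(1-3) S, of "cball 0 1"] emeasure_lborel_pr_prod[OF BC dis full S, of "cball 0 1"]
    by (simp add: pr_span_eq[OF B B' eq])
  moreover have "emeasure (lam C) (cball 0 1) \<noteq> 0" "emeasure (lam C) (cball 0 1) \<noteq> \<infinity>"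
    using unit_ball_vol_pos[of "real (card C)"] by (simp_all add: emeasure_lam_cball[OF onC] less_imp_neq[symmetric] del: unit_ball_vol_pos)
  ultimately show "emeasure (lam B) S = emeasure (lam B') S"
    by (metis ennreal_mult_cancel_left infinity_ennreal_def mult.commute)
qed simp

lemma nn_integral_lam_scale:
  fixes B :: "'a::euclidean_space set"
  assumes "finite B" "f \<in> borel_measurable borel" "r > 0"
  shows "(\<integral>\<^sup>+x. f x \<partial>lam B) = ennreal (r ^ card B) * (\<integral>\<^sup>+x. f (r *\<^sub>R x) \<partial>lam B)"
  using assms
proof (induction B arbitrary: f rule: finite_induct)
  case empty
  then show ?case using nn_integral_lam_empty[of f] nn_integral_lam_empty[of "\<lambda>x. f (r *\<^sub>R x)"] by simp
next
  case (insert v B)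
  note [measurable] = insert.prems(1)
  have 1: "(\<integral>\<^sup>+t. f (r *\<^sub>R y + t *\<^sub>R v) \<partial>lborel) = ennreal r * (\<integral>\<^sup>+t. f (r *\<^sub>R (y + t *\<^sub>R v)) \<partial>lborel)" for y
    using nn_integral_real_affine[of "\<lambda>t. f (r *\<^sub>R y + t *\<^sub>R v)" r 0] insert.prems(2) by (simp add: scaleR_add_right)
  have "(\<integral>\<^sup>+x. f x \<partial>lam (insert v B)) = (\<integral>\<^sup>+y. (\<integral>\<^sup>+t. f (y + t *\<^sub>R v) \<partial>lborel) \<partial>lam B)"
    using insert by (intro nn_integral_lam_insert) auto
  also have "\<dots> = ennreal (r ^ card B) * (\<integral>\<^sup>+y. (\<integral>\<^sup>+t. f (r *\<^sub>R y + t *\<^sub>R v) \<partial>lborel) \<partial>lam B)"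
    using insert.prems(2) by (intro insert.IH) auto
  also have "\<dots> = ennreal (r ^ card B) * (ennreal r * (\<integral>\<^sup>+x. f (r *\<^sub>R x) \<partial>lam (insert v B)))"
    unfolding 1 using insert.hyps by (simp add: nn_integral_lam_insert nn_integral_cmult)
  finally show ?case using insert by (simp add: ennreal_mult mult_ac)
qed

text \<open>The Jacobian of stretching the \<open>B\<close> component alone; it is the source of the
  powers of \<open>r\<close> in the Steiner polynomial.\<close>

lemma nn_integral_lborel_scale:
  assumes BC: "orthonormal (B \<union> C)" "B \<inter> C = {}" "span (B \<union> C) = UNIV" and r: "r > 0"
    and [measurable]: "f \<in> borel_measurable borel"
  shows "(\<integral>\<^sup>+x. f x \<partial>lborel) = ennreal (r ^ card B) * (\<integral>\<^sup>+x. f (r *\<^sub>R pr B x + pr C x) \<partial>lborel)"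
proof -
  have B: "orthonormal B" and C: "orthonormal C" using BC orthonormal_subset by blast+
  interpret C: sigma_finite_measure "lam C" by (rule sigma_finite_lam[OF C])
  have eq: "r *\<^sub>R pr B (y + z) + pr C (y + z) = r *\<^sub>R y + z" if "y \<in> span B" "z \<in> span C" for y z
    using pr_split[OF BC(1,2) that] by simp
  have "(\<integral>\<^sup>+x. f x \<partial>lborel) = (\<integral>\<^sup>+y. (\<integral>\<^sup>+z. f (y + z) \<partial>lam C) \<partial>lam B)"
    by (rule nn_integral_lborel_split[OF BC]) simp
  also have "\<dots> = ennreal (r ^ card B) * (\<integral>\<^sup>+y. (\<integral>\<^sup>+z. f (r *\<^sub>R y + z) \<partial>lam C) \<partial>lam B)"
    by (rule nn_integral_lam_scale[OF orthonormal_finite[OF B] _ r]) measurable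
  also have "(\<integral>\<^sup>+y. (\<integral>\<^sup>+z. f (r *\<^sub>R y + z) \<partial>lam C) \<partial>lam B) = (\<integral>\<^sup>+y. (\<integral>\<^sup>+z. f (r *\<^sub>R pr B (y + z) + pr C (y + z)) \<partial>lam C) \<partial>lam B)"
  proof (rule nn_integral_cong_AE)
    show "AE y in lam B. (\<integral>\<^sup>+z. f (r *\<^sub>R y + z) \<partial>lam C) = (\<integral>\<^sup>+z. f (r *\<^sub>R pr B (y + z) + pr C (y + z)) \<partial>lam C)"
      using AE_lam_span[of B] by eventually_elim (use AE_lam_span[of C] eq in \<open>auto intro!: nn_integral_cong_AE elim!: eventually_mono\<close>)
  qed
  also have "\<dots> = (\<integral>\<^sup>+x. f (r *\<^sub>R pr B x + pr C x) \<partial>lborel)"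
    by (rule nn_integral_lborel_split[OF BC, symmetric]) measurable
  finally show ?thesis .
qed

section \<open>Hausdorff measure\<close>

definition hcovers :: "real \<Rightarrow> 'a::euclidean_space set \<Rightarrow> (nat \<Rightarrow> 'a set) set" where
  "hcovers \<delta> A = {C. A \<subseteq> (\<Union>i. C i) \<and> (\<forall>i. bounded (C i) \<and> diameter (C i) \<le> \<delta>)}"

text \<open>The summand in \<open>hausdorff_pre\<close>. For \<open>s = 0\<close> the empty set
  would weigh 1; the recurring assumption \<open>s > 0\<close> allows covers to be padded by empty
  sets.\<close>

definition hweight :: "nat \<Rightarrow> 'a::euclidean_space set \<Rightarrow> ennreal" where
  "hweight s C = ennreal (unit_ball_vol (real s) * (diameter C / 2) ^ s)"

lemma hausdorff_pre_alt: "hausdorff_pre s \<delta> A = (INF C\<in>hcovers \<delta> A. \<Sum>i. hweight s (C i))"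
  by (simp add: hausdorff_pre_def hcovers_def hweight_def)

lemma hweight_empty [simp]: "s > 0 \<Longrightarrow> hweight s {} = 0"
  by (simp add: hweight_def)

lemma hausdorff_pre_le: "C \<in> hcovers \<delta> A \<Longrightarrow> hausdorff_pre s \<delta> A \<le> (\<Sum>i. hweight s (C i))"
  unfolding hausdorff_pre_alt by (rule INF_lower)

lemma hausdorff_pre_mono: "A \<subseteq> B \<Longrightarrow> \<delta>' \<le> \<delta> \<Longrightarrow> hausdorff_pre s \<delta> A \<le> hausdorff_pre s \<delta>' B"
  unfolding hausdorff_pre_alt hcovers_def by (rule INF_superset_mono) (auto intro: order_trans)

lemma hausdorff_pre_le_measure: "\<delta> > 0 \<Longrightarrow> hausdorff_pre s \<delta> A \<le> hausdorff_measure s A"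
  unfolding hausdorff_measure_def by (rule SUP_upper) auto

lemma hausdorff_measure_mono: "A \<subseteq> B \<Longrightarrow> hausdorff_measure s A \<le> hausdorff_measure s B"
  unfolding hausdorff_measure_def by (intro SUP_mono) (auto intro: hausdorff_pre_mono)

lemma hausdorff_pre_empty: "s > 0 \<Longrightarrow> \<delta> > 0 \<Longrightarrow> hausdorff_pre s \<delta> {} = 0"
  using hausdorff_pre_le[of "\<lambda>_. {}" \<delta> "{}" s] by (simp add: hcovers_def)

lemma hausdorff_measure_empty: "s > 0 \<Longrightarrow> hausdorff_measure s {} = 0"
  unfolding hausdorff_measure_def by (simp add: hausdorff_pre_empty)

lemma hausdorff_pre_subadditive:
  fixes A :: "nat \<Rightarrow> 'a::euclidean_space set"
  assumes "\<delta> > 0"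
  shows "hausdorff_pre s \<delta> (\<Union>i. A i) \<le> (\<Sum>i. hausdorff_pre s \<delta> (A i))"
proof (rule ennreal_le_epsilon)
  fix e :: real assume fin: "(\<Sum>i. hausdorff_pre s \<delta> (A i)) < top" and e: "e > 0"
  have f: "hausdorff_pre s \<delta> (A i) \<noteq> \<infinity>" for i
  proof
    assume "hausdorff_pre s \<delta> (A i) = \<infinity>"
    moreover have "hausdorff_pre s \<delta> (A i) \<le> (\<Sum>i. hausdorff_pre s \<delta> (A i))"
      using sum_le_suminf[of "\<lambda>i. hausdorff_pre s \<delta> (A i)" "{i}"] by simp
    ultimately show False using fin by (simp add: top_unique)
  qed
  have "\<exists>C\<in>hcovers \<delta> (A i). (\<Sum>k. hweight s (C k)) < hausdorff_pre s \<delta> (A i) + ennreal (e * (1/2)^Suc i)" for i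
    using INF_approx_ennreal[of "e * (1/2)^Suc i" "hausdorff_pre s \<delta> (A i)" _ "hcovers \<delta> (A i)"] f[of i] e
    unfolding hausdorff_pre_alt by fastforce
  then obtain C where C: "\<And>i. C i \<in> hcovers \<delta> (A i)"
    and Cs: "\<And>i. (\<Sum>k. hweight s (C i k)) < hausdorff_pre s \<delta> (A i) + ennreal (e * (1/2)^Suc i)" by metis
  define D where "D n = (case prod_decode n of (i,k) \<Rightarrow> C i k)" for n
  have "D \<in> hcovers \<delta> (\<Union>i. A i)"
  proof -
    have "x \<in> (\<Union>n. D n)" if x: "x \<in> A i" for x i
    proof -
      obtain k where "x \<in> C i k" using C[of i] x by (auto simp: hcovers_def)
      then have "x \<in> D (prod_encode (i,k))" by (simp add: D_def)
      then show ?thesis by blast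
    qed
    moreover have "bounded (D n) \<and> diameter (D n) \<le> \<delta>" for n
      using C by (auto simp: D_def hcovers_def split: prod.split)
    ultimately show ?thesis by (auto simp: hcovers_def)
  qed
  then have "hausdorff_pre s \<delta> (\<Union>i. A i) \<le> (\<Sum>n. hweight s (D n))" by (rule hausdorff_pre_le)
  also have "\<dots> = (\<Sum>i. \<Sum>k. hweight s (C i k))"
    using suminf_ennreal_2dimen[of "\<lambda>i. \<Sum>k. hweight s (C i k)" "\<lambda>(i,k). hweight s (C i k)"]
    by (simp add: D_def split_def)
  also have "\<dots> \<le> (\<Sum>i. hausdorff_pre s \<delta> (A i) + ennreal (e * (1/2)^Suc i))"
    using Cs by (intro suminf_le) (auto intro: less_imp_le)
  also have "\<dots> = (\<Sum>i. hausdorff_pre s \<delta> (A i)) + (\<Sum>i. ennreal (e * (1/2)^Suc i))"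
    by (rule suminf_add[symmetric]) auto
  also have "(\<Sum>i. ennreal (e * (1/2)^Suc i)) = ennreal e"
  proof -
    have "(\<lambda>i. e * (1/2)^Suc i) sums (e * 1)" by (intro sums_mult power_half_series)
    then show ?thesis using e by (subst suminf_ennreal_eq) auto
  qed
  finally show "hausdorff_pre s \<delta> (\<Union>i. A i) \<le> (\<Sum>i. hausdorff_pre s \<delta> (A i)) + ennreal e" .
qed

lemma hausdorff_measure_subadditive:
  fixes A :: "nat \<Rightarrow> 'a::euclidean_space set"
  shows "hausdorff_measure s (\<Union>i. A i) \<le> (\<Sum>i. hausdorff_measure s (A i))"
  unfolding hausdorff_measure_def[of s "\<Union>i. A i"]
proof (rule SUP_least)
  fix \<delta> :: real assume "\<delta> \<in> {0<..}"
  then have "\<delta> > 0" by simp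
  have "hausdorff_pre s \<delta> (\<Union>i. A i) \<le> (\<Sum>i. hausdorff_pre s \<delta> (A i))"
    using \<open>\<delta> > 0\<close> by (rule hausdorff_pre_subadditive)
  also have "\<dots> \<le> (\<Sum>i. hausdorff_measure s (A i))"
    using \<open>\<delta> > 0\<close> by (intro suminf_le hausdorff_pre_le_measure) auto
  finally show "hausdorff_pre s \<delta> (\<Union>i. A i) \<le> (\<Sum>i. hausdorff_measure s (A i))" .
qed

text \<open>A covering set of diameter below \<open>d\<close> cannot meet both \<open>A\<close> and
  \<open>B\<close>, so a fine cover of the union splits into a cover of each.\<close>

lemma hausdorff_measure_separated:
  fixes A B :: "'a::euclidean_space set"
  assumes s: "s > 0" and d: "d > 0" "\<And>x y. x \<in> A \<Longrightarrow> y \<in> B \<Longrightarrow> dist x y \<ge> d"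
  shows "hausdorff_measure s A + hausdorff_measure s B \<le> hausdorff_measure s (A \<union> B)"
proof -
  have key: "hausdorff_pre s \<delta> A + hausdorff_pre s \<delta> B \<le> hausdorff_measure s (A \<union> B)" if \<delta>: "0 < \<delta>" "\<delta> < d" for \<delta>
  proof -
    have "hausdorff_pre s \<delta> A + hausdorff_pre s \<delta> B \<le> hausdorff_pre s \<delta> (A \<union> B)"
      unfolding hausdorff_pre_alt[of s \<delta> "A \<union> B"]
    proof (rule INF_greatest)
      fix C assume C: "C \<in> hcovers \<delta> (A \<union> B)"
      define CA where "CA i = (if C i \<inter> A = {} then {} else C i)" for i
      define CB where "CB i = (if C i \<inter> A = {} then C i else {})" for i
      have disj: "C i \<inter> B = {}" if CA: "C i \<inter> A \<noteq> {}" for i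
      proof (rule ccontr)
        assume "C i \<inter> B \<noteq> {}"
        then obtain x y where "x \<in> A" "x \<in> C i" "y \<in> B" "y \<in> C i" using CA by auto
        moreover have "dist x y \<le> diameter (C i)"
          using C by (intro diameter_bounded_bound \<open>x \<in> C i\<close> \<open>y \<in> C i\<close>) (auto simp: hcovers_def)
        moreover have "diameter (C i) \<le> \<delta>" using C by (auto simp: hcovers_def)
        ultimately show False using d(2)[of x y] \<delta> by linarith
      qed
      have "CA \<in> hcovers \<delta> A"
        using C \<delta> unfolding hcovers_def CA_def by (auto split: if_splits) blast
      moreover have "CB \<in> hcovers \<delta> B"
        using C \<delta> disj unfolding hcovers_def CB_def by (auto split: if_splits) blast
      ultimately have "hausdorff_pre s \<delta> A + hausdorff_pre s \<delta> B \<le> (\<Sum>i. hweight s (CA i)) + (\<Sum>i. hweight s (CB i))"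
        by (intro add_mono hausdorff_pre_le)
      also have "\<dots> = (\<Sum>i. hweight s (CA i) + hweight s (CB i))" by (rule suminf_add) auto
      also have "\<dots> = (\<Sum>i. hweight s (C i))"
        using s by (intro suminf_cong) (auto simp: CA_def CB_def)
      finally show "hausdorff_pre s \<delta> A + hausdorff_pre s \<delta> B \<le> (\<Sum>i. hweight s (C i))" .
    qed
    also have "\<dots> \<le> hausdorff_measure s (A \<union> B)" using \<delta>(1) by (rule hausdorff_pre_le_measure)
    finally show ?thesis .
  qed
  have "hausdorff_pre s x A + hausdorff_pre s y B \<le> hausdorff_measure s (A \<union> B)" if "x > 0" "y > 0" for x y
  proof -
    let ?m = "min (min x y) (d/2)"
    have "hausdorff_pre s x A + hausdorff_pre s y B \<le> hausdorff_pre s ?m A + hausdorff_pre s ?m B"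
      by (intro add_mono hausdorff_pre_mono) auto
    also have "\<dots> \<le> hausdorff_measure s (A \<union> B)" using that d(1) by (intro key) auto
    finally show ?thesis .
  qed
  then show ?thesis
    unfolding hausdorff_measure_def[of s A] hausdorff_measure_def[of s B]
    by (subst ennreal_SUP_add_left[symmetric], simp, intro SUP_least, subst ennreal_SUP_add_right) (auto intro!: SUP_least)
qed

lemma hausdorff_measure_subadditive2:
  assumes "s > 0" shows "hausdorff_measure s (A \<union> B) \<le> hausdorff_measure s A + hausdorff_measure s B"
proof -
  have "hausdorff_measure s (\<Union>i::nat. if i = 0 then A else if i = 1 then B else {}) \<le> (\<Sum>i::nat. hausdorff_measure s (if i = 0 then A else if i = 1 then B else {}))"
    by (rule hausdorff_measure_subadditive)
  also have "(\<Union>i::nat. if i = 0 then A else if i = 1 then B else {}) = A \<union> B" by (auto split: if_splits)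
  also have "(\<Sum>i::nat. hausdorff_measure s (if i = 0 then A else if i = 1 then B else {})) = (\<Sum>i\<in>{0,1::nat}. hausdorff_measure s (if i = 0 then A else if i = 1 then B else {}))"
    by (rule suminf_finite) (auto simp: hausdorff_measure_empty assms)
  also have "\<dots> = hausdorff_measure s A + hausdorff_measure s B" by simp
  finally show ?thesis .
qed

text \<open>Caratheodory's argument for metric outer measures: closed sets split every set
  additively, so Borel sets are measurable.\<close>

lemma hausdorff_measure_Caratheodory_closed:
  fixes F X :: "'a::euclidean_space set"
  assumes s: "s > 0" and F: "closed F"
  shows "hausdorff_measure s (X \<inter> F) + hausdorff_measure s (X - F) \<le> hausdorff_measure s X"
proof (cases "hausdorff_measure s X = top \<or> F = {}")
  case True
  then show ?thesis by (auto simp: hausdorff_measure_empty s)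
next
  case False
  then have fin: "hausdorff_measure s X < top" and ne: "F \<noteq> {}" by (auto simp: less_top)
  let ?H = "hausdorff_measure s"
  define d where "d x = infdist x F" for x
  have dpos: "d x > 0" if "x \<notin> F" for x
    using that F ne unfolding d_def by (metis in_closed_iff_infdist_zero infdist_nonneg less_eq_real_def)
  have dlip: "d x \<le> d y + dist x y" for x y unfolding d_def by (rule infdist_triangle)
  \<comment> \<open>Layers of \<open>X\<close> around \<open>F\<close> by distance;
    \<open>Y k\<close> together with the layers from \<open>k\<close> on exhausts
    \<open>X - F\<close>.\<close>
  define R where "R k = {x\<in>X. 1 / real (k+2) \<le> d x \<and> d x < 1 / real (k+1)}" for k
  define Y where "Y k = {x\<in>X. 1 / real (k+1) \<le> d x}" for k
  have sepR: "dist x y \<ge> 1 / real (i+2) - 1 / real (k+1)" if "x \<in> R i" "y \<in> R k" for x y i k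
    using dlip[of x y] that by (auto simp: R_def)
  \<comment> \<open>Layers two indices apart have positive distance, so the separated case adds
    their measures. Later \<open>c\<close> is 0 or 1: even and odd layers are summed apart because
    neighbours may touch.\<close>
  have chain: "(\<Sum>k<N. ?H (R (2*k + c))) \<le> ?H (\<Union>k<N. R (2*k + c))" for N c :: nat
  proof (induction N)
    case 0 then show ?case by simp
  next
    case (Suc N)
    have eq: "(\<Union>k<Suc N. R (2*k + c)) = (\<Union>k<N. R (2*k + c)) \<union> R (2*N + c)" by (auto simp: lessThan_Suc)
    have sep: "dist x y \<ge> 1 / real (2*N+c) - 1 / real (2*N+c+1)" if "x \<in> (\<Union>k<N. R (2*k + c))" "y \<in> R (2*N + c)" for x y
    proof -
      obtain k where k: "k < N" "x \<in> R (2*k+c)" using \<open>x \<in> _\<close> by auto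
      have "1 / real (2*N+c) \<le> 1 / real (2*k+c+2)" using k(1) by (intro divide_left_mono) auto
      then show ?thesis using sepR[OF k(2) that(2)] by simp
    qed
    have "?H (\<Union>k<N. R (2*k + c)) + ?H (R (2*N+c)) \<le> ?H (\<Union>k<Suc N. R (2*k + c))"
    proof (cases "N = 0")
      case True then show ?thesis by (simp add: hausdorff_measure_empty s lessThan_Suc)
    next
      case False
      have "1 / real (2*N+c+1) < 1 / real (2*N+c)" using False by (intro divide_strict_left_mono) auto
      then have "0 < 1 / real (2*N+c) - 1 / real (2*N+c+1)" by linarith
      from hausdorff_measure_separated[OF s this sep] show ?thesis unfolding eq by blast
    qed
    with add_right_mono[OF Suc, of "?H (R (2*N+c))"] show ?case unfolding sum.lessThan_Suc by (rule order_trans)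
  qed
  have sumfin: "(\<Sum>k. ?H (R k)) < top"
  proof -
    have "(\<Sum>k. ?H (R (2*k + c))) \<le> ?H X" for c
    proof -
      have "(\<Sum>k<N. ?H (R (2*k + c))) \<le> ?H X" for N
        by (rule order_trans[OF chain hausdorff_measure_mono]) (auto simp: R_def)
      then show ?thesis by (rule suminf_le_const[OF summableI])
    qed
    from this[of 0] this[of 1] have "(\<Sum>k. ?H (R (2*k))) + (\<Sum>k. ?H (R (2*k+1))) < top"
      using fin by (simp add: le_less_trans)
    moreover have "(\<Sum>k<n. ?H (R k)) \<le> (\<Sum>k. ?H (R (2*k))) + (\<Sum>k. ?H (R (2*k+1)))" for n
    proof -
      have "(\<Sum>k<n. ?H (R k)) \<le> (\<Sum>k<2*n. ?H (R k))" by (intro sum_mono2) auto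
      also have "\<dots> = (\<Sum>k<n. ?H (R (2*k)) + ?H (R (2*k+1)))" by (induction n) (auto simp: add_ac)
      also have "\<dots> = (\<Sum>k<n. ?H (R (2*k))) + (\<Sum>k<n. ?H (R (2*k+1)))" by (rule sum.distrib)
      also have "\<dots> \<le> (\<Sum>k. ?H (R (2*k))) + (\<Sum>k. ?H (R (2*k+1)))" by (intro add_mono sum_le_suminf) auto
      finally show ?thesis .
    qed
    ultimately show ?thesis by (meson suminf_le_const[OF summableI] le_less_trans)
  qed
  have tail: "?H (X - F) \<le> ?H (Y k) + (\<Sum>i. ?H (R (i + k)))" for k
  proof -
    have "X - F \<subseteq> Y k \<union> (\<Union>i. R (i + k))"
    proof
      fix x assume x: "x \<in> X - F"
      show "x \<in> Y k \<union> (\<Union>i. R (i + k))"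
      proof (cases "x \<in> Y k")
        case False
        then have dk: "d x < 1 / real (k+1)" using x by (auto simp: Y_def)
        obtain n where n: "1 / real (n+1) \<le> d x" using dpos[of x] x reals_Archimedean[of "d x"]
          by (auto simp: inverse_eq_divide) (metis less_imp_le of_nat_Suc add.commute)
        define m where "m = (LEAST m. 1 / real (m+1) \<le> d x)"
        have m: "1 / real (m+1) \<le> d x" unfolding m_def by (rule LeastI) (rule n)
        have mk: "k < m"
        proof (rule ccontr)
          assume "\<not> k < m"
          then have "1 / real (k+1) \<le> 1 / real (m+1)" by (intro divide_left_mono) auto
          then show False using m dk by linarith
        qed
        then have "\<not> 1 / real (m - 1 + 1) \<le> d x" using not_less_Least[of "m - 1" "\<lambda>m. 1 / real (m+1) \<le> d x"] unfolding m_def[symmetric] by auto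
        then have "x \<in> R (m - 1)" using m mk x by (auto simp: R_def)
        moreover have "m - 1 = (m - 1 - k) + k" using mk by simp
        ultimately show ?thesis by (metis UN_I UNIV_I UnI2)
      qed simp
    qed
    then have "?H (X - F) \<le> ?H (Y k \<union> (\<Union>i. R (i + k)))" by (rule hausdorff_measure_mono)
    also have "\<dots> \<le> ?H (Y k) + ?H (\<Union>i. R (i + k))" by (rule hausdorff_measure_subadditive2[OF s])
    also have "\<dots> \<le> ?H (Y k) + (\<Sum>i. ?H (R (i + k)))" by (intro add_left_mono hausdorff_measure_subadditive)
    finally show ?thesis .
  qed
  have XY: "?H (X \<inter> F) + ?H (Y k) \<le> ?H X" for k
  proof -
    have "?H (X \<inter> F) + ?H (Y k) \<le> ?H (X \<inter> F \<union> Y k)"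
    proof (rule hausdorff_measure_separated[OF s, of "1 / real (k+1)"])
      fix x y assume "x \<in> X \<inter> F" "y \<in> Y k"
      then show "1 / real (k+1) \<le> dist x y"
        using dlip[of y x] by (auto simp: Y_def d_def dist_commute)
    qed simp
    also have "\<dots> \<le> ?H X" by (rule hausdorff_measure_mono) (auto simp: Y_def)
    finally show ?thesis .
  qed
  \<comment> \<open>Tails of a convergent series: what \<open>Y k\<close> misses of
    \<open>X - F\<close> becomes negligible.\<close>
  have lim: "(\<lambda>k. \<Sum>i. ?H (R (i + k))) \<longlonglongrightarrow> 0"
  proof -
    define r where "r k = enn2real (?H (R k))" for k
    have rf: "?H (R k) = ennreal (r k)" for k
    proof -
      have "?H (R k) \<le> (\<Sum>k. ?H (R k))" using sum_le_suminf[of "\<lambda>i. ?H (R i)" "{k}"] by simp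
      then show ?thesis using sumfin by (simp add: r_def le_less_trans)
    qed
    have sr: "summable r" using sumfin unfolding rf by (intro summable_suminf_not_top) (auto simp: r_def)
    have "(\<lambda>k. ennreal (\<Sum>i. r (i + k))) \<longlonglongrightarrow> ennreal 0"
      by (intro tendsto_ennrealI) (use suminf_exist_split2[OF sr] in simp)
    moreover have "(\<Sum>i. ?H (R (i + k))) = ennreal (\<Sum>i. r (i + k))" for k
      unfolding rf using summable_ignore_initial_segment[OF sr, of k] by (intro suminf_ennreal2) (auto simp: r_def)
    ultimately show ?thesis by simp
  qed
  have "?H (X \<inter> F) + ?H (X - F) \<le> ?H X + (\<Sum>i. ?H (R (i + k)))" for k
  proof -
    have "?H (X \<inter> F) + ?H (X - F) \<le> ?H (X \<inter> F) + ?H (Y k) + (\<Sum>i. ?H (R (i + k)))"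
      using tail[of k] by (simp add: add.assoc add_left_mono)
    also have "\<dots> \<le> ?H X + (\<Sum>i. ?H (R (i + k)))" using XY by (rule add_right_mono)
    finally show ?thesis .
  qed
  moreover have "(\<lambda>k. ?H X + (\<Sum>i. ?H (R (i + k)))) \<longlonglongrightarrow> ?H X + 0"
    using lim fin by (intro tendsto_add tendsto_const) auto
  ultimately show ?thesis by (intro LIMSEQ_le_const[where X="\<lambda>k. ?H X + (\<Sum>i. ?H (R (i + k)))"]) auto
qed

definition Hm :: "nat \<Rightarrow> 'a::euclidean_space measure" where
  "Hm s = measure_of UNIV (sets borel) (hausdorff_measure s)"

lemma sets_Hm [simp, measurable_cong]: "sets (Hm s) = sets borel"
  and space_Hm [simp]: "space (Hm s) = UNIV"
  using sets.sigma_sets_eq[of borel] sets.space_closed[of borel] by (simp_all add: Hm_def sets_measure_of space_measure_of)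

lemma emeasure_Hm:
  fixes A :: "'a::euclidean_space set"
  assumes s: "s > 0" and A: "A \<in> sets borel"
  shows "emeasure (Hm s) A = hausdorff_measure s A"
proof -
  let ?L = "lambda_system UNIV (Pow UNIV) (hausdorff_measure s :: 'a set \<Rightarrow> ennreal)"
  interpret P: sigma_algebra "UNIV :: 'a set" "Pow UNIV" by (rule sigma_algebra_Pow)
  have oms: "outer_measure_space (Pow UNIV) (hausdorff_measure s :: 'a set \<Rightarrow> ennreal)"
    unfolding outer_measure_space_def positive_def increasing_def countably_subadditive_def
    using hausdorff_measure_subadditive by (auto simp: hausdorff_measure_empty s hausdorff_measure_mono)
  have ms: "measure_space UNIV ?L (hausdorff_measure s)"
    by (rule P.caratheodory_lemma[OF oms])
  then have sa: "sigma_algebra UNIV ?L" and ca: "countably_additive ?L (hausdorff_measure s)" and pos: "positive ?L (hausdorff_measure s)"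
    by (auto simp: measure_space_def)
  have "F \<in> ?L" if "closed F" for F
  proof -
    have "hausdorff_measure s (X \<inter> F) + hausdorff_measure s (X - F) = hausdorff_measure s X" for X
    proof (rule antisym)
      show "hausdorff_measure s X \<le> hausdorff_measure s (X \<inter> F) + hausdorff_measure s (X - F)"
        using hausdorff_measure_subadditive2[OF s, of "X \<inter> F" "X - F"] by (simp add: Int_Diff_Un)
    qed (rule hausdorff_measure_Caratheodory_closed[OF s that])
    then show ?thesis unfolding P.lambda_system_eq by auto
  qed
  then have "sigma_sets UNIV {F. closed F} \<subseteq> ?L"
    by (intro sigma_algebra.sigma_sets_subset[OF sa]) auto
  then have sub: "sets borel \<subseteq> ?L"
    by (simp add: borel_eq_closed sets_measure_of)
  have "countably_additive (sets borel) (hausdorff_measure s :: 'a set \<Rightarrow> ennreal)"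
    using ca sub unfolding countably_additive_def by (meson subset_trans subsetD)
  then show ?thesis unfolding Hm_def
    using sets.sigma_algebra_axioms[of "borel :: 'a measure"]
    by (intro emeasure_measure_of_sigma A) (auto simp: positive_def hausdorff_measure_empty s)
qed

section \<open>Hausdorff measure under contractions and on hyperplanes\<close>

lemma hausdorff_measure_contraction:
  fixes f :: "'a::euclidean_space \<Rightarrow> 'b::euclidean_space"
  assumes f: "\<And>x y. x \<in> A \<Longrightarrow> y \<in> A \<Longrightarrow> dist (f x) (f y) \<le> dist x y"
  shows "hausdorff_measure s (f ` A) \<le> hausdorff_measure s A"
  unfolding hausdorff_measure_def
proof (rule SUP_mono)
  fix \<delta> :: real assume \<delta>: "\<delta> \<in> {0<..}"
  have "hausdorff_pre s \<delta> (f ` A) \<le> hausdorff_pre s \<delta> A"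
    unfolding hausdorff_pre_alt[of s \<delta> A]
  proof (rule INF_greatest)
    fix C assume C: "C \<in> hcovers \<delta> A"
    have b: "bounded (C i)" "diameter (C i) \<le> \<delta>" for i using C by (auto simp: hcovers_def)
    have d: "dist (f x) (f y) \<le> diameter (C i)" if "x \<in> C i \<inter> A" "y \<in> C i \<inter> A" for x y i
      using f[of x y] diameter_bounded_bound[OF b(1), of x i y] that by auto
    have dm: "diameter (f ` (C i \<inter> A)) \<le> diameter (C i)" for i
      using d diameter_ge_0[OF b(1)] by (intro diameter_le) (auto simp: dist_norm)
    have bd: "bounded (f ` (C i \<inter> A))" for i
    proof (cases "C i \<inter> A = {}")
      case False
      then obtain z where z: "z \<in> C i \<inter> A" by auto
      show ?thesis unfolding bounded_def
        by (intro exI[of _ "f z"] exI[of _ "diameter (C i)"]) (use d z in auto)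
    qed simp
    have "(\<lambda>i. f ` (C i \<inter> A)) \<in> hcovers \<delta> (f ` A)"
      using C dm bd b(2) unfolding hcovers_def by (auto intro: order_trans) blast
    then have "hausdorff_pre s \<delta> (f ` A) \<le> (\<Sum>i. hweight s (f ` (C i \<inter> A)))" by (rule hausdorff_pre_le)
    also have "\<dots> \<le> (\<Sum>i. hweight s (C i))"
      using dm diameter_ge_0[OF bd] by (intro suminf_le) (auto simp: hweight_def intro!: ennreal_leI mult_left_mono power_mono)
    finally show "hausdorff_pre s \<delta> (f ` A) \<le> (\<Sum>i. hweight s (C i))" .
  qed
  with \<delta> show "\<exists>m\<in>{0<..}. hausdorff_pre s \<delta> (f ` A) \<le> hausdorff_pre s m A" by blast
qed

lemma hausdorff_measure_isometry:
  fixes f :: "'a::euclidean_space \<Rightarrow> 'b::euclidean_space"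
  assumes f: "\<And>x y. x \<in> A \<Longrightarrow> y \<in> A \<Longrightarrow> dist (f x) (f y) = dist x y"
  shows "hausdorff_measure s (f ` A) = hausdorff_measure s A"
proof (rule antisym)
  show "hausdorff_measure s (f ` A) \<le> hausdorff_measure s A"
    by (rule hausdorff_measure_contraction) (simp add: f)
  have inj: "inj_on f A" by (rule inj_onI) (metis f dist_eq_0_iff)
  have "hausdorff_measure s (the_inv_into A f ` (f ` A)) \<le> hausdorff_measure s (f ` A)"
    by (rule hausdorff_measure_contraction) (auto simp: the_inv_into_f_f[OF inj] f)
  also have "the_inv_into A f ` (f ` A) = A"
    using the_inv_into_f_f[OF inj] by force
  finally show "hausdorff_measure s A \<le> hausdorff_measure s (f ` A)" .
qed

lemma hausdorff_pre_le_finite: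
  assumes s: "s > 0" and I: "finite I" and A: "A \<subseteq> (\<Union>i\<in>I. C i)" and C: "\<And>i. i \<in> I \<Longrightarrow> bounded (C i) \<and> diameter (C i) \<le> \<delta>"
    and \<delta>: "\<delta> > 0"
  shows "hausdorff_pre s \<delta> A \<le> (\<Sum>i\<in>I. hweight s (C i))"
proof -
  obtain h where h: "bij_betw h {..<card I} I" using I by (metis ex_bij_betw_nat_finite atLeast0LessThan)
  define D where "D i = (if i < card I then C (h i) else {})" for i
  have "D \<in> hcovers \<delta> A"
  proof -
    have "x \<in> (\<Union>i. D i)" if "x \<in> A" for x
    proof -
      obtain i where "i \<in> I" "x \<in> C i" using A \<open>x \<in> A\<close> by auto
      then obtain k where "k < card I" "h k = i" using h by (metis bij_betw_imp_surj_on imageE lessThan_iff)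
      then have "x \<in> D k" using \<open>x \<in> C i\<close> by (simp add: D_def)
      then show ?thesis by blast
    qed
    moreover have "bounded (D i) \<and> diameter (D i) \<le> \<delta>" for i
      using C \<delta> bij_betw_apply[OF h, of i] by (auto simp: D_def)
    ultimately show ?thesis by (auto simp: hcovers_def)
  qed
  then have "hausdorff_pre s \<delta> A \<le> (\<Sum>i. hweight s (D i))" by (rule hausdorff_pre_le)
  also have "\<dots> = (\<Sum>i<card I. hweight s (D i))" using s by (intro suminf_finite) (auto simp: D_def)
  also have "\<dots> = (\<Sum>i<card I. hweight s (C (h i)))" by (simp add: D_def)
  also have "\<dots> = (\<Sum>i\<in>I. hweight s (C i))" by (rule sum.reindex_bij_betw[OF h])
  finally show ?thesis .
qed

text \<open>With \<open>k = card B\<close>, a grid of \<open>N ^ k\<close> cells of diameter of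
  order \<open>1 / N\<close> has a total weight that does not depend on \<open>N\<close>.\<close>

lemma hausdorff_measure_span_finite:
  fixes B :: "'a::euclidean_space set"
  assumes B: "orthonormal B" and k: "card B > 0" and S: "S \<subseteq> span B" "bounded S"
  shows "hausdorff_measure (card B) S < \<infinity>"
proof -
  let ?k = "card B"
  have fin: "finite B" using B by (rule orthonormal_finite)
  obtain R where R: "R > 0" "\<And>x. x \<in> S \<Longrightarrow> norm x \<le> R" using S(2) by (metis bounded_pos)
  let ?c = "ennreal (unit_ball_vol (real ?k) * (real ?k * R) ^ ?k)"
  have "hausdorff_pre ?k \<delta> S \<le> ?c" if \<delta>: "\<delta> > 0" for \<delta>
  proof -
    obtain N :: nat where N: "real ?k * (2 * R) / \<delta> < real N" using reals_Archimedean2 by blast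
    then have N0: "N > 0" using R \<delta> k by (smt (verit) divide_nonneg_pos gr0I mult_nonneg_nonneg of_nat_0 of_nat_0_le_iff)
    have kd: "real ?k * (2 * R / N) \<le> \<delta>" using N N0 \<delta> by (simp add: field_simps)
    define C where "C g = {x\<in>span B. \<forall>v\<in>B. - R + real (g v) * (2 * R / N) \<le> x \<bullet> v \<and> x \<bullet> v \<le> - R + (real (g v) + 1) * (2 * R / N)}" for g :: "'a \<Rightarrow> nat"
    let ?I = "B \<rightarrow>\<^sub>E {..<N}"
    have d: "norm (x - y) \<le> real ?k * (2 * R / N)" if "x \<in> C g" "y \<in> C g" for x y g
    proof -
      have "norm (x - y) = norm (pr B (x - y))" using that by (subst pr_id[OF B]) (auto simp: C_def span_diff)
      also have "\<dots> \<le> (\<Sum>v\<in>B. norm (((x - y) \<bullet> v) *\<^sub>R v))" unfolding pr_def by (rule norm_sum)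
      also have "\<dots> \<le> (\<Sum>v\<in>B. 2 * R / N)"
      proof (rule sum_mono)
        fix v assume v: "v \<in> B"
        then have "norm v = 1" using B by (auto simp: orthonormal_def)
        moreover have "- R + real (g v) * (2 * R / N) \<le> x \<bullet> v" "x \<bullet> v \<le> - R + (real (g v) + 1) * (2 * R / N)"
          "- R + real (g v) * (2 * R / N) \<le> y \<bullet> v" "y \<bullet> v \<le> - R + (real (g v) + 1) * (2 * R / N)"
          using that v by (auto simp: C_def)
        ultimately show "norm (((x - y) \<bullet> v) *\<^sub>R v) \<le> 2 * R / N"
          by (simp add: inner_diff_left abs_le_iff) (simp add: algebra_simps add_divide_distrib)
      qed
      finally show ?thesis by simp
    qed
    have dC: "diameter (C g) \<le> real ?k * (2 * R / N)" for g
      using d R N0 by (intro diameter_le) auto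
    have bC: "bounded (C g)" for g
    proof (cases "C g = {}")
      case False then obtain z where z: "z \<in> C g" by auto
      show ?thesis unfolding bounded_def dist_norm
        by (intro exI[of _ z] exI[of _ "real ?k * (2 * R / N)"]) (use d z in auto)
    qed simp
    have cover: "S \<subseteq> (\<Union>g\<in>?I. C g)"
    proof
      fix x assume x: "x \<in> S"
      define t where "t v = (x \<bullet> v + R) / (2 * R / N)" for v
      \<comment> \<open>The cap \<open>N - 1\<close> puts the right end point \<open>t v = N\<close>
        into the last cell.\<close>
      define g where "g = (\<lambda>v\<in>B. min (N - 1) (nat \<lfloor>t v\<rfloor>))"
      have gI: "g \<in> ?I" using N0 by (auto simp: g_def)
      have "- R + real (g v) * (2 * R / N) \<le> x \<bullet> v \<and> x \<bullet> v \<le> - R + (real (g v) + 1) * (2 * R / N)" if v: "v \<in> B" for v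
      proof -
        have "\<bar>x \<bullet> v\<bar> \<le> R" using Cauchy_Schwarz_ineq2[of x v] R(2)[OF x] v B by (auto simp: orthonormal_def)
        then have "0 \<le> x \<bullet> v + R" "x \<bullet> v + R \<le> 2 * R" by auto
        then have "0 \<le> (x \<bullet> v + R) / (2 * R)" "(x \<bullet> v + R) / (2 * R) \<le> 1" using R by auto
        moreover have "t v = (x \<bullet> v + R) / (2 * R) * N" by (simp add: t_def)
        ultimately have t: "0 \<le> t v" "t v \<le> N" using mult_right_mono[of "(x \<bullet> v + R) / (2 * R)" 1 "real N"] mult_nonneg_nonneg[of "(x \<bullet> v + R) / (2 * R)" "real N"] by auto
        have "real (g v) \<le> t v" using t v by (auto simp: g_def min_def) linarith+
        moreover have "t v \<le> real (g v) + 1" using t v N0 by (auto simp: g_def min_def of_nat_diff)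
        moreover have "x \<bullet> v = - R + t v * (2 * R / N)" using R N0 by (simp add: t_def)
        ultimately show ?thesis using R by (auto intro!: mult_right_mono divide_right_mono)
      qed
      then have "x \<in> C g" using x S by (auto simp: C_def)
      with gI show "x \<in> (\<Union>g\<in>?I. C g)" by blast
    qed
    have "hausdorff_pre ?k \<delta> S \<le> (\<Sum>g\<in>?I. hweight ?k (C g))"
      using k fin cover bC \<delta> order_trans[OF dC kd] by (intro hausdorff_pre_le_finite finite_PiE) auto
    also have "\<dots> \<le> (\<Sum>g\<in>?I. ennreal (unit_ball_vol (real ?k) * (real ?k * R / N) ^ ?k))"
    proof (rule sum_mono)
      fix g
      have "real ?k * (2 * R / N) = 2 * (real ?k * R / N)" by simp
      then have "diameter (C g) / 2 \<le> real ?k * R / N" using dC[of g] by linarith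
      then show "hweight ?k (C g) \<le> ennreal (unit_ball_vol (real ?k) * (real ?k * R / N) ^ ?k)"
        using diameter_ge_0[OF bC[of g]] unfolding hweight_def by (intro ennreal_leI mult_left_mono power_mono) auto
    qed
    also have "\<dots> = ennreal (real N ^ ?k * (unit_ball_vol (real ?k) * (real ?k * R / N) ^ ?k))"
      using fin R by (simp add: card_PiE ennreal_mult' ennreal_of_nat_eq_real_of_nat)
    also have "\<dots> = ?c" using N0 by (simp add: power_divide)
    finally show ?thesis .
  qed
  then have "hausdorff_measure ?k S \<le> ?c" unfolding hausdorff_measure_def by (intro SUP_least) auto
  then show ?thesis by (simp add: le_less_trans)
qed

text \<open>Reflection in the hyperplane orthogonal to \<open>a - b\<close>.\<close>

lemma orthogonal_transformation_exists_unit: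
  fixes a b :: "'a::euclidean_space"
  assumes "norm a = norm b"
  obtains f where "orthogonal_transformation f" "f a = b"
proof (cases "a = b")
  case True then show ?thesis using that[of id] by (simp add: orthogonal_transformation_def linear_id)
next
  case False
  define d where "d = a - b"
  define f where "f x = x - (2 * (x \<bullet> d) / (d \<bullet> d)) *\<^sub>R d" for x
  have d: "d \<bullet> d \<noteq> 0" using False by (simp add: d_def)
  have "linear f" unfolding f_def by (rule linearI) (auto simp: inner_add_left algebra_simps add_divide_distrib)
  moreover have "f v \<bullet> f w = v \<bullet> w" for v w
    using d by (simp add: f_def inner_diff_left inner_diff_right field_simps inner_commute)
  moreover have "f a = b"
  proof -
    have "2 * (a \<bullet> d) = d \<bullet> d" using assms by (simp add: d_def inner_diff_left inner_diff_right inner_commute norm_eq)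
    then show ?thesis using d by (simp add: f_def) (simp add: d_def)
  qed
  ultimately show ?thesis using that[of f] by (simp add: orthogonal_transformation_def)
qed

text \<open>The product of Hausdorff measure on the hyperplane with length along \<open>nu\<close>
  is translation invariant, hence a multiple of Lebesgue measure. The slab of height 1 converts this
  into a formula for sets in the hyperplane, with the factor left unevaluated.\<close>

lemma hausdorff_measure_slab_direction:
  fixes nu :: "'a::euclidean_space"
  assumes n2: "DIM('a) \<ge> 2" and nu: "norm nu = 1"
  obtains c where "c < (\<infinity>::ennreal)"
    "\<And>S. S \<in> sets borel \<Longrightarrow> S \<subseteq> {x. x \<bullet> nu = 0} \<Longrightarrow> hausdorff_measure (DIM('a) - 1) S
        = c * emeasure lborel {x. x - (x \<bullet> nu) *\<^sub>R nu \<in> S \<and> 0 < x \<bullet> nu \<and> x \<bullet> nu \<le> 1}"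
proof -
  let ?s = "DIM('a) - 1"
  have s: "?s > 0" using n2 by simp
  let ?V = "{x. x \<bullet> nu = 0}"
  have nu1: "nu \<bullet> nu = 1" using nu by (simp add: norm_eq_1)
  have V: "?V \<in> sets borel" using closed_hyperplane[of nu 0] by (simp add: inner_commute borel_closed)
  obtain B where B: "orthonormal B" "span B = ?V" "card B = ?s"
  proof -
    have "orthonormal {nu}" using nu by (simp add: orthonormal_def)
    from orthonormal_extend[OF this] obtain C where C: "orthonormal ({nu} \<union> C)" "span C = orthogonal_comp (span {nu})" "card C = DIM('a) - card {nu}" by metis
    have "orthogonal_comp (span {nu}) = ?V"
      by (auto simp: orthogonal_comp_def orthogonal_def span_singleton inner_commute)
    with C show ?thesis using that[of C] orthonormal_subset[OF C(1)] by auto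
  qed
  define N where "N = density (Hm ?s) (indicator ?V)"
  have [simp, measurable_cong]: "sets N = sets borel" and [simp]: "space N = UNIV" by (auto simp: N_def)
  have emN: "emeasure N A = hausdorff_measure ?s (A \<inter> ?V)" if "A \<in> sets borel" for A
    using that V s by (simp add: N_def emeasure_density emeasure_Hm[symmetric] Int_commute indicator_inter_arith[symmetric])
  have Nfin: "emeasure N (cball 0 r) < \<infinity>" for r
    using hausdorff_measure_span_finite[OF B(1), of "cball 0 r \<inter> ?V"] B s by (simp add: emN bounded_Int)
  interpret N: sigma_finite_measure N by (rule sigma_finite_if_cball_finite[OF _ Nfin]) simp
  interpret P: pair_sigma_finite N "lborel :: real measure" ..
  have Ninv: "distr N borel (\<lambda>x. x + a) = N" if a: "a \<bullet> nu = 0" for a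
  proof (rule measure_eqI)
    fix A assume "A \<in> sets (distr N borel (\<lambda>x. x + a))"
    then have A: "A \<in> sets borel" by simp
    have A': "(\<lambda>x. x + a) -` A \<in> sets borel" using measurable_sets_borel[of "\<lambda>x. x + a" borel A] A by simp
    have "emeasure (distr N borel (\<lambda>x. x + a)) A = hausdorff_measure ?s ((\<lambda>x. x + a) -` A \<inter> ?V)"
      using A A' by (simp add: emeasure_distr emN)
    also have "\<dots> = hausdorff_measure ?s ((\<lambda>x. x + a) ` ((\<lambda>x. x + a) -` A \<inter> ?V))"
      by (rule hausdorff_measure_isometry[symmetric]) (simp add: dist_norm)
    also have "(\<lambda>x. x + a) ` ((\<lambda>x. x + a) -` A \<inter> ?V) = A \<inter> ?V"
    proof -
      have "y \<in> (\<lambda>x. x + a) ` ((\<lambda>x. x + a) -` A \<inter> ?V)" if "y \<in> A \<inter> ?V" for y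
        using that a by (intro image_eqI[of _ _ "y - a"]) (auto simp: inner_diff_left)
      then show ?thesis using a by (auto simp: inner_add_left)
    qed
    finally show "emeasure (distr N borel (\<lambda>x. x + a)) A = emeasure N A" using A by (simp add: emN)
  qed simp
  define M where "M = distr (N \<Otimes>\<^sub>M lborel) borel (\<lambda>(z,t). z + t *\<^sub>R nu)"
  have [measurable]: "(\<lambda>(z,t). z + t *\<^sub>R nu) \<in> N \<Otimes>\<^sub>M lborel \<rightarrow>\<^sub>M borel" by measurable
  have nnM: "(\<integral>\<^sup>+x. f x \<partial>M) = (\<integral>\<^sup>+z. (\<integral>\<^sup>+t. f (z + t *\<^sub>R nu) \<partial>lborel) \<partial>N)" if [measurable]: "f \<in> borel_measurable borel" for f
    by (simp add: M_def nn_integral_distr lborel.nn_integral_fst[symmetric])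
  have setsM: "sets M = sets borel" by (simp add: M_def)
  have Minv: "distr M borel (\<lambda>x. x + a) = M" for a
  proof (rule measure_eqI)
    fix A assume "A \<in> sets (distr M borel (\<lambda>x. x + a))"
    then have A[measurable]: "A \<in> sets borel" by simp
    define b where "b = a - (a \<bullet> nu) *\<^sub>R nu"
    have b: "b \<bullet> nu = 0" by (simp add: b_def inner_diff_left nu1)
    have "emeasure (distr M borel (\<lambda>x. x + a)) A = (\<integral>\<^sup>+x. indicator A x \<partial>distr M borel (\<lambda>x. x + a))" by simp
    also have "\<dots> = (\<integral>\<^sup>+x. indicator A (x + a) \<partial>M)" by (subst nn_integral_distr) (auto simp: M_def)
    also have "\<dots> = (\<integral>\<^sup>+z. (\<integral>\<^sup>+t. indicator A (z + t *\<^sub>R nu + a) \<partial>lborel) \<partial>N)" by (subst nnM) auto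
    also have "\<dots> = (\<integral>\<^sup>+z. (\<integral>\<^sup>+t. indicator A (z + b + t *\<^sub>R nu) \<partial>lborel) \<partial>N)"
    proof (rule nn_integral_cong)
      fix z
      have "(\<integral>\<^sup>+t. indicator A (z + b + t *\<^sub>R nu) \<partial>lborel) = (\<integral>\<^sup>+t. indicator A (z + b + t *\<^sub>R nu) \<partial>distr lborel borel ((+) (a \<bullet> nu)))"
        by (simp add: lborel_distr_plus)
      also have "\<dots> = (\<integral>\<^sup>+t. indicator A (z + b + (a \<bullet> nu + t) *\<^sub>R nu) \<partial>lborel)" by (subst nn_integral_distr) auto
      finally show "(\<integral>\<^sup>+t. indicator A (z + t *\<^sub>R nu + a) \<partial>lborel) = (\<integral>\<^sup>+t. indicator A (z + b + t *\<^sub>R nu) \<partial>lborel)"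
        by (simp add: b_def algebra_simps)
    qed
    also have "\<dots> = (\<integral>\<^sup>+z. (\<integral>\<^sup>+t. indicator A (z + t *\<^sub>R nu) \<partial>lborel) \<partial>distr N borel (\<lambda>x. x + b))"
      by (subst nn_integral_distr) auto
    also have "\<dots> = (\<integral>\<^sup>+x. indicator A x \<partial>M)" by (simp add: nnM Ninv[OF b])
    finally show "emeasure (distr M borel (\<lambda>x. x + a)) A = emeasure M A" by (simp add: setsM)
  qed (simp add: setsM)
  have Mfin: "emeasure M (cball 0 r) < \<infinity>" for r
  proof -
    have "emeasure M (cball 0 r) = (\<integral>\<^sup>+x. indicator (cball 0 r) x \<partial>M)" by (simp add: setsM)
    also have "\<dots> = (\<integral>\<^sup>+z. (\<integral>\<^sup>+t. indicator (cball 0 r) (z + t *\<^sub>R nu) \<partial>lborel) \<partial>N)" by (subst nnM) (simp_all add: borel_measurable_indicator)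
    also have "\<dots> \<le> (\<integral>\<^sup>+z. (\<integral>\<^sup>+t. indicator (cball 0 (2*r)) z * indicator {-r..r} t \<partial>lborel) \<partial>N)"
    proof (rule nn_integral_mono_AE)
      have "AE z in N. z \<in> ?V" unfolding N_def using V by (subst AE_density) (auto simp: indicator_def)
      then show "AE z in N. (\<integral>\<^sup>+t. indicator (cball 0 r) (z + t *\<^sub>R nu) \<partial>lborel) \<le> (\<integral>\<^sup>+t. indicator (cball 0 (2*r)) z * indicator {-r..r} t \<partial>lborel)"
      proof eventually_elim
        case (elim z)
        show ?case
        proof (rule nn_integral_mono)
          fix t :: real
          show "(indicator (cball 0 r) (z + t *\<^sub>R nu) :: ennreal) \<le> indicator (cball 0 (2*r)) z * indicator {-r..r} t"
          proof (cases "z + t *\<^sub>R nu \<in> cball 0 r")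
            case True
            have "t = (z + t *\<^sub>R nu) \<bullet> nu" using elim by (simp add: inner_add_left nu1)
            then have "\<bar>t\<bar> \<le> r" using Cauchy_Schwarz_ineq2[of "z + t *\<^sub>R nu" nu] True nu by simp
            moreover have "norm z \<le> norm (z + t *\<^sub>R nu) + \<bar>t\<bar>" using norm_triangle_ineq4[of "z + t *\<^sub>R nu" "t *\<^sub>R nu"] nu by simp
            ultimately show ?thesis using True by (auto simp: abs_le_iff indicator_def)
          qed simp
        qed
      qed
    qed
    also have "\<dots> = emeasure N (cball 0 (2*r)) * emeasure lborel {-r..r}"
      by (simp add: nn_integral_cmult) (subst nn_integral_multc, auto intro!: borel_measurable_indicator)
    also have "\<dots> < \<infinity>" using Nfin[of "2*r"] by (simp add: ennreal_mult_less_top emeasure_lborel_Icc_eq)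
    finally show ?thesis .
  qed
  define c where "c = emeasure M (uminus -` cbox 0 One)"
  have M: "emeasure M A = c * emeasure lborel A" if "A \<in> sets borel" for A
    unfolding c_def by (rule translation_invariant_emeasure[OF setsM Minv Mfin that])
  have "c < \<infinity>"
  proof -
    have "emeasure M (cball 0 1) < \<infinity>" by (rule Mfin)
    moreover have "emeasure lborel (cball (0::'a) 1) \<noteq> 0"
      using unit_ball_vol_pos[of "real DIM('a)"] by (simp add: emeasure_cball less_imp_neq[symmetric] del: unit_ball_vol_pos)
    ultimately show ?thesis using M[of "cball 0 1"] by (auto simp: ennreal_mult_less_top)
  qed
  moreover have "hausdorff_measure ?s S = c * emeasure lborel {x. x - (x \<bullet> nu) *\<^sub>R nu \<in> S \<and> 0 < x \<bullet> nu \<and> x \<bullet> nu \<le> 1}"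
    if S[measurable]: "S \<in> sets borel" and SV: "S \<subseteq> ?V" for S
  proof -
    let ?A = "{x. x - (x \<bullet> nu) *\<^sub>R nu \<in> S \<and> 0 < x \<bullet> nu \<and> x \<bullet> nu \<le> 1}"
    have A[measurable]: "?A \<in> sets borel" by measurable
    have "c * emeasure lborel ?A = emeasure M ?A" using M[OF A] by simp
    also have "\<dots> = (\<integral>\<^sup>+x. indicator ?A x \<partial>M)" by (simp add: setsM)
    also have "\<dots> = (\<integral>\<^sup>+z. (\<integral>\<^sup>+t. indicator ?A (z + t *\<^sub>R nu) \<partial>lborel) \<partial>N)" by (subst nnM) auto
    also have "\<dots> = (\<integral>\<^sup>+z. (\<integral>\<^sup>+t. indicator S z * indicator {0<..1::real} t \<partial>lborel) \<partial>N)"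
    proof (rule nn_integral_cong_AE)
      have "AE z in N. z \<in> ?V" unfolding N_def using V by (subst AE_density) (auto simp: indicator_def)
      then show "AE z in N. (\<integral>\<^sup>+t. indicator ?A (z + t *\<^sub>R nu) \<partial>lborel) = (\<integral>\<^sup>+t. indicator S z * indicator {0<..1::real} t \<partial>lborel)"
      proof eventually_elim
        case (elim z)
        have "indicator ?A (z + t *\<^sub>R nu) = (indicator S z * indicator {0<..1::real} t :: ennreal)" for t
          using elim by (auto simp: indicator_def inner_add_left nu1)
        then show ?case by simp
      qed
    qed
    also have "\<dots> = emeasure N S" by (simp add: nn_integral_cmult)
    also have "\<dots> = hausdorff_measure ?s S" using SV by (simp add: emN Int_absorb2)
    finally show ?thesis ..
  qed
  ultimately show ?thesis by (rule that)
qed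

text \<open>A rigid motion carrying one fixed hyperplane to the given one transports the formula, so
  a single \<open>c\<close> serves all positions and directions.\<close>

lemma hausdorff_measure_slab:
  assumes n2: "DIM('a::euclidean_space) \<ge> 2"
  obtains c where "c < (\<infinity>::ennreal)"
    "\<And>S nu a. S \<in> sets borel \<Longrightarrow> norm (nu::'a) = 1 \<Longrightarrow> S \<subseteq> {x. x \<bullet> nu = a} \<Longrightarrow> hausdorff_measure (DIM('a) - 1) S
        = c * emeasure lborel {x. x - (x \<bullet> nu - a) *\<^sub>R nu \<in> S \<and> 0 < x \<bullet> nu - a \<and> x \<bullet> nu - a \<le> 1}"
proof -
  obtain e :: 'a where e: "norm e = 1" using norm_Basis[OF SOME_Basis] by blast
  obtain c where c: "c < (\<infinity>::ennreal)" "\<And>S. S \<in> sets borel \<Longrightarrow> S \<subseteq> {x. x \<bullet> e = 0} \<Longrightarrow> hausdorff_measure (DIM('a) - 1) S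
        = c * emeasure lborel {x. x - (x \<bullet> e) *\<^sub>R e \<in> S \<and> 0 < x \<bullet> e \<and> x \<bullet> e \<le> 1}"
    using hausdorff_measure_slab_direction[OF n2 e] by blast
  show ?thesis
  proof (rule that[OF c(1)])
    fix S and nu :: 'a and a
    assume S[measurable]: "S \<in> sets borel" and nu: "norm nu = 1" and SV: "S \<subseteq> {x. x \<bullet> nu = a}"
    have nu1: "nu \<bullet> nu = 1" using nu by (simp add: norm_eq_1)
    obtain U where U: "orthogonal_transformation U" "U e = nu"
      using orthogonal_transformation_exists_unit[of e nu] e nu by auto
    have lin: "linear U" using U by (simp add: orthogonal_transformation_linear)
    define f where "f x = U x + a *\<^sub>R nu" for x
    have [measurable]: "U \<in> borel_measurable borel"
      using lin by (intro borel_measurable_continuous_onI linear_continuous_on linear_conv_bounded_linear[THEN iffD1])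
    have f[measurable]: "f \<in> borel_measurable borel" unfolding f_def by measurable
    have df: "dist (f x) (f y) = dist x y" for x y
      using U(1) by (simp add: f_def dist_norm linear_diff[OF lin, symmetric] orthogonal_transformation_norm)
    have inn: "f x \<bullet> nu = x \<bullet> e + a" for x
      using U unfolding f_def orthogonal_transformation_def by (auto simp: inner_add_left nu1)
    have surj: "surj f"
    proof -
      have "surj U" using U(1) by (rule orthogonal_transformation_surj)
      have "y \<in> range f" for y
      proof -
        obtain x where "U x = y - a *\<^sub>R nu" using \<open>surj U\<close> by (metis surjD)
        then have "f x = y" by (simp add: f_def)
        then show ?thesis by blast
      qed
      then show ?thesis by blast
    qed
    let ?S = "f -` S"
    let ?X = "{x. x - (x \<bullet> nu - a) *\<^sub>R nu \<in> S \<and> 0 < x \<bullet> nu - a \<and> x \<bullet> nu - a \<le> 1}"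
    have X[measurable]: "?X \<in> sets borel" by measurable
    have S': "?S \<in> sets borel" using measurable_sets_borel[OF f S] .
    have "hausdorff_measure (DIM('a) - 1) S = hausdorff_measure (DIM('a) - 1) (f ` ?S)"
      using surj by (simp add: surj_image_vimage_eq)
    also have "\<dots> = hausdorff_measure (DIM('a) - 1) ?S"
      by (rule hausdorff_measure_isometry) (rule df)
    also have "\<dots> = c * emeasure lborel {x. x - (x \<bullet> e) *\<^sub>R e \<in> ?S \<and> 0 < x \<bullet> e \<and> x \<bullet> e \<le> 1}"
    proof (rule c(2)[OF S'])
      show "?S \<subseteq> {x. x \<bullet> e = 0}"
      proof
        fix x assume "x \<in> ?S"
        then have "f x \<bullet> nu = a" using SV by auto
        then show "x \<in> {x. x \<bullet> e = 0}" by (simp add: inn)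
      qed
    qed
    also have "{x. x - (x \<bullet> e) *\<^sub>R e \<in> ?S \<and> 0 < x \<bullet> e \<and> x \<bullet> e \<le> 1} = f -` ?X"
    proof -
      have "f (x - (x \<bullet> e) *\<^sub>R e) = f x - (f x \<bullet> nu - a) *\<^sub>R nu" for x
        unfolding inn by (simp add: f_def linear_diff[OF lin] linear_scale[OF lin] U(2))
      then show ?thesis by (auto simp: inn)
    qed
    also have "emeasure lborel (f -` ?X) = emeasure (distr lborel borel f) ?X"
      by (simp add: emeasure_distr)
    also have "distr lborel borel f = distr (distr lborel borel U) borel ((+) (a *\<^sub>R nu))"
      by (subst distr_distr) (auto simp: o_def f_def[abs_def] add.commute)
    also have "\<dots> = lborel" by (simp add: lborel_distr_orthogonal[OF U(1)] lborel_distr_plus)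
    finally show "hausdorff_measure (DIM('a) - 1) S = c * emeasure lborel ?X" .
  qed
qed

section \<open>Polynomial functions determined by their values\<close>

text \<open>Lagrange interpolation at the nodes 0 to \<open>N\<close>: \<open>w k i\<close> is the
  coefficient of degree \<open>k\<close> of the polynomial that is 1 at \<open>i\<close> and 0 at
  the other nodes.\<close>

lemma vandermonde_weights:
  "\<exists>w :: nat \<Rightarrow> nat \<Rightarrow> real. \<forall>a. \<forall>k\<le>N. a k = (\<Sum>i\<le>N. w k i * (\<Sum>l\<le>N. a l * real i ^ l))"
proof -
  define L :: "nat \<Rightarrow> real poly" where "L i = (\<Prod>j\<in>{..N}-{i}. smult (1 / (real i - real j)) [:- real j, 1:])" for i
  have Lv: "poly (L i) (real j) = (if i = j then 1 else 0)" if "i \<le> N" "j \<le> N" for i j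
  proof (cases "i = j")
    case True
    have "poly (L i) (real j) = 1"
      unfolding L_def poly_prod using True by (intro prod.neutral ballI) (auto simp: diff_divide_distrib[symmetric])
    then show ?thesis using True by simp
  next
    case False
    then have "\<exists>j'\<in>{..N}-{i}. poly (smult (1 / (real i - real j')) [:- real j', 1:]) (real j) = 0"
      using that by (intro bexI[of _ j]) auto
    then show ?thesis using False unfolding L_def poly_prod by (simp add: prod_zero_iff)
  qed
  have Ld: "degree (L i) \<le> N" if "i \<le> N" for i
  proof -
    have "degree (L i) \<le> (\<Sum>j\<in>{..N}-{i}. degree (smult (1 / (real i - real j)) [:- real j, 1:]))"
      unfolding L_def by (rule degree_prod_sum_le[simplified o_def]) auto
    also have "\<dots> \<le> (\<Sum>j\<in>{..N}-{i}. 1)" by (intro sum_mono) (auto intro: order_trans[OF degree_smult_le])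
    also have "\<dots> \<le> N" using that by simp
    finally show ?thesis .
  qed
  show ?thesis
  proof (intro exI[of _ "\<lambda>k i. coeff (L i) k"] allI impI)
    fix a :: "nat \<Rightarrow> real" and k assume k: "k \<le> N"
    define p where "p = (\<Sum>l\<le>N. monom (a l) l)"
    have pv: "poly p x = (\<Sum>l\<le>N. a l * x ^ l)" for x by (simp add: p_def poly_sum poly_monom)
    let ?p = "\<Sum>i\<le>N. smult (poly p (real i)) (L i)"
    have "p = ?p"
    proof (rule poly_eqI_degree[of "real ` {..N}"])
      fix x assume "x \<in> real ` {..N}"
      then obtain j where j: "j \<le> N" "x = real j" by auto
      have "poly ?p x = (\<Sum>i\<le>N. if i = j then poly p (real i) else 0)"
        unfolding poly_sum using j by (intro sum.cong) (auto simp: Lv)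
      then show "poly p x = poly ?p x" using j by simp
    next
      have c: "card (real ` {..N}) = Suc N" by (subst card_image) (auto simp: inj_on_def)
      have "degree p \<le> N" unfolding p_def by (intro degree_sum_le) (auto intro: order_trans[OF degree_monom_le])
      then show "card (real ` {..N}) > degree p" using c by simp
      have "degree ?p \<le> N"
        by (intro degree_sum_le) (auto simp: Ld)
      then show "card (real ` {..N}) > degree ?p" using c by simp
    qed
    from arg_cong[OF this, of "\<lambda>q. coeff q k"] have "coeff p k = (\<Sum>i\<le>N. poly p (real i) * coeff (L i) k)" by (simp add: coeff_sum)
    moreover have "coeff p k = a k"
    proof -
      have "coeff p k = (\<Sum>l\<le>N. if l = k then a l else 0)" by (simp add: p_def coeff_sum)
      then show ?thesis using k by simp
    qed
    ultimately show "a k = (\<Sum>i\<le>N. coeff (L i) k * (\<Sum>l\<le>N. a l * real i ^ l))" by (simp add: pv mult.commute)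
  qed
qed

definition wts :: "nat \<Rightarrow> nat \<Rightarrow> nat \<Rightarrow> real" where
  "wts N = (SOME w. \<forall>a. \<forall>k\<le>N. a k = (\<Sum>i\<le>N. w k i * (\<Sum>l\<le>N. a l * real i ^ l)))"

text \<open>A coefficient written as a fixed linear combination of finitely many values. It makes
  sense for every \<open>F\<close> and passes to pointwise limits, which is how Steiner formulas
  survive approximation.\<close>

definition cfs :: "nat \<Rightarrow> nat \<Rightarrow> (real \<Rightarrow> real) \<Rightarrow> real" where
  "cfs N k F = (\<Sum>i\<le>N. wts N k i * F (real i))"

definition ispoly :: "nat \<Rightarrow> (real \<Rightarrow> real) \<Rightarrow> bool" where
  "ispoly N F \<longleftrightarrow> (\<forall>r\<ge>0. F r = (\<Sum>k\<le>N. cfs N k F * r ^ k))"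

lemma wts: "k \<le> N \<Longrightarrow> a k = (\<Sum>i\<le>N. wts N k i * (\<Sum>l\<le>N. a l * real i ^ l))"
  using someI_ex[OF vandermonde_weights[of N]] unfolding wts_def by blast

lemma cfs_eq:
  assumes "\<And>r. r \<ge> 0 \<Longrightarrow> F r = (\<Sum>k\<le>N. a k * r ^ k)" and "k \<le> N"
  shows "cfs N k F = a k"
  using wts[OF assms(2), of a] by (simp add: cfs_def assms(1))

lemma ispolyI:
  assumes "\<And>r. r \<ge> 0 \<Longrightarrow> F r = (\<Sum>k\<le>N. a k * r ^ k)"
  shows "ispoly N F"
  unfolding ispoly_def using cfs_eq[OF assms] assms by simp

lemma cfs_tendsto:
  assumes "\<And>r. r \<ge> 0 \<Longrightarrow> (\<lambda>n. F n r) \<longlonglongrightarrow> G r"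
  shows "(\<lambda>n. cfs N k (F n)) \<longlonglongrightarrow> cfs N k G"
  unfolding cfs_def by (intro tendsto_intros assms) auto

lemma ispoly_lim:
  assumes "\<And>r. r \<ge> 0 \<Longrightarrow> (\<lambda>n. F n r) \<longlonglongrightarrow> G r" "\<And>n. ispoly N (F n)"
  shows "ispoly N G"
  unfolding ispoly_def
proof (intro allI impI)
  fix r :: real assume r: "r \<ge> 0"
  have "(\<lambda>n. F n r) \<longlonglongrightarrow> (\<Sum>k\<le>N. cfs N k G * r ^ k)"
    using assms(2) r unfolding ispoly_def by (simp, intro tendsto_intros cfs_tendsto assms(1))
  then show "G r = (\<Sum>k\<le>N. cfs N k G * r ^ k)" using assms(1)[OF r] LIMSEQ_unique by blast
qed

section \<open>The local Steiner formula\<close>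

abbreviation "cp \<equiv> closest_point"

lemma cp_eqI:
  assumes K: "convex K" "closed K" and y: "y \<in> K" "\<And>z. z \<in> K \<Longrightarrow> (x - y) \<bullet> (z - y) \<le> 0"
  shows "cp K x = y"
proof -
  have "dist x y \<le> dist x z" if "z \<in> K" for z
  proof -
    have "(dist x z)\<^sup>2 = (dist x y)\<^sup>2 + (dist y z)\<^sup>2 - 2 * ((x - y) \<bullet> (z - y))"
      by (simp add: dist_norm power2_norm_eq_inner inner_diff_left inner_diff_right inner_commute)
    then have "(dist x y)\<^sup>2 \<le> (dist x z)\<^sup>2" using y(2)[OF that] zero_le_power2[of "dist y z"] by linarith
    then show ?thesis by (simp add: power2_le_iff_abs_le)
  qed
  then show ?thesis using closest_point_unique[OF K y(1)] by metis
qed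

lemma cp_measurable:
  fixes K :: "'a::euclidean_space set"
  assumes "convex K" "closed K" "K \<noteq> {}" shows "cp K \<in> borel_measurable borel"
  by (intro borel_measurable_continuous_onI continuous_on_closest_point assms)

lemma cp_extend:
  fixes K :: "'a::euclidean_space set"
  assumes K: "convex K" "closed K" "K \<noteq> {}" and t: "t \<ge> 0"
  shows "cp K (cp K x + t *\<^sub>R (x - cp K x)) = cp K x"
  using closest_point_dot[OF K(1,2)] t closest_point_in_set[OF K(2,3)]
  by (intro cp_eqI K) (auto simp: mult_nonneg_nonpos)

text \<open>The strict inequality removes \<open>K\<close> itself, so local parallel volumes have no
  constant term.\<close>

definition shell :: "'a::euclidean_space set \<Rightarrow> real \<Rightarrow> 'a set" where
  "shell K r = {x. 0 < dist x (cp K x) \<and> dist x (cp K x) \<le> r}"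

definition stein :: "'a::euclidean_space set \<Rightarrow> ('a \<Rightarrow> real) \<Rightarrow> real \<Rightarrow> real" where
  "stein K f r = (\<integral>x. indicator (shell K r) x * f (cp K x) \<partial>lborel)"

lemma shell_measurable:
  assumes "convex K" "closed K" "K \<noteq> {}" shows "shell K r \<in> sets borel"
  unfolding shell_def using cp_measurable[OF assms] by measurable

lemma shell_subset:
  assumes "closed K" "K \<subseteq> cball 0 R" "K \<noteq> {}"
  shows "shell K r \<subseteq> cball 0 (R + r)"
proof
  fix x assume "x \<in> shell K r"
  then have "dist x (cp K x) \<le> r" by (simp add: shell_def)
  moreover have "norm (cp K x) \<le> R" using closest_point_in_set[OF assms(1,3), of x] assms(2) by auto
  ultimately show "x \<in> cball 0 (R + r)" using norm_triangle_ineq2[of x "cp K x"] by (simp add: dist_norm)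
qed

lemma shell_0 [simp]: "shell K 0 = {}"
  by (auto simp: shell_def)

lemma stein_0 [simp]: "stein K f 0 = 0"
  by (simp add: stein_def)

definition unitfun :: "('a::euclidean_space \<Rightarrow> real) \<Rightarrow> bool" where
  "unitfun f \<longleftrightarrow> f \<in> borel_measurable borel \<and> (\<forall>x. 0 \<le> f x \<and> f x \<le> 1)"

lemma stein_measurable:
  assumes K: "convex K" "closed K" "K \<noteq> {}" and f: "unitfun f"
  shows "(\<lambda>x. indicator (shell K r) x * f (cp K x)) \<in> borel_measurable borel"
proof -
  note [measurable] = cp_measurable[OF K] shell_measurable[OF K, of r]
  have [measurable]: "f \<in> borel_measurable borel" using f by (simp add: unitfun_def)
  show ?thesis by measurable
qed

lemma integrable_indicator_cball: "integrable lborel (indicator (cball (a::'a::euclidean_space) r) :: 'a \<Rightarrow> real)"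
  by (intro integrable_real_indicator) (use emeasure_lborel_cball_finite in \<open>auto simp: less_top\<close>)

lemma stein_integrable:
  fixes K :: "'a::euclidean_space set"
  assumes K: "convex K" "compact K" "K \<noteq> {}" and f: "unitfun f"
  shows "integrable lborel (\<lambda>x. indicator (shell K r) x * f (cp K x))"
proof -
  obtain R where R: "K \<subseteq> cball 0 R" using compact_imp_bounded[OF K(2)] by (metis bounded_subset_ballD ball_subset_cball subset_trans)
  have cl: "closed K" using K(2) by (rule compact_imp_closed)
  show ?thesis
  proof (rule Bochner_Integration.integrable_bound[of _ "indicator (cball 0 (R + r))"])
    show "integrable lborel (indicator (cball (0::'a) (R + r)) :: 'a \<Rightarrow> real)" by (rule integrable_indicator_cball)
    show "(\<lambda>x. indicator (shell K r) x * f (cp K x)) \<in> borel_measurable lborel"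
      using stein_measurable[OF K(1) cl K(3) f] by simp
    show "AE x in lborel. norm (indicator (shell K r) x * f (cp K x)) \<le> norm (indicator (cball 0 (R + r)) x :: real)"
      using shell_subset[OF cl R K(3), of r] f by (intro AE_I2) (auto simp: indicator_def unitfun_def)
  qed
qed

lemma stein_mono:
  assumes K: "convex K" "compact K" "K \<noteq> {}" and f: "unitfun f" "unitfun g" and le: "\<And>x. x \<in> K \<Longrightarrow> f x \<le> g x"
  shows "stein K f r \<le> stein K g r"
  unfolding stein_def using closest_point_in_set[OF compact_imp_closed[OF K(2)] K(3)]
  by (intro integral_mono stein_integrable K f) (auto simp: indicator_def le)

lemma stein_cong:
  assumes "closed K" "K \<noteq> {}" "\<And>x. x \<in> K \<Longrightarrow> f x = g x" shows "stein K f r = stein K g r"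
  unfolding stein_def using closest_point_in_set[OF assms(1,2)] assms(3) by simp

lemma stein_nonneg: "unitfun f \<Longrightarrow> stein K f r \<ge> 0"
  unfolding stein_def by (intro integral_nonneg_AE) (auto simp: unitfun_def)

lemma stein_add:
  assumes K: "convex K" "compact K" "K \<noteq> {}" and f: "unitfun f" "unitfun g"
  shows "stein K (\<lambda>x. f x + g x) r = stein K f r + stein K g r"
  unfolding stein_def by (subst Bochner_Integration.integral_add[symmetric]) (auto intro!: stein_integrable K f simp: distrib_left)

subsection \<open>Convergence\<close>

text \<open>Convergence in the Hausdorff metric.\<close>

definition hconv :: "(nat \<Rightarrow> 'a::euclidean_space set) \<Rightarrow> 'a set \<Rightarrow> bool" where
  "hconv K C \<longleftrightarrow> (\<forall>e>0. \<forall>\<^sub>F i in sequentially. (\<forall>x\<in>C. \<exists>y\<in>K i. dist x y \<le> e) \<and> (\<forall>x\<in>K i. \<exists>y\<in>C. dist x y \<le> e))"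

text \<open>The angle at the nearest point is not acute, so by the cosine rule a point of
  \<open>C\<close> that is almost as close to \<open>x\<close> must lie near
  \<open>cp C x\<close>.\<close>

lemma cp_near:
  fixes C :: "'a::euclidean_space set"
  assumes C: "convex C" "closed C" "C \<noteq> {}" and y: "y \<in> C" "dist x y \<le> dist x (cp C x) + \<eta>" "\<eta> \<ge> 0"
  shows "(dist y (cp C x))\<^sup>2 \<le> 2 * dist x (cp C x) * \<eta> + \<eta>\<^sup>2"
proof -
  have "(x - cp C x) \<bullet> (y - cp C x) \<le> 0" by (rule closest_point_dot[OF C(1,2) y(1)])
  moreover have "(dist x y)\<^sup>2 = (dist x (cp C x))\<^sup>2 + (dist y (cp C x))\<^sup>2 - 2 * ((x - cp C x) \<bullet> (y - cp C x))"
    by (simp add: dist_norm power2_norm_eq_inner inner_diff_left inner_diff_right inner_commute)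
  ultimately have "(dist y (cp C x))\<^sup>2 \<le> (dist x y)\<^sup>2 - (dist x (cp C x))\<^sup>2" by linarith
  also have "(dist x y)\<^sup>2 \<le> (dist x (cp C x) + \<eta>)\<^sup>2" using y(2) by (intro power_mono) auto
  finally show ?thesis by (simp add: power2_eq_square algebra_simps)
qed

lemma hconv_cp:
  fixes C :: "'a::euclidean_space set"
  assumes C: "convex C" "closed C" "C \<noteq> {}" and K: "\<And>i. convex (K i)" "\<And>i. closed (K i)" "\<And>i. K i \<noteq> {}" and h: "hconv K C"
  shows "(\<lambda>i. cp (K i) x) \<longlonglongrightarrow> cp C x"
proof -
  define d where "d = dist x (cp C x)"
  have key: "\<forall>\<^sub>F i in sequentially. dist (cp (K i) x) (cp C x) \<le> e + sqrt (2 * d * (2 * e) + (2 * e)\<^sup>2)" if e: "e > 0" for e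
  proof -
    have "\<forall>\<^sub>F i in sequentially. (\<forall>x\<in>C. \<exists>y\<in>K i. dist x y \<le> e) \<and> (\<forall>x\<in>K i. \<exists>y\<in>C. dist x y \<le> e)" using h e by (simp add: hconv_def)
    then show ?thesis
    proof eventually_elim
      case (elim i)
      obtain y where y: "y \<in> C" "dist (cp (K i) x) y \<le> e" using elim closest_point_in_set[OF K(2,3)] by blast
      obtain z where z: "z \<in> K i" "dist (cp C x) z \<le> e" using elim closest_point_in_set[OF C(2,3)] by blast
      have "dist x (cp (K i) x) \<le> dist x z" by (rule closest_point_le[OF K(2) z(1)])
      also have "\<dots> \<le> d + e" using z(2) dist_triangle[of x z "cp C x"] by (simp add: d_def)
      finally have "dist x y \<le> d + 2 * e" using y(2) dist_triangle[of x y "cp (K i) x"] by linarith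
      then have "(dist y (cp C x))\<^sup>2 \<le> 2 * d * (2*e) + (2*e)\<^sup>2"
        using cp_near[OF C y(1), of x "2*e"] e by (simp add: d_def)
      then have "dist y (cp C x) \<le> sqrt (2 * d * (2*e) + (2*e)\<^sup>2)" by (rule real_le_rsqrt)
      then show ?case using y(2) dist_triangle[of "cp (K i) x" "cp C x" y] by linarith
    qed
  qed
  have lim: "((\<lambda>e. e + sqrt (2 * d * (2 * e) + (2 * e)\<^sup>2)) \<longlongrightarrow> 0 + sqrt (2 * d * (2 * 0) + (2 * 0)\<^sup>2)) (at_right 0)"
    by (intro tendsto_intros)
  show ?thesis
  proof (rule tendstoI)
    fix \<epsilon> :: real assume "\<epsilon> > 0"
    then have "\<forall>\<^sub>F e in at_right 0. e + sqrt (2 * d * (2 * e) + (2 * e)\<^sup>2) < \<epsilon>"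
      using order_tendstoD(2)[OF lim, of \<epsilon>] by simp
    moreover have "\<forall>\<^sub>F e::real in at_right 0. e > 0" by (simp add: eventually_at_right_less)
    ultimately have "\<exists>e>0. e + sqrt (2 * d * (2 * e) + (2 * e)\<^sup>2) < \<epsilon>"
      using eventually_happens'[OF trivial_limit_at_right_real[of 0]] eventually_conj by (metis (mono_tags, lifting))
    then obtain e where e: "e > 0" "e + sqrt (2 * d * (2 * e) + (2 * e)\<^sup>2) < \<epsilon>" by blast
    show "\<forall>\<^sub>F i in sequentially. dist (cp (K i) x) (cp C x) < \<epsilon>"
      using key[OF e(1)] by eventually_elim (use e(2) in linarith)
  qed
qed

lemma interior_in_approx:
  fixes K :: "'a::euclidean_space set"
  assumes K: "convex K" "closed K" "K \<noteq> {}" and e: "e > 0" and b: "ball x (2*e) \<subseteq> C" and near: "\<forall>x\<in>C. \<exists>y\<in>K. dist x y \<le> e"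
  shows "x \<in> K"
proof (rule ccontr)
  assume "x \<notin> K"
  define y where "y = cp K x"
  have yK: "y \<in> K" unfolding y_def by (rule closest_point_in_set[OF K(2,3)])
  then have xy: "x \<noteq> y" using \<open>x \<notin> K\<close> by auto
  define u where "u = (1 / norm (x - y)) *\<^sub>R (x - y)"
  have u: "norm u = 1" using xy by (simp add: u_def)
  \<comment> \<open>\<open>p\<close> is still in \<open>ball x (2*e)\<close> and hence in
    \<open>C\<close>, but it lies at least \<open>3/2*e\<close> beyond the hyperplane supporting
    \<open>K\<close> at \<open>y\<close>, so no point of \<open>K\<close> is within \<open>e\<close>
    of it.\<close>
  define p where "p = x + (3/2*e) *\<^sub>R u"
  have "p \<in> C" using b e u by (auto simp: p_def dist_norm intro!: subsetD[OF b])
  then obtain z where z: "z \<in> K" "dist p z \<le> e" using near by blast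
  have "(x - y) \<bullet> (z - y) \<le> 0" unfolding y_def by (rule closest_point_dot[OF K(1,2) z(1)])
  then have "u \<bullet> (z - y) \<le> 0" by (simp add: u_def divide_nonpos_nonneg)
  moreover have "u \<bullet> (x - y) = norm (x - y)" using xy by (simp add: u_def dot_square_norm power2_eq_square)
  moreover have "u \<bullet> u = 1" using u by (simp add: norm_eq_1)
  ultimately have "u \<bullet> (p - z) \<ge> 3/2*e" by (simp add: p_def inner_diff_right inner_add_right) (smt (verit) norm_ge_zero)
  moreover have "u \<bullet> (p - z) \<le> norm (p - z)" using norm_cauchy_schwarz[of u "p - z"] u by simp
  ultimately show False using z(2) e by (simp add: dist_norm)
qed

lemma parallel_set_convex:
  fixes C :: "'a::euclidean_space set"
  assumes C: "convex C" "closed C" "C \<noteq> {}"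
  shows "convex {x. dist x (cp C x) \<le> r}"
  unfolding convex_alt mem_Collect_eq
proof (intro ballI allI impI)
  fix x y and u :: real
  assume xy: "x \<in> {x. dist x (cp C x) \<le> r}" "y \<in> {x. dist x (cp C x) \<le> r}" and u: "0 \<le> u \<and> u \<le> 1"
  let ?z = "(1 - u) *\<^sub>R x + u *\<^sub>R y"
  let ?w = "(1 - u) *\<^sub>R cp C x + u *\<^sub>R cp C y"
  have "?w \<in> C" using u closest_point_in_set[OF C(2,3)] convexD_alt[OF C(1)] by blast
  then have "dist ?z (cp C ?z) \<le> dist ?z ?w" by (rule closest_point_le[OF C(2)])
  also have "\<dots> = norm ((1 - u) *\<^sub>R (x - cp C x) + u *\<^sub>R (y - cp C y))" by (simp add: dist_norm algebra_simps)
  also have "\<dots> \<le> (1 - u) * norm (x - cp C x) + u * norm (y - cp C y)"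
    using u by (intro norm_triangle_le) auto
  also have "\<dots> \<le> (1 - u) * r + u * r" using xy u by (intro add_mono mult_left_mono) (auto simp: dist_norm)
  finally show "dist ?z (cp C ?z) \<le> r" by (simp add: algebra_simps)
qed

text \<open>Moving outwards along the normal ray raises the distance, so the level set lies on the
  boundary of a convex parallel set, and such boundaries are null.\<close>

lemma null_level_set:
  assumes C: "convex C" "closed C" "C \<noteq> {}" and r: "r > 0"
  shows "AE x in lborel. dist x (cp C x) \<noteq> r"
proof -
  let ?D = "{x. dist x (cp C x) \<le> r}"
  have "x \<in> frontier ?D" if x: "dist x (cp C x) = r" for x
  proof -
    have "x \<notin> interior ?D"
    proof
      assume "x \<in> interior ?D"
      then obtain e where e: "e > 0" "ball x e \<subseteq> ?D" by (meson mem_interior)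
      let ?y = "cp C x + (1 + e / (2*r)) *\<^sub>R (x - cp C x)"
      have n: "norm (x - cp C x) = r" using x by (simp add: dist_norm)
      have "?y - x = (e/(2*r)) *\<^sub>R (x - cp C x)" by (simp add: algebra_simps)
      then have "dist x ?y = e/2" using n r e by (simp add: dist_norm norm_minus_commute[of x])
      then have "?y \<in> ?D" using e by (intro subsetD[OF e(2)]) simp
      moreover have "cp C ?y = cp C x" using e r by (intro cp_extend C) auto
      ultimately have "(1 + e/(2*r)) * r \<le> r" using n e r by (simp add: dist_norm)
      then show False using e r by (simp add: field_simps) (smt (verit) mult_pos_pos)
    qed
    moreover have "x \<in> closure ?D" using x closure_subset[of ?D] by auto
    ultimately show ?thesis by (simp add: frontier_def)
  qed
  then have "{x. dist x (cp C x) = r} \<subseteq> frontier ?D" by auto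
  moreover have "negligible (frontier ?D)" by (intro negligible_convex_frontier parallel_set_convex C)
  ultimately have "negligible {x. dist x (cp C x) = r}" by (rule negligible_subset[rotated])
  moreover have "{x. dist x (cp C x) = r} \<in> sets borel" using cp_measurable[OF C] by measurable
  ultimately have "{x. dist x (cp C x) = r} \<in> null_sets lborel"
    by (simp add: negligible_iff_null_sets null_sets_completion_iff)
  from AE_not_in[OF this] show ?thesis by simp
qed

lemma AE_not_frontier:
  assumes "convex C" shows "AE x in lborel. x \<notin> frontier C"
proof -
  have "frontier C \<in> null_sets lborel"
    using negligible_convex_frontier[OF assms] by (simp add: negligible_iff_null_sets null_sets_completion_iff borel_closed)
  then show ?thesis by (rule AE_not_in)
qed

text \<open>Dominated convergence. The shell indicators converge except on the boundary of
  \<open>C\<close> and at distance exactly \<open>r\<close>, both null; the weights converge because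
  \<open>f\<close> is continuous and nearest points converge.\<close>

lemma stein_hconv:
  fixes C :: "'a::euclidean_space set"
  assumes C: "convex C" "compact C" "C \<noteq> {}" and K: "\<And>i. convex (K i)" "\<And>i. compact (K i)" "\<And>i. K i \<noteq> {}" and h: "hconv K C"
    and f: "unitfun f" "continuous_on UNIV f" and r: "r \<ge> 0"
  shows "(\<lambda>i. stein (K i) f r) \<longlonglongrightarrow> stein C f r"
proof (cases "r = 0")
  case False
  with r have r: "r > 0" by simp
  have clC: "closed C" and clK: "closed (K i)" for i using C K compact_imp_closed by auto
  obtain R where R: "C \<subseteq> cball 0 R" using compact_imp_bounded[OF C(2)] by (metis bounded_subset_ballD ball_subset_cball subset_trans)
  have ev: "\<forall>\<^sub>F i in sequentially. (\<forall>x\<in>C. \<exists>y\<in>K i. dist x y \<le> e) \<and> (\<forall>x\<in>K i. \<exists>y\<in>C. dist x y \<le> e)" if "e > 0" for e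
    using h that by (simp add: hconv_def)
  from ev[of 1] obtain i0 where i0: "\<And>i. i \<ge> i0 \<Longrightarrow> \<forall>x\<in>K i. \<exists>y\<in>C. dist x y \<le> 1" unfolding eventually_sequentially by (meson zero_less_one)
  have KR: "K i \<subseteq> cball 0 (R + 1)" if ii: "i \<ge> i0" for i
  proof
    fix x assume "x \<in> K i"
    then obtain y where "y \<in> C" "dist x y \<le> 1" using i0[OF ii] by blast
    then show "x \<in> cball 0 (R + 1)" using R norm_triangle_ineq2[of x y] by (auto simp: dist_norm subset_iff)
  qed
  have "(\<lambda>i. stein (K (i + i0)) f r) \<longlonglongrightarrow> stein C f r"
    unfolding stein_def
  proof (rule integral_dominated_convergence[where w="indicator (cball 0 (R + 1 + r))"])
    show "(\<lambda>x. indicator (shell C r) x * f (cp C x)) \<in> borel_measurable lborel"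
      using stein_measurable[OF C(1) clC C(3) f(1)] by simp
    show "(\<lambda>x. indicator (shell (K (i + i0)) r) x * f (cp (K (i + i0)) x)) \<in> borel_measurable lborel" for i
      using stein_measurable[OF K(1) clK K(3) f(1)] by simp
    show "integrable lborel (indicator (cball (0::'a) (R + 1 + r)) :: 'a \<Rightarrow> real)" by (rule integrable_indicator_cball)
    show "AE x in lborel. norm (indicator (shell (K (i + i0)) r) x * f (cp (K (i + i0)) x)) \<le> indicator (cball 0 (R + 1 + r)) x" for i
      using shell_subset[OF clK KR K(3), of "i + i0" r] f by (intro AE_I2) (auto simp: indicator_def unitfun_def)
    show "AE x in lborel. (\<lambda>i. indicator (shell (K (i + i0)) r) x * f (cp (K (i + i0)) x)) \<longlonglongrightarrow> indicator (shell C r) x * f (cp C x)"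
      using null_level_set[OF C(1) clC C(3) r] AE_not_frontier[OF C(1)]
    proof eventually_elim
      case (elim x)
      have cpl: "(\<lambda>i. cp (K i) x) \<longlonglongrightarrow> cp C x" by (rule hconv_cp[OF C(1) clC C(3) K(1) clK K(3) h])
      have dl: "(\<lambda>i. dist x (cp (K i) x)) \<longlonglongrightarrow> dist x (cp C x)" by (intro tendsto_intros cpl)
      have fl: "(\<lambda>i. f (cp (K i) x)) \<longlonglongrightarrow> f (cp C x)"
        using f(2) cpl by (intro isCont_tendsto_compose[of _ f]) (auto simp: continuous_on_eq_continuous_at)
      have il: "\<forall>\<^sub>F i in sequentially. indicator (shell (K i) r) x = (indicator (shell C r) x :: real)"
      proof (cases "x \<in> C")
        case True
        then have "x \<in> interior C" using elim(2) clC by (auto simp: frontier_def closure_closed)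
        then obtain e where e: "e > 0" "ball x e \<subseteq> C" by (meson mem_interior)
        from ev[of "e/2"] e(1) have "\<forall>\<^sub>F i in sequentially. (\<forall>x\<in>C. \<exists>y\<in>K i. dist x y \<le> e/2) \<and> (\<forall>x\<in>K i. \<exists>y\<in>C. dist x y \<le> e/2)" by simp
        then have "\<forall>\<^sub>F i in sequentially. x \<in> K i"
        proof eventually_elim
          case (elim i)
          then show ?case using e by (intro interior_in_approx[OF K(1) clK K(3), of "e/2" x C]) auto
        qed
        then show ?thesis
          by eventually_elim (use True in \<open>auto simp: shell_def closest_point_self indicator_def\<close>)
      next
        case False
        then have d0: "dist x (cp C x) > 0" using closest_point_refl[OF clC C(3), of x] by auto
        have 1: "\<forall>\<^sub>F i in sequentially. dist x (cp (K i) x) > 0" using order_tendstoD(1)[OF dl d0] .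
        show ?thesis
        proof (cases "dist x (cp C x) < r")
          case True
          from 1 order_tendstoD(2)[OF dl True] show ?thesis
            by eventually_elim (use d0 True in \<open>auto simp: shell_def indicator_def\<close>)
        next
          case False
          with elim(1) have *: "r < dist x (cp C x)" by simp
          from 1 order_tendstoD(1)[OF dl *] show ?thesis
            by eventually_elim (use d0 * in \<open>auto simp: shell_def indicator_def\<close>)
        qed
      qed
      have "(\<lambda>i. indicator (shell C r) x * f (cp (K i) x)) \<longlonglongrightarrow> indicator (shell C r) x * f (cp C x)"
        by (intro tendsto_intros fl)
      then have "(\<lambda>i. indicator (shell (K i) r) x * f (cp (K i) x)) \<longlonglongrightarrow> indicator (shell C r) x * f (cp C x)"
        by (rule Lim_transform_eventually) (use il in eventually_elim, simp)
      then show ?case by (rule LIMSEQ_ignore_initial_segment)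
    qed
  qed
  then show ?thesis by (rule LIMSEQ_offset)
qed simp

section \<open>Approximation by inscribed and circumscribed polytopes\<close>

lemma polytope_approx:
  fixes C :: "'a::euclidean_space set"
  assumes C: "convex C" "compact C" "C \<noteq> {}" and e: "e > 0"
  obtains K K' where "polytope K" "polytope K'" "K \<noteq> {}" "K \<subseteq> C" "C \<subseteq> K'" "\<forall>x\<in>C. \<exists>y\<in>K. dist x y \<le> e" "\<forall>x\<in>K'. \<exists>y\<in>C. dist x y \<le> e"
proof -
  \<comment> \<open>A cube of half side \<open>d\<close> has all its points within
    \<open>DIM * d = e\<close> of the centre in the 1-norm, so the outer polytope stays
    \<open>e\<close>-close to \<open>C\<close>.\<close>
  define d where "d = e / real DIM('a)"
  have d: "d > 0" using e by (simp add: d_def)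
  have "e * 1 \<le> e * real DIM('a)" using e DIM_positive[where 'a='a] by (intro mult_left_mono) linarith+
  then have d: "d > 0" "d \<le> e" using d by (auto simp: d_def divide_le_eq)
  obtain F where F: "finite F" "F \<subseteq> C" "C \<subseteq> (\<Union>x\<in>F. ball x d)"
    using seq_compact_imp_totally_bounded[OF compact_imp_seq_compact[OF C(2)], rule_format, OF d(1)] by (elim exE conjE)
  have ne: "F \<noteq> {}" using F C(3) by auto
  let ?d = "(\<Sum>i\<in>Basis. d *\<^sub>R i) :: 'a"
  have "\<exists>V. finite V \<and> cbox (x - ?d) (x + ?d) = convex hull V" for x
    using cube_convex_hull[OF d(1), of x] by metis
  then obtain V where V: "\<And>x. finite (V x)" "\<And>x. cbox (x - ?d) (x + ?d) = convex hull (V x)" by metis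
  have cb: "y \<in> cbox (x - ?d) (x + ?d) \<longleftrightarrow> (\<forall>i\<in>Basis. \<bar>(y - x) \<bullet> i\<bar> \<le> d)" for x y
    by (auto simp: mem_box inner_diff_left inner_add_left abs_le_iff inner_sum_left inner_Basis if_distrib cong: if_cong)
  show ?thesis
  proof
    show "polytope (convex hull F)" using F by (simp add: polytope_convex_hull)
    show "polytope (convex hull (\<Union>x\<in>F. V x))" using F V by (simp add: polytope_convex_hull)
    show "convex hull F \<noteq> {}" using ne by simp
    show "convex hull F \<subseteq> C" using F C by (simp add: hull_minimal)
    show "C \<subseteq> convex hull (\<Union>x\<in>F. V x)"
    proof
      fix y assume "y \<in> C"
      then obtain x where x: "x \<in> F" "dist x y < d" using F by auto
      have "y \<in> cbox (x - ?d) (x + ?d)"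
        unfolding cb using x(2) by (auto simp: dist_norm norm_minus_commute intro!: order_trans[OF Basis_le_norm])
      then have "y \<in> convex hull (V x)" by (simp add: V)
      also have "convex hull (V x) \<subseteq> convex hull (\<Union>x\<in>F. V x)" using x by (intro hull_mono) auto
      finally show "y \<in> convex hull (\<Union>x\<in>F. V x)" .
    qed
    show "\<forall>x\<in>C. \<exists>y\<in>convex hull F. dist x y \<le> e"
    proof
      fix y assume "y \<in> C"
      then obtain x where "x \<in> F" "dist x y < d" using F(3) by auto
      then show "\<exists>y'\<in>convex hull F. dist y y' \<le> e" using d(2) by (intro bexI[of _ x]) (auto simp: dist_commute hull_inc)
    qed
    show "\<forall>x\<in>convex hull (\<Union>x\<in>F. V x). \<exists>y\<in>C. dist x y \<le> e"
    proof -
      let ?D = "{x. dist x (cp C x) \<le> e}"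
      have cl: "closed C" using C compact_imp_closed by blast
      have "v \<in> ?D" if v: "x \<in> F" "v \<in> V x" for x v
      proof -
        have "v \<in> cbox (x - ?d) (x + ?d)" using v V hull_inc by metis
        then have "(\<Sum>b\<in>Basis. \<bar>(v - x) \<bullet> b\<bar>) \<le> (\<Sum>i\<in>(Basis::'a set). d)" unfolding cb by (intro sum_mono) auto
        then have "norm (v - x) \<le> (\<Sum>i\<in>(Basis::'a set). d)" by (rule order_trans[OF norm_le_l1])
        then have "dist v x \<le> e" by (simp add: d_def dist_norm)
        moreover have "dist v (cp C v) \<le> dist v x" using v F by (intro closest_point_le cl) auto
        ultimately show ?thesis by simp
      qed
      then have "convex hull (\<Union>x\<in>F. V x) \<subseteq> ?D"
        by (intro hull_minimal parallel_set_convex C cl) auto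
      then show ?thesis using closest_point_in_set[OF cl C(3)] by blast
    qed
  qed
qed

lemma polytope_approx_seq:
  fixes C :: "'a::euclidean_space set"
  assumes C: "convex C" "compact C" "C \<noteq> {}"
  obtains K K' where "\<And>i. polytope (K i)" "\<And>i. polytope (K' i)" "\<And>i. K i \<noteq> {}" "\<And>i. K i \<subseteq> C" "\<And>i. C \<subseteq> K' i" "hconv K C" "hconv K' C"
proof -
  have "\<forall>i. \<exists>K K'. polytope K \<and> polytope K' \<and> K \<noteq> {} \<and> K \<subseteq> C \<and> C \<subseteq> K' \<and> (\<forall>x\<in>C. \<exists>y\<in>K. dist x y \<le> 1 / real (Suc i)) \<and> (\<forall>x\<in>K'. \<exists>y\<in>C. dist x y \<le> 1 / real (Suc i))"
    using polytope_approx[OF C] by (metis of_nat_0_less_iff zero_less_Suc zero_less_divide_1_iff)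
  then obtain K K' where K: "\<And>i. polytope (K i)" "\<And>i. polytope (K' i)" "\<And>i. K i \<noteq> {}" "\<And>i. K i \<subseteq> C" "\<And>i. C \<subseteq> K' i"
    "\<And>i. \<forall>x\<in>C. \<exists>y\<in>K i. dist x y \<le> 1 / real (Suc i)" "\<And>i. \<forall>x\<in>K' i. \<exists>y\<in>C. dist x y \<le> 1 / real (Suc i)" by metis
  have ev: "\<forall>\<^sub>F i in sequentially. 1 / real (Suc i) \<le> e" if "e > 0" for e :: real
    using order_tendstoD(2)[OF LIMSEQ_inverse_real_of_nat that] by (auto simp: inverse_eq_divide elim: eventually_mono)
  have "hconv K C" unfolding hconv_def
  proof (intro allI impI)
    fix e :: real assume e: "e > 0"
    show "\<forall>\<^sub>F i in sequentially. (\<forall>x\<in>C. \<exists>y\<in>K i. dist x y \<le> e) \<and> (\<forall>x\<in>K i. \<exists>y\<in>C. dist x y \<le> e)"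
      using ev[OF e]
    proof eventually_elim
      case (elim i)
      show ?case
      proof (intro conjI ballI)
        fix x assume "x \<in> C" then show "\<exists>y\<in>K i. dist x y \<le> e" using K(6)[of i] elim by (meson order_trans)
      next
        fix x assume "x \<in> K i" then show "\<exists>y\<in>C. dist x y \<le> e" using K(4)[of i] e by (intro bexI[of _ x]) auto
      qed
    qed
  qed
  moreover have "hconv K' C" unfolding hconv_def
  proof (intro allI impI)
    fix e :: real assume e: "e > 0"
    show "\<forall>\<^sub>F i in sequentially. (\<forall>x\<in>C. \<exists>y\<in>K' i. dist x y \<le> e) \<and> (\<forall>x\<in>K' i. \<exists>y\<in>C. dist x y \<le> e)"
      using ev[OF e]
    proof eventually_elim
      case (elim i)
      show ?case
      proof (intro conjI ballI)
        fix x assume "x \<in> K' i" then show "\<exists>y\<in>C. dist x y \<le> e" using K(7)[of i] elim by (meson order_trans)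
      next
        fix x assume "x \<in> C" then show "\<exists>y\<in>K' i. dist x y \<le> e" using K(5)[of i] e by (intro bexI[of _ x]) auto
      qed
    qed
  qed
  ultimately show ?thesis using K that by blast
qed

section \<open>The Steiner formula for polytopes, face by face\<close>

lemma polytope_point_in_face_rel_interior:
  fixes K :: "'a::euclidean_space set"
  assumes "polytope K" "z \<in> K"
  shows "\<exists>G. G face_of K \<and> z \<in> rel_interior G"
  using assms
proof (induction "nat (aff_dim K + 1)" arbitrary: K rule: less_induct)
  case less
  show ?case
  proof (cases "z \<in> rel_interior K")
    case True
    then show ?thesis using face_of_refl[OF polytope_imp_convex[OF less.prems(1)]] by blast
  next
    case False
    then obtain F where F: "F facet_of K" "z \<in> F"
      using rel_boundary_of_polyhedron[OF polytope_imp_polyhedron[OF less.prems(1)]] less.prems(2) by blast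
    then have FK: "F face_of K" and dim: "aff_dim F = aff_dim K - 1" and ne: "F \<noteq> {}"
      by (auto simp: facet_of_def)
    have "nat (aff_dim F + 1) < nat (aff_dim K + 1)"
      using dim ne aff_dim_geq[of F] aff_dim_empty[of F] by linarith
    with less.hyps[OF this face_of_polytope_polytope[OF less.prems(1) FK] F(2)] show ?thesis
      using FK face_of_trans by blast
  qed
qed

lemma rel_interior_borel:
  fixes S :: "'a::euclidean_space set" shows "rel_interior S \<in> sets borel"
proof -
  obtain T where "open T" "rel_interior S = affine hull S \<inter> T"
    using openin_rel_interior[of S] unfolding openin_open by blast
  then show ?thesis by (auto intro: borel_open borel_closed closed_affine_hull)
qed

text \<open>From a relatively interior point the face continues both towards \<open>y\<close> and
  away from it, so the inequality for nearest points holds with both signs.\<close>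

lemma face_normal_orthogonal:
  fixes K :: "'a::euclidean_space set"
  assumes K: "convex K" "closed K" and G: "convex G" "G \<subseteq> K" and z: "cp K x \<in> rel_interior G" and y: "y \<in> G"
  shows "(x - cp K x) \<bullet> (y - cp K x) = 0"
proof (rule antisym)
  let ?z = "cp K x"
  show "(x - ?z) \<bullet> (y - ?z) \<le> 0" using closest_point_dot[OF K, of y x] G y by auto
  obtain e where e: "e > 1" "(1 - e) *\<^sub>R y + e *\<^sub>R ?z \<in> G"
    using convex_rel_interior_if2[OF G(1) z] y hull_inc by metis
  have "(x - ?z) \<bullet> ((1 - e) *\<^sub>R y + e *\<^sub>R ?z - ?z) \<le> 0" using closest_point_dot[OF K] e G by auto
  moreover have "(1 - e) *\<^sub>R y + e *\<^sub>R ?z - ?z = (1 - e) *\<^sub>R (y - ?z)" by (simp add: algebra_simps)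
  ultimately have "(1 - e) * ((x - ?z) \<bullet> (y - ?z)) \<le> 0" by simp
  then show "0 \<le> (x - ?z) \<bullet> (y - ?z)" using e by (simp add: mult_le_0_iff)
qed

text \<open>Where \<open>g\<close> is nonzero, normals lie in \<open>span B\<close> and nearest
  points in \<open>z0 + span C\<close>. Stretching the \<open>B\<close> component by
  \<open>r\<close> therefore fixes nearest points and multiplies distances by
  \<open>r\<close>.\<close>

lemma stein_scale:
  assumes K: "convex K" "compact K" "K \<noteq> {}" and g: "unitfun g"
    and BC: "orthonormal (B \<union> C)" "B \<inter> C = {}" "span (B \<union> C) = UNIV"
    and sup: "\<And>x. g (cp K x) \<noteq> 0 \<Longrightarrow> x - cp K x \<in> span B \<and> cp K x - z0 \<in> span C"
    and r: "r > 0"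
  shows "stein K g r = r ^ card B * stein K g 1"
proof -
  have cl: "closed K" using K compact_imp_closed by blast
  have B: "orthonormal B" and C: "orthonormal C" using BC orthonormal_subset by blast+
  define F where "F s x = ennreal (indicator (shell K s) x * g (cp K x))" for s x
  have [measurable]: "F s \<in> borel_measurable borel" for s
    unfolding F_def using stein_measurable[OF K(1) cl K(3) g, of s] by measurable
  have st: "stein K g s = enn2real (\<integral>\<^sup>+x. F s x \<partial>lborel)" for s
    unfolding stein_def F_def using g stein_measurable[OF K(1) cl K(3) g, of s]
    by (intro integral_eq_nn_integral) (auto simp: unitfun_def)
  let ?T = "\<lambda>y. z0 + (r *\<^sub>R pr B y + pr C y)"
  note split = pr_split[OF BC(1,2)] and dec = pr_decomp[OF BC]
  have one: "cp K (?T y) = cp K (z0 + y) \<and> ?T y - cp K (z0 + y) = r *\<^sub>R (z0 + y - cp K (z0 + y))" if "g (cp K (z0 + y)) \<noteq> 0" for y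
  proof -
    define z where "z = cp K (z0 + y)"
    have "z0 + y - z \<in> span B" "z - z0 \<in> span C" using sup[OF that] by (auto simp: z_def)
    from split[OF this] have "pr B y = z0 + y - z" "pr C y = z - z0" by (simp_all add: algebra_simps)
    then have T: "?T y = z + r *\<^sub>R (z0 + y - z)" by simp
    then have "cp K (?T y) = z" unfolding T z_def using r by (intro cp_extend K cl) auto
    then show ?thesis using T by (simp add: z_def)
  qed
  have eq: "F r (?T y) = F 1 (z0 + y)" for y
  proof (cases "g (cp K (z0 + y)) = 0")
    case False
    have c: "cp K (?T y) = cp K (z0 + y)" using one[OF False] by simp
    have "dist (?T y) (cp K (z0 + y)) = r * dist (z0 + y) (cp K (z0 + y))"
      unfolding dist_norm using one[OF False] r by (metis abs_of_pos norm_scaleR)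
    then have "?T y \<in> shell K r \<longleftrightarrow> z0 + y \<in> shell K 1"
      unfolding shell_def mem_Collect_eq c using r by (simp add: zero_less_mult_iff)
    then show ?thesis by (simp only: F_def c indicator_def)
  next
    case True
    have "g (cp K (?T y)) = 0"
    proof (rule ccontr)
      assume nz: "g (cp K (?T y)) \<noteq> 0"
      define z where "z = cp K (?T y)"
      have zz: "?T y - z \<in> span B" "z - z0 \<in> span C" using sup[OF nz] by (auto simp: z_def)
      have "pr B (r *\<^sub>R pr B y + pr C y) = ?T y - z" "pr C (r *\<^sub>R pr B y + pr C y) = z - z0"
        using split[OF zz] by (simp_all add: algebra_simps)
      then have "r *\<^sub>R pr B y = ?T y - z" "pr C y = z - z0"
        using split[OF span_scale[OF pr_in_span] pr_in_span, of r y y] by auto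
      then have "pr B y = (1/r) *\<^sub>R (?T y - z)" using r by (metis divide_self_if less_numeral_extra(3) mult.commute scaleR_one scaleR_scaleR times_divide_eq_left mult_1)
      with \<open>pr C y = z - z0\<close> dec[of y] have "z0 + y = z + (1/r) *\<^sub>R (?T y - z)" by (metis add.commute add_diff_cancel_left' add_diff_eq diff_add_cancel)
      then have "cp K (z0 + y) = z" unfolding z_def using r cp_extend[OF K(1) cl K(3), of "1/r" "?T y"] by simp
      then show False using True nz by (simp add: z_def)
    qed
    then show ?thesis using True by (simp add: F_def)
  qed
  have tr: "(\<integral>\<^sup>+x. F s x \<partial>lborel) = (\<integral>\<^sup>+y. F s (z0 + y) \<partial>lborel)" for s
    by (subst lborel_distr_plus[symmetric, of z0]) (simp add: nn_integral_distr)
  have "(\<integral>\<^sup>+x. F r x \<partial>lborel) = ennreal (r ^ card B) * (\<integral>\<^sup>+y. F r (?T y) \<partial>lborel)"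
    unfolding tr[of r] by (rule nn_integral_lborel_scale[OF BC r]) measurable
  also have "\<dots> = ennreal (r ^ card B) * (\<integral>\<^sup>+x. F 1 x \<partial>lborel)" by (simp add: eq tr[of 1])
  finally show ?thesis using r by (simp add: st enn2real_mult)
qed

lemma face_frame:
  fixes G :: "'a::euclidean_space set"
  assumes z0: "z0 \<in> G"
  obtains B C where "orthonormal (B \<union> C)" "B \<inter> C = {}" "span (B \<union> C) = UNIV" "span C = span ((\<lambda>y. y - z0) ` G)"
    "span B = orthogonal_comp (span C)" "int (card B) = int DIM('a) - aff_dim G"
proof -
  obtain C where C: "orthonormal C" "span C = span ((\<lambda>y. y - z0) ` G)" "card C = dim (span ((\<lambda>y. y - z0) ` G))"
    using orthonormal_basis_of[OF subspace_span] by metis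
  obtain B where B: "orthonormal (C \<union> B)" "C \<inter> B = {}" "span (C \<union> B) = UNIV" "span B = orthogonal_comp (span C)" "card B = DIM('a) - card C"
    using orthonormal_extend[OF C(1)] by metis
  have "aff_dim G = int (dim ((\<lambda>x. - z0 + x) ` G))" by (rule aff_dim_eq_dim) (simp add: z0 hull_inc)
  then have "aff_dim G = int (card C)" using C(3) by simp
  moreover have "card C \<le> DIM('a)" using C(3) dim_subset_UNIV by metis
  ultimately have "int (card B) = int DIM('a) - aff_dim G" using B(5) by simp
  with B C show ?thesis by (intro that[of B C]) (auto simp: Un_commute Int_commute)
qed

lemma unitfun_indicator_mult:
  "unitfun f \<Longrightarrow> A \<in> sets borel \<Longrightarrow> unitfun (\<lambda>x. indicator A x * f x)"
  by (auto simp: unitfun_def indicator_def intro!: borel_measurable_times)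

lemma unitfun_indicator: "A \<in> sets borel \<Longrightarrow> unitfun (indicator A)"
  by (auto simp: unitfun_def indicator_def)

lemma stein_face_scale:
  fixes K :: "'a::euclidean_space set"
  assumes K: "polytope K" and G: "G face_of K" "G \<noteq> {}" and f: "unitfun f" and r: "r > 0"
  shows "stein K (\<lambda>x. indicator (rel_interior G) x * f x) r = r ^ nat (int DIM('a) - aff_dim G) * stein K (\<lambda>x. indicator (rel_interior G) x * f x) 1"
proof -
  have K': "convex K" "compact K" "K \<noteq> {}" "closed K"
    using K G polytope_imp_convex polytope_imp_compact polytope_imp_closed face_of_imp_subset by auto
  obtain z0 where z0: "z0 \<in> G" using G by auto
  obtain B C where BC: "orthonormal (B \<union> C)" "B \<inter> C = {}" "span (B \<union> C) = UNIV" "span C = span ((\<lambda>y. y - z0) ` G)"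
    "span B = orthogonal_comp (span C)" "int (card B) = int DIM('a) - aff_dim G"
    using face_frame[OF z0] by blast
  have "stein K (\<lambda>x. indicator (rel_interior G) x * f x) r = r ^ card B * stein K (\<lambda>x. indicator (rel_interior G) x * f x) 1"
  proof (rule stein_scale[OF K'(1-3) _ BC(1-3) _ r, of _ z0])
    show "unitfun (\<lambda>x. indicator (rel_interior G) x * f x)" by (intro unitfun_indicator_mult f rel_interior_borel)
    fix x assume "indicator (rel_interior G) (cp K x) * f (cp K x) \<noteq> 0"
    then have z: "cp K x \<in> rel_interior G" by (auto simp: indicator_def split: if_splits)
    have o: "(x - cp K x) \<bullet> (y - cp K x) = 0" if "y \<in> G" for y
      using face_normal_orthogonal[OF K'(1,4) face_of_imp_convex[OF G(1)] face_of_imp_subset[OF G(1)] z that] .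
    have "(x - cp K x) \<bullet> (y - z0) = 0" if "y \<in> G" for y using o[OF that] o[OF z0] by (simp add: inner_diff_right)
    then have "x - cp K x \<in> orthogonal_comp (span ((\<lambda>y. y - z0) ` G))"
      unfolding orthogonal_comp_def mem_Collect_eq
      by (intro ballI) (metis (no_types, lifting) orthogonal_to_span orthogonal_commute orthogonal_def imageE)
    moreover have "cp K x - z0 \<in> span ((\<lambda>y. y - z0) ` G)"
      using z rel_interior_subset by (intro span_base) auto
    ultimately show "x - cp K x \<in> span B \<and> cp K x - z0 \<in> span C" using BC by simp
  qed
  moreover have "card B = nat (int DIM('a) - aff_dim G)" using BC(6) by simp
  ultimately show ?thesis by simp
qed

text \<open>A point outside a convex body never has an interior point as its nearest point.\<close>

lemma stein_full_face_0:
  fixes K :: "'a::euclidean_space set"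
  assumes K: "polytope K" and G: "G face_of K" "aff_dim G = int DIM('a)"
  shows "stein K (\<lambda>x. indicator (rel_interior G) x * f x) r = 0"
proof -
  have K': "convex K" "closed K" "K \<noteq> {}"
    using K G polytope_imp_convex polytope_imp_closed face_of_imp_subset[OF G(1)] by auto
  have *: "indicator (shell K r) x * (indicator (rel_interior G) (cp K x) * f (cp K x)) = 0" for x
  proof (rule ccontr)
    assume "\<not> ?thesis"
    then have x: "x \<in> shell K r" "cp K x \<in> rel_interior G" by (auto simp: indicator_def split: if_splits)
    have "cp K x \<in> interior K"
      using x(2) G face_of_imp_subset[OF G(1)] interior_mono[of G K] rel_interior_interior[of G] aff_dim_eq_full[of G] by auto
    then obtain e where e: "e > 0" "ball (cp K x) e \<subseteq> K" by (meson mem_interior)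
    have n: "norm (x - cp K x) > 0" using x(1) by (simp add: shell_def dist_norm)
    define y where "y = cp K x + (e / (2 * norm (x - cp K x))) *\<^sub>R (x - cp K x)"
    have "y \<in> K" using e n by (intro subsetD[OF e(2)]) (simp add: y_def dist_norm)
    then have "(x - cp K x) \<bullet> (y - cp K x) \<le> 0" by (rule closest_point_dot[OF K'(1,2)])
    then have "e / (2 * norm (x - cp K x)) * ((x - cp K x) \<bullet> (x - cp K x)) \<le> 0" by (simp add: y_def)
    moreover have "e / (2 * norm (x - cp K x)) * ((x - cp K x) \<bullet> (x - cp K x)) > 0"
      using e n by (intro mult_pos_pos) auto
    ultimately show False by linarith
  qed
  show ?thesis unfolding stein_def * by simp
qed

text \<open>The relative interiors of the faces partition the polytope, so every nearest point is
  counted for exactly one face.\<close>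

lemma stein_polytope_decomp:
  assumes K: "polytope K" "K \<noteq> {}" and f: "unitfun f"
  shows "stein K f r = (\<Sum>G | G face_of K \<and> G \<noteq> {}. stein K (\<lambda>x. indicator (rel_interior G) x * f x) r)"
proof -
  have K': "convex K" "compact K" "closed K"
    using K polytope_imp_convex polytope_imp_compact polytope_imp_closed by auto
  let ?F = "{G. G face_of K \<and> G \<noteq> {}}"
  have fin: "finite ?F" using finite_polytope_faces[OF K(1)] by simp
  have one: "(\<Sum>G\<in>?F. indicator (rel_interior G) z) = (1::real)" if zK: "z \<in> K" for z
  proof -
    obtain G where G: "G face_of K" "z \<in> rel_interior G" using polytope_point_in_face_rel_interior[OF K(1) zK] by blast
    have un: "indicator (rel_interior G') z = (if G' = G then 1 else (0::real))" if G': "G' \<in> ?F" for G'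
    proof (cases "z \<in> rel_interior G'")
      case True
      have "G' = G" by (rule face_of_eq) (use G G' True in blast)+
      then show ?thesis using G by simp
    next
      case False
      then have "G' \<noteq> G" using G by auto
      then show ?thesis using False by simp
    qed
    have "G \<in> ?F" using G rel_interior_subset by auto
    have "(\<Sum>G'\<in>?F. indicator (rel_interior G') z) = (\<Sum>G'\<in>?F. if G' = G then 1 else (0::real))"
      by (rule sum.cong[OF refl]) (rule un)
    then show ?thesis using \<open>G \<in> ?F\<close> fin by (simp add: sum.delta')
  qed
  have "stein K f r = (\<integral>x. (\<Sum>G\<in>?F. indicator (shell K r) x * (indicator (rel_interior G) (cp K x) * f (cp K x))) \<partial>lborel)"
    unfolding stein_def
  proof (rule Bochner_Integration.integral_cong[OF refl])
    fix x
    have "(\<Sum>G\<in>?F. indicator (shell K r) x * (indicator (rel_interior G) (cp K x) * f (cp K x))) = indicator (shell K r) x * f (cp K x) * (\<Sum>G\<in>?F. indicator (rel_interior G) (cp K x))"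
      by (simp add: sum_distrib_left mult_ac)
    then show "indicator (shell K r) x * f (cp K x) = (\<Sum>G\<in>?F. indicator (shell K r) x * (indicator (rel_interior G) (cp K x) * f (cp K x)))"
      using one[OF closest_point_in_set[OF K'(3) K(2)], of x] by simp
  qed
  also have "\<dots> = (\<Sum>G\<in>?F. stein K (\<lambda>x. indicator (rel_interior G) x * f x) r)"
    unfolding stein_def
    by (rule Bochner_Integration.integral_sum) (intro stein_integrable[of K "\<lambda>x. indicator (rel_interior _) x * f x"] K K' unitfun_indicator_mult f rel_interior_borel)
  finally show ?thesis .
qed

lemma stein_polytope:
  fixes K :: "'a::euclidean_space set"
  assumes K: "polytope K" "K \<noteq> {}" and f: "unitfun f"
  defines "a \<equiv> \<lambda>k. \<Sum>G | G face_of K \<and> G \<noteq> {} \<and> nat (int DIM('a) - aff_dim G) = k. stein K (\<lambda>x. indicator (rel_interior G) x * f x) 1"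
  assumes r: "r \<ge> 0"
  shows "stein K f r = (\<Sum>k\<le>DIM('a). a k * r ^ k)"
proof -
  let ?F = "{G. G face_of K \<and> G \<noteq> {}}"
  let ?k = "\<lambda>G::'a set. nat (int DIM('a) - aff_dim G)"
  let ?s = "\<lambda>G r. stein K (\<lambda>x. indicator (rel_interior G) x * f x) r"
  have fin: "finite ?F" using finite_polytope_faces[OF K(1)] by simp
  have kle: "?k G \<in> {..DIM('a)}" if "G \<in> ?F" for G using that aff_dim_geq[of G] aff_dim_empty[of G] by auto
  \<comment> \<open>At \<open>r = 0\<close> only codimension 0 could fail, because
    \<open>0 ^ 0 = 1\<close>; there the coefficient itself vanishes.\<close>
  have sc: "?s G r = ?s G 1 * r ^ ?k G" if "G \<in> ?F" for G
  proof (cases "r = 0")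
    case True
    show ?thesis
    proof (cases "?k G = 0")
      case T: True
      then have "aff_dim G = int DIM('a)" using aff_dim_le_DIM[of G] by simp
      then have "?s G 1 = 0" using stein_full_face_0[OF K(1)] that by blast
      then show ?thesis using True by simp
    next
      case False then show ?thesis using True by (simp add: zero_power)
    qed
  next
    case False
    then show ?thesis using stein_face_scale[OF K(1), of G f r] that f r by (simp add: mult.commute)
  qed
  have "stein K f r = (\<Sum>G\<in>?F. ?s G 1 * r ^ ?k G)"
    using stein_polytope_decomp[OF K f, of r] sc by simp
  also have "\<dots> = (\<Sum>k\<le>DIM('a). \<Sum>G | G \<in> ?F \<and> ?k G = k. ?s G 1 * r ^ ?k G)"
    by (rule sum.group[symmetric, OF fin]) (use kle in auto)
  also have "\<dots> = (\<Sum>k\<le>DIM('a). a k * r ^ k)"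
    by (intro sum.cong refl) (simp add: a_def sum_distrib_right conj_assoc)
  finally show ?thesis .
qed

lemma stein_ispoly_continuous:
  fixes C :: "'a::euclidean_space set"
  assumes C: "convex C" "compact C" "C \<noteq> {}" and f: "unitfun f" "continuous_on UNIV f"
  shows "ispoly DIM('a) (stein C f)"
proof -
  obtain K K' where K: "\<And>i::nat. polytope (K i)" "\<And>i. K i \<noteq> {}" "hconv K C"
    using polytope_approx_seq[OF C] by metis
  show ?thesis
  proof (rule ispoly_lim[of "\<lambda>i. stein (K i) f"])
    show "ispoly DIM('a) (stein (K i) f)" for i
      by (rule ispolyI[OF stein_polytope[OF K(1,2) f(1)]])
    show "(\<lambda>i. stein (K i) f r) \<longlonglongrightarrow> stein C f r" if "r \<ge> 0" for r
      using K polytope_imp_convex polytope_imp_compact that by (intro stein_hconv C f) auto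
  qed
qed

text \<open>Lipschitz functions decreasing in \<open>k\<close> to the indicator of a nonempty closed
  set; they carry results for continuous weights over to closed sets.\<close>

definition bump :: "'a::euclidean_space set \<Rightarrow> nat \<Rightarrow> 'a \<Rightarrow> real" where
  "bump A k x = max 0 (1 - real k * infdist x A)"

lemma continuous_bump: "continuous_on S (bump A k)"
  unfolding bump_def[abs_def] by (intro continuous_intros)

lemma unitfun_bump: "unitfun (bump A k)"
  using borel_measurable_continuous_onI[OF continuous_bump, of A k] by (auto simp: unitfun_def bump_def infdist_nonneg)

lemma bump_ge: "x \<in> A \<Longrightarrow> bump A k x = 1"
  by (simp add: bump_def)

lemma bump_lim:
  assumes A: "closed A" "A \<noteq> {}" shows "(\<lambda>k. bump A k x) \<longlonglongrightarrow> indicator A x"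
proof (cases "x \<in> A")
  case False
  then have d: "infdist x A > 0" using A by (metis in_closed_iff_infdist_zero infdist_nonneg less_eq_real_def)
  obtain N :: nat where N: "1 / infdist x A < real N" using reals_Archimedean2 by blast
  have "bump A k x = 0" if "k \<ge> N" for k
  proof -
    have "1 < real N * infdist x A" using N d by (simp add: field_simps)
    also have "\<dots> \<le> real k * infdist x A" using that d by (intro mult_right_mono) auto
    finally show ?thesis by (simp add: bump_def)
  qed
  then have "\<forall>\<^sub>F k in sequentially. bump A k x = indicator A x" using False by (auto simp: eventually_sequentially)
  then show ?thesis by (rule tendsto_eventually)
qed (simp add: bump_ge)

lemma stein_dominated:
  fixes C :: "'a::euclidean_space set"
  assumes C: "convex C" "compact C" "C \<noteq> {}" and f: "\<And>k. unitfun (f k)" "unitfun g" and lim: "\<And>x. x \<in> C \<Longrightarrow> (\<lambda>k. f k x) \<longlonglongrightarrow> g x"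
  shows "(\<lambda>k. stein C (f k) r) \<longlonglongrightarrow> stein C g r"
proof -
  have cl: "closed C" using C compact_imp_closed by blast
  have one: "unitfun (\<lambda>x::'a. 1)" by (simp add: unitfun_def)
  show ?thesis unfolding stein_def
  proof (rule integral_dominated_convergence[where w="\<lambda>x. indicator (shell C r) x * 1"])
    show "(\<lambda>x. indicator (shell C r) x * g (cp C x)) \<in> borel_measurable lborel"
      "(\<lambda>x. indicator (shell C r) x * f k (cp C x)) \<in> borel_measurable lborel" for k
      using stein_measurable[OF C(1) cl C(3)] f by auto
    show "integrable lborel (\<lambda>x. indicator (shell C r) x * (1::real))" using stein_integrable[OF C one, of r] by simp
    show "AE x in lborel. norm (indicator (shell C r) x * f k (cp C x)) \<le> indicator (shell C r) x * 1" for k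
      using f by (intro AE_I2) (auto simp: indicator_def unitfun_def)
    show "AE x in lborel. (\<lambda>k. indicator (shell C r) x * f k (cp C x)) \<longlonglongrightarrow> indicator (shell C r) x * g (cp C x)"
      using lim closest_point_in_set[OF cl C(3)] by (intro AE_I2 tendsto_intros) auto
  qed
qed

lemma stein_bump_lim:
  assumes C: "convex C" "compact C" "C \<noteq> {}" and A: "closed A" "A \<noteq> {}"
  shows "(\<lambda>k. stein C (bump A k) r) \<longlonglongrightarrow> stein C (indicator A) r"
  using A by (intro stein_dominated C unitfun_bump unitfun_indicator bump_lim) auto

lemma stein_ispoly_closed:
  fixes C :: "'a::euclidean_space set"
  assumes C: "convex C" "compact C" "C \<noteq> {}" and A: "closed A"
  shows "ispoly DIM('a) (stein C (indicator A))"
proof (cases "A = {}")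
  case True
  then have "stein C (indicator A) r = (\<Sum>k\<le>DIM('a). 0 * r ^ k)" for r by (simp add: stein_def)
  then show ?thesis by (rule ispolyI)
next
  case False
  show ?thesis
    by (rule ispoly_lim[OF stein_bump_lim[OF C A False]]) (intro stein_ispoly_continuous C unitfun_bump continuous_bump)
qed

text \<open>Isolates the only property of the normalising factor that matters, so that both bodies
  can refer to the same unevaluated constant.\<close>

definition slabconst :: "'a::euclidean_space itself \<Rightarrow> real \<Rightarrow> bool" where
  "slabconst _ c \<longleftrightarrow> c \<ge> 0 \<and> (\<forall>S nu a. S \<in> sets borel \<longrightarrow> norm (nu::'a) = 1 \<longrightarrow> S \<subseteq> {x. x \<bullet> nu = a} \<longrightarrow> hausdorff_measure (DIM('a) - 1) S
        = ennreal c * emeasure lborel {x. x - (x \<bullet> nu - a) *\<^sub>R nu \<in> S \<and> 0 < x \<bullet> nu - a \<and> x \<bullet> nu - a \<le> 1})"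

lemma slabconst_exists:
  assumes "DIM('a::euclidean_space) \<ge> 2" obtains c where "slabconst TYPE('a) c"
proof -
  obtain c where c: "c < (\<infinity>::ennreal)"
    "\<And>S nu a. S \<in> sets borel \<Longrightarrow> norm (nu::'a) = 1 \<Longrightarrow> S \<subseteq> {x. x \<bullet> nu = a} \<Longrightarrow> hausdorff_measure (DIM('a) - 1) S
        = c * emeasure lborel {x. x - (x \<bullet> nu - a) *\<^sub>R nu \<in> S \<and> 0 < x \<bullet> nu - a \<and> x \<bullet> nu - a \<le> 1}"
    using hausdorff_measure_slab[OF assms] by blast
  then have "ennreal (enn2real c) = c" by simp
  with c(2) have "slabconst TYPE('a) (enn2real c)" unfolding slabconst_def by auto
  then show ?thesis by (rule that)
qed

lemma slabconstD:
  assumes "slabconst TYPE('a::euclidean_space) c" "S \<in> sets borel" "norm (nu::'a) = 1" "S \<subseteq> {x. x \<bullet> nu = a}"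
  shows "hausdorff_measure (DIM('a) - 1) S
        = ennreal c * emeasure lborel {x. x - (x \<bullet> nu - a) *\<^sub>R nu \<in> S \<and> 0 < x \<bullet> nu - a \<and> x \<bullet> nu - a \<le> 1}"
  using assms unfolding slabconst_def by blast

section \<open>Hausdorff measure of boundaries through Steiner coefficients\<close>

lemma face_support:
  fixes K :: "'a::euclidean_space set"
  assumes K: "polytope K" and G: "G face_of K" "G \<noteq> {}" "G \<noteq> K"
  obtains nu b where "norm nu = 1" "K \<subseteq> {x. x \<bullet> nu \<le> b}" "G = K \<inter> {x. x \<bullet> nu = b}"
proof -
  have "G exposed_face_of K" using exposed_face_of_polyhedron[OF polytope_imp_polyhedron[OF K]] G by blast
  then obtain a c where a: "K \<subseteq> {x. a \<bullet> x \<le> c}" "G = K \<inter> {x. a \<bullet> x = c}" by (auto simp: exposed_face_of_def)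
  have "a \<noteq> 0" using a G by auto
  then show ?thesis using a
    by (intro that[of "a /\<^sub>R norm a" "c / norm a"]) (auto simp: inner_commute divide_simps)
qed

text \<open>Over a facet the shell of height 1 is a prism, whose volume determines the measure of
  its base through \<open>c\<close>. For a smaller face the prism in the chosen normal direction
  lies in a proper affine subspace and is null.\<close>

lemma face_hausdorff:
  fixes K :: "'a::euclidean_space set"
  assumes c: "slabconst TYPE('a) c" and K: "polytope K" and G: "G face_of K" "G \<noteq> {}" "G \<noteq> K" and S: "S \<in> sets borel"
  shows "hausdorff_measure (DIM('a) - 1) (rel_interior G \<inter> S) =
    (if aff_dim G = int DIM('a) - 1 then ennreal c * ennreal (stein K (\<lambda>x. indicator (rel_interior G) x * indicator S x) 1) else 0)"
proof -
  have K': "convex K" "compact K" "closed K" "K \<noteq> {}"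
    using K G polytope_imp_convex polytope_imp_compact polytope_imp_closed face_of_imp_subset by auto
  obtain nu b where nu: "norm nu = 1" "K \<subseteq> {x. x \<bullet> nu \<le> b}" "G = K \<inter> {x. x \<bullet> nu = b}"
    using face_support[OF K G] by blast
  have nu1: "nu \<bullet> nu = 1" using nu by (simp add: norm_eq_1)
  obtain z0 where z0: "z0 \<in> G" using G by auto
  let ?V = "span ((\<lambda>y. y - z0) ` G)"
  let ?S = "rel_interior G \<inter> S"
  let ?X = "{x. x - (x \<bullet> nu - b) *\<^sub>R nu \<in> ?S \<and> 0 < x \<bullet> nu - b \<and> x \<bullet> nu - b \<le> 1}"
  have Sb[measurable]: "?S \<in> sets borel" using S rel_interior_borel by auto
  have X[measurable]: "?X \<in> sets borel" by measurable
  have SG: "?S \<subseteq> G" using rel_interior_subset by auto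
  have H: "hausdorff_measure (DIM('a) - 1) ?S = ennreal c * emeasure lborel ?X"
    using SG nu by (intro slabconstD[OF c Sb nu(1)]) auto
  have VG: "v \<bullet> nu = 0" if "v \<in> ?V" for v
  proof -
    have "orthogonal nu v" using that
      by (rule orthogonal_to_span) (use nu(3) z0 in \<open>auto simp: orthogonal_def inner_diff_right inner_commute\<close>)
    then show ?thesis by (simp add: orthogonal_def inner_commute)
  qed
  have dimV: "aff_dim G = int (dim ?V)"
    using aff_dim_eq_dim[of z0 G] z0 hull_inc[of z0 G] by simp
  show ?thesis
  proof (cases "aff_dim G = int DIM('a) - 1")
    case True
    have sub: "?V \<subseteq> {x. nu \<bullet> x = 0}" using VG by (auto simp: inner_commute)
    have dims: "dim ?V = dim {x. nu \<bullet> x = 0}"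
      using True dimV dim_hyperplane[of nu] nu(1) by fastforce
    have V: "?V = {x. nu \<bullet> x = 0}"
      by (rule subspace_dim_equal) (use sub dims subspace_hyperplane in auto)
    obtain y0 where y0: "y0 \<in> K" "y0 \<bullet> nu < b" using G(3) nu by force
    \<comment> \<open>Normals at relatively interior points of a facet are nonnegative multiples of
      \<open>nu\<close>, so the unit shell over the facet is exactly the prism.\<close>
    have iff: "x \<in> ?X \<longleftrightarrow> x \<in> shell K 1 \<and> cp K x \<in> ?S" for x
    proof
      assume x: "x \<in> ?X"
      define z where "z = x - (x \<bullet> nu - b) *\<^sub>R nu"
      have z: "z \<in> ?S" "z \<in> K" "z \<bullet> nu = b" using x SG nu(3) by (auto simp: z_def)
      have xz: "x - z = (x \<bullet> nu - b) *\<^sub>R nu" by (simp add: z_def)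
      have "cp K x = z"
      proof (rule cp_eqI[OF K'(1,3) z(2)])
        fix w assume "w \<in> K"
        then have "nu \<bullet> (w - z) \<le> 0" using nu(2) z(3) by (auto simp: inner_diff_right inner_commute)
        then show "(x - z) \<bullet> (w - z) \<le> 0" using x unfolding xz by (simp add: mult_nonneg_nonpos)
      qed
      moreover have "dist x z = x \<bullet> nu - b" using x nu(1) by (simp add: dist_norm xz)
      ultimately show "x \<in> shell K 1 \<and> cp K x \<in> ?S" using x z by (auto simp: shell_def)
    next
      assume x: "x \<in> shell K 1 \<and> cp K x \<in> ?S"
      define z where "z = cp K x"
      have zG: "z \<in> G" using x SG by (auto simp: z_def)
      have o: "(x - z) \<bullet> (y - z) = 0" if "y \<in> G" for y
        unfolding z_def using x by (intro face_normal_orthogonal[OF K'(1,3) face_of_imp_convex[OF G(1)] face_of_imp_subset[OF G(1)] _ that]) auto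
      have oV: "(x - z) \<bullet> v = 0" if "v \<in> ?V" for v
      proof -
        have "(x - z) \<bullet> (y - z0) = 0" if "y \<in> G" for y using o[OF that] o[OF z0] by (simp add: inner_diff_right)
        then have "orthogonal (x - z) v" using that by (intro orthogonal_to_span[OF that]) (auto simp: orthogonal_def)
        then show ?thesis by (simp add: orthogonal_def)
      qed
      define s where "s = (x - z) \<bullet> nu"
      define d where "d = (x - z) - s *\<^sub>R nu"
      have "nu \<bullet> d = 0" by (simp add: d_def s_def inner_diff_right nu1 inner_commute)
      then have "(x - z) \<bullet> d = 0" using oV[of d] V by auto
      then have "d \<bullet> d = 0" using \<open>nu \<bullet> d = 0\<close> by (simp add: d_def inner_diff_left)
      then have xz: "x - z = s *\<^sub>R nu" by (simp add: d_def)
      have "z \<bullet> nu = b" using zG nu(3) by auto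
      then have s: "s = x \<bullet> nu - b" by (simp add: s_def inner_diff_left)
      have "s \<ge> 0"
      proof -
        have "(x - z) \<bullet> (y0 - z) \<le> 0" unfolding z_def by (rule closest_point_dot[OF K'(1,3) y0(1)])
        then have "s * (nu \<bullet> (y0 - z)) \<le> 0" by (simp add: xz)
        moreover have "nu \<bullet> (y0 - z) < 0" using y0 \<open>z \<bullet> nu = b\<close> by (simp add: inner_diff_right inner_commute)
        ultimately show ?thesis by (auto simp: mult_le_0_iff)
      qed
      moreover have "dist x z = \<bar>s\<bar>" by (simp add: dist_norm xz nu(1))
      ultimately have "0 < s" "s \<le> 1" using x by (auto simp: shell_def z_def)
      moreover have "x - s *\<^sub>R nu = z" using xz by (simp add: algebra_simps)
      ultimately show "x \<in> ?X" using x s by (auto simp: z_def)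
    qed
    have "stein K (\<lambda>x. indicator (rel_interior G) x * indicator S x) 1 = (\<integral>x. indicator ?X x \<partial>lborel)"
      unfolding stein_def
    proof (rule Bochner_Integration.integral_cong[OF refl])
      fix x show "indicator (shell K 1) x * (indicator (rel_interior G) (cp K x) * indicator S (cp K x)) = (indicator ?X x :: real)"
        using iff[of x] by (auto simp: indicator_def)
    qed
    also have "\<dots> = measure lborel ?X" by simp
    finally have st: "stein K (\<lambda>x. indicator (rel_interior G) x * indicator S x) 1 = measure lborel ?X" .
    obtain R where R: "K \<subseteq> cball 0 R" using compact_imp_bounded[OF K'(2)] by (metis bounded_subset_ballD ball_subset_cball subset_trans)
    have "?X \<subseteq> shell K 1" using iff by blast
    then have "?X \<subseteq> cball 0 (R + 1)" using shell_subset[OF K'(3) R K'(4), of 1] by (rule subset_trans)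
    then have "bounded ?X" by (rule bounded_subset[OF bounded_cball])
    then have "emeasure lborel ?X < \<infinity>" by (rule emeasure_bounded_finite)
    then have "emeasure lborel ?X = ennreal (measure lborel ?X)" by (intro emeasure_eq_ennreal_measure) auto
    then show ?thesis using True H st by simp
  next
    case False
    have "aff_dim G < aff_dim K" using face_of_aff_dim_lt[OF K'(1) G(1,3)] .
    then have "aff_dim G < int DIM('a) - 1" using False aff_dim_le_DIM[of K] by linarith
    then have dl: "dim ?V + 1 < DIM('a)" using dimV by linarith
    have "?X \<subseteq> (+) z0 ` span (insert nu ?V)"
    proof
      fix x assume x: "x \<in> ?X"
      then have "x - (x \<bullet> nu - b) *\<^sub>R nu - z0 \<in> ?V" using SG by (intro span_base) auto
      then have "(x - (x \<bullet> nu - b) *\<^sub>R nu - z0) + (x \<bullet> nu - b) *\<^sub>R nu \<in> span (insert nu ?V)"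
        by (intro span_add span_scale) (auto intro: span_base)
      then show "x \<in> (+) z0 ` span (insert nu ?V)" by (intro image_eqI[of _ _ "x - z0"]) (auto simp: algebra_simps)
    qed
    moreover have "dim (span (insert nu ?V)) < DIM('a)"
      using dl by (simp add: dim_insert)
    then have "negligible (span (insert nu ?V))" by (rule negligible_lowdim)
    then have "negligible ((+) z0 ` span (insert nu ?V))" by (rule negligible_translation)
    ultimately have "negligible ?X" by (rule negligible_subset[rotated])
    then have "emeasure lborel ?X = 0" using X by (simp add: negligible_iff_null_sets null_sets_completion_iff null_setsD1)
    then show ?thesis using False H by simp
  qed
qed

text \<open>The boundary is the disjoint union of the relative interiors of proper faces. Only
  facets can have positive measure, and they are also the faces collected by the linear Steiner
  coefficient.\<close>

lemma polytope_frontier_hausdorff: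
  fixes K :: "'a::euclidean_space set"
  assumes n2: "DIM('a) \<ge> 2" and c: "slabconst TYPE('a) c" and K: "polytope K" "interior K \<noteq> {}" and S: "S \<in> sets borel"
  shows "hausdorff_measure (DIM('a) - 1) (frontier K \<inter> S) = ennreal c * ennreal (cfs DIM('a) 1 (stein K (indicator S)))"
proof -
  let ?g = "\<lambda>G x. indicator (rel_interior G) x * indicator S x"
  let ?s = "DIM('a) - 1"
  have s: "?s > 0" using n2 by simp
  have K': "convex K" "compact K" "closed K" "K \<noteq> {}"
    using K polytope_imp_convex polytope_imp_compact polytope_imp_closed by auto
  let ?F = "{G. G face_of K \<and> G \<noteq> {} \<and> G \<noteq> K}"
  have fin: "finite ?F" using finite_polytope_faces[OF K(1)] by simp
  have dimK: "aff_dim K = int DIM('a)" using K(2) by (simp add: aff_dim_nonempty_interior)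
  have rK: "rel_interior K = interior K" using K(2) by (simp add: rel_interior_nonempty_interior)
  have fr: "frontier K = (\<Union>G\<in>?F. rel_interior G)"
  proof (rule set_eqI, rule iffI)
    fix z assume "z \<in> frontier K"
    then have z: "z \<in> K" "z \<notin> interior K" using K'(3) by (auto simp: frontier_def)
    obtain G where G: "G face_of K" "z \<in> rel_interior G" using polytope_point_in_face_rel_interior[OF K(1) z(1)] by blast
    then have "G \<in> ?F" using z rK rel_interior_subset by auto
    then show "z \<in> (\<Union>G\<in>?F. rel_interior G)" using G by blast
  next
    fix z assume "z \<in> (\<Union>G\<in>?F. rel_interior G)"
    then obtain G where G: "G face_of K" "G \<noteq> K" "z \<in> rel_interior G" by blast
    have "z \<in> G" using G rel_interior_subset by blast
    then have "z \<notin> interior K" using face_of_disjoint_interior[OF G(1,2)] by blast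
    then show "z \<in> frontier K" using \<open>z \<in> G\<close> face_of_imp_subset[OF G(1)] K'(3) by (auto simp: frontier_def)
  qed
  have disj: "disjoint_family_on (\<lambda>G. rel_interior G \<inter> S) ?F"
    unfolding disjoint_family_on_def using face_of_eq by blast
  have "hausdorff_measure ?s (frontier K \<inter> S) = emeasure (Hm ?s) (\<Union>G\<in>?F. rel_interior G \<inter> S)"
    using S fin rel_interior_borel by (subst emeasure_Hm[OF s]) (auto simp: fr intro!: sets.finite_UN arg_cong[where f="hausdorff_measure ?s"])
  also have "\<dots> = (\<Sum>G\<in>?F. emeasure (Hm ?s) (rel_interior G \<inter> S))"
    using S rel_interior_borel by (intro sum_emeasure[symmetric] disj fin) auto
  also have "\<dots> = (\<Sum>G\<in>?F. if aff_dim G = int DIM('a) - 1 then ennreal c * ennreal (stein K (?g G) 1) else 0)"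
  proof (rule sum.cong[OF refl])
    fix G assume G: "G \<in> ?F"
    have "emeasure (Hm ?s) (rel_interior G \<inter> S) = hausdorff_measure ?s (rel_interior G \<inter> S)"
      using S rel_interior_borel by (intro emeasure_Hm[OF s]) auto
    then show "emeasure (Hm ?s) (rel_interior G \<inter> S) = (if aff_dim G = int DIM('a) - 1 then ennreal c * ennreal (stein K (?g G) 1) else 0)"
      using face_hausdorff[OF c K(1) _ _ _ S, of G] G by simp
  qed
  also have "\<dots> = (\<Sum>G | G face_of K \<and> G \<noteq> {} \<and> nat (int DIM('a) - aff_dim G) = 1. ennreal c * ennreal (stein K (?g G) 1))"
  proof -
    have eq: "{G. G face_of K \<and> G \<noteq> {} \<and> nat (int DIM('a) - aff_dim G) = 1} = {G\<in>?F. aff_dim G = int DIM('a) - 1}"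
      using dimK by auto
    show ?thesis unfolding eq by (rule sum.inter_filter[OF fin, symmetric])
  qed
  also have "\<dots> = ennreal c * ennreal (\<Sum>G | G face_of K \<and> G \<noteq> {} \<and> nat (int DIM('a) - aff_dim G) = 1. stein K (?g G) 1)"
    using S rel_interior_borel by (subst sum_ennreal[symmetric]) (auto simp: sum_distrib_left intro!: stein_nonneg unitfun_indicator_mult unitfun_indicator)
  also have "(\<Sum>G | G face_of K \<and> G \<noteq> {} \<and> nat (int DIM('a) - aff_dim G) = 1. stein K (?g G) 1) = cfs DIM('a) 1 (stein K (indicator S))"
    using n2 by (subst cfs_eq[OF stein_polytope[OF K(1) K'(4) unitfun_indicator[OF S]]]) auto
  finally show ?thesis .
qed

text \<open>The linear coefficient is the limit of \<open>F r / r\<close> at 0, and this limit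
  respects the order.\<close>

lemma cfs_1_mono:
  assumes N: "N \<ge> 1" and F: "ispoly N F" "ispoly N G" "F 0 = 0" "G 0 = 0" and le: "\<And>r. r > 0 \<Longrightarrow> F r \<le> G r"
  shows "cfs N 1 F \<le> cfs N 1 G"
proof -
  have lim: "((\<lambda>r. F r / r) \<longlongrightarrow> cfs N 1 F) (at_right 0)" if F: "ispoly N F" "F 0 = 0" for F
  proof -
    have F': "F r = (\<Sum>k\<le>N. cfs N k F * r ^ k)" if "r \<ge> 0" for r using F(1) that by (simp add: ispoly_def)
    have c0: "cfs N 0 F = 0" using F'[of 0] F(2) by (simp add: power_0_left if_distrib cong: if_cong)
    have "F r / r = (\<Sum>k\<in>{1..N}. cfs N k F * r ^ (k - 1))" if "r > 0" for r
    proof -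
      have "F r = (\<Sum>k\<in>{1..N}. cfs N k F * r ^ k)"
        using F'[of r] that c0 by (simp add: sum.atMost_shift atMost_atLeast0 sum.atLeast_Suc_atMost)
      then show ?thesis using that by (simp add: sum_divide_distrib power_diff)
    qed
    then have ev: "\<forall>\<^sub>F r in at_right 0. (\<Sum>k\<in>{1..N}. cfs N k F * r ^ (k - 1)) = F r / r"
      by (auto simp: eventually_at_right_less intro: eventually_mono[OF eventually_at_right_less])
    have "((\<lambda>r. \<Sum>k\<in>{1..N}. cfs N k F * r ^ (k - 1)) \<longlongrightarrow> (\<Sum>k\<in>{1..N}. cfs N k F * 0 ^ (k - 1))) (at_right 0)"
      by (intro tendsto_intros)
    moreover have "(\<Sum>k\<in>{1..N}. cfs N k F * 0 ^ (k - 1)) = (\<Sum>k\<in>{1..N}. if k = 1 then cfs N k F else 0)"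
      by (intro sum.cong) (auto simp: power_0_left)
    ultimately have "((\<lambda>r. \<Sum>k\<in>{1..N}. cfs N k F * r ^ (k - 1)) \<longlongrightarrow> cfs N 1 F) (at_right 0)" using N by simp
    then show ?thesis using ev by (rule Lim_transform_eventually)
  qed
  show ?thesis
    by (rule tendsto_le[OF _ lim[OF F(2,4)] lim[OF F(1,3)]])
       (auto intro!: eventually_mono[OF eventually_at_right_less] divide_right_mono le)
qed

text \<open>Follow an outer normal ray from \<open>y\<close> to its last point in \<open>B\<close>;
  the whole ray has nearest point \<open>y\<close>. Thus the nearest-point map, a contraction,
  covers the inner boundary by the outer one, and Hausdorff measures can be compared.\<close>

lemma frontier_cp:
  fixes A B :: "'a::euclidean_space set"
  assumes A: "convex A" "closed A" "interior A \<noteq> {}" and B: "compact B" and AB: "A \<subseteq> B" and y: "y \<in> frontier A"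
  obtains x where "x \<in> frontier B" "cp A x = y"
proof -
  have yA: "y \<in> A" using y A(2) by (auto simp: frontier_def)
  obtain u where u: "u \<noteq> 0" "\<And>z. z \<in> A \<Longrightarrow> u \<bullet> z \<le> u \<bullet> y"
  proof -
    have "y \<notin> interior A" using y by (simp add: frontier_def)
    then have "y \<notin> rel_interior A" using A(3) by (simp add: rel_interior_nonempty_interior)
    obtain a where "a \<noteq> 0" "\<And>z. z \<in> A \<Longrightarrow> a \<bullet> y \<le> a \<bullet> z"
      using supporting_hyperplane_rel_boundary[OF A(1) yA \<open>y \<notin> rel_interior A\<close>] by metis
    then show ?thesis using that[of "- a"] by simp
  qed
  let ?T = "{t. 0 \<le> t \<and> y + t *\<^sub>R u \<in> B}"
  obtain R where R: "\<And>x. x \<in> B \<Longrightarrow> norm x \<le> R" using compact_imp_bounded[OF B] by (auto simp: bounded_iff)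
  have "compact ?T"
  proof -
    have "?T = {0..} \<inter> (\<lambda>t. y + t *\<^sub>R u) -` B" by auto
    moreover have "closed ((\<lambda>t. y + t *\<^sub>R u) -` B)" using compact_imp_closed[OF B]
      by (intro closed_vimage) (auto intro!: continuous_intros)
    moreover have "\<bar>t\<bar> \<le> (R + norm y) / norm u" if "y + t *\<^sub>R u \<in> B" for t
    proof -
      have "norm (t *\<^sub>R u) \<le> norm (y + t *\<^sub>R u) + norm y" by (metis add_diff_cancel_left' norm_triangle_ineq4)
      then have "\<bar>t\<bar> * norm u \<le> R + norm y" using R[OF that] by simp
      then show ?thesis using u(1) by (simp add: field_simps)
    qed
    then have "bounded ?T" unfolding bounded_iff by (intro exI[of _ "(R + norm y) / norm u"]) fastforce
    ultimately show ?thesis unfolding compact_eq_bounded_closed by (metis closed_Int closed_atLeast)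
  qed
  moreover have "0 \<in> ?T" using yA AB by auto
  ultimately obtain t where t: "t \<in> ?T" "\<And>s. s \<in> ?T \<Longrightarrow> s \<le> t" using compact_attains_sup[of ?T] by blast
  let ?x = "y + t *\<^sub>R u"
  have "?x \<notin> interior B"
  proof
    assume "?x \<in> interior B"
    then obtain e where e: "e > 0" "ball ?x e \<subseteq> B" by (meson mem_interior)
    have "y + (t + e / (2 * norm u)) *\<^sub>R u \<in> B"
      using e u(1) by (intro subsetD[OF e(2)]) (simp add: dist_norm algebra_simps)
    moreover have "0 \<le> t + e / (2 * norm u)" using t(1) e by auto
    ultimately have "t + e / (2 * norm u) \<le> t" by (intro t(2)) simp
    then show False using e u(1) by (simp add: field_simps)
  qed
  then have "?x \<in> frontier B" using t(1) closure_subset[of B] by (auto simp: frontier_def)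
  moreover have "cp A ?x = y"
    using t(1) u(2) by (intro cp_eqI A(1,2) yA) (auto simp: inner_diff_right intro!: mult_left_mono)
  ultimately show ?thesis by (rule that)
qed

lemma unitfun_compose:
  assumes "unitfun f" "g \<in> borel_measurable borel" shows "unitfun (\<lambda>x. f (g x))"
  using assms by (auto simp: unitfun_def)

context
  fixes C :: "'a::euclidean_space set" and c :: real
  assumes n2: "DIM('a) \<ge> 2" and c: "slabconst TYPE('a) c"
    and C: "convex C" "compact C" "interior C \<noteq> {}"
begin

private lemma C': "closed C" "C \<noteq> {}"
  using C compact_imp_closed by auto

private lemma c0: "c \<ge> 0" using c by (simp add: slabconst_def)

text \<open>Circumscribed polytopes: \<open>\<beta>\<close> is the image of part of their boundary
  under the contraction \<open>cp C\<close>. The weight is enlarged to a bump before the limit in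
  \<open>i\<close>, since \<open>stein_hconv\<close> requires continuity; \<open>k\<close> tends to
  infinity afterwards.\<close>

lemma hausdorff_le_steiner:
  assumes b: "closed \<beta>" "\<beta> \<subseteq> frontier C"
  shows "hausdorff_measure (DIM('a) - 1) \<beta> \<le> ennreal (c * cfs DIM('a) 1 (stein C (indicator \<beta>)))"
proof (cases "\<beta> = {}")
  case True
  then show ?thesis using n2 by (simp add: hausdorff_measure_empty)
next
  case False
  let ?n = "DIM('a)" and ?H = "hausdorff_measure (DIM('a) - 1)"
  have n1: "?n \<ge> 1" using n2 by simp
  obtain K where K: "\<And>i::nat. polytope (K i)" "\<And>i. C \<subseteq> K i" "hconv K C"
    using polytope_approx_seq[OF C(1,2) C'(2)] by metis
  let ?S = "\<lambda>i k. stein (K i) (\<lambda>x. bump \<beta> k (cp C x))"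
  have K': "convex (K i)" "compact (K i)" "closed (K i)" "K i \<noteq> {}" "interior (K i) \<noteq> {}" for i
    using polytope_imp_convex[OF K(1)] polytope_imp_compact[OF K(1)] polytope_imp_closed[OF K(1)] K(2)[of i] C'(2) interior_mono[OF K(2), of i] C(3) by auto
  have cpm: "cp C \<in> borel_measurable borel" by (rule cp_measurable[OF C(1) C'])
  have cl: "closed (cp C -` \<beta>)" using b(1) by (intro closed_vimage continuous_on_closest_point C(1) C')
  have bm: "continuous_on UNIV (\<lambda>x. bump \<beta> k (cp C x))" for k
    by (rule continuous_on_compose2[OF continuous_bump continuous_on_closest_point[OF C(1) C']]) auto
  have step: "?H \<beta> \<le> ennreal (c * cfs ?n 1 (?S i k))" for i k
  proof -
    have "\<beta> \<subseteq> cp C ` (frontier (K i) \<inter> cp C -` \<beta>)"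
    proof
      fix y assume y: "y \<in> \<beta>"
      then obtain x where "x \<in> frontier (K i)" "cp C x = y"
        using frontier_cp[OF C(1) C'(1) C(3) K'(2) K(2)] b(2) by blast
      then show "y \<in> cp C ` (frontier (K i) \<inter> cp C -` \<beta>)" using y by (intro image_eqI[of _ _ x]) auto
    qed
    then have "?H \<beta> \<le> ?H (cp C ` (frontier (K i) \<inter> cp C -` \<beta>))" by (rule hausdorff_measure_mono)
    also have "\<dots> \<le> ?H (frontier (K i) \<inter> cp C -` \<beta>)"
      by (rule hausdorff_measure_contraction) (rule closest_point_lipschitz[OF C(1) C'])
    also have "\<dots> = ennreal c * ennreal (cfs ?n 1 (stein (K i) (indicator (cp C -` \<beta>))))"
      by (rule polytope_frontier_hausdorff[OF n2 c K(1) K'(5)]) (use cl in auto)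
    also have "\<dots> \<le> ennreal c * ennreal (cfs ?n 1 (?S i k))"
    proof (intro mult_left_mono ennreal_leI cfs_1_mono n1)
      have u: "unitfun (indicator (cp C -` \<beta>) :: 'a \<Rightarrow> real)" using cl by (intro unitfun_indicator) auto
      have u2: "unitfun (\<lambda>x. bump \<beta> k (cp C x))" by (rule unitfun_compose[OF unitfun_bump cpm])
      show "ispoly ?n (stein (K i) (indicator (cp C -` \<beta>)))"
        by (rule ispolyI[OF stein_polytope[OF K(1) K'(4) u]])
      show "ispoly ?n (?S i k)"
        by (rule ispolyI[OF stein_polytope[OF K(1) K'(4) u2]])
      show "stein (K i) (indicator (cp C -` \<beta>)) r \<le> ?S i k r" for r
        by (rule stein_mono[OF K'(1,2,4) u u2]) (auto simp: indicator_def bump_ge bump_def)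
    qed auto
    also have "\<dots> = ennreal (c * cfs ?n 1 (?S i k))" using c0 by (simp add: ennreal_mult')
    finally show ?thesis .
  qed
  have "?H \<beta> \<le> ennreal (c * cfs ?n 1 (stein C (bump \<beta> k)))" for k
  proof (rule LIMSEQ_le_const)
    have "(\<lambda>i. cfs ?n 1 (?S i k)) \<longlonglongrightarrow> cfs ?n 1 (stein C (\<lambda>x. bump \<beta> k (cp C x)))"
      by (intro cfs_tendsto stein_hconv C(1,2) C' K'(1,2,4) K(3) unitfun_compose[OF unitfun_bump cpm] bm)
    moreover have "stein C (\<lambda>x. bump \<beta> k (cp C x)) = stein C (bump \<beta> k)"
      by (rule ext, rule stein_cong[OF C']) (simp add: closest_point_self)
    ultimately show "(\<lambda>i. ennreal (c * cfs ?n 1 (?S i k))) \<longlonglongrightarrow> ennreal (c * cfs ?n 1 (stein C (bump \<beta> k)))"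
      by (intro tendsto_ennrealI tendsto_mult tendsto_const) simp
  qed (use step in auto)
  moreover have "(\<lambda>k. ennreal (c * cfs ?n 1 (stein C (bump \<beta> k)))) \<longlonglongrightarrow> ennreal (c * cfs ?n 1 (stein C (indicator \<beta>)))"
    by (intro tendsto_ennrealI tendsto_mult tendsto_const cfs_tendsto stein_bump_lim C(1,2) C'(2) b(1) False)
  ultimately show ?thesis by (intro LIMSEQ_le_const[where X="\<lambda>k. ennreal (c * cfs ?n 1 (stein C (bump \<beta> k)))"]) auto
qed

text \<open>Inscribed polytopes: their boundary is a contracted image of the boundary of
  \<open>C\<close>. This bounds only the total measure.\<close>

lemma hausdorff_frontier_ge_steiner:
  "ennreal (c * cfs DIM('a) 1 (stein C (\<lambda>_. 1))) \<le> hausdorff_measure (DIM('a) - 1) (frontier C)"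
proof -
  let ?n = "DIM('a)" and ?H = "hausdorff_measure (DIM('a) - 1)"
  obtain K where K: "\<And>i::nat. polytope (K i)" "\<And>i. K i \<noteq> {}" "\<And>i. K i \<subseteq> C" "hconv K C"
    using polytope_approx_seq[OF C(1,2) C'(2)] by metis
  have K': "convex (K i)" "compact (K i)" "closed (K i)" for i
    using polytope_imp_convex[OF K(1)] polytope_imp_compact[OF K(1)] polytope_imp_closed[OF K(1)] by auto
  obtain x0 where "x0 \<in> interior C" using C(3) by blast
  then obtain e where e: "e > 0" "ball x0 e \<subseteq> C" by (meson mem_interior)
  have "\<forall>\<^sub>F i in sequentially. (\<forall>x\<in>C. \<exists>y\<in>K i. dist x y \<le> e/3) \<and> (\<forall>x\<in>K i. \<exists>y\<in>C. dist x y \<le> e/3)"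
    using K(4)[unfolded hconv_def, rule_format, of "e/3"] e(1) by (metis divide_pos_pos zero_less_numeral)
  then have int: "\<forall>\<^sub>F i in sequentially. interior (K i) \<noteq> {}"
  proof eventually_elim
    case (elim i)
    have "ball x0 (e/3) \<subseteq> K i"
    proof
      fix y assume y: "y \<in> ball x0 (e/3)"
      have "ball y (2 * (e/3)) \<subseteq> ball x0 e"
      proof
        fix w assume "w \<in> ball y (2 * (e/3))"
        then show "w \<in> ball x0 e" using y dist_triangle[of x0 w y] by auto
      qed
      then show "y \<in> K i" using e elim by (intro interior_in_approx[OF K'(1,3) K(2), of "e/3" y C]) auto
    qed
    then have "x0 \<in> interior (K i)" using e(1) by (meson mem_interior divide_pos_pos zero_less_numeral)
    then show ?case by blast
  qed
  have one: "unitfun (\<lambda>x::'a. 1)" by (simp add: unitfun_def)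
  have ev: "\<forall>\<^sub>F i in sequentially. ennreal (c * cfs ?n 1 (stein (K i) (\<lambda>_. 1))) \<le> ?H (frontier C)"
    using int
  proof eventually_elim
    case (elim i)
    have eq: "stein (K i) (\<lambda>_. 1) = stein (K i) (indicator UNIV)" by (rule ext) (simp add: stein_def)
    have sub: "frontier (K i) \<subseteq> cp (K i) ` frontier C"
    proof
      fix y assume "y \<in> frontier (K i)"
      then obtain x where "x \<in> frontier C" "cp (K i) x = y"
        using frontier_cp[OF K'(1,3) elim C(2) K(3)] by blast
      then show "y \<in> cp (K i) ` frontier C" by blast
    qed
    have "ennreal (c * cfs ?n 1 (stein (K i) (\<lambda>_. 1))) = ?H (frontier (K i))"
      using polytope_frontier_hausdorff[OF n2 c K(1) elim, of UNIV] c0 unfolding eq ennreal_mult'[OF c0] by simp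
    also have "\<dots> \<le> ?H (cp (K i) ` frontier C)" using sub by (rule hausdorff_measure_mono)
    also have "\<dots> \<le> ?H (frontier C)"
      by (rule hausdorff_measure_contraction) (rule closest_point_lipschitz[OF K'(1,3) K(2)])
    finally show ?case .
  qed
  have "(\<lambda>i. ennreal (c * cfs ?n 1 (stein (K i) (\<lambda>_. 1)))) \<longlonglongrightarrow> ennreal (c * cfs ?n 1 (stein C (\<lambda>_. 1)))"
    by (intro tendsto_ennrealI tendsto_mult tendsto_const cfs_tendsto stein_hconv C(1,2) C' K' K(2,4) one continuous_on_const)
  then show ?thesis using ev by (rule tendsto_upperbound) simp
qed

text \<open>The upper bound is local and the lower bound global. The upper bound on the complement
  of \<open>\<beta>\<close> turns the global lower bound into one for
  \<open>\<beta>\<close>.\<close>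

lemma hausdorff_eq_steiner:
  assumes b: "closed \<beta>" "\<beta> \<subseteq> frontier C"
  shows "hausdorff_measure (DIM('a) - 1) \<beta> = ennreal (c * cfs DIM('a) 1 (stein C (indicator \<beta>)))"
proof (rule antisym[OF hausdorff_le_steiner[OF b]])
  let ?n = "DIM('a)" and ?H = "hausdorff_measure (DIM('a) - 1)"
  have n1: "?n \<ge> 1" and s: "?n - 1 > 0" using n2 by auto
  let ?k = "\<lambda>A. cfs ?n 1 (stein C (indicator A))"
  have one: "stein C (\<lambda>_. 1) = stein C (indicator UNIV)" by (rule ext) (simp add: stein_def)
  have u: "unitfun (indicator A :: 'a \<Rightarrow> real)" if "closed A" for A using that by (intro unitfun_indicator) auto
  have pos: "?k A \<ge> 0" if "closed A" for A
  proof -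
    have "cfs ?n 1 (\<lambda>_. 0) \<le> ?k A"
      by (intro cfs_1_mono n1 stein_ispoly_closed C(1,2) C'(2) that) (auto intro!: ispolyI[where a="\<lambda>_. 0"] stein_nonneg u that)
    then show ?thesis by (simp add: cfs_def)
  qed
  have add: "?k A + ?k B \<le> ?k UNIV" if AB: "closed A" "closed B" "A \<inter> B = {}" for A B
  proof -
    have "stein C (indicator A) r + stein C (indicator B) r = stein C (indicator (A \<union> B)) r" for r
      using AB by (subst stein_add[OF C(1,2) C'(2) u u, symmetric]) (auto simp: stein_def indicator_def intro!: Bochner_Integration.integral_cong)
    then have "?k A + ?k B = ?k (A \<union> B)" by (simp add: cfs_def sum.distrib[symmetric] distrib_left[symmetric])
    also have "\<dots> \<le> ?k UNIV"
      using AB by (intro cfs_1_mono n1 stein_ispoly_closed C(1,2) C'(2) stein_mono u) (auto simp: indicator_def)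
    finally show ?thesis .
  qed
  have bd: "?H (frontier C - \<beta>) \<le> ennreal (c * (?k UNIV - ?k \<beta>))"
  proof (cases "\<beta> = {}")
    case True
    have "?H (frontier C) \<le> ennreal (c * ?k (frontier C))" by (intro hausdorff_le_steiner) auto
    also have "\<dots> \<le> ennreal (c * (?k UNIV - ?k \<beta>))"
      using add[of "frontier C" \<beta>] True c0 by (intro ennreal_leI mult_left_mono) auto
    finally show ?thesis using True by simp
  next
    case False
    \<comment> \<open>The upper bound is for closed sets; these exhaust the complement of
      \<open>\<beta>\<close> in the boundary.\<close>
    define D where "D k = {x \<in> frontier C. infdist x \<beta> \<ge> 1 / real (Suc k)}" for k
    have clD: "closed (D k)" for k
      unfolding D_def by (intro closed_Collect_conj closed_Collect_le continuous_intros) auto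
    have "D k \<inter> \<beta> = {}" for k by (auto simp: D_def)
    then have HD: "?H (D k) \<le> ennreal (c * (?k UNIV - ?k \<beta>))" for k
      using add[OF clD b(1), of k] c0 by (intro order_trans[OF hausdorff_le_steiner[OF clD]] ennreal_leI mult_left_mono) (auto simp: D_def)
    have inc: "incseq D"
    proof (rule incseq_SucI)
      fix k
      have "1 / real (Suc (Suc k)) \<le> 1 / real (Suc k)" by (intro divide_left_mono) auto
      then show "D k \<subseteq> D (Suc k)" unfolding D_def by (auto simp del: of_nat_Suc)
    qed
    have un: "(\<Union>k. D k) = frontier C - \<beta>"
    proof (intro set_eqI iffI)
      fix x assume x: "x \<in> frontier C - \<beta>"
      then have "infdist x \<beta> > 0" using b(1) False by (metis DiffD2 in_closed_iff_infdist_zero infdist_nonneg less_eq_real_def)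
      then obtain k where "inverse (real (Suc k)) < infdist x \<beta>" using reals_Archimedean by blast
      then have "x \<in> D k" using x by (auto simp: D_def inverse_eq_divide)
      then show "x \<in> (\<Union>k. D k)" by blast
    qed (auto simp: D_def)
    have "(\<lambda>k. emeasure (Hm (?n - 1)) (D k)) \<longlonglongrightarrow> emeasure (Hm (?n - 1)) (\<Union>k. D k)"
      using clD inc by (intro Lim_emeasure_incseq) auto
    moreover have "emeasure (Hm (?n - 1)) (D k) = ?H (D k)" for k using clD by (intro emeasure_Hm[OF s] borel_closed)
    moreover have "emeasure (Hm (?n - 1)) (\<Union>k. D k) = ?H (frontier C - \<beta>)" unfolding un using b(1)
      by (intro emeasure_Hm[OF s] sets.Diff borel_closed) auto
    ultimately have "(\<lambda>k. ?H (D k)) \<longlonglongrightarrow> ?H (frontier C - \<beta>)" by simp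
    then show ?thesis by (rule LIMSEQ_le_const2) (use HD in auto)
  qed
  have "ennreal (c * ?k UNIV) \<le> ?H (frontier C)" using hausdorff_frontier_ge_steiner unfolding one .
  also have "\<dots> \<le> ?H \<beta> + ?H (frontier C - \<beta>)"
  proof -
    have "\<beta> \<union> (frontier C - \<beta>) = frontier C" using b(2) by blast
    then show ?thesis using hausdorff_measure_subadditive2[OF s, of \<beta> "frontier C - \<beta>"] by simp
  qed
  also have "\<dots> \<le> ?H \<beta> + ennreal (c * (?k UNIV - ?k \<beta>))" by (intro add_left_mono bd)
  finally have le: "ennreal (c * ?k UNIV) \<le> ?H \<beta> + ennreal (c * (?k UNIV - ?k \<beta>))" .
  have "?H \<beta> < top" using hausdorff_le_steiner[OF b] by (rule le_less_trans) simp
  then obtain h where h: "?H \<beta> = ennreal h" "h \<ge> 0" by (metis enn2real_nonneg ennreal_enn2real)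
  have "?k UNIV - ?k \<beta> \<ge> 0" using add[of \<beta> "{}"] b(1) pos[of "{}"] by simp
  then have "c * ?k UNIV \<le> h + c * (?k UNIV - ?k \<beta>)"
    using le h c0 pos[of UNIV] by (simp add: ennreal_plus[symmetric] del: ennreal_plus)
  then show "ennreal (c * ?k \<beta>) \<le> ?H \<beta>" unfolding h(1) by (intro ennreal_leI) (simp add: algebra_simps)
qed

end

section \<open>Subgradients are unique almost everywhere\<close>

text \<open>Test points are restricted to \<open>U\<close> because the functions of interest are
  convex only over the interior of a projection.\<close>

definition subgrad :: "('a::euclidean_space \<Rightarrow> real) \<Rightarrow> 'a set \<Rightarrow> 'a \<Rightarrow> 'a \<Rightarrow> bool" where
  "subgrad h U x z \<longleftrightarrow> (\<forall>y\<in>U. h y \<ge> h x + z \<bullet> (y - x))"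

lemma subgrad_mono:
  assumes "subgrad h U x z" "subgrad h U y w" "x \<in> U" "y \<in> U"
  shows "(w - z) \<bullet> (y - x) \<ge> 0"
  using assms unfolding subgrad_def by (force simp: inner_diff_left inner_diff_right)

text \<open>Average the translates of \<open>N\<close> along \<open>e\<close> and exchange
  integrals: every line in direction \<open>e\<close> meets \<open>N\<close> at most once.\<close>

lemma null_of_line_singletons:
  assumes N[measurable]: "N \<in> sets borel" and one: "\<And>x t. x \<in> N \<Longrightarrow> t > 0 \<Longrightarrow> x + t *\<^sub>R e \<notin> N"
  shows "N \<in> null_sets lborel"
proof -
  have z: "(\<integral>\<^sup>+s. indicator {0..1} s * indicator N (x + s *\<^sub>R e) \<partial>lborel) = 0" for x
  proof -
    have "countable {s. x + s *\<^sub>R e \<in> N}"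
    proof (cases "\<exists>s. x + s *\<^sub>R e \<in> N")
      case True
      then obtain s where s: "x + s *\<^sub>R e \<in> N" by blast
      have "t = s" if "x + t *\<^sub>R e \<in> N" for t
      proof (rule ccontr)
        assume "t \<noteq> s"
        then consider "t > s" | "t < s" by linarith
        then show False
        proof cases
          case 1 then show False using one[OF s, of "t - s"] that by (simp add: algebra_simps)
        next
          case 2 then show False using one[OF that, of "s - t"] s by (simp add: algebra_simps)
        qed
      qed
      then have "{s. x + s *\<^sub>R e \<in> N} = {s}" using s by blast
      then show ?thesis by simp
    qed auto
    then have "{s. x + s *\<^sub>R e \<in> N} \<in> null_sets lborel" by (rule countable_imp_null_set_lborel)
    then have "AE s in lborel. s \<notin> {s. x + s *\<^sub>R e \<in> N}" by (rule AE_not_in)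
    then have "AE s in lborel. indicator {0..1} s * indicator N (x + s *\<^sub>R e) = (0::ennreal)" by eventually_elim simp
    then have "(\<integral>\<^sup>+s. indicator {0..1} s * indicator N (x + s *\<^sub>R e) \<partial>lborel) = (\<integral>\<^sup>+s. 0 \<partial>(lborel::real measure))"
      by (rule nn_integral_cong_AE)
    then show ?thesis by simp
  qed
  have sh: "(\<integral>\<^sup>+x. indicator N (x + a) \<partial>lborel) = emeasure lborel N" for a
  proof -
    have "emeasure lborel N = (\<integral>\<^sup>+x. indicator N x \<partial>distr lborel borel ((+) a))" by (simp add: lborel_distr_plus)
    also have "\<dots> = (\<integral>\<^sup>+x. indicator N (x + a) \<partial>lborel)" by (subst nn_integral_distr) (auto simp: add.commute)
    finally show ?thesis ..
  qed
  have "emeasure lborel N = (\<integral>\<^sup>+s. indicator {0..1::real} s * emeasure lborel N \<partial>lborel)" by (subst nn_integral_multc) auto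
  also have "\<dots> = (\<integral>\<^sup>+s. (\<integral>\<^sup>+x. indicator {0..1} s * indicator N (x + s *\<^sub>R e) \<partial>lborel) \<partial>lborel)"
  proof (rule nn_integral_cong)
    fix s :: real
    show "indicator {0..1} s * emeasure lborel N = (\<integral>\<^sup>+x. indicator {0..1} s * indicator N (x + s *\<^sub>R e) \<partial>lborel)"
      unfolding sh[of "s *\<^sub>R e", symmetric] by (rule nn_integral_cmult[symmetric]) measurable
  qed
  also have "\<dots> = (\<integral>\<^sup>+x. (\<integral>\<^sup>+s. indicator {0..1} s * indicator N (x + s *\<^sub>R e) \<partial>lborel) \<partial>lborel)"
    by (rule lborel_pair.Fubini') measurable
  also have "\<dots> = 0" by (simp add: z)
  finally show ?thesis using N by (simp add: null_sets_def)
qed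

text \<open>Two different subgradients at \<open>x\<close> are separated in some coordinate
  \<open>e\<close> by rationals \<open>p < q\<close>. Monotonicity of subgradients allows this at
  most once on each line in direction \<open>e\<close>. The bound \<open>k\<close> presents the
  exceptional set as a union of projections of compact sets, hence as a Borel set.\<close>

lemma AE_unique_subgrad:
  fixes h :: "'a::euclidean_space \<Rightarrow> real"
  assumes U: "open U" and h: "continuous_on U h"
  shows "AE x in lborel. x \<in> U \<longrightarrow> (\<forall>z w. subgrad h U x z \<longrightarrow> subgrad h U x w \<longrightarrow> z = w)"
proof -
  define N where "N e p q k = {x\<in>U. \<exists>z w. norm z \<le> real k \<and> norm w \<le> real k \<and> z \<bullet> e \<le> p \<and> q \<le> w \<bullet> e \<and> subgrad h U x z \<and> subgrad h U x w}" for e p q and k :: nat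
  have meas: "N e p q k \<in> sets borel" for e p q k
  proof -
    obtain K where K: "\<And>n::nat. compact (K n)" "\<And>n. K n \<subseteq> U" "(\<Union>n. K n) = U"
      using open_Union_compact_subsets[OF U] by metis
    have "compact (N e p q k \<inter> K n)" for n
    proof -
      let ?B = "cball (0::'a) (real k)"
      let ?T = "K n \<times> ?B \<times> ?B"
      have ct: "compact ?T" using K by (intro compact_Times) auto
      have hc: "continuous_on ?T (\<lambda>a. h (fst a))"
        by (rule continuous_on_compose2[OF h]) (use K in \<open>auto intro!: continuous_intros\<close>)
      let ?Q = "\<lambda>a. fst (snd a) \<bullet> e \<le> p \<and> q \<le> snd (snd a) \<bullet> e \<and> (\<forall>y\<in>U. h (fst a) + fst (snd a) \<bullet> (y - fst a) \<le> h y) \<and> (\<forall>y\<in>U. h (fst a) + snd (snd a) \<bullet> (y - fst a) \<le> h y)"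
      have eq: "{a\<in>?T. ?Q a} = {a\<in>?T. fst (snd a) \<bullet> e \<le> p} \<inter> {a\<in>?T. q \<le> snd (snd a) \<bullet> e}
         \<inter> (\<Inter>y\<in>U. {a\<in>?T. h (fst a) + fst (snd a) \<bullet> (y - fst a) \<le> h y}) \<inter> (\<Inter>y\<in>U. {a\<in>?T. h (fst a) + snd (snd a) \<bullet> (y - fst a) \<le> h y}) \<inter> ?T"
        by auto
      have clT: "closed ?T" using ct by (rule compact_imp_closed)
      have cle: "closed {a\<in>?T. f a \<le> g a}" if "continuous_on ?T f" "continuous_on ?T g" for f g :: "_ \<Rightarrow> real"
        using continuous_on_closed_Collect_le[OF that clT] .
      have "closed {a\<in>?T. ?Q a}" unfolding eq
        by (intro closed_Int closed_INT ballI cle clT) (intro continuous_intros hc)+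
      moreover have "bounded {a\<in>?T. ?Q a}" by (rule bounded_subset[OF compact_imp_bounded[OF ct]]) blast
      ultimately have "compact {a\<in>?T. ?Q a}" by (simp only: compact_eq_bounded_closed simp_thms)
      then have "compact (fst ` {a\<in>?T. ?Q a})" by (intro compact_continuous_image continuous_intros)
      also have "fst ` {a\<in>?T. ?Q a} = N e p q k \<inter> K n"
      proof (intro set_eqI iffI)
        fix x assume "x \<in> fst ` {a\<in>?T. ?Q a}"
        then obtain z w where "(x, z, w) \<in> ?T" "?Q (x, z, w)" by auto
        then show "x \<in> N e p q k \<inter> K n" using K(2)[of n] unfolding N_def subgrad_def by auto
      next
        fix x assume x: "x \<in> N e p q k \<inter> K n"
        then obtain z w where "norm z \<le> real k" "norm w \<le> real k" "z \<bullet> e \<le> p" "q \<le> w \<bullet> e" "subgrad h U x z" "subgrad h U x w" by (auto simp: N_def)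
        then have "(x, z, w) \<in> {a\<in>?T. ?Q a}" using x by (auto simp: subgrad_def)
        then show "x \<in> fst ` {a\<in>?T. ?Q a}" by (rule image_eqI[rotated]) simp
      qed
      finally show ?thesis .
    qed
    then have "(\<Union>n. N e p q k \<inter> K n) \<in> sets borel" by (intro sets.countable_UN) (auto intro: borel_compact)
    moreover have "(\<Union>n. N e p q k \<inter> K n) = N e p q k" using K(3) by (auto simp: N_def)
    ultimately show ?thesis by simp
  qed
  have null: "N e p q k \<in> null_sets lborel" if "p < q" for e p q k
  proof (rule null_of_line_singletons[OF meas, of _ _ _ _ e], rule notI)
    fix x and t :: real assume x: "x \<in> N e p q k" and t: "t > 0" and y: "x + t *\<^sub>R e \<in> N e p q k"
    obtain w where w: "q \<le> w \<bullet> e" "subgrad h U x w" using x by (auto simp: N_def)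
    obtain z where z: "z \<bullet> e \<le> p" "subgrad h U (x + t *\<^sub>R e) z" using y by (auto simp: N_def)
    have "(z - w) \<bullet> (x + t *\<^sub>R e - x) \<ge> 0" using subgrad_mono[OF w(2) z(2)] x y by (auto simp: N_def)
    then have "t * ((z - w) \<bullet> e) \<ge> 0" by simp
    then have "(z - w) \<bullet> e \<ge> 0" using t by (simp add: zero_le_mult_iff)
    then show False using w z that by (simp add: inner_diff_left)
  qed
  have "AE x in lborel. \<forall>e\<in>Basis. \<forall>p\<in>\<rat>. \<forall>q\<in>\<rat>. \<forall>k. p < q \<longrightarrow> x \<notin> N e p q k"
    unfolding AE_ball_countable[OF countable_finite[OF finite_Basis]] AE_ball_countable[OF countable_rat] AE_all_countable
    using AE_not_in[OF null] by (auto intro!: AE_I2)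
  then show ?thesis
  proof eventually_elim
    case (elim x)
    show ?case
    proof (intro impI allI)
      fix z w assume x: "x \<in> U" and zw: "subgrad h U x z" "subgrad h U x w"
      have le: "w \<bullet> e \<le> z \<bullet> e" if e: "e \<in> Basis" and zw: "subgrad h U x z" "subgrad h U x w" for e z w
      proof (rule ccontr)
        assume "\<not> w \<bullet> e \<le> z \<bullet> e"
        then have lt: "z \<bullet> e < w \<bullet> e" by simp
        then obtain p where p: "p \<in> \<rat>" "z \<bullet> e < p" "p < w \<bullet> e" using Rats_dense_in_real by blast
        then obtain q where q: "q \<in> \<rat>" "p < q" "q < w \<bullet> e" using Rats_dense_in_real by blast
        obtain k where k: "max (norm z) (norm w) \<le> real k" using real_arch_simple by blast
        have "x \<in> N e p q k" unfolding N_def using x zw p q k by fastforce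
        then show False using elim e p q by blast
      qed
      show "z = w" by (rule euclidean_eqI) (use le zw in \<open>meson antisym\<close>)
    qed
  qed
qed

section \<open>The average volume of support sets\<close>

text \<open>The \<open>B\<close> component of \<open>x\<close> is a direction from the unit ball,
  and the \<open>C\<close> component ranges over the projected support set of that direction. By
  Fubini the volume of this set is the required average.\<close>

definition suppset :: "'a::euclidean_space set \<Rightarrow> 'a set \<Rightarrow> 'a set \<Rightarrow> 'a set" where
  "suppset P B C = {x. norm (pr B x) \<le> 1 \<and> (\<exists>p\<in>P. pr C p = pr C x \<and> (\<forall>q\<in>P. q \<bullet> pr B x \<le> p \<bullet> pr B x))}"

lemma compact_suppset:
  fixes P :: "'a::euclidean_space set"
  assumes BC: "orthonormal (B \<union> C)" "B \<inter> C = {}" "span (B \<union> C) = UNIV" and P: "compact P"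
  shows "compact (suppset P B C)"
proof -
  obtain R where R: "\<And>x. x \<in> P \<Longrightarrow> norm x \<le> R" using compact_imp_bounded[OF P] by (auto simp: bounded_iff)
  have C: "orthonormal C" using BC orthonormal_subset by blast
  let ?T = "cball (0::'a) (1 + R) \<times> P"
  have ct: "compact ?T" using P by (intro compact_Times) auto
  let ?D = "{a. norm (pr B (fst a)) \<le> 1} \<inter> {a. pr C (snd a) = pr C (fst a)} \<inter> (\<Inter>q\<in>P. {a. q \<bullet> pr B (fst a) \<le> snd a \<bullet> pr B (fst a)})"
  have "closed ?D"
    by (intro closed_Int closed_INT ballI closed_Collect_le closed_Collect_eq continuous_intros)
  then have "compact (?T \<inter> ?D)" using ct by (rule compact_Int_closed[rotated])
  then have "compact (fst ` (?T \<inter> ?D))" by (intro compact_continuous_image continuous_intros)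
  also have "fst ` (?T \<inter> ?D) = suppset P B C"
  proof (intro set_eqI iffI)
    fix x assume x: "x \<in> suppset P B C"
    then obtain p where p: "p \<in> P" "pr C p = pr C x" "\<forall>q\<in>P. q \<bullet> pr B x \<le> p \<bullet> pr B x" and n: "norm (pr B x) \<le> 1" by (auto simp: suppset_def)
    have "norm x \<le> norm (pr B x) + norm (pr C x)" using norm_triangle_ineq[of "pr B x" "pr C x"] pr_decomp[OF BC, of x] by simp
    also have "\<dots> \<le> 1 + R" using n norm_pr_le[OF C, of p] R[OF p(1)] p(2) by simp
    finally have "(x, p) \<in> ?T \<inter> ?D" using p n by auto
    then show "x \<in> fst ` (?T \<inter> ?D)" by force
  qed (auto simp: suppset_def)
  finally show ?thesis .
qed

lemma compact_attains_max_inner: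
  fixes P :: "'a::euclidean_space set"
  assumes "compact P" "P \<noteq> {}" obtains p where "p \<in> P" "\<And>q. q \<in> P \<Longrightarrow> q \<bullet> y \<le> p \<bullet> y"
proof -
  have "continuous_on P (\<lambda>q. q \<bullet> y)" by (intro continuous_intros)
  from continuous_attains_sup[OF assms this] show ?thesis using that by blast
qed

text \<open>Maximizers are subgradients of the support function of \<open>K\<close>.\<close>

lemma AE_unique_maximizer:
  assumes K: "compact K" "K \<noteq> {}"
  shows "AE x in lborel. \<forall>z\<in>K. \<forall>w\<in>K. (\<forall>q\<in>K. q \<bullet> x \<le> z \<bullet> x) \<longrightarrow> (\<forall>q\<in>K. q \<bullet> x \<le> w \<bullet> x) \<longrightarrow> z = w"
proof -
  define h where "h x = (SUP q\<in>K. q \<bullet> x)" for x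
  obtain R where R: "\<And>q. q \<in> K \<Longrightarrow> norm q \<le> R" using compact_imp_bounded[OF K(1)] by (auto simp: bounded_iff)
  have bdd: "bdd_above ((\<lambda>q. q \<bullet> x) ` K)" for x
    by (intro bdd_aboveI2[where M="R * norm x"] order_trans[OF norm_cauchy_schwarz] mult_right_mono R) auto
  have up: "q \<bullet> x \<le> h x" if "q \<in> K" for q x unfolding h_def by (rule cSUP_upper[OF that bdd])
  have att: "h x = z \<bullet> x" if "z \<in> K" "\<forall>q\<in>K. q \<bullet> x \<le> z \<bullet> x" for z x
    unfolding h_def using that K(2) by (intro antisym cSUP_least cSUP_upper bdd) auto
  have lip: "\<bar>h x - h y\<bar> \<le> R * norm (x - y)" for x y
  proof -
    have "h x \<le> h y + R * norm (x - y)" for x y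
      unfolding h_def[of x]
    proof (rule cSUP_least[OF K(2)])
      fix q assume q: "q \<in> K"
      have "q \<bullet> x = q \<bullet> y + q \<bullet> (x - y)" by (simp add: inner_diff_right)
      also have "q \<bullet> (x - y) \<le> R * norm (x - y)" using norm_cauchy_schwarz[of q "x - y"] R[OF q] mult_right_mono[of "norm q" R "norm (x - y)"] by simp
      finally show "q \<bullet> x \<le> h y + R * norm (x - y)" using up[OF q, of y] by linarith
    qed
    from this[of x y] this[of y x] show ?thesis by (simp add: norm_minus_commute abs_le_iff)
  qed
  have R0: "R \<ge> 0" using K(2) R norm_ge_zero order_trans by blast
  have "continuous_on UNIV h"
    by (rule lipschitz_on_continuous_on[of R]) (use lip R0 in \<open>auto simp: lipschitz_on_def dist_norm real_norm_def\<close>)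
  from AE_unique_subgrad[OF open_UNIV this] show ?thesis
  proof eventually_elim
    case (elim x)
    have sg: "subgrad h UNIV x z" if "z \<in> K" "\<forall>q\<in>K. q \<bullet> x \<le> z \<bullet> x" for z
      using att[OF that] up[OF that(1)] by (auto simp: subgrad_def inner_diff_right)
    then show ?case using elim by auto
  qed
qed

section \<open>Area measures on great subspheres\<close>

text \<open>Being nearest is decided by arbitrarily short segments from \<open>y\<close>, and these
  stay inside the ball.\<close>

lemma cp_truncate:
  fixes D :: "'a::euclidean_space set"
  assumes D: "convex D" "closed D" and y: "norm y < R"
  shows "cp (D \<inter> cball 0 R) x = y \<and> y \<in> D \<longleftrightarrow> cp D x = y \<and> y \<in> D"
proof (intro iffI conjI; elim conjE)
  have DR: "convex (D \<inter> cball 0 R)" "closed (D \<inter> cball 0 R)" using D by (auto intro: convex_Int)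
  assume yD: "y \<in> D"
  then have ne: "D \<noteq> {}" "D \<inter> cball 0 R \<noteq> {}" using y by auto
  {
    assume c: "cp D x = y"
    show "cp (D \<inter> cball 0 R) x = y"
      using c yD y closest_point_dot[OF D, of _ x] by (intro cp_eqI DR) auto
  }
  {
    assume c: "cp (D \<inter> cball 0 R) x = y"
    show "cp D x = y"
    proof (rule cp_eqI[OF D yD])
      fix z assume z: "z \<in> D"
      define t where "t = min 1 ((R - norm y) / (1 + norm (z - y)))"
      have t: "0 < t" "t \<le> 1" using y by (auto simp: t_def intro!: divide_pos_pos add_pos_nonneg)
      have "t * norm (z - y) \<le> (R - norm y) / (1 + norm (z - y)) * norm (z - y)" by (intro mult_right_mono) (auto simp: t_def)
      also have "\<dots> = (R - norm y) * (norm (z - y) / (1 + norm (z - y)))" by simp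
      also have "\<dots> \<le> (R - norm y) * 1" using y by (intro mult_left_mono) (auto simp: divide_le_eq add_pos_nonneg)
      finally have "norm (y + t *\<^sub>R (z - y)) \<le> R" using norm_triangle_ineq[of y "t *\<^sub>R (z - y)"] t by simp
      moreover have "y + t *\<^sub>R (z - y) \<in> D" using convexD_alt[OF D(1) yD z, of t] t by (simp add: algebra_simps)
      ultimately have "(x - y) \<bullet> (y + t *\<^sub>R (z - y) - y) \<le> 0"
        using closest_point_dot[OF DR, of "y + t *\<^sub>R (z - y)" x] c by simp
      then have "t * ((x - y) \<bullet> (z - y)) \<le> 0" by simp
      then show "(x - y) \<bullet> (z - y) \<le> 0" using t by (simp add: mult_le_0_iff)
    qed
  }
qed

text \<open>The claimed point maximizes the functional \<open>x - cp K x\<close> over the parallel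
  set: the part in \<open>K\<close> is bounded by the property of the nearest point, the remaining
  displacement by Cauchy-Schwarz.\<close>

lemma cp_parallel:
  fixes K :: "'a::euclidean_space set"
  assumes K: "convex K" "closed K" "K \<noteq> {}" and r: "0 \<le> r" and d: "r < dist x (cp K x)"
  shows "cp {x. dist x (cp K x) \<le> r} x = cp K x + (r / dist x (cp K x)) *\<^sub>R (x - cp K x)"
proof -
  define y where "y = cp K x"
  define d where "d = dist x y"
  define w where "w = y + (r / d) *\<^sub>R (x - y)"
  have dr: "r < d" "d > 0" using assms by (auto simp: d_def y_def)
  have n: "norm (x - y) = d" by (simp add: d_def dist_norm)
  have cw: "cp K w = y" unfolding w_def y_def using r dr by (intro cp_extend K) auto
  have dw: "dist w (cp K w) = r" unfolding cw using dr r by (simp add: w_def dist_norm n)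
  have "continuous_on UNIV (\<lambda>x. dist x (cp K x))" by (intro continuous_intros continuous_on_closest_point K)
  then have cl: "closed {x. dist x (cp K x) \<le> r}" by (intro closed_Collect_le) auto
  show ?thesis
    unfolding y_def[symmetric] d_def[symmetric] w_def[symmetric]
  proof (rule cp_eqI[OF parallel_set_convex[OF K] cl])
    show "w \<in> {x. dist x (cp K x) \<le> r}" using dw by simp
    fix z assume z: "z \<in> {x. dist x (cp K x) \<le> r}"
    have 1: "(x - y) \<bullet> (cp K z - y) \<le> 0" unfolding y_def by (rule closest_point_dot[OF K(1,2) closest_point_in_set[OF K(2,3)]])
    have "(x - y) \<bullet> (z - cp K z) \<le> d * norm (z - cp K z)" using norm_cauchy_schwarz[of "x - y" "z - cp K z"] n by simp
    also have "\<dots> \<le> d * r" using z dr by (intro mult_left_mono) (auto simp: dist_norm)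
    finally have 2: "(x - y) \<bullet> (z - y) \<le> d * r" using 1 by (simp add: inner_diff_right)
    have "(x - y) \<bullet> (w - y) = d * r" using n dr by (simp add: w_def dot_square_norm power2_eq_square)
    with 2 have "(x - y) \<bullet> (z - w) \<le> 0" by (simp add: inner_diff_right)
    moreover have "x - w = (1 - r / d) *\<^sub>R (x - y)" by (simp add: w_def algebra_simps)
    ultimately show "(x - w) \<bullet> (z - w) \<le> 0" using dr by (simp add: mult_nonneg_nonpos)
  qed
qed

text \<open>Taylor expansion at \<open>r\<close>; the sum is the derivative there. It describes the
  passage from a body to its parallel body at distance \<open>r\<close>.\<close>

lemma cfs_1_shift:
  assumes F: "ispoly N F" and r: "r \<ge> 0" and N: "N \<ge> 1"
  shows "ispoly N (\<lambda>s. F (r + s) - F r)" "cfs N 1 (\<lambda>s. F (r + s) - F r) = (\<Sum>k\<le>N. cfs N k F * real k * r ^ (k - 1))"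
proof -
  let ?a = "\<lambda>k. cfs N k F"
  define b where "b l = (if l = 0 then 0 else \<Sum>k\<le>N. ?a k * (real (k choose l) * r ^ (k - l)))" for l
  have F': "F r = (\<Sum>k\<le>N. ?a k * r ^ k)" if "r \<ge> 0" for r using F that by (simp add: ispoly_def)
  have bin: "(r + s) ^ k = (\<Sum>l\<le>N. real (k choose l) * r ^ (k - l) * s ^ l)" if "k \<le> N" for k s
  proof -
    have "(r + s) ^ k = (s + r) ^ k" by (simp add: add.commute)
    also have "\<dots> = (\<Sum>l\<le>k. real (k choose l) * s ^ l * r ^ (k - l))" by (rule binomial_ring)
    also have "\<dots> = (\<Sum>l\<le>N. real (k choose l) * s ^ l * r ^ (k - l))"
      using that by (intro sum.mono_neutral_left) auto
    finally show ?thesis by (simp add: mult_ac)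
  qed
  have eq: "F (r + s) - F r = (\<Sum>l\<le>N. b l * s ^ l)" if "s \<ge> 0" for s
  proof -
    have "F (r + s) = (\<Sum>k\<le>N. \<Sum>l\<le>N. ?a k * (real (k choose l) * r ^ (k - l)) * s ^ l)"
      using F'[of "r + s"] r that by (simp add: bin sum_distrib_left mult.assoc)
    also have "\<dots> = (\<Sum>l\<le>N. (\<Sum>k\<le>N. ?a k * (real (k choose l) * r ^ (k - l))) * s ^ l)"
      by (subst sum.swap) (simp add: sum_distrib_right)
    also have "\<dots> = (\<Sum>l\<le>N. b l * s ^ l) + (\<Sum>k\<le>N. ?a k * r ^ k)"
    proof -
      have "(\<Sum>l\<le>N. (\<Sum>k\<le>N. ?a k * (real (k choose l) * r ^ (k - l))) * s ^ l)
        = (\<Sum>l\<le>N. b l * s ^ l + (if l = 0 then (\<Sum>k\<le>N. ?a k * r ^ k) else 0))"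
        by (intro sum.cong) (auto simp: b_def)
      then show ?thesis by (simp add: sum.distrib)
    qed
    finally show ?thesis using F'[OF r] by simp
  qed
  show "ispoly N (\<lambda>s. F (r + s) - F r)" by (rule ispolyI[OF eq])
  show "cfs N 1 (\<lambda>s. F (r + s) - F r) = (\<Sum>k\<le>N. cfs N k F * real k * r ^ (k - 1))"
    using cfs_eq[of "\<lambda>s. F (r + s) - F r", OF eq N] by (simp add: b_def mult.assoc)
qed

text \<open>A polynomial of growth order \<open>m\<close> has no higher terms; they are eliminated
  one at a time from degree \<open>N\<close> downwards.\<close>

lemma cfs_top:
  assumes F: "ispoly N F" and lim: "(\<lambda>i. F (real (Suc i)) / real (Suc i) ^ m) \<longlonglongrightarrow> L" and m: "m \<le> N"
  shows "cfs N m F = L" "\<And>k. m < k \<Longrightarrow> k \<le> N \<Longrightarrow> cfs N k F = 0"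
proof -
  let ?q = "\<lambda>i. real (Suc i)"
  let ?a = "\<lambda>k. cfs N k F"
  have F': "F r = (\<Sum>k\<le>N. ?a k * r ^ k)" if "r \<ge> 0" for r using F that by (simp add: ispoly_def)
  have inv: "(\<lambda>i. 1 / ?q i ^ l) \<longlonglongrightarrow> (if l = 0 then 1 else 0)" for l
  proof (cases "l = 0")
    case False
    have "(\<lambda>i. (inverse (?q i)) ^ l) \<longlonglongrightarrow> 0 ^ l" by (intro tendsto_power LIMSEQ_inverse_real_of_nat)
    then show ?thesis using False by (simp add: inverse_eq_divide power_one_over zero_power)
  qed simp
  have top: "(\<lambda>i. F (?q i) / ?q i ^ d) \<longlonglongrightarrow> ?a d" if d: "d \<le> N" "\<And>k. d < k \<Longrightarrow> k \<le> N \<Longrightarrow> ?a k = 0" for d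
  proof -
    have eq: "F (?q i) / ?q i ^ d = (\<Sum>k\<le>d. ?a k * (1 / ?q i ^ (d - k)))" for i
    proof -
      have "F (?q i) = (\<Sum>k\<le>d. ?a k * ?q i ^ k)"
      proof -
        have "F (?q i) = (\<Sum>k\<le>N. ?a k * ?q i ^ k)" by (rule F') simp
        also have "\<dots> = (\<Sum>k\<le>d. ?a k * ?q i ^ k)" using d by (intro sum.mono_neutral_right) auto
        finally show ?thesis .
      qed
      then have "F (?q i) / ?q i ^ d = (\<Sum>k\<le>d. ?a k * (?q i ^ k / ?q i ^ d))"
        by (simp add: sum_divide_distrib)
      also have "\<dots> = (\<Sum>k\<le>d. ?a k * (1 / ?q i ^ (d - k)))"
      proof (rule sum.cong[OF refl])
        fix k assume "k \<in> {..d}"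
        then have "?q i ^ d = ?q i ^ k * ?q i ^ (d - k)" by (simp add: power_add[symmetric])
        then show "?a k * (?q i ^ k / ?q i ^ d) = ?a k * (1 / ?q i ^ (d - k))" by simp
      qed
      finally show ?thesis .
    qed
    have "(\<lambda>i. \<Sum>k\<le>d. ?a k * (1 / ?q i ^ (d - k))) \<longlonglongrightarrow> (\<Sum>k\<le>d. ?a k * (if d - k = 0 then 1 else 0))"
      by (intro tendsto_intros inv)
    moreover have "(\<Sum>k\<le>d. ?a k * (if d - k = 0 then 1 else 0)) = (\<Sum>k\<le>d. if k = d then ?a k else 0)"
      by (intro sum.cong) auto
    ultimately show ?thesis by (simp add: eq del: of_nat_Suc)
  qed
  have zero: "\<forall>k. N - i < k \<and> k \<le> N \<longrightarrow> ?a k = 0" if "m \<le> N - i" for i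
    using that
  proof (induction i)
    case (Suc i)
    show ?case
    proof (cases "i < N")
      case True
      let ?d = "N - i"
      have IH: "\<forall>k. ?d < k \<and> k \<le> N \<longrightarrow> ?a k = 0" using Suc by auto
      have md: "m < ?d" using Suc.prems True by linarith
      have "(\<lambda>i. F (?q i) / ?q i ^ m * (1 / ?q i ^ (?d - m))) \<longlonglongrightarrow> L * 0"
        using inv[of "?d - m"] md by (intro tendsto_mult lim) (metis diff_is_0_eq not_le)
      moreover have "F (?q l) / ?q l ^ m * (1 / ?q l ^ (?d - m)) = F (?q l) / ?q l ^ ?d" for l
      proof -
        have "?q l ^ ?d = ?q l ^ m * ?q l ^ (?d - m)" using md by (simp only: power_add[symmetric]) simp
        then show ?thesis by (simp del: of_nat_Suc)
      qed
      ultimately have "(\<lambda>i. F (?q i) / ?q i ^ ?d) \<longlonglongrightarrow> 0" by (simp only: mult_zero_right)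
      moreover have "(\<lambda>i. F (?q i) / ?q i ^ ?d) \<longlonglongrightarrow> ?a ?d" using IH by (intro top) auto
      ultimately have "?a ?d = 0" using LIMSEQ_unique by blast
      then show ?thesis using IH Suc_diff_Suc[OF True] by (metis Suc_leI le_neq_implies_less)
    qed (use Suc in auto)
  qed auto
  show z: "\<And>k. m < k \<Longrightarrow> k \<le> N \<Longrightarrow> cfs N k F = 0" using zero[of "N - m"] m by auto
  show "cfs N m F = L" using top[OF m z] lim LIMSEQ_unique by blast
qed

section \<open>The local Steiner polynomial of the cylinder over a projection of
  \<open>P\<close>\<close>

context
  fixes P B C :: "'a::euclidean_space set" and c :: real
  assumes n2: "DIM('a) \<ge> 2" and c: "slabconst TYPE('a) c"
    and BC: "orthonormal (B \<union> C)" "B \<inter> C = {}" "span (B \<union> C) = UNIV"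
    and P: "convex P" "compact P" "interior P \<noteq> {}"
begin

private lemma B: "orthonormal B" and C: "orthonormal C" using BC orthonormal_subset by blast+

private lemma dec: "pr B x + pr C x = x" by (rule pr_decomp[OF BC])

private lemma spB: "x \<in> span B \<longleftrightarrow> pr C x = 0"
  using pr_pr_orth[OF BC(1,2)] dec[of x] pr_in_span[of B x] by (metis add.right_neutral)

private lemma inner_split: "x \<in> span B \<Longrightarrow> x \<bullet> z = x \<bullet> pr B z"
  using pr_inner_span[OF B, of x z] by (simp add: inner_commute)

private lemma Pne: "P \<noteq> {}" using P(3) interior_subset by auto

text \<open>All normals of this cylinder lie in \<open>span B\<close>, and at a point of
  \<open>P\<close> they are exactly the normals of \<open>P\<close> in \<open>span B\<close>. Its
  local parallel volume over \<open>P\<close> therefore isolates what the great subsphere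
  sees.\<close>

definition "cyl = {x. pr B x \<in> pr B ` P}"

private lemma cyl: "convex cyl" "closed cyl" "P \<subseteq> cyl" "cyl \<noteq> {}"
proof -
  have "cyl = pr B -` (pr B ` P)" by (auto simp: cyl_def)
  moreover have "convex (pr B -` (pr B ` P))" by (intro convex_linear_vimage linear_pr convex_linear_image P(1))
  moreover have "closed (pr B -` (pr B ` P))"
    by (intro closed_vimage compact_imp_closed compact_continuous_image continuous_intros P(2))
  ultimately show "convex cyl" "closed cyl" by auto
  show "P \<subseteq> cyl" by (auto simp: cyl_def)
  then show "cyl \<noteq> {}" using Pne by auto
qed

text \<open>The cylinder is invariant under translations along \<open>span C\<close>, so nearest
  points are reached within \<open>span B\<close>.\<close>

private lemma cp_cyl: "pr C (cp cyl x) = pr C x"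
proof -
  define y where "y = cp cyl x"
  have y: "y \<in> cyl" unfolding y_def by (rule closest_point_in_set[OF cyl(2,4)])
  have "(x - y) \<bullet> v = 0" if v: "v \<in> C" for v
  proof -
    have "pr B v = 0" using pr_pr_orth[of C B v] BC v by (simp add: Un_commute Int_commute span_base)
    then have "y + s *\<^sub>R v \<in> cyl" for s using y by (simp add: cyl_def pr_add pr_scaleR)
    then have "(x - y) \<bullet> (y + s *\<^sub>R v - y) \<le> 0" for s unfolding y_def by (rule closest_point_dot[OF cyl(1,2)])
    from this[of 1] this[of "-1"] show ?thesis by simp
  qed
  then have "pr C (x - y) = 0" by (rule pr_eq_0)
  then show ?thesis by (simp add: pr_diff y_def)
qed

private lemma cp_cyl_iff:
  assumes y: "y \<in> P"
  shows "cp cyl x = y \<longleftrightarrow> x - y \<in> span B \<and> (\<forall>p\<in>P. (x - y) \<bullet> (p - y) \<le> 0)"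
proof
  assume "cp cyl x = y"
  then show "x - y \<in> span B \<and> (\<forall>p\<in>P. (x - y) \<bullet> (p - y) \<le> 0)"
    using cp_cyl[of x] closest_point_dot[OF cyl(1,2), of _ x] cyl(3) by (auto simp: spB pr_diff)
next
  assume a: "x - y \<in> span B \<and> (\<forall>p\<in>P. (x - y) \<bullet> (p - y) \<le> 0)"
  show "cp cyl x = y"
  proof (rule cp_eqI[OF cyl(1,2)])
    show "y \<in> cyl" using y cyl(3) by blast
    fix z assume "z \<in> cyl"
    then obtain p where p: "p \<in> P" "pr B z = pr B p" by (auto simp: cyl_def)
    then have "(x - y) \<bullet> z = (x - y) \<bullet> p" using a inner_split[of "x - y"] by metis
    then show "(x - y) \<bullet> (z - y) \<le> 0" using a p by (simp add: inner_diff_right)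
  qed
qed

text \<open>The margin 1 keeps the support of \<open>bump P k\<close>, for \<open>k \<ge> 1\<close>,
  inside the open ball, where \<open>cyl\<close> and its truncation have the same nearest
  points.\<close>

definition "rad = (SOME R. R > 1 \<and> (\<forall>x\<in>P. norm x < R - 1))"

private lemma rad: "rad > 1" "x \<in> P \<Longrightarrow> norm x < rad - 1"
proof -
  obtain R where R: "\<And>x. x \<in> P \<Longrightarrow> norm x \<le> R" using compact_imp_bounded[OF P(2)] by (auto simp: bounded_iff)
  have "\<exists>R. R > 1 \<and> (\<forall>x\<in>P. norm x < R - 1)"
    using R by (intro exI[of _ "\<bar>R\<bar> + 2"]) force
  from someI_ex[OF this] show "rad > 1" "x \<in> P \<Longrightarrow> norm x < rad - 1" by (auto simp: rad_def)
qed

text \<open>The Steiner formula is available for compact sets only; the truncation happens away from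
  \<open>P\<close>.\<close>

definition "body = cyl \<inter> cball 0 rad"

private lemma body: "convex body" "compact body" "closed body" "body \<noteq> {}" "P \<subseteq> body" "interior body \<noteq> {}"
proof -
  show "convex body" unfolding body_def using cyl by (intro convex_Int) auto
  show "compact body" unfolding body_def using cyl by (intro closed_Int_compact) auto
  then show "closed body" by (rule compact_imp_closed)
  show sub: "P \<subseteq> body" using cyl(3) rad by (force simp: body_def)
  then show "body \<noteq> {}" using Pne by auto
  show "interior body \<noteq> {}" using interior_mono[OF sub] P(3) by auto
qed

private lemma cp_body:
  assumes y: "norm y < rad"
  shows "cp body x = y \<longleftrightarrow> cp cyl x = y"
  using cp_truncate[OF cyl(1,2) y, of x] closest_point_in_set[OF body(3,4), of x] closest_point_in_set[OF cyl(2,4), of x]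
  by (auto simp: body_def)

private lemma cp_body_P: "y \<in> P \<Longrightarrow> cp body x = y \<longleftrightarrow> x - y \<in> span B \<and> (\<forall>p\<in>P. (x - y) \<bullet> (p - y) \<le> 0)"
  using cp_body[of y x] rad(2)[of y] cp_cyl_iff by simp

text \<open>The copy at distance \<open>r\<close> of the points of \<open>P\<close> that have a
  normal in \<open>span B\<close>.\<close>

definition "lift r = {y + r *\<^sub>R u | y u. y \<in> P \<and> u \<in> span B \<and> norm u = 1 \<and> (\<forall>p\<in>P. u \<bullet> (p - y) \<le> 0)}"

private lemma parallel_bodyI: "p \<in> P \<Longrightarrow> norm b \<le> 1 \<Longrightarrow> p + r *\<^sub>R b \<in> parallel_body P r"
  unfolding parallel_body_def mem_Collect_eq by (intro exI conjI) auto

private lemma rev_spherical_image_lift: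
  assumes r: "r \<ge> 0"
  shows "rev_spherical_image (parallel_body P r) (sphere 0 1 \<inter> span B) = lift r"
proof (intro set_eqI iffI)
  fix x assume "x \<in> rev_spherical_image (parallel_body P r) (sphere 0 1 \<inter> span B)"
  then obtain u where x: "x \<in> frontier (parallel_body P r)" and u: "u \<in> span B" "norm u = 1" "\<And>y. y \<in> parallel_body P r \<Longrightarrow> (y - x) \<bullet> u \<le> 0"
    by (auto simp: rev_spherical_image_def)
  have "compact (parallel_body P r)"
  proof -
    have "parallel_body P r = (\<lambda>(x, b). x + r *\<^sub>R b) ` (P \<times> cball 0 1)" by (auto simp: parallel_body_def) blast
    moreover have "compact \<dots>" using P(2) by (intro compact_continuous_image compact_Times) (auto intro!: continuous_intros simp: case_prod_beta)
    ultimately show ?thesis by simp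
  qed
  then have "x \<in> parallel_body P r" using x compact_imp_closed frontier_subset_closed by blast
  then obtain y b where y: "x = y + r *\<^sub>R b" "y \<in> P" "norm b \<le> 1" by (auto simp: parallel_body_def)
  have uu: "u \<bullet> u = 1" using u(2) by (simp add: norm_eq_1)
  have n: "u \<bullet> (p - y) \<le> 0" if "p \<in> P" for p
  proof -
    have "p + r *\<^sub>R b \<in> parallel_body P r" using that y by (intro parallel_bodyI) auto
    from u(3)[OF this] show ?thesis by (simp add: y inner_commute)
  qed
  \<comment> \<open>Testing the supporting inequality with \<open>y + r *\<^sub>R u\<close> gives
    \<open>1 \<le> b \<bullet> u\<close>, which with \<open>norm b \<le> 1\<close> forces
    \<open>b = u\<close>; for \<open>r = 0\<close> both sides vanish.\<close>
  have "r *\<^sub>R b = r *\<^sub>R u"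
  proof (cases "r = 0")
    case False
    then have rp: "r > 0" using r by simp
    have "y + r *\<^sub>R u \<in> parallel_body P r" using u y by (intro parallel_bodyI) auto
    from u(3)[OF this] have "r * ((u - b) \<bullet> u) \<le> 0" by (simp add: y inner_diff_left algebra_simps)
    then have bu: "1 \<le> b \<bullet> u" using rp uu by (simp add: mult_le_0_iff inner_diff_left)
    have "(norm (b - u))\<^sup>2 = b \<bullet> b - 2 * (b \<bullet> u) + 1" by (simp add: power2_norm_eq_inner inner_diff_left inner_diff_right inner_commute uu)
    moreover have "b \<bullet> b \<le> 1" using y(3) by (simp add: dot_square_norm abs_square_le_1)
    ultimately have "(norm (b - u))\<^sup>2 \<le> 0" using bu by linarith
    then show ?thesis by simp
  qed simp
  then have "x = y + r *\<^sub>R u" using y by simp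
  then show "x \<in> lift r" unfolding lift_def using y u n by blast
next
  fix x assume "x \<in> lift r"
  then obtain y u where x: "x = y + r *\<^sub>R u" and y: "y \<in> P" and u: "u \<in> span B" "norm u = 1" "\<And>p. p \<in> P \<Longrightarrow> u \<bullet> (p - y) \<le> 0"
    by (auto simp: lift_def)
  have uu: "u \<bullet> u = 1" using u(2) by (simp add: norm_eq_1)
  have xin: "x \<in> parallel_body P r" unfolding x using y u by (intro parallel_bodyI) auto
  have sup: "(z - x) \<bullet> u \<le> 0" if zz: "z \<in> parallel_body P r" for z
  proof -
    obtain p b where p: "z = p + r *\<^sub>R b" "p \<in> P" "norm b \<le> 1" using zz by (auto simp: parallel_body_def)
    have "b \<bullet> u \<le> 1" using norm_cauchy_schwarz[of b u] p(3) u(2) by simp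
    then have "r * (b \<bullet> u) \<le> r * 1" using r by (rule mult_left_mono)
    moreover have "p \<bullet> u \<le> y \<bullet> u" using u(3)[OF p(2)] by (simp add: inner_diff_right inner_commute)
    ultimately show ?thesis by (simp add: p x inner_diff_left inner_add_left uu)
  qed
  have "x \<notin> interior (parallel_body P r)"
  proof
    assume "x \<in> interior (parallel_body P r)"
    then obtain e where e: "e > 0" "ball x e \<subseteq> parallel_body P r" by (meson mem_interior)
    have "x + (e/2) *\<^sub>R u \<in> parallel_body P r" using e u by (intro subsetD[OF e(2)]) (simp add: dist_norm)
    from sup[OF this] show False using e uu by simp
  qed
  then have "x \<in> frontier (parallel_body P r)" using xin closure_subset by (auto simp: frontier_def)
  then show "x \<in> rev_spherical_image (parallel_body P r) (sphere 0 1 \<inter> span B)"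
    unfolding rev_spherical_image_def mem_Collect_eq using u sup by (intro conjI bexI[of _ u] ballI) auto
qed

private lemma closed_lift: "closed (lift r)"
proof -
  let ?T = "P \<times> (sphere 0 1 \<inter> span B)"
  let ?D = "\<Inter>p\<in>P. {a. snd a \<bullet> (p - fst a) \<le> 0}"
  have "closed ?D" by (intro closed_INT ballI closed_Collect_le continuous_intros)
  moreover have "compact ?T" using P(2) closed_subspace[OF subspace_span[of B]] by (intro compact_Times compact_Int_closed) auto
  ultimately have "compact (?T \<inter> ?D)" by (intro compact_Int_closed)
  then have "compact ((\<lambda>a. fst a + r *\<^sub>R snd a) ` (?T \<inter> ?D))" by (intro compact_continuous_image continuous_intros)
  also have "(\<lambda>a. fst a + r *\<^sub>R snd a) ` (?T \<inter> ?D) = lift r"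
  proof (intro set_eqI iffI)
    fix x assume "x \<in> lift r"
    then obtain y u where x: "x = y + r *\<^sub>R u" and "y \<in> P" "u \<in> span B" "norm u = 1" "\<forall>p\<in>P. u \<bullet> (p - y) \<le> 0"
      by (auto simp: lift_def)
    then have "(y, u) \<in> ?T \<inter> ?D" by auto
    then show "x \<in> (\<lambda>a. fst a + r *\<^sub>R snd a) ` (?T \<inter> ?D)" using x by (intro image_eqI[of _ _ "(y,u)"]) auto
  next
    fix x assume "x \<in> (\<lambda>a. fst a + r *\<^sub>R snd a) ` (?T \<inter> ?D)"
    then show "x \<in> lift r" unfolding lift_def by auto blast
  qed
  finally show ?thesis by (rule compact_imp_closed)
qed

text \<open>\<open>lift r\<close> lies on the boundary of this convex body too, and there its
  normals are confined to \<open>span B\<close>, which makes the local parallel volume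
  computable.\<close>

definition "pbody r = {x. dist x (cp body x) \<le> r}"

private lemma pbody: assumes r: "r \<ge> 0" shows "convex (pbody r)" "compact (pbody r)" "interior (pbody r) \<noteq> {}"
proof -
  show "convex (pbody r)" unfolding pbody_def by (rule parallel_set_convex[OF body(1,3,4)])
  have "continuous_on UNIV (\<lambda>x. dist x (cp body x))" by (intro continuous_intros continuous_on_closest_point body)
  then have cl: "closed (pbody r)" unfolding pbody_def by (intro closed_Collect_le) auto
  have "pbody r \<subseteq> cball 0 (rad + r)"
  proof
    fix x assume "x \<in> pbody r"
    moreover have "norm (cp body x) \<le> rad" using closest_point_in_set[OF body(3,4), of x] by (auto simp: body_def)
    ultimately show "x \<in> cball 0 (rad + r)" using norm_triangle_ineq2[of x "cp body x"] by (auto simp: pbody_def dist_norm)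
  qed
  then have "bounded (pbody r)" by (rule bounded_subset[OF bounded_cball])
  then show "compact (pbody r)" using cl by (simp add: compact_eq_bounded_closed)
  have "body \<subseteq> pbody r" using r by (auto simp: pbody_def closest_point_self)
  then show "interior (pbody r) \<noteq> {}" using interior_mono body(6) by blast
qed

private lemma cp_lift:
  assumes "y \<in> P" "u \<in> span B" "\<forall>p\<in>P. u \<bullet> (p - y) \<le> 0" "s \<ge> 0"
  shows "cp body (y + s *\<^sub>R u) = y"
  using assms by (subst cp_body_P) (auto intro: span_scale simp: mult_nonneg_nonpos)

private lemma lift_frontier: assumes r: "r \<ge> 0" shows "lift r \<subseteq> frontier (pbody r)"
proof
  fix x assume "x \<in> lift r"
  then obtain y u where x: "x = y + r *\<^sub>R u" and y: "y \<in> P" "u \<in> span B" "\<forall>p\<in>P. u \<bullet> (p - y) \<le> 0" and n: "norm u = 1"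
    by (auto simp: lift_def)
  have in_iff: "y + s *\<^sub>R u \<in> pbody r \<longleftrightarrow> s \<le> r" if "s \<ge> 0" for s
    using that n cp_lift[OF y that] by (simp add: pbody_def dist_norm)
  have "x \<notin> interior (pbody r)"
  proof
    assume "x \<in> interior (pbody r)"
    then obtain e where e: "e > 0" "ball x e \<subseteq> pbody r" by (meson mem_interior)
    have "y + (r + e/2) *\<^sub>R u \<in> pbody r" using e n by (intro subsetD[OF e(2)]) (simp add: dist_norm x algebra_simps)
    then show False using in_iff[of "r + e/2"] r e by simp
  qed
  moreover have "x \<in> pbody r" using in_iff[OF r] x by simp
  ultimately show "x \<in> frontier (pbody r)" using closure_subset by (auto simp: frontier_def)
qed

text \<open>Nearest points in \<open>pbody r\<close> lie on the segments to nearest points in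
  \<open>body\<close>, so the shell over \<open>lift r\<close> is the layer over \<open>P\<close>
  between the distances \<open>r\<close> and \<open>r + s\<close>.\<close>

private lemma stein_lift:
  assumes r: "r \<ge> 0" and s: "s \<ge> 0"
  shows "stein (pbody r) (indicator (lift r)) s = stein body (indicator P) (r + s) - stein body (indicator P) r"
proof -
  have uP: "unitfun (indicator P :: 'a \<Rightarrow> real)" using compact_imp_closed[OF P(2)] by (intro unitfun_indicator) auto
  have cb: "compact (pbody r)" "closed (pbody r)" "pbody r \<noteq> {}" using pbody[OF r] compact_imp_closed interior_subset by auto
  have pt: "indicator (shell (pbody r) s) x * indicator (lift r) (cp (pbody r) x) =
     indicator (shell body (r + s)) x * indicator P (cp body x) - indicator (shell body r) x * (indicator P (cp body x) :: real)" for x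
  proof (cases "r < dist x (cp body x)")
    case False
    then have "x \<in> pbody r" by (simp add: pbody_def)
    then have "cp (pbody r) x = x" by (rule closest_point_self)
    then have "x \<notin> shell (pbody r) s" by (simp add: shell_def)
    moreover have "x \<in> shell body (r + s) \<longleftrightarrow> x \<in> shell body r" using False s by (auto simp: shell_def)
    ultimately show ?thesis by (simp add: indicator_def)
  next
    case True
    define y where "y = cp body x"
    define d where "d = dist x y"
    define u where "u = (1/d) *\<^sub>R (x - y)"
    have d: "r < d" "d > 0" using True r by (auto simp: d_def y_def)
    then have xne: "x \<noteq> y" by (auto simp: d_def)
    have nu: "norm u = 1" using d by (simp add: u_def d_def dist_norm)
    have xy: "x = y + d *\<^sub>R u" using d by (simp add: u_def)
    have cpb: "cp (pbody r) x = y + r *\<^sub>R u"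
      using cp_parallel[OF body(1,3,4) r True] d by (simp add: pbody_def y_def[symmetric] d_def[symmetric] u_def)
    have dist: "dist x (cp (pbody r) x) = d - r"
    proof -
      have "x - (y + r *\<^sub>R u) = (d - r) *\<^sub>R u" by (subst (1) xy) (simp add: algebra_simps)
      then show ?thesis using d nu by (simp add: cpb dist_norm)
    qed
    have sh: "x \<in> shell (pbody r) s \<longleftrightarrow> x \<in> shell body (r + s)"
      unfolding shell_def mem_Collect_eq dist y_def[symmetric] d_def[symmetric] using d by auto
    have nsh: "x \<notin> shell body r" using True by (simp add: shell_def)
    have "cp (pbody r) x \<in> lift r \<longleftrightarrow> y \<in> P"
    proof
      assume yP: "y \<in> P"
      have "x - y \<in> span B \<and> (\<forall>p\<in>P. (x - y) \<bullet> (p - y) \<le> 0)" using cp_body_P[OF yP, of x] by (simp add: y_def)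
      then have "u \<in> span B \<and> (\<forall>p\<in>P. u \<bullet> (p - y) \<le> 0)" using d by (auto simp: u_def intro: span_scale divide_nonpos_pos)
      then show "cp (pbody r) x \<in> lift r" unfolding cpb lift_def using yP nu by blast
    next
      assume "cp (pbody r) x \<in> lift r"
      then obtain y' u' where y': "y + r *\<^sub>R u = y' + r *\<^sub>R u'" "y' \<in> P" "u' \<in> span B" "\<forall>p\<in>P. u' \<bullet> (p - y') \<le> 0"
        unfolding cpb by (auto simp: lift_def)
      have "cp body (y' + r *\<^sub>R u') = y'" by (rule cp_lift[OF y'(2-4) r])
      moreover have "cp body (y + r *\<^sub>R u) = y"
        using cp_extend[OF body(1,3,4), of "r/d" x] d r by (simp add: y_def[symmetric] u_def)
      ultimately show "y \<in> P" using y' by simp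
    qed
    then show ?thesis using sh nsh by (simp add: indicator_def y_def)
  qed
  have "stein (pbody r) (indicator (lift r)) s = (\<integral>x. indicator (shell body (r + s)) x * indicator P (cp body x) - indicator (shell body r) x * indicator P (cp body x) \<partial>lborel)"
    unfolding stein_def by (rule Bochner_Integration.integral_cong[OF refl]) (rule pt)
  also have "\<dots> = stein body (indicator P) (r + s) - stein body (indicator P) r"
    unfolding stein_def by (intro Bochner_Integration.integral_diff stein_integrable body uP)
  finally show ?thesis .
qed

text \<open>Up to \<open>c\<close>, the surface area is the linear coefficient in \<open>s\<close>
  of \<open>stein_lift\<close>, that is the derivative at \<open>r\<close> of one fixed
  polynomial.\<close>

lemma surface_area_parallel:
  assumes r: "r \<ge> 0"
  shows "surface_area_measure (parallel_body P r) (sphere 0 1 \<inter> span B) =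
    c * (\<Sum>k\<le>DIM('a). cfs DIM('a) k (stein body (indicator P)) * real k * r ^ (k - 1))"
proof -
  let ?F = "stein body (indicator P)"
  let ?n = "DIM('a)"
  have n1: "?n \<ge> 1" using n2 by simp
  have pol: "ispoly ?n ?F" by (rule stein_ispoly_closed[OF body(1,2,4) compact_imp_closed[OF P(2)]])
  have cf: "cfs ?n 1 (stein (pbody r) (indicator (lift r))) = cfs ?n 1 (\<lambda>s. ?F (r + s) - ?F r)"
    unfolding cfs_def using stein_lift[OF r] by simp
  have pos: "0 \<le> cfs ?n 1 (stein (pbody r) (indicator (lift r)))"
  proof -
    have "pbody r \<noteq> {}" using pbody(3)[OF r] interior_subset by auto
    then have "cfs ?n 1 (\<lambda>_. 0) \<le> cfs ?n 1 (stein (pbody r) (indicator (lift r)))"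
      using pbody[OF r] closed_lift n1
      by (intro cfs_1_mono stein_ispoly_closed) (auto intro!: ispolyI[where a="\<lambda>_. 0"] stein_nonneg unitfun_indicator)
    then show ?thesis by (simp add: cfs_def)
  qed
  have c0: "c \<ge> 0" using c by (simp add: slabconst_def)
  have "surface_area_measure (parallel_body P r) (sphere 0 1 \<inter> span B) = enn2real (hausdorff_measure (?n - 1) (lift r))"
    unfolding surface_area_measure_def rev_spherical_image_lift[OF r] ..
  also have "hausdorff_measure (?n - 1) (lift r) = ennreal (c * cfs ?n 1 (stein (pbody r) (indicator (lift r))))"
    by (rule hausdorff_eq_steiner[OF n2 c pbody[OF r] closed_lift lift_frontier[OF r]])
  also have "enn2real \<dots> = c * cfs ?n 1 (stein (pbody r) (indicator (lift r)))"
    using c0 pos by (intro enn2real_ennreal mult_nonneg_nonneg)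
  also have "\<dots> = c * cfs ?n 1 (\<lambda>s. ?F (r + s) - ?F r)" by (simp only: cf)
  also have "\<dots> = c * (\<Sum>k\<le>?n. cfs ?n k ?F * real k * r ^ (k - 1))" by (simp only: cfs_1_shift(2)[OF pol r n1])
  finally show ?thesis .
qed

section \<open>The leading Steiner coefficient as a limit at infinity\<close>

private lemma AE_unique_max:
  "AE x in lborel. \<exists>z\<in>pr B ` P. (\<forall>q\<in>P. q \<bullet> pr B x \<le> z \<bullet> x) \<and> (\<forall>w\<in>pr B ` P. (\<forall>q\<in>P. q \<bullet> pr B x \<le> w \<bullet> x) \<longrightarrow> w = z)"
proof -
  have K: "compact (pr B ` P)" "pr B ` P \<noteq> {}" using P(2) Pne by (auto intro!: compact_continuous_image continuous_intros)
  have inn: "q \<bullet> pr B x = pr B q \<bullet> x" for q x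
    using inner_split[OF pr_in_span, of x q] inner_split[OF pr_in_span, of q x] by (simp add: inner_commute)
  from AE_unique_maximizer[OF K] show ?thesis
  proof eventually_elim
    case (elim x)
    obtain z where z: "z \<in> pr B ` P" "\<And>q. q \<in> pr B ` P \<Longrightarrow> q \<bullet> x \<le> z \<bullet> x" using compact_attains_max_inner[OF K] by blast
    show ?case
    proof (intro bexI[OF _ z(1)] conjI ballI impI)
      fix q assume "q \<in> P" then show "q \<bullet> pr B x \<le> z \<bullet> x" using z(2)[of "pr B q"] inn[of q x] by simp
    next
      fix w assume w: "w \<in> pr B ` P" "\<forall>q\<in>P. q \<bullet> pr B x \<le> w \<bullet> x"
      have "q \<bullet> x \<le> w \<bullet> x" if "q \<in> pr B ` P" for q using that w(2) inn by force
      then show "w = z" using elim[rule_format, OF w(1) z(1)] z(2) by blast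
    qed
  qed
qed

text \<open>Determined for almost every \<open>x\<close> only, which suffices under the
  integral.\<close>

private definition "zmax x = (THE z. z \<in> pr B ` P \<and> (\<forall>q\<in>P. q \<bullet> pr B x \<le> z \<bullet> x))"

private lemma AE_zmax:
  "AE x in lborel. zmax x \<in> pr B ` P \<and> (\<forall>q\<in>P. q \<bullet> pr B x \<le> zmax x \<bullet> x) \<and> (\<forall>w\<in>pr B ` P. (\<forall>q\<in>P. q \<bullet> pr B x \<le> w \<bullet> x) \<longrightarrow> w = zmax x)"
  using AE_unique_max
proof eventually_elim
  case (elim x)
  then obtain z where z: "z \<in> pr B ` P" "\<forall>q\<in>P. q \<bullet> pr B x \<le> z \<bullet> x" "\<forall>w\<in>pr B ` P. (\<forall>q\<in>P. q \<bullet> pr B x \<le> w \<bullet> x) \<longrightarrow> w = z" by blast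
  have "zmax x = z" unfolding zmax_def by (rule the_equality) (use z in blast)+
  then show ?case using z by blast
qed

private lemma bump_support: assumes "k \<ge> 1" "bump P k y \<noteq> 0" shows "norm y < rad"
proof -
  have "real k * infdist y P < 1" using assms(2) by (auto simp: bump_def max_def split: if_splits)
  moreover have "infdist y P \<le> real k * infdist y P" using assms(1) mult_right_mono[of 1 "real k" "infdist y P"] by (simp add: infdist_nonneg)
  ultimately have "infdist y P < 1" by linarith
  moreover obtain p where "p \<in> P" "infdist y P = dist y p" using infdist_attains_inf[OF compact_imp_closed[OF P(2)] Pne] by blast
  ultimately show ?thesis using rad(2)[of p] norm_triangle_ineq2[of y p] by (simp add: dist_norm)
qed

private lemma stein_body_cyl:
  assumes "k \<ge> 1"
  shows "indicator (shell body r) x * bump P k (cp body x) = indicator (shell cyl r) x * bump P k (cp cyl x)"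
proof (cases "norm (cp body x) < rad \<or> norm (cp cyl x) < rad")
  case True
  then have "cp cyl x = cp body x" using cp_body by metis
  then show ?thesis by (simp add: shell_def indicator_def)
next
  case False
  then have "bump P k (cp body x) = 0" "bump P k (cp cyl x) = 0" using bump_support[OF assms] by blast+
  then show ?thesis by simp
qed

text \<open>Seen from far away in direction \<open>pr B x\<close>, the nearest point of the
  projection of \<open>P\<close> nearly maximizes this direction; compactness and uniqueness of the
  maximizer give convergence.\<close>

private lemma pr_cp_cyl_lim:
  assumes z: "zmax x \<in> pr B ` P" "\<forall>q\<in>P. q \<bullet> pr B x \<le> zmax x \<bullet> x" "\<forall>w\<in>pr B ` P. (\<forall>q\<in>P. q \<bullet> pr B x \<le> w \<bullet> x) \<longrightarrow> w = zmax x"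
  shows "(\<lambda>i. pr B (cp cyl (real (Suc i) *\<^sub>R pr B x + pr C x))) \<longlonglongrightarrow> zmax x"
proof (rule tendstoI)
  fix e :: real assume e: "e > 0"
  let ?K = "pr B ` P" and ?z = "zmax x" and ?b = "pr B x"
  define k where "k i = pr B (cp cyl (real (Suc i) *\<^sub>R pr B x + pr C x))" for i
  have K: "compact ?K" using P(2) by (intro compact_continuous_image continuous_intros)
  have zs: "?z \<in> span B" using z(1) by auto
  have inn: "q \<bullet> pr B x = pr B q \<bullet> x" for q
    using inner_split[OF pr_in_span, of x q] inner_split[OF pr_in_span, of q x] by (simp add: inner_commute)
  have inK: "w \<bullet> x = w \<bullet> ?b" if "w \<in> ?K" for w using that inner_split[of w x] by auto
  have max: "w \<bullet> ?b \<le> ?z \<bullet> ?b" if wK: "w \<in> ?K" for w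
  proof -
    obtain q where q: "q \<in> P" "w = pr B q" using wK by auto
    have "w \<bullet> x \<le> ?z \<bullet> x" using z(2) q inn[of q] by auto
    then show ?thesis using inK[OF wK] inK[OF z(1)] by simp
  qed
  have uniq: "w = ?z" if "w \<in> ?K" "w \<bullet> ?b = ?z \<bullet> ?b" for w
    using z(2,3) that inK[OF that(1)] inK[OF z(1)] by auto
  have kK: "k i \<in> ?K" for i
    using closest_point_in_set[OF cyl(2,4), of "real (Suc i) *\<^sub>R pr B x + pr C x"] by (auto simp: k_def cyl_def)
  note split = pr_split[OF BC(1,2)]
  \<comment> \<open>Expanding the squares in \<open>norm (r b - k) \<le> norm (r b - z)\<close>
    leaves an error of order \<open>1 / r\<close>.\<close>
  have low: "?z \<bullet> ?b - (norm ?z)\<^sup>2 / (2 * real (Suc i)) \<le> k i \<bullet> ?b" for i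
  proof -
    let ?r = "real (Suc i)" and ?T = "real (Suc i) *\<^sub>R pr B x + pr C x"
    have cpT: "cp cyl ?T = k i + pr C x"
    proof -
      have "pr C ?T = pr C x" by (intro split) (auto intro: span_scale)
      then show ?thesis using dec[of "cp cyl ?T"] cp_cyl[of ?T] by (simp add: k_def)
    qed
    have "?z + pr C x \<in> cyl" using z(1) split(1)[OF zs, of "pr C x"] by (simp add: cyl_def)
    then have "dist ?T (cp cyl ?T) \<le> dist ?T (?z + pr C x)" by (rule closest_point_le[OF cyl(2)])
    then have "norm (?r *\<^sub>R ?b - k i) \<le> norm (?r *\<^sub>R ?b - ?z)" unfolding cpT by (simp add: dist_norm del: of_nat_Suc)
    then have "(norm (?r *\<^sub>R ?b - k i))\<^sup>2 \<le> (norm (?r *\<^sub>R ?b - ?z))\<^sup>2" by (intro power_mono) auto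
    then have "(norm (k i))\<^sup>2 - 2 * ?r * (k i \<bullet> ?b) \<le> (norm ?z)\<^sup>2 - 2 * ?r * (?z \<bullet> ?b)"
      by (simp add: power2_norm_eq_inner inner_diff_left inner_diff_right inner_commute mult.assoc del: of_nat_Suc)
    then have "2 * ?r * (?z \<bullet> ?b) - (norm ?z)\<^sup>2 \<le> 2 * ?r * (k i \<bullet> ?b)" using zero_le_power2[of "norm (k i)"] by linarith
    then show ?thesis by (simp add: field_simps del: of_nat_Suc)
  qed
  show "\<forall>\<^sub>F i in sequentially. dist (pr B (cp cyl (real (Suc i) *\<^sub>R pr B x + pr C x))) ?z < e"
    unfolding k_def[symmetric]
  proof (cases "?K - ball ?z e = {}")
    case True
    then have "dist (k i) ?z < e" for i using kK[of i] by (auto simp: dist_commute)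
    then show "\<forall>\<^sub>F i in sequentially. dist (k i) ?z < e" by simp
  next
    case False
    have "compact (?K - ball ?z e)" using K by (simp add: compact_diff)
    then obtain w where w: "w \<in> ?K - ball ?z e" "\<And>q. q \<in> ?K - ball ?z e \<Longrightarrow> q \<bullet> ?b \<le> w \<bullet> ?b"
      using compact_attains_max_inner[OF _ False] by blast
    have "w \<noteq> ?z" using w(1) e by auto
    then have lt: "w \<bullet> ?b < ?z \<bullet> ?b" using max[of w] uniq[of w] w(1) by force
    have "(\<lambda>i. (norm ?z)\<^sup>2 / 2 * inverse (real (Suc i))) \<longlonglongrightarrow> (norm ?z)\<^sup>2 / 2 * 0" by (intro tendsto_mult tendsto_const LIMSEQ_inverse_real_of_nat)
    then have "\<forall>\<^sub>F i in sequentially. (norm ?z)\<^sup>2 / 2 * inverse (real (Suc i)) < ?z \<bullet> ?b - w \<bullet> ?b"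
      by (rule order_tendstoD(2)) (use lt in simp)
    then show "\<forall>\<^sub>F i in sequentially. dist (k i) ?z < e"
    proof eventually_elim
      case (elim i)
      show ?case
      proof (rule ccontr)
        assume "\<not> dist (k i) ?z < e"
        then have "k i \<in> ?K - ball ?z e" using kK[of i] by (auto simp: dist_commute)
        then have "k i \<bullet> ?b \<le> w \<bullet> ?b" by (rule w(2))
        moreover have "(norm ?z)\<^sup>2 / 2 * inverse (real (Suc i)) = (norm ?z)\<^sup>2 / (2 * real (Suc i))" by (simp only: inverse_eq_divide times_divide_times_eq mult_1_right)
        ultimately show False using low[of i] elim by linarith
      qed
    qed
  qed
qed

text \<open>Stretching the \<open>B\<close> component by \<open>r\<close> turns the shell into the
  condition \<open>norm (pr B x) \<le> 1\<close> and the nearest point into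
  \<open>zmax x + pr C x\<close> in the limit. The function \<open>L\<close> is a measurable version
  of this limit, obtained without proving that \<open>zmax\<close> is measurable.\<close>

private lemma stein_bump_top:
  assumes k: "k \<ge> 1" and B0: "B \<noteq> {}"
  shows "\<exists>L. L \<in> borel_measurable borel \<and> (AE x in lborel. L x = indicator {x. norm (pr B x) \<le> 1} x * bump P k (zmax x + pr C x))
    \<and> (\<lambda>i. stein body (bump P k) (real (Suc i)) / real (Suc i) ^ card B) \<longlonglongrightarrow> (\<integral>x. L x \<partial>lborel)"
proof -
  let ?q = "\<lambda>i. real (Suc i)"
  let ?l = "\<lambda>x. indicator {x. norm (pr B x) \<le> 1} x * bump P k (zmax x + pr C x)"
  define G where "G r x = indicator (shell cyl r) x * bump P k (cp cyl x)" for r x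
  let ?T = "\<lambda>r x. r *\<^sub>R pr B x + pr C x"
  have Gm[measurable]: "G r \<in> borel_measurable borel" for r
    unfolding G_def by (rule stein_measurable[OF cyl(1,2,4) unitfun_bump])
  have G01: "0 \<le> G r x" "G r x \<le> 1" for r x using unitfun_bump[of P k] by (auto simp: G_def unitfun_def indicator_def)
  note split = pr_split[OF BC(1,2)]
  have sc: "stein body (bump P k) r / r ^ card B = (\<integral>x. G r (?T r x) \<partial>lborel)" if r: "r > 0" for r
  proof -
    have "stein body (bump P k) r = (\<integral>x. G r x \<partial>lborel)" unfolding stein_def G_def stein_body_cyl[OF k] ..
    also have "\<dots> = enn2real (\<integral>\<^sup>+x. ennreal (G r x) \<partial>lborel)" by (rule integral_eq_nn_integral) (auto simp: G01)
    also have "(\<integral>\<^sup>+x. ennreal (G r x) \<partial>lborel) = ennreal (r ^ card B) * (\<integral>\<^sup>+x. ennreal (G r (?T r x)) \<partial>lborel)"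
      by (rule nn_integral_lborel_scale[OF BC r]) measurable
    also have "enn2real \<dots> = r ^ card B * enn2real (\<integral>\<^sup>+x. ennreal (G r (?T r x)) \<partial>lborel)" using r by (simp add: enn2real_mult)
    also have "enn2real (\<integral>\<^sup>+x. ennreal (G r (?T r x)) \<partial>lborel) = (\<integral>x. G r (?T r x) \<partial>lborel)" by (rule integral_eq_nn_integral[symmetric]) (auto simp: G01)
    finally show ?thesis using r by simp
  qed
  define L where "L x = lim (\<lambda>i. G (?q i) (?T (?q i) x))" for x
  have Lm: "L \<in> borel_measurable borel" unfolding L_def by (intro borel_measurable_lim_metric) measurable
  have cpT: "cp cyl (?T r x) = pr B (cp cyl (?T r x)) + pr C x" for r x
  proof -
    have "pr C (?T r x) = pr C x" by (intro split) (auto intro: span_scale)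
    then show ?thesis using dec[of "cp cyl (?T r x)"] cp_cyl[of "?T r x"] by simp
  qed
  have dT: "dist (?T r x) (cp cyl (?T r x)) = norm (r *\<^sub>R pr B x - pr B (cp cyl (?T r x)))" for r x
    by (subst cpT) (simp add: dist_norm)
  \<comment> \<open>These are the points at distance exactly 1 from \<open>span C\<close>.\<close>
  have nb: "AE x in lborel. norm (pr B x) \<noteq> 1"
  proof -
    have sc: "convex (span C)" "closed (span C)" "span C \<noteq> {}" using subspace_imp_convex[OF subspace_span] closed_subspace[OF subspace_span] span_zero by blast+
    have "cp (span C) x = pr C x" for x
    proof (rule cp_eqI[OF sc(1,2)])
      fix z assume "z \<in> span C"
      then have "z - pr C x \<in> span C" by (intro span_diff) auto
      moreover have "x - pr C x = pr B x" using dec[of x] by (simp add: algebra_simps)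
      ultimately show "(x - pr C x) \<bullet> (z - pr C x) \<le> 0" using span_orthogonal[OF BC(1,2) pr_in_span, of "z - pr C x" x] by simp
    qed simp
    moreover have "dist x (pr C x) = norm (pr B x)" for x using dec[of x] by (metis add_diff_cancel_right' dist_norm)
    ultimately show ?thesis using null_level_set[OF sc, of 1] by simp
  qed
  have n0: "AE x in lborel. pr B x \<noteq> 0"
  proof -
    have "card C < DIM('a)"
      using orthonormal_full[OF BC(1,3)] card_Un_disjoint[OF orthonormal_finite[OF B] orthonormal_finite[OF C] BC(2)] B0 orthonormal_finite[OF B] card_gt_0_iff[of B] by linarith
    then have "negligible (span C)" using orthonormal_card[OF C] by (intro negligible_lowdim) simp
    moreover have "span C \<in> sets borel" using closed_subspace[OF subspace_span[of C]] by (rule borel_closed)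
    ultimately have "span C \<in> null_sets lborel" by (simp add: negligible_iff_null_sets null_sets_completion_iff)
    from AE_not_in[OF this] show ?thesis
    proof eventually_elim
      case (elim x) then show ?case using dec[of x] pr_in_span[of C x] by (metis add.left_neutral)
    qed
  qed
  have pt: "AE x in lborel. (\<lambda>i. G (?q i) (?T (?q i) x)) \<longlonglongrightarrow> ?l x"
    using AE_zmax nb n0
  proof eventually_elim
    case (elim x)
    let ?k = "\<lambda>i. pr B (cp cyl (?T (?q i) x))"
    have kl: "?k \<longlonglongrightarrow> zmax x" using elim(1) by (intro pr_cp_cyl_lim) auto
    have "isCont (bump P k) y" for y using continuous_bump[of UNIV P k] by (simp add: continuous_on_eq_continuous_at)
    then have fl: "(\<lambda>i. bump P k (?k i + pr C x)) \<longlonglongrightarrow> bump P k (zmax x + pr C x)"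
      by (rule isCont_tendsto_compose) (intro tendsto_intros kl)
    have "(\<lambda>i. norm (pr B x - inverse (?q i) *\<^sub>R ?k i)) \<longlonglongrightarrow> norm (pr B x - 0 *\<^sub>R zmax x)"
      by (intro tendsto_intros kl LIMSEQ_inverse_real_of_nat)
    then have dl: "(\<lambda>i. dist (?T (?q i) x) (cp cyl (?T (?q i) x)) / ?q i) \<longlonglongrightarrow> norm (pr B x)"
    proof -
      have "dist (?T (?q i) x) (cp cyl (?T (?q i) x)) / ?q i = norm (pr B x - inverse (?q i) *\<^sub>R ?k i)" for i
      proof -
        have "?q i *\<^sub>R pr B x - ?k i = ?q i *\<^sub>R (pr B x - inverse (?q i) *\<^sub>R ?k i)" by (simp add: scaleR_diff_right del: of_nat_Suc)
        then show ?thesis unfolding dT by (simp del: of_nat_Suc)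
      qed
      then show ?thesis using \<open>(\<lambda>i. norm (pr B x - inverse (?q i) *\<^sub>R ?k i)) \<longlonglongrightarrow> _\<close> by (simp del: of_nat_Suc)
    qed
    have ev: "\<forall>\<^sub>F i in sequentially. indicator (shell cyl (?q i)) (?T (?q i) x) = (indicator {x. norm (pr B x) \<le> 1} x :: real)"
    proof -
      have p: "\<forall>\<^sub>F i in sequentially. 0 < dist (?T (?q i) x) (cp cyl (?T (?q i) x)) / ?q i"
        using elim(3) by (intro order_tendstoD(1)[OF dl]) simp
      show ?thesis
      proof (cases "norm (pr B x) < 1")
        case True
        from p order_tendstoD(2)[OF dl True] show ?thesis
          by eventually_elim (use True in \<open>simp add: shell_def indicator_def divide_less_eq zero_less_divide_iff del: of_nat_Suc\<close>)
      next
        case False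
        then have gt: "1 < norm (pr B x)" using elim(2) by simp
        from order_tendstoD(1)[OF dl gt] show ?thesis
          by eventually_elim (use gt in \<open>simp add: shell_def indicator_def less_divide_eq del: of_nat_Suc\<close>)
      qed
    qed
    have "(\<lambda>i. indicator {x. norm (pr B x) \<le> 1} x * bump P k (?k i + pr C x)) \<longlonglongrightarrow> ?l x"
      by (intro tendsto_intros fl)
    then show ?case
      by (rule Lim_transform_eventually) (use ev in eventually_elim, simp only: G_def cpT[symmetric])
  qed
  have AEL: "AE x in lborel. L x = ?l x"
    using pt by eventually_elim (simp only: L_def limI)
  have "(\<lambda>i. \<integral>x. G (?q i) (?T (?q i) x) \<partial>lborel) \<longlonglongrightarrow> (\<integral>x. L x \<partial>lborel)"
  proof (rule integral_dominated_convergence[where w="indicator (cball 0 (1 + 2 * rad))"])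
    show "L \<in> borel_measurable lborel" using Lm by simp
    show "(\<lambda>x. G (?q i) (?T (?q i) x)) \<in> borel_measurable lborel" for i by measurable
    show "integrable lborel (indicator (cball (0::'a) (1 + 2 * rad)) :: 'a \<Rightarrow> real)" by (rule integrable_indicator_cball)
    show "AE x in lborel. (\<lambda>i. G (?q i) (?T (?q i) x)) \<longlonglongrightarrow> L x"
      using pt AEL by eventually_elim simp
    show "AE x in lborel. norm (G (?q i) (?T (?q i) x)) \<le> indicator (cball 0 (1 + 2 * rad)) x" for i
    proof (intro AE_I2)
      fix x
      let ?r = "?q i" let ?y = "cp cyl (?T ?r x)"
      show "norm (G ?r (?T ?r x)) \<le> indicator (cball 0 (1 + 2 * rad)) x"
      proof (cases "G ?r (?T ?r x) = 0")
        case False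
        then have sh: "?T ?r x \<in> shell cyl ?r" and "bump P k ?y \<noteq> 0" by (auto simp: G_def indicator_def split: if_splits)
        then have ny: "norm ?y < rad" using bump_support[OF k] by blast
        have "pr C ?y = pr C x" using cp_cyl[of "?T ?r x"] split(2)[of "?r *\<^sub>R pr B x" "pr C x"] by (simp add: span_scale del: of_nat_Suc)
        then have "norm (pr C x) = norm (pr C ?y)" by simp
        also have "\<dots> < rad" using norm_pr_le[OF C, of ?y] ny by linarith
        finally have c1: "norm (pr C x) < rad" .
        have "norm (?r *\<^sub>R pr B x) \<le> norm (?r *\<^sub>R pr B x - pr B ?y) + norm (pr B ?y)" using norm_triangle_sub[of "?r *\<^sub>R pr B x" "pr B ?y"] by simp
        also have "\<dots> \<le> ?r + rad" using sh dT[of ?r x] norm_pr_le[OF B, of ?y] ny by (auto simp: shell_def)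
        finally have "?r * norm (pr B x) \<le> ?r + rad" by (simp only: norm_scaleR abs_of_nat)
        moreover have "rad \<le> ?r * rad" using rad(1) mult_right_mono[of 1 ?r rad] by simp
        ultimately have "?r * norm (pr B x) \<le> ?r * (1 + rad)" by (simp only: distrib_left mult_1_right)
        then have "norm (pr B x) \<le> 1 + rad" by (rule mult_left_le_imp_le) simp
        then have "norm x \<le> 1 + 2 * rad" using c1 norm_triangle_ineq[of "pr B x" "pr C x"] dec[of x] by simp
        then show ?thesis using G01[of ?r "?T ?r x"] by simp
      qed simp
    qed
  qed
  then have "(\<lambda>i. stein body (bump P k) (?q i) / ?q i ^ card B) \<longlonglongrightarrow> (\<integral>x. L x \<partial>lborel)"
    using sc by (simp del: of_nat_Suc)
  then show ?thesis using Lm AEL by blast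
qed

text \<open>First \<open>r\<close> tends to infinity for the weight \<open>bump P (Suc k)\<close>,
  then \<open>k\<close> does. The growth order already excludes powers above
  \<open>card B\<close>.\<close>

lemma cfs_stein_top:
  assumes B0: "B \<noteq> {}"
  shows "cfs DIM('a) (card B) (stein body (indicator P)) = measure lborel (suppset P B C)"
    and "\<And>k. card B < k \<Longrightarrow> k \<le> DIM('a) \<Longrightarrow> cfs DIM('a) k (stein body (indicator P)) = 0"
proof -
  let ?n = "DIM('a)"
  have le: "card B \<le> ?n"
    using orthonormal_full[OF BC(1,3)] card_Un_disjoint[OF orthonormal_finite[OF B] orthonormal_finite[OF C] BC(2)] by simp
  have clP: "closed P" using P(2) by (rule compact_imp_closed)
  define A where "A k L \<longleftrightarrow> L \<in> borel_measurable borel \<and> (AE x in lborel. L x = indicator {x. norm (pr B x) \<le> 1} x * bump P (Suc k) (zmax x + pr C x))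
    \<and> (\<lambda>i. stein body (bump P (Suc k)) (real (Suc i)) / real (Suc i) ^ card B) \<longlonglongrightarrow> (\<integral>x. L x \<partial>lborel)" for k L
  have "\<exists>L. A k L" for k unfolding A_def by (rule stein_bump_top[OF _ B0]) simp
  then obtain L where "\<And>k. A k (L k)" by metis
  note L = this[unfolded A_def, THEN conjunct1] this[unfolded A_def, THEN conjunct2, THEN conjunct1] this[unfolded A_def, THEN conjunct2, THEN conjunct2]
  have pol: "ispoly ?n (stein body (bump P k))" for k
    by (intro stein_ispoly_continuous body unitfun_bump continuous_bump)
  have lim: "(\<lambda>k. cfs ?n l (stein body (bump P (Suc k)))) \<longlonglongrightarrow> cfs ?n l (stein body (indicator P))" for l
    using LIMSEQ_Suc[OF stein_bump_lim[OF body(1,2,4) clP Pne]] by (intro cfs_tendsto) auto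
  show "cfs ?n k (stein body (indicator P)) = 0" if "card B < k" "k \<le> ?n" for k
    using lim[of k] cfs_top(2)[OF pol L(3) le that] by (simp add: LIMSEQ_const_iff)
  have S: "suppset P B C \<in> sets borel" by (intro borel_compact compact_suppset BC P(2))
  obtain R where R: "suppset P B C \<subseteq> cball 0 R" using compact_imp_bounded[OF compact_suppset[OF BC P(2)]] by (metis bounded_subset_ballD ball_subset_cball subset_trans)
  have inn: "q \<bullet> pr B x = pr B q \<bullet> x" for q x
    using inner_split[OF pr_in_span, of x q] inner_split[OF pr_in_span, of q x] by (simp add: inner_commute)
  have "(\<lambda>k. \<integral>x. L k x \<partial>lborel) \<longlonglongrightarrow> (\<integral>x. indicator (suppset P B C) x \<partial>lborel)"
  proof (rule integral_dominated_convergence[where w="indicator (cball 0 (1 + rad))"])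
    show "(indicator (suppset P B C) :: 'a \<Rightarrow> real) \<in> borel_measurable lborel" using S by simp
    show "L k \<in> borel_measurable lborel" for k using L(1) by simp
    show "integrable lborel (indicator (cball (0::'a) (1 + rad)) :: 'a \<Rightarrow> real)" by (rule integrable_indicator_cball)
    show "AE x in lborel. norm (L k x) \<le> indicator (cball 0 (1 + rad)) x" for k
      using L(2)[of k] AE_zmax
    proof eventually_elim
      case (elim x)
      show ?case
      proof (cases "L k x = 0")
        case False
        then have b: "norm (pr B x) \<le> 1" and "bump P (Suc k) (zmax x + pr C x) \<noteq> 0" using elim(1) by (auto simp: indicator_def split: if_splits)
        then have "norm (zmax x + pr C x) < rad" using bump_support[of "Suc k"] by simp
        moreover have "pr C (zmax x + pr C x) = pr C x"
          using elim(2) pr_pr_orth[OF BC(1,2), of "zmax x"] pr_id[OF C] by (auto simp: pr_add)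
        ultimately have "norm (pr C x) < rad" using norm_pr_le[OF C, of "zmax x + pr C x"] by simp
        then have "norm x \<le> 1 + rad" using b norm_triangle_ineq[of "pr B x" "pr C x"] dec[of x] by simp
        then show ?thesis using elim(1) unitfun_bump[of P "Suc k"] by (auto simp: unitfun_def indicator_def)
      qed simp
    qed
    have "AE x in lborel. \<forall>k. L k x = indicator {x. norm (pr B x) \<le> 1} x * bump P (Suc k) (zmax x + pr C x)"
      using L(2) by (simp add: AE_all_countable)
    then show "AE x in lborel. (\<lambda>k. L k x) \<longlonglongrightarrow> indicator (suppset P B C) x"
      using AE_zmax
    proof eventually_elim
      case (elim x)
      have "(\<lambda>k. L k x) \<longlonglongrightarrow> indicator {x. norm (pr B x) \<le> 1} x * indicator P (zmax x + pr C x)"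
        using elim(1) LIMSEQ_Suc[OF bump_lim[OF clP Pne, of "zmax x + pr C x"]] by (simp add: tendsto_mult_left)
      moreover have "zmax x + pr C x \<in> P \<longleftrightarrow> (\<exists>p\<in>P. pr C p = pr C x \<and> (\<forall>q\<in>P. q \<bullet> pr B x \<le> p \<bullet> pr B x))"
      proof
        assume zP: "zmax x + pr C x \<in> P"
        have zs: "zmax x \<in> span B" using elim(2) by auto
        have "pr C (zmax x + pr C x) = pr C x" using pr_pr_orth[OF BC(1,2) zs] pr_id[OF C] by (simp add: pr_add)
        moreover have "(zmax x + pr C x) \<bullet> pr B x = zmax x \<bullet> x"
          using span_orthogonal[OF BC(1,2) pr_in_span pr_in_span, of x x] inner_split[OF zs, of x] by (simp add: inner_add_left inner_add_right inner_commute)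
        ultimately show "\<exists>p\<in>P. pr C p = pr C x \<and> (\<forall>q\<in>P. q \<bullet> pr B x \<le> p \<bullet> pr B x)" using zP elim(2) by metis
      next
        assume "\<exists>p\<in>P. pr C p = pr C x \<and> (\<forall>q\<in>P. q \<bullet> pr B x \<le> p \<bullet> pr B x)"
        then obtain p where p: "p \<in> P" "pr C p = pr C x" "\<forall>q\<in>P. q \<bullet> pr B x \<le> p \<bullet> pr B x" by blast
        then have "pr B p = zmax x" using elim(2) by (auto simp: inn[of p])
        then show "zmax x + pr C x \<in> P" using p dec[of p] by metis
      qed
      then have "indicator {x. norm (pr B x) \<le> 1} x * indicator P (zmax x + pr C x) = (indicator (suppset P B C) x :: real)"
        by (simp add: suppset_def indicator_def)
      ultimately show ?case by simp
    qed
  qed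
  moreover have "(\<integral>x. L k x \<partial>lborel) = cfs ?n (card B) (stein body (bump P (Suc k)))" for k
    using cfs_top(1)[OF pol L(3) le] by simp
  ultimately have "(\<lambda>k. cfs ?n (card B) (stein body (bump P (Suc k)))) \<longlonglongrightarrow> measure lborel (suppset P B C)" by simp
  then show "cfs ?n (card B) (stein body (indicator P)) = measure lborel (suppset P B C)"
    using lim[of "card B"] LIMSEQ_unique by blast
qed

text \<open>The Steiner coefficient of index \<open>card B\<close> enters the surface area with the
  factor \<open>card B\<close> from differentiation; the binomial comes from the normalisation in
  the definition of area measures.\<close>

lemma area_measure_eq:
  assumes B0: "B \<noteq> {}" and Bn: "card B \<le> DIM('a)"
  shows "area_measure (DIM('a) - card B) P (sphere 0 1 \<inter> span B) =
    c * real (card B) * measure lborel (suppset P B C) / real (DIM('a) - 1 choose (DIM('a) - card B))"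
proof -
  let ?n = "DIM('a)"
  let ?S = "\<lambda>r. surface_area_measure (parallel_body P r) (sphere 0 1 \<inter> span B)"
  define a where "a k = cfs ?n k (stein body (indicator P))" for k
  \<comment> \<open>Order \<open>m\<close> accompanies the power of \<open>r\<close> with exponent
    \<open>?n - 1 - m\<close>, which after differentiation belongs to the Steiner coefficient of
    index \<open>?n - m\<close>.\<close>
  define co where "co m = (if m < ?n then c * real (?n - m) * a (?n - m) / real (?n - 1 choose m) else 0)" for m
  have n1: "?n \<ge> 1" using n2 by simp
  have rev: "(\<Sum>m<?n. r ^ (?n - 1 - m) * real (?n - 1 choose m) * g m) = (\<Sum>k\<le>?n - 1. (real (?n - 1 choose (?n - 1 - k)) * g (?n - 1 - k)) * r ^ k)" for g :: "nat \<Rightarrow> real" and r :: real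
  proof -
    have "(\<Sum>m<?n. r ^ (?n - 1 - m) * real (?n - 1 choose m) * g m) = (\<Sum>k<?n. (\<lambda>m. r ^ (?n - 1 - m) * real (?n - 1 choose m) * g m) (?n - Suc k))"
      by (rule sum.nat_diff_reindex[symmetric])
    also have "\<dots> = (\<Sum>k\<le>?n - 1. (real (?n - 1 choose (?n - 1 - k)) * g (?n - 1 - k)) * r ^ k)"
    proof (rule sum.cong)
      show "{..<?n} = {..?n - 1}" using n1 lessThan_Suc_atMost[of "?n - 1"] by simp
      fix k assume "k \<in> {..?n - 1}"
      then have "?n - 1 - (?n - Suc k) = k" "?n - Suc k = ?n - 1 - k" using n1 by auto
      then show "r ^ (?n - 1 - (?n - Suc k)) * real (?n - 1 choose (?n - Suc k)) * g (?n - Suc k) = real (?n - 1 choose (?n - 1 - k)) * g (?n - 1 - k) * r ^ k"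
        by (simp only: mult_ac)
    qed
    finally show ?thesis .
  qed
  have S: "?S r = (\<Sum>k\<le>?n - 1. (c * a (Suc k) * real (Suc k)) * r ^ k)" if "r \<ge> 0" for r
  proof -
    have "?S r = c * (\<Sum>k\<le>?n. a k * real k * r ^ (k - 1))" unfolding a_def by (rule surface_area_parallel[OF that])
    also have "(\<Sum>k\<le>?n. a k * real k * r ^ (k - 1)) = (\<Sum>k\<le>Suc (?n - 1). a k * real k * r ^ (k - 1))" using n1 by simp
    also have "\<dots> = (\<Sum>k\<le>?n - 1. a (Suc k) * real (Suc k) * r ^ k)"
      by (subst sum.atMost_Suc_shift) simp
    finally show ?thesis by (simp add: sum_distrib_left mult_ac)
  qed
  have co: "(\<forall>m\<ge>?n. co m = 0) \<and> (\<forall>r\<ge>0. ?S r = (\<Sum>m<?n. r ^ (?n - 1 - m) * real (?n - 1 choose m) * co m))"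
  proof (intro conjI allI impI)
    fix r :: real assume r: "r \<ge> 0"
    have "(real (?n - 1 choose (?n - 1 - k)) * co (?n - 1 - k)) = c * a (Suc k) * real (Suc k)" if "k \<le> ?n - 1" for k
    proof -
      have "real (?n - 1 choose (?n - 1 - k)) \<noteq> 0" by simp
      moreover have "?n - (?n - 1 - k) = Suc k" "?n - 1 - k < ?n" using that n1 by linarith+
      ultimately show ?thesis by (simp add: co_def del: of_nat_Suc)
    qed
    then show "?S r = (\<Sum>m<?n. r ^ (?n - 1 - m) * real (?n - 1 choose m) * co m)"
      unfolding rev S[OF r] by (intro sum.cong refl) auto
  qed (auto simp: co_def)
  \<comment> \<open>For the definite description: values determine coefficients through
    \<open>cfs\<close>, and the binomials do not vanish.\<close>
  have uniq: "d = co" if d: "(\<forall>m\<ge>?n. d m = 0) \<and> (\<forall>r\<ge>0. ?S r = (\<Sum>m<?n. r ^ (?n - 1 - m) * real (?n - 1 choose m) * d m))" for d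
  proof
    fix m
    have cf: "cfs (?n - 1) k ?S = real (?n - 1 choose (?n - 1 - k)) * g (?n - 1 - k)"
      if "\<forall>r\<ge>0. ?S r = (\<Sum>m<?n. r ^ (?n - 1 - m) * real (?n - 1 choose m) * g m)" "k \<le> ?n - 1" for k g
      by (rule cfs_eq[OF _ that(2)]) (simp only: that(1)[rule_format] rev)
    show "d m = co m"
    proof (cases "m < ?n")
      case True
      define k where "k = ?n - 1 - m"
      have k: "k \<le> ?n - 1" "?n - 1 - k = m" using True by (auto simp: k_def)
      have "real (?n - 1 choose m) * d m = real (?n - 1 choose m) * co m"
        using cf[OF conjunct2[OF d] k(1)] cf[OF conjunct2[OF co] k(1)] k(2) by simp
      moreover have "real (?n - 1 choose m) \<noteq> 0" using True by simp
      ultimately show ?thesis by simp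
    qed (use d co in auto)
  qed
  have "area_measure (?n - card B) P (sphere 0 1 \<inter> span B) = co (?n - card B)"
  proof -
    have "(THE d. (\<forall>m\<ge>?n. d m = 0) \<and> (\<forall>r\<ge>0. ?S r = (\<Sum>m<?n. r ^ (?n - 1 - m) * real (?n - 1 choose m) * d m))) = co"
      by (rule the_equality) (rule co, rule uniq)
    then show ?thesis by (simp only: area_measure_def)
  qed
  moreover have "card B > 0" using B0 orthonormal_finite[OF B] by (simp add: card_gt_0_iff)
  ultimately show ?thesis using Bn n1 cfs_stein_top(1)[OF B0] by (simp add: co_def a_def)
qed

end

section \<open>Volumes of projections by slicing\<close>

lemma nn_integral_lam_uminus:
  fixes B :: "'a::euclidean_space set"
  assumes "finite B" "f \<in> borel_measurable borel"
  shows "(\<integral>\<^sup>+x. f (- x) \<partial>lam B) = (\<integral>\<^sup>+x. f x \<partial>lam B)"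
  using assms
proof (induction B arbitrary: f rule: finite_induct)
  case empty
  then show ?case using nn_integral_lam_empty[of "\<lambda>x. f (- x)"] nn_integral_lam_empty[of f] by simp
next
  case (insert v B)
  note [measurable] = insert.prems
  have refl: "(\<integral>\<^sup>+t. g (- t) \<partial>lborel) = (\<integral>\<^sup>+t. g t \<partial>lborel)" if [measurable]: "g \<in> borel_measurable borel" for g :: "real \<Rightarrow> ennreal"
    by (subst (2) lborel_distr_uminus[symmetric]) (simp add: nn_integral_distr)
  have "(\<integral>\<^sup>+x. f (- x) \<partial>lam (insert v B)) = (\<integral>\<^sup>+y. (\<integral>\<^sup>+t. f (- (y + t *\<^sub>R v)) \<partial>lborel) \<partial>lam B)"
    using insert by (intro nn_integral_lam_insert) auto
  also have "\<dots> = (\<integral>\<^sup>+y. (\<lambda>y. \<integral>\<^sup>+t. f (y + t *\<^sub>R v) \<partial>lborel) (- y) \<partial>lam B)"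
  proof (rule nn_integral_cong)
    fix y show "(\<integral>\<^sup>+t. f (- (y + t *\<^sub>R v)) \<partial>lborel) = (\<lambda>y. \<integral>\<^sup>+t. f (y + t *\<^sub>R v) \<partial>lborel) (- y)"
      using refl[of "\<lambda>t. f (- y + t *\<^sub>R v)"] by simp
  qed
  also have "\<dots> = (\<integral>\<^sup>+y. (\<integral>\<^sup>+t. f (y + t *\<^sub>R v) \<partial>lborel) \<partial>lam B)"
    by (rule insert.IH) measurable
  also have "\<dots> = (\<integral>\<^sup>+x. f x \<partial>lam (insert v B))"
    using insert by (intro nn_integral_lam_insert[symmetric]) auto
  finally show ?case .
qed

lemma distr_lam_uminus:
  fixes B :: "'a::euclidean_space set"
  assumes "finite B" shows "distr (lam B) borel uminus = lam B"
proof (rule measure_eqI)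
  fix A assume "A \<in> sets (distr (lam B) borel uminus)"
  then have A[measurable]: "A \<in> sets borel" by simp
  have "emeasure (distr (lam B) borel uminus) A = (\<integral>\<^sup>+x. indicator A x \<partial>distr (lam B) borel uminus)" by simp
  also have "\<dots> = (\<integral>\<^sup>+x. indicator A (- x) \<partial>lam B)" by (subst nn_integral_distr) auto
  also have "\<dots> = (\<integral>\<^sup>+x. indicator A x \<partial>lam B)" by (rule nn_integral_lam_uminus[OF assms]) measurable
  finally show "emeasure (distr (lam B) borel uminus) A = emeasure (lam B) A" by simp
qed simp

text \<open>The unspecified basis inside \<open>subspace_vol\<close> is exchanged for
  \<open>B\<close> by \<open>lam_span_eq\<close>; coordinates with respect to it identify the two
  sets.\<close>

lemma subspace_vol_lam:
  fixes B :: "'a::euclidean_space set"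
  assumes B: "orthonormal B" and S: "S \<subseteq> span B" "S \<in> sets borel"
  shows "subspace_vol (card B) (span B) S = measure (lam B) S"
proof -
  let ?k = "card B"
  let ?P = "\<lambda>b :: nat \<Rightarrow> 'a. (\<forall>i<?k. norm (b i) = 1) \<and> (\<forall>i<?k. \<forall>i'<?k. i \<noteq> i' \<longrightarrow> inner (b i) (b i') = 0) \<and> span (b ` {..<?k}) = span B"
  define b where "b = (SOME b. ?P b)"
  obtain h where h: "bij_betw h {..<?k} B" using orthonormal_finite[OF B] by (metis ex_bij_betw_nat_finite atLeast0LessThan)
  have "?P h"
  proof (intro conjI allI impI)
    have hB: "h i \<in> B" if "i < ?k" for i using h that by (auto simp: bij_betw_def)
    show "norm (h i) = 1" if "i < ?k" for i using hB[OF that] B by (auto simp: orthonormal_def)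
    show "h i \<bullet> h i' = 0" if "i < ?k" "i' < ?k" "i \<noteq> i'" for i i'
    proof -
      have "h i \<noteq> h i'" using h that unfolding bij_betw_def inj_on_def by blast
      then show ?thesis using orthonormal_inner[OF B hB hB] that by simp
    qed
    show "span (h ` {..<?k}) = span B" using h by (simp add: bij_betw_def)
  qed
  then have b: "?P b" unfolding b_def by (rule someI[of ?P h])
  have inj: "inj_on b {..<?k}"
  proof (rule inj_onI)
    fix i j assume ij: "i \<in> {..<?k}" "j \<in> {..<?k}" "b i = b j"
    show "i = j"
    proof (rule ccontr)
      assume "i \<noteq> j"
      have "b i \<bullet> b j = 0" using b ij(1,2) \<open>i \<noteq> j\<close> by (metis lessThan_iff)
      then have "b i = 0" using ij(3) by simp
      moreover have "norm (b i) = 1" using b ij(1) by (metis lessThan_iff)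
      ultimately show False by simp
    qed
  qed
  let ?B = "b ` {..<?k}"
  let ?M = "Pi\<^sub>M {..<?k} (\<lambda>_. lborel :: real measure)" and ?N = "Pi\<^sub>M ?B (\<lambda>_. lborel :: real measure)"
  let ?s = "\<lambda>f. \<Sum>i<?k. f i *\<^sub>R b i" and ?r = "\<lambda>x. restrict (\<lambda>i. x \<bullet> b i) {..<?k}"
  have onB: "orthonormal ?B" using b by (auto simp: orthonormal_def pairwise_def orthogonal_def)
  have fin: "finite ?B" by simp
  have lamB: "lam ?B = lam B" using b by (intro lam_span_eq onB B) auto
  let ?t = "\<lambda>f. \<lambda>v\<in>?B. f (inv_into {..<?k} b v)"
  have inv: "inv_into {..<?k} b (b i) = i" if "i < ?k" for i using inv_into_f_f[OF inj] that by simp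
  have t[measurable]: "?t \<in> ?M \<rightarrow>\<^sub>M ?N"
    by (intro measurable_restrict measurable_component_singleton) (auto simp: inv)
  have eq: "distr ?M ?N ?t = ?N"
  proof (rule PL.PiM_eqI[OF fin])
    fix A assume A: "\<And>i. i \<in> ?B \<Longrightarrow> A i \<in> sets (lborel :: real measure)"
    have "Pi\<^sub>E ?B A \<in> sets ?N" using fin A by (rule sets_PiM_I_finite)
    then have "emeasure (distr ?M ?N ?t) (Pi\<^sub>E ?B A)
      = emeasure ?M (Pi\<^sub>E {..<?k} (\<lambda>i. A (b i)))"
      by (subst emeasure_distr[OF t]) (auto intro!: arg_cong2[where f=emeasure] simp: space_PiM PiE_def Pi_def inv)
    also have "\<dots> = (\<Prod>i\<in>{..<?k}. emeasure lborel (A (b i)))"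
      using A by (intro PL.emeasure_PiM) auto
    also have "\<dots> = (\<Prod>v\<in>?B. emeasure lborel (A v))" by (simp add: prod.reindex[OF inj])
    finally show "emeasure (distr ?M ?N ?t) (Pi\<^sub>E ?B A) = (\<Prod>v\<in>?B. emeasure lborel (A v))" .
  qed simp
  have lam': "lam B = distr ?M borel ?s"
  proof -
    have "lam ?B = distr (distr ?M ?N ?t) borel (\<lambda>f. \<Sum>v\<in>?B. f v *\<^sub>R v)"
      unfolding eq lam_def ..
    also have "\<dots> = distr ?M borel ?s"
      by (subst distr_distr) (auto simp: o_def sum.reindex[OF inj] inv intro!: distr_cong sum.cong)
    finally show ?thesis using lamB by simp
  qed
  have m: "?s \<in> ?M \<rightarrow>\<^sub>M borel"
  proof (rule borel_measurable_sum)
    fix i assume "i \<in> {..<?k}"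
    then have "(\<lambda>f. f i) \<in> borel_measurable ?M"
      using measurable_component_singleton[of i "{..<?k}" "\<lambda>_. lborel"] by simp
    then show "(\<lambda>f. f i *\<^sub>R b i) \<in> borel_measurable ?M"
      by (intro borel_measurable_scaleR) auto
  qed
  have rep: "(\<Sum>i<?k. (x \<bullet> b i) *\<^sub>R b i) = x" if "x \<in> span B" for x
    using pr_id[OF onB, of x] b that by (simp add: pr_def sum.reindex[OF inj])
  have co: "(\<Sum>l<?k. f l *\<^sub>R b l) \<bullet> b i = f i" if "i < ?k" for f i
  proof -
    have "(\<Sum>l<?k. f l *\<^sub>R b l) \<bullet> b i = (\<Sum>l<?k. if l = i then f l else 0)"
      unfolding inner_sum_left using b that by (intro sum.cong) (auto simp: norm_eq_1)
    then show ?thesis using that by simp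
  qed
  have img: "?r ` S = ?s -` S \<inter> space ?M"
  proof (intro set_eqI iffI)
    fix f assume "f \<in> ?r ` S"
    then obtain x where x: "x \<in> S" "f = restrict (\<lambda>i. x \<bullet> b i) {..<?k}" by blast
    then have "(\<Sum>i<?k. f i *\<^sub>R b i) = x" using rep[of x] S by auto
    then show "f \<in> ?s -` S \<inter> space ?M" using x by (auto simp: space_PiM)
  next
    fix f assume f: "f \<in> ?s -` S \<inter> space ?M"
    have "f = restrict (\<lambda>i. (\<Sum>l<?k. f l *\<^sub>R b l) \<bullet> b i) {..<?k}"
      using f by (intro extensionalityI[of _ "{..<?k}"]) (auto simp: space_PiM PiE_def co)
    then show "f \<in> ?r ` S" using f by blast
  qed
  have "subspace_vol ?k (span B) S = measure ?M (?r ` S)"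
    unfolding subspace_vol_def Let_def b_def ..
  also have "\<dots> = measure (lam B) S" unfolding img lam' using S by (intro measure_distr[symmetric] m) auto
  finally show ?thesis .
qed

lemma proj_set_eq:
  assumes B: "orthonormal B" shows "proj_set P (span B) = pr B ` P"
proof (intro set_eqI iffI)
  fix y assume "y \<in> proj_set P (span B)"
  then obtain x where "y \<in> span B" "x \<in> P" "\<forall>z\<in>span B. (x - y) \<bullet> z = 0" by (auto simp: proj_set_def)
  then have "pr B x = y" by (intro pr_eqI B) (auto simp: inner_diff_left span_base)
  then show "y \<in> pr B ` P" using \<open>x \<in> P\<close> by blast
next
  fix y assume "y \<in> pr B ` P"
  then obtain x where "x \<in> P" "y = pr B x" by blast
  then show "y \<in> proj_set P (span B)" by (auto simp: proj_set_def inner_diff_left pr_inner_span[OF B] intro!: bexI[of _ x])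
qed

definition fib :: "'a::euclidean_space set \<Rightarrow> 'a set \<Rightarrow> 'a \<Rightarrow> 'a set" where
  "fib B P w = {x\<in>P. pr B x = w}"

text \<open>Support function of the section of \<open>P\<close> over \<open>w\<close>. The default 0
  for empty sections makes integrals over all \<open>w\<close> integrals over the
  projection.\<close>

definition hf :: "'a::euclidean_space set \<Rightarrow> 'a set \<Rightarrow> 'a \<Rightarrow> 'a \<Rightarrow> real" where
  "hf B P w v = (if fib B P w = {} then 0 else SUP x\<in>fib B P w. x \<bullet> v)"

lemma compact_fib: assumes "compact P" shows "compact (fib B P w)"
proof -
  have "fib B P w = P \<inter> {x. pr B x = w}" by (auto simp: fib_def)
  moreover have "closed {x. pr B x = w}" by (intro closed_Collect_eq continuous_intros)
  ultimately show ?thesis using assms by (simp add: compact_Int_closed)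
qed

lemma convex_fib: assumes "convex P" shows "convex (fib B P w)"
proof -
  have "fib B P w = P \<inter> pr B -` {w}" by (auto simp: fib_def)
  then show ?thesis using assms by (simp add: convex_Int convex_linear_vimage)
qed

lemma hf_max: "x \<in> fib B P w \<Longrightarrow> (\<And>y. y \<in> fib B P w \<Longrightarrow> y \<bullet> v \<le> x \<bullet> v) \<Longrightarrow> hf B P w v = x \<bullet> v"
  unfolding hf_def by (auto intro!: cSup_eq_maximum)

lemma hf_attained:
  assumes "compact P" "fib B P w \<noteq> {}"
  obtains x where "x \<in> fib B P w" "hf B P w v = x \<bullet> v" "\<And>y. y \<in> fib B P w \<Longrightarrow> y \<bullet> v \<le> x \<bullet> v"
  using compact_attains_max_inner[OF compact_fib[OF assms(1)] assms(2), of v] hf_max by metis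

lemma hf_upper: "compact P \<Longrightarrow> x \<in> fib B P w \<Longrightarrow> x \<bullet> v \<le> hf B P w v"
  by (metis empty_iff hf_attained)

lemma fib_empty_iff: "fib B P w = {} \<longleftrightarrow> w \<notin> pr B ` P"
  by (auto simp: fib_def)

lemma hf_scale: assumes "compact P" "c \<ge> 0" shows "hf B P w (c *\<^sub>R v) = c * hf B P w v"
proof (cases "fib B P w = {}")
  case False
  obtain x where x: "x \<in> fib B P w" "hf B P w v = x \<bullet> v" "\<And>y. y \<in> fib B P w \<Longrightarrow> y \<bullet> v \<le> x \<bullet> v"
    using hf_attained[OF assms(1) False] by blast
  have "hf B P w (c *\<^sub>R v) = x \<bullet> (c *\<^sub>R v)" using x assms(2) by (intro hf_max) (auto intro: mult_left_mono)
  then show ?thesis using x by simp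
qed (simp add: hf_def)

lemma hf_subadd: assumes "compact P" shows "hf B P w (u + v) \<le> hf B P w u + hf B P w v"
proof (cases "fib B P w = {}")
  case False
  then obtain x where "x \<in> fib B P w" "hf B P w (u + v) = x \<bullet> (u + v)" using hf_attained[OF assms] by metis
  then show ?thesis using hf_upper[OF assms, of x B w u] hf_upper[OF assms, of x B w v] by (simp add: inner_add_right)
qed (simp add: hf_def)

lemma hf_bound:
  assumes "compact P" "\<And>x. x \<in> P \<Longrightarrow> norm x \<le> R" "R \<ge> 0" shows "\<bar>hf B P w v\<bar> \<le> R * norm v"
proof (cases "fib B P w = {}")
  case False
  then obtain x where x: "x \<in> fib B P w" "hf B P w v = x \<bullet> v" using hf_attained[OF assms(1)] by metis
  have "\<bar>x \<bullet> v\<bar> \<le> norm x * norm v" by (rule Cauchy_Schwarz_ineq2)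
  also have "\<dots> \<le> R * norm v" using x assms by (intro mult_right_mono) (auto simp: fib_def)
  finally show ?thesis using x by simp
qed (use assms in \<open>simp add: hf_def\<close>)

text \<open>A superlevel set is the projection of a compact part of \<open>P\<close>; for levels up
  to 0 the default value adds the complement of the projection.\<close>

lemma hf_measurable [measurable]:
  assumes "compact P" shows "(\<lambda>w. hf B P w v) \<in> borel_measurable borel"
proof (subst borel_measurable_iff_ge, rule allI)
  fix c
  let ?A = "pr B ` (P \<inter> {x. c \<le> x \<bullet> v})" and ?D = "pr B ` P"
  have "compact ?A" "compact ?D" using assms
    by (auto intro!: compact_continuous_image compact_Int_closed closed_Collect_le continuous_intros)
  then have "?A \<in> sets borel" "?D \<in> sets borel" by (auto intro: borel_compact)
  moreover have "{w \<in> space borel. c \<le> hf B P w v} = ?A \<union> (if c \<le> 0 then - ?D else {})"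
  proof (intro set_eqI)
    fix w
    show "w \<in> {w \<in> space borel. c \<le> hf B P w v} \<longleftrightarrow> w \<in> ?A \<union> (if c \<le> 0 then - ?D else {})"
    proof (cases "fib B P w = {}")
      case True then show ?thesis by (auto simp: hf_def fib_def)
    next
      case False
      then obtain x where x: "x \<in> fib B P w" "hf B P w v = x \<bullet> v" using hf_attained[OF assms] by metis
      have "c \<le> hf B P w v \<longleftrightarrow> w \<in> ?A"
        using x hf_upper[OF assms, of _ B w v] by (force simp: fib_def)
      moreover have "w \<in> ?D" using x by (auto simp: fib_def)
      ultimately show ?thesis by auto
    qed
  qed
  ultimately show "{w \<in> space borel. c \<le> hf B P w v} \<in> sets borel" by auto
qed

lemma integrable_lam_bounded:
  fixes f :: "'a::euclidean_space \<Rightarrow> real"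
  assumes B: "orthonormal B" and f: "f \<in> borel_measurable borel" "\<And>w. \<bar>f w\<bar> \<le> K" "\<And>w. w \<notin> cball 0 R \<Longrightarrow> f w = 0"
  shows "integrable (lam B) f"
proof (rule Bochner_Integration.integrable_bound[of _ "\<lambda>x. K * indicator (cball 0 R) x"])
  have "integrable (lam B) (indicator (cball 0 R) :: 'a \<Rightarrow> real)"
    using emeasure_lam_bounded[OF B, of "cball 0 R"] by (intro integrable_real_indicator) auto
  then show "integrable (lam B) (\<lambda>x. K * indicator (cball 0 R) x)" by (rule integrable_mult_right)
  show "f \<in> borel_measurable (lam B)" using f(1) by simp
  show "AE x in lam B. norm (f x) \<le> norm (K * indicator (cball 0 R) x)"
  proof (intro AE_I2)
    fix x show "norm (f x) \<le> norm (K * indicator (cball 0 R) x)"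
      using f(2)[of x] f(3)[of x] by (cases "x \<in> cball 0 R") auto
  qed
qed

lemma hf_integrable:
  assumes B0: "orthonormal B0" and B: "orthonormal B" and P: "compact P" shows "integrable (lam B0) (\<lambda>w. hf B P w v)"
proof -
  obtain R where R: "R > 0" "\<And>x. x \<in> P \<Longrightarrow> norm x \<le> R" using compact_imp_bounded[OF P] by (metis bounded_pos)
  show ?thesis
  proof (rule integrable_lam_bounded[OF B0 hf_measurable[OF P]])
    show "\<bar>hf B P w v\<bar> \<le> R * norm v" for w using hf_bound[OF P R(2), of B w v] R by simp
    show "hf B P w v = 0" if "w \<notin> cball 0 R" for w
    proof -
      have "w \<notin> pr B ` P" using that R(2) norm_pr_le[OF B] by (force intro: order_trans)
      then show ?thesis by (simp add: hf_def fib_empty_iff)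
    qed
  qed
qed

lemma fib_uminus: "origin_symmetric P \<Longrightarrow> fib B P (- w) = uminus ` fib B P w"
proof -
  assume s: "origin_symmetric P"
  have "x \<in> uminus ` fib B P w" if "x \<in> fib B P (- w)" for x
    using that s by (intro image_eqI[of _ _ "- x"]) (auto simp: fib_def pr_minus origin_symmetric_def)
  moreover have "- x \<in> fib B P (- w)" if "x \<in> fib B P w" for x
    using that s by (auto simp: fib_def pr_minus origin_symmetric_def)
  ultimately show ?thesis by blast
qed

lemma hf_uminus:
  assumes P: "compact P" "origin_symmetric P" shows "hf B P (- w) v = hf B P w (- v)"
proof (cases "fib B P w = {}")
  case True then show ?thesis using fib_uminus[OF P(2), of B w] by (simp add: hf_def)
next
  case False
  obtain x where x: "x \<in> fib B P w" "hf B P w (- v) = x \<bullet> (- v)" "\<And>y. y \<in> fib B P w \<Longrightarrow> y \<bullet> (- v) \<le> x \<bullet> (- v)"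
    using hf_attained[OF P(1) False] by blast
  have "hf B P (- w) v = (- x) \<bullet> v"
    using x by (intro hf_max) (auto simp: fib_uminus[OF P(2)])
  then show ?thesis using x by simp
qed

lemma fib_inner_image:
  assumes P: "convex P" "compact P" and ne: "fib B P w \<noteq> {}"
  shows "(\<lambda>x. x \<bullet> u) ` fib B P w = {- hf B P w (- u) .. hf B P w u}"
proof -
  let ?I = "(\<lambda>x. x \<bullet> u) ` fib B P w"
  have "connected ?I" by (intro connected_continuous_image continuous_intros convex_connected convex_fib P)
  obtain x where x: "x \<in> fib B P w" "hf B P w u = x \<bullet> u" using hf_attained[OF P(2) ne] by metis
  obtain y where y: "y \<in> fib B P w" "hf B P w (- u) = y \<bullet> (- u)" using hf_attained[OF P(2) ne] by metis
  have "{y \<bullet> u .. x \<bullet> u} \<subseteq> ?I" using \<open>connected ?I\<close> x y by (intro connected_contains_Icc) auto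
  moreover have "?I \<subseteq> {y \<bullet> u .. x \<bullet> u}"
    using hf_upper[OF P(2), of _ B w u] hf_upper[OF P(2), of _ B w "- u"] x(2) y(2) by force
  ultimately show ?thesis using x y by auto
qed

text \<open>Over \<open>w\<close> the projection is an interval of length
  \<open>hf B P w u + hf B P w (- u)\<close>. Symmetry turns the second term into the value of
  \<open>u\<close> at \<open>- w\<close>, whence the factor 2.\<close>

lemma measure_pr_insert:
  assumes B: "orthonormal (insert u B)" "u \<notin> B" and P: "convex P" "compact P" "origin_symmetric P"
  shows "measure (lam (insert u B)) (pr (insert u B) ` P) = 2 * (\<integral>w. hf B P w u \<partial>lam B)"
proof -
  let ?I = "\<integral>w. hf B P w u \<partial>lam B"
  let ?P = "pr (insert u B) ` P"
  have onB: "orthonormal B" using B(1) orthonormal_subset by blast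
  have fin: "finite B" using onB by (rule orthonormal_finite)
  have u1: "u \<bullet> u = 1" using B(1) by (auto simp: orthonormal_def norm_eq_1)
  have cS: "compact ?P" using P by (intro compact_continuous_image continuous_intros)
  then have S[measurable]: "?P \<in> sets borel" by (rule borel_compact)
  have prB: "pr B (w + t *\<^sub>R u) = w" "(w + t *\<^sub>R u) \<bullet> u = t" if "w \<in> span B" for w t
  proof -
    have "pr B u = 0" using B orthonormal_inner[OF B(1)] by (intro pr_eq_0) auto
    then show "pr B (w + t *\<^sub>R u) = w" using pr_id[OF onB that] by (simp add: pr_add pr_scaleR)
    have "w \<bullet> u = 0" using span_orthogonal[of B "{u}" w u] B that by (simp add: span_base)
    then show "(w + t *\<^sub>R u) \<bullet> u = t" by (simp add: inner_add_left u1)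
  qed
  have mem: "w + t *\<^sub>R u \<in> ?P \<longleftrightarrow> t \<in> (\<lambda>x. x \<bullet> u) ` fib B P w" if w: "w \<in> span B" for w t
  proof
    assume "w + t *\<^sub>R u \<in> ?P"
    then obtain x where x: "x \<in> P" "w + t *\<^sub>R u = (x \<bullet> u) *\<^sub>R u + pr B x" using pr_insert[OF fin B(2)] by auto
    have "w = pr B x" using arg_cong[OF x(2), of "pr B"] prB(1)[OF w, of t] prB(1)[of "pr B x" "x \<bullet> u"] by (simp add: add.commute)
    moreover have "t = x \<bullet> u" using arg_cong[OF x(2), of "\<lambda>y. y \<bullet> u"] prB(2)[OF w, of t] prB(2)[of "pr B x" "x \<bullet> u"] by (simp add: add.commute)
    ultimately show "t \<in> (\<lambda>x. x \<bullet> u) ` fib B P w" using x(1) by (auto simp: fib_def)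
  next
    assume "t \<in> (\<lambda>x. x \<bullet> u) ` fib B P w"
    then obtain x where "x \<in> P" "pr B x = w" "t = x \<bullet> u" by (auto simp: fib_def)
    then show "w + t *\<^sub>R u \<in> ?P" using pr_insert[OF fin B(2), of x] by (intro image_eqI[of _ _ x]) (auto simp: add.commute)
  qed
  have nn: "0 \<le> hf B P w u + hf B P (- w) u" for w
    using hf_subadd[OF P(2), of B w u "- u"] hf_scale[OF P(2), of 0 B w u] by (simp add: hf_uminus[OF P(2,3)])
  have int1: "integrable (lam B) (\<lambda>w. hf B P w u)" by (rule hf_integrable[OF onB onB P(2)])
  have dm: "integrable (lam B) (\<lambda>w. hf B P (- w) u) \<and> (\<integral>w. hf B P (- w) u \<partial>lam B) = ?I"
  proof -
    have "integrable (distr (lam B) borel uminus) (\<lambda>w. hf B P w u)" using int1 by (simp add: distr_lam_uminus[OF fin])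
    moreover have "(\<integral>w. hf B P w u \<partial>distr (lam B) borel uminus) = ?I" by (simp add: distr_lam_uminus[OF fin])
    ultimately show ?thesis using hf_measurable[OF P(2)] by (simp add: integrable_distr_eq integral_distr)
  qed
  have "emeasure (lam (insert u B)) ?P = (\<integral>\<^sup>+x. indicator ?P x \<partial>lam (insert u B))" by simp
  also have "\<dots> = (\<integral>\<^sup>+w. (\<integral>\<^sup>+t. indicator ?P (w + t *\<^sub>R u) \<partial>lborel) \<partial>lam B)"
    by (rule nn_integral_lam_insert[OF fin B(2)]) measurable
  also have "\<dots> = (\<integral>\<^sup>+w. ennreal (hf B P w u + hf B P (- w) u) \<partial>lam B)"
  proof (rule nn_integral_cong_AE, use AE_lam_span[of B] in eventually_elim)
    case (elim w)
    have "(\<integral>\<^sup>+t. indicator ?P (w + t *\<^sub>R u) \<partial>lborel) = (\<integral>\<^sup>+t. indicator ((\<lambda>x. x \<bullet> u) ` fib B P w) t \<partial>lborel)"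
      by (intro nn_integral_cong) (simp add: indicator_def mem[OF elim])
    also have "\<dots> = ennreal (hf B P w u + hf B P (- w) u)"
    proof (cases "fib B P w = {}")
      case True
      then have "fib B P (- w) = {}" using fib_uminus[OF P(3)] by blast
      then show ?thesis using True by (simp add: hf_def)
    next
      case False
      have "(\<integral>\<^sup>+t. indicator ((\<lambda>x. x \<bullet> u) ` fib B P w) t \<partial>lborel) = emeasure lborel {- hf B P w (- u) .. hf B P w u}"
        unfolding fib_inner_image[OF P(1,2) False] by simp
      then show ?thesis using nn[of w] by (simp add: hf_uminus[OF P(2,3)] emeasure_lborel_Icc_eq)
    qed
    finally show ?case .
  qed
  also have "\<dots> = ennreal (\<integral>w. hf B P w u + hf B P (- w) u \<partial>lam B)"
    using int1 dm nn by (intro nn_integral_eq_integral) auto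
  also have "(\<integral>w. hf B P w u + hf B P (- w) u \<partial>lam B) = 2 * ?I"
    using int1 dm by simp
  finally have e: "emeasure (lam (insert u B)) ?P = ennreal (2 * ?I)" .
  have "0 \<le> (\<integral>w. hf B P w u + hf B P (- w) u \<partial>lam B)" using nn by (intro integral_nonneg_AE) auto
  then have "0 \<le> 2 * ?I" using int1 dm by simp
  then show ?thesis unfolding measure_def e by (rule enn2real_ennreal)
qed

lemma orthonormal_complement:
  fixes A B :: "'a::euclidean_space set"
  assumes AB: "orthonormal (A \<union> B)" "A \<inter> B = {}" and card: "card A + card B = DIM('a)"
  shows "span (A \<union> B) = UNIV" "orthogonal_comp (span B) = span A"
proof -
  have fin: "finite A" "finite B" using orthonormal_finite[OF AB(1)] by auto
  have A: "orthonormal A" and B: "orthonormal B" using AB(1) orthonormal_subset by blast+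
  have "dim (span (A \<union> B)) = DIM('a)" using orthonormal_card[OF AB(1)] card_Un_disjoint[OF fin AB(2)] card by simp
  then show full: "span (A \<union> B) = UNIV" by (metis dim_eq_full span_span)
  show "orthogonal_comp (span B) = span A"
  proof (intro set_eqI iffI)
    fix x assume "x \<in> orthogonal_comp (span B)"
    then have "pr B x = 0" by (intro pr_eq_0) (auto simp: orthogonal_comp_def orthogonal_def inner_commute span_base)
    then have "pr A x = x" using pr_decomp[OF AB full, of x] by simp
    then show "x \<in> span A" by (metis pr_in_span)
  next
    fix x assume "x \<in> span A"
    then show "x \<in> orthogonal_comp (span B)"
      unfolding orthogonal_comp_def orthogonal_def using span_orthogonal[OF AB] by (auto, metis inner_commute)
  qed
qed

text \<open>With \<open>X\<close> and \<open>Y\<close> fixed, an orthonormal pair turns in the plane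
  of \<open>x1\<close> and \<open>x2\<close>, so \<open>insert u1 X\<close> and
  \<open>insert u2 Y\<close> always span complementary subspaces. Homogeneity removes the
  normalisation by \<open>\<rho>\<close>, and the identity holds on the whole plane, where
  differences can be formed.\<close>

lemma projection_body_rotation:
  fixes P Q :: "'a::euclidean_space set"
  assumes PQ: "is_j_projection_body j P Q"
    and P: "convex P" "compact P" "origin_symmetric P" and Q: "convex Q" "compact Q" "origin_symmetric Q"
    and on: "orthonormal (X \<union> {x1, x2} \<union> Y)" and dis: "X \<inter> Y = {}" "x1 \<notin> X" "x2 \<notin> X" "x1 \<notin> Y" "x2 \<notin> Y" "x1 \<noteq> x2"
    and card: "card X + 1 = j" "card Y + 1 = DIM('a) - j" "j \<le> DIM('a)"
  shows "(\<integral>w. hf X P w (\<alpha> *\<^sub>R x1 + \<beta> *\<^sub>R x2) \<partial>lam X) = (\<integral>w. hf Y Q w (\<alpha> *\<^sub>R x2 - \<beta> *\<^sub>R x1) \<partial>lam Y)"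
proof (cases "\<alpha> = 0 \<and> \<beta> = 0")
  case True
  have "hf B K w 0 = 0" if "compact K" for B K and w :: 'a using hf_scale[OF that, of 0 B w 0] by simp
  then show ?thesis using True P Q by simp
next
  case False
  define \<rho> where "\<rho> = sqrt (\<alpha>\<^sup>2 + \<beta>\<^sup>2)"
  have \<rho>: "\<rho> > 0" "\<rho>\<^sup>2 = \<alpha>\<^sup>2 + \<beta>\<^sup>2" using False by (auto simp: \<rho>_def sum_power2_gt_zero_iff)
  define u1 where "u1 = (1/\<rho>) *\<^sub>R (\<alpha> *\<^sub>R x1 + \<beta> *\<^sub>R x2)"
  define u2 where "u2 = (1/\<rho>) *\<^sub>R (\<alpha> *\<^sub>R x2 - \<beta> *\<^sub>R x1)"
  have inn: "v \<bullet> w = (if v = w then 1 else 0)" if "v \<in> X \<union> {x1, x2} \<union> Y" "w \<in> X \<union> {x1, x2} \<union> Y" for v w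
    using orthonormal_inner[OF on that] .
  have x12: "x1 \<bullet> x1 = 1" "x2 \<bullet> x2 = 1" "x1 \<bullet> x2 = 0" "x2 \<bullet> x1 = 0" using inn[of x1 x1] inn[of x2 x2] inn[of x1 x2] inn[of x2 x1] dis by auto
  have nz: "\<alpha> * \<alpha> + \<beta> * \<beta> = \<rho> * \<rho>" using \<rho> by (simp add: power2_eq_square)
  have u: "u1 \<bullet> u1 = 1" "u2 \<bullet> u2 = 1" "u1 \<bullet> u2 = 0"
  proof -
    have r: "\<rho> *\<^sub>R u1 = \<alpha> *\<^sub>R x1 + \<beta> *\<^sub>R x2" "\<rho> *\<^sub>R u2 = \<alpha> *\<^sub>R x2 - \<beta> *\<^sub>R x1" using \<rho> by (auto simp: u1_def u2_def)
    have "\<rho> * \<rho> * (u1 \<bullet> u1) = (\<rho> *\<^sub>R u1) \<bullet> (\<rho> *\<^sub>R u1)" "\<rho> * \<rho> * (u2 \<bullet> u2) = (\<rho> *\<^sub>R u2) \<bullet> (\<rho> *\<^sub>R u2)" "\<rho> * \<rho> * (u1 \<bullet> u2) = (\<rho> *\<^sub>R u1) \<bullet> (\<rho> *\<^sub>R u2)"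
      by simp_all
    then have "\<rho> * \<rho> * (u1 \<bullet> u1) = \<rho> * \<rho>" "\<rho> * \<rho> * (u2 \<bullet> u2) = \<rho> * \<rho>" "\<rho> * \<rho> * (u1 \<bullet> u2) = 0"
      unfolding r using nz by (simp_all add: inner_add_left inner_add_right inner_diff_left inner_diff_right x12)
    then show "u1 \<bullet> u1 = 1" "u2 \<bullet> u2 = 1" "u1 \<bullet> u2 = 0" using \<rho> by auto
  qed
  have uX: "u1 \<bullet> v = 0" "u2 \<bullet> v = 0" if "v \<in> X \<union> Y" for v
    using that inn[of x1 v] inn[of x2 v] dis by (auto simp: u1_def u2_def inner_add_left inner_diff_left)
  have vX: "u1 \<notin> X \<union> Y" "u2 \<notin> X \<union> Y" "u1 \<noteq> u2" using uX u by force+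
  have on2: "orthonormal (insert u1 X \<union> insert u2 Y)"
    unfolding orthonormal_def pairwise_def orthogonal_def
  proof (intro conjI ballI impI)
    fix v w assume vw: "v \<in> insert u1 X \<union> insert u2 Y" "w \<in> insert u1 X \<union> insert u2 Y" "v \<noteq> w"
    show "v \<bullet> w = 0"
    proof (cases "v \<in> X \<union> Y \<and> w \<in> X \<union> Y")
      case True then show ?thesis using inn[of v w] vw by auto
    next
      case False then show ?thesis using vw uX[of v] uX[of w] u by (auto simp: inner_commute)
    qed
  next
    fix v assume "v \<in> insert u1 X \<union> insert u2 Y"
    then show "norm v = 1" using u on by (auto simp: norm_eq_1 orthonormal_def)
  qed
  have fin: "finite X" "finite Y" using orthonormal_finite[OF on] by auto
  have cX: "card (insert u1 X) = j" "card (insert u2 Y) = DIM('a) - j" using vX fin card by auto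
  have disj: "insert u1 X \<inter> insert u2 Y = {}" using vX dis by auto
  have on1: "orthonormal (insert u1 X)" "orthonormal (insert u2 Y)" using on2 orthonormal_subset by blast+
  have comp: "orthogonal_comp (span (insert u2 Y)) = span (insert u1 X)"
    using cX card(3) by (intro orthonormal_complement[OF on2 disj]) simp
  have "span (insert u2 Y) \<in> grassmannian (DIM('a) - j)"
    using orthonormal_card[OF on1(2)] cX by (simp add: grassmannian_def)
  then have eq: "subspace_vol j (span (insert u1 X)) (proj_set P (span (insert u1 X))) = subspace_vol (DIM('a) - j) (span (insert u2 Y)) (proj_set Q (span (insert u2 Y)))"
    using PQ unfolding is_j_projection_body_def comp[symmetric] by blast
  have sv: "subspace_vol (card A) (span A) (proj_set K (span A)) = measure (lam A) (pr A ` K)" if "orthonormal A" "compact K" for A K :: "'a set"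
    unfolding proj_set_eq[OF that(1)] using that
    by (intro subspace_vol_lam) (auto intro!: borel_compact compact_continuous_image continuous_intros)
  have "measure (lam (insert u1 X)) (pr (insert u1 X) ` P) = measure (lam (insert u2 Y)) (pr (insert u2 Y) ` Q)"
    using eq sv[OF on1(1) P(2)] sv[OF on1(2) Q(2)] cX by simp
  then have i: "(\<integral>w. hf X P w u1 \<partial>lam X) = (\<integral>w. hf Y Q w u2 \<partial>lam Y)"
    using measure_pr_insert[OF on1(1) _ P] measure_pr_insert[OF on1(2) _ Q] vX by simp
  have "hf X P w (\<alpha> *\<^sub>R x1 + \<beta> *\<^sub>R x2) = \<rho> * hf X P w u1" for w
    using hf_scale[OF P(2), of \<rho> X w u1] \<rho> by (simp add: u1_def)
  moreover have "hf Y Q w (\<alpha> *\<^sub>R x2 - \<beta> *\<^sub>R x1) = \<rho> * hf Y Q w u2" for w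
    using hf_scale[OF Q(2), of \<rho> Y w u2] \<rho> by (simp add: u2_def)
  ultimately show ?thesis using i by simp
qed

section \<open>Comparing support sets of \<open>P\<close> and \<open>Q\<close>\<close>

definition fmax :: "'a::euclidean_space set \<Rightarrow> 'a set \<Rightarrow> 'a \<Rightarrow> 'a \<Rightarrow> 'a set" where
  "fmax B P w u = {x\<in>fib B P w. \<forall>y\<in>fib B P w. y \<bullet> u \<le> x \<bullet> u}"

text \<open>A lexicographic maximum: \<open>b\<close> is maximized among the points of the section
  that already maximize \<open>u\<close>.\<close>

definition smax :: "'a::euclidean_space set \<Rightarrow> 'a set \<Rightarrow> 'a \<Rightarrow> 'a \<Rightarrow> 'a \<Rightarrow> real" where
  "smax B P w u b = (if fib B P w = {} then 0 else SUP x\<in>fmax B P w u. x \<bullet> b)"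

lemma fmax: assumes "compact P" "fib B P w \<noteq> {}" shows "compact (fmax B P w u)" "fmax B P w u \<noteq> {}"
proof -
  have "fmax B P w u = fib B P w \<inter> (\<Inter>y\<in>fib B P w. {x. y \<bullet> u \<le> x \<bullet> u})" by (auto simp: fmax_def)
  moreover have "closed (\<Inter>y\<in>fib B P w. {x. y \<bullet> u \<le> x \<bullet> u})" by (intro closed_INT ballI closed_Collect_le continuous_intros)
  ultimately show "compact (fmax B P w u)" using compact_fib[OF assms(1)] by (simp add: compact_Int_closed)
  obtain x where "x \<in> fib B P w" "\<And>y. y \<in> fib B P w \<Longrightarrow> y \<bullet> u \<le> x \<bullet> u"
    using compact_attains_max_inner[OF compact_fib[OF assms(1)] assms(2)] by blast
  then show "fmax B P w u \<noteq> {}" by (auto simp: fmax_def)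
qed

lemma convex_fmax: assumes "convex P" shows "convex (fmax B P w u)"
proof -
  have "fmax B P w u = fib B P w \<inter> (\<Inter>y\<in>fib B P w. {x. u \<bullet> x \<ge> y \<bullet> u})" by (auto simp: fmax_def inner_commute)
  then show ?thesis using convex_fib[OF assms] by (auto intro!: convex_Int convex_INT convex_halfspace_ge)
qed

lemma smax_attained:
  assumes "compact P" "fib B P w \<noteq> {}"
  obtains x where "x \<in> fmax B P w u" "smax B P w u b = x \<bullet> b" "\<And>y. y \<in> fmax B P w u \<Longrightarrow> y \<bullet> b \<le> x \<bullet> b"
proof -
  obtain x where x: "x \<in> fmax B P w u" "\<And>y. y \<in> fmax B P w u \<Longrightarrow> y \<bullet> b \<le> x \<bullet> b"
    using compact_attains_max_inner[OF fmax[OF assms]] by blast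
  then have "smax B P w u b = x \<bullet> b" using assms(2) unfolding smax_def by (auto intro!: cSup_eq_maximum)
  with x show ?thesis using that by blast
qed

text \<open>\<open>y\<close> is a maximizer for parameter \<open>s\<close> and \<open>x\<close> for
  \<open>2 * s\<close>; testing each against the other support value traps the difference between
  \<open>x \<bullet> b\<close> and \<open>y \<bullet> b\<close>. These bounds do not grow with
  \<open>s\<close>, so convergence is dominated.\<close>

lemma hf_second_difference:
  assumes P: "compact P" and s: "s \<ge> 0" and ne: "fib B P w \<noteq> {}"
  obtains x y where "x \<in> fib B P w" "y \<in> fib B P w" "hf B P w (b + s *\<^sub>R u) = y \<bullet> (b + s *\<^sub>R u)"
    "x \<bullet> b \<le> 2 * hf B P w (b + s *\<^sub>R u) - hf B P w (b + (2 * s) *\<^sub>R u)"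
    "2 * hf B P w (b + s *\<^sub>R u) - hf B P w (b + (2 * s) *\<^sub>R u) \<le> y \<bullet> b" "smax B P w u b \<le> x \<bullet> b"
proof -
  obtain y where y: "y \<in> fib B P w" "hf B P w (b + s *\<^sub>R u) = y \<bullet> (b + s *\<^sub>R u)" using hf_attained[OF P ne] by metis
  obtain x where x: "x \<in> fib B P w" "hf B P w (b + (2 * s) *\<^sub>R u) = x \<bullet> (b + (2 * s) *\<^sub>R u)" using hf_attained[OF P ne] by metis
  obtain z where z: "z \<in> fmax B P w u" "smax B P w u b = z \<bullet> b" using smax_attained[OF P ne] by metis
  have "x \<bullet> (b + s *\<^sub>R u) \<le> hf B P w (b + s *\<^sub>R u)" by (rule hf_upper[OF P x(1)])
  then have 1: "x \<bullet> b \<le> 2 * hf B P w (b + s *\<^sub>R u) - hf B P w (b + (2 * s) *\<^sub>R u)" using x(2) by (simp add: inner_add_right)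
  have "y \<bullet> (b + (2 * s) *\<^sub>R u) \<le> hf B P w (b + (2 * s) *\<^sub>R u)" by (rule hf_upper[OF P y(1)])
  then have 2: "2 * hf B P w (b + s *\<^sub>R u) - hf B P w (b + (2 * s) *\<^sub>R u) \<le> y \<bullet> b" using y(2) by (simp add: inner_add_right)
  have "z \<bullet> (b + (2 * s) *\<^sub>R u) \<le> x \<bullet> (b + (2 * s) *\<^sub>R u)" using hf_upper[OF P, of z B w "b + (2 * s) *\<^sub>R u"] z(1) x(2) by (auto simp: fmax_def)
  moreover have "x \<bullet> u \<le> z \<bullet> u" using z(1) x(1) by (auto simp: fmax_def)
  then have "(2 * s) * (x \<bullet> u) \<le> (2 * s) * (z \<bullet> u)" using s by (intro mult_left_mono) auto
  ultimately have "z \<bullet> b \<le> x \<bullet> b" by (simp add: inner_add_right)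
  then show ?thesis using that[OF x(1) y(1,2) 1 2] z(2) by simp
qed

text \<open>The limit is a lower bound for every parameter. Points whose \<open>b\<close> value
  exceeds it by \<open>e\<close> have, by compactness, a \<open>u\<close> value below the maximum by
  a fixed amount, so they cannot be maximizers for large parameters.\<close>

lemma smax_lim:
  assumes P: "compact P"
  shows "(\<lambda>i. 2 * hf B P w (b + real i *\<^sub>R u) - hf B P w (b + (2 * real i) *\<^sub>R u)) \<longlonglongrightarrow> smax B P w u b"
proof (cases "fib B P w = {}")
  case True
  then show ?thesis by (simp add: smax_def hf_def)
next
  case False
  let ?f = "\<lambda>i. 2 * hf B P w (b + real i *\<^sub>R u) - hf B P w (b + (2 * real i) *\<^sub>R u)"
  obtain z where z: "z \<in> fmax B P w u" "smax B P w u b = z \<bullet> b" "\<And>y. y \<in> fmax B P w u \<Longrightarrow> y \<bullet> b \<le> z \<bullet> b"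
    using smax_attained[OF P False] by blast
  obtain R where R: "\<And>x. x \<in> P \<Longrightarrow> norm x \<le> R" using compact_imp_bounded[OF P] by (auto simp: bounded_iff)
  have low: "z \<bullet> b \<le> ?f i" for i
    using hf_second_difference[OF P _ False, of "real i" b u] z(2) by (metis of_nat_0_le_iff order_trans)
  show ?thesis unfolding z(2)
  proof (rule tendstoI)
    fix e :: real assume e: "e > 0"
    let ?K = "fib B P w \<inter> {x. z \<bullet> b + e \<le> x \<bullet> b}"
    have K: "compact ?K" using compact_fib[OF P] by (intro compact_Int_closed closed_Collect_le continuous_intros)
    have up: "\<forall>\<^sub>F i in sequentially. ?f i < z \<bullet> b + e"
    proof (cases "?K = {}")
      case True
      have "?f i < z \<bullet> b + e" for i
      proof -
        obtain y where "y \<in> fib B P w" "?f i \<le> y \<bullet> b" using hf_second_difference[OF P _ False, of "real i" b u] by (metis of_nat_0_le_iff)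
        then show ?thesis using True by force
      qed
      then show ?thesis by simp
    next
      case ne: False
      obtain k where k: "k \<in> ?K" "\<And>y. y \<in> ?K \<Longrightarrow> y \<bullet> u \<le> k \<bullet> u" using compact_attains_max_inner[OF K ne] by blast
      have lt: "k \<bullet> u < z \<bullet> u"
      proof (rule ccontr)
        assume "\<not> k \<bullet> u < z \<bullet> u"
        then have "k \<in> fmax B P w u" using z(1) k(1) by (fastforce simp: fmax_def)
        then show False using z(3)[of k] k(1) e by auto
      qed
      obtain N :: nat where N: "2 * R * norm b / (z \<bullet> u - k \<bullet> u) < real N" using reals_Archimedean2 by blast
      have "?f i < z \<bullet> b + e" if i: "i \<ge> N" for i
      proof (rule ccontr)
        assume "\<not> ?f i < z \<bullet> b + e"
        moreover obtain y where y: "y \<in> fib B P w" "hf B P w (b + real i *\<^sub>R u) = y \<bullet> (b + real i *\<^sub>R u)" "?f i \<le> y \<bullet> b"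
          using hf_second_difference[OF P _ False, of "real i" b u] by (metis of_nat_0_le_iff)
        ultimately have "y \<in> ?K" by auto
        then have yu: "y \<bullet> u \<le> k \<bullet> u" by (rule k(2))
        have "z \<bullet> (b + real i *\<^sub>R u) \<le> y \<bullet> (b + real i *\<^sub>R u)"
          using hf_upper[OF P, of z B w "b + real i *\<^sub>R u"] z(1) y(2) by (auto simp: fmax_def)
        then have "real i * (z \<bullet> u - y \<bullet> u) \<le> y \<bullet> b - z \<bullet> b" by (simp add: inner_add_right right_diff_distrib)
        also have "\<dots> = (y - z) \<bullet> b" by (simp add: inner_diff_left)
        also have "\<dots> \<le> norm (y - z) * norm b" by (rule norm_cauchy_schwarz)
        also have "\<dots> \<le> 2 * R * norm b"
        proof (intro mult_right_mono)
          have "norm y \<le> R" "norm z \<le> R" using y(1) z(1) R by (auto simp: fmax_def fib_def)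
          then show "norm (y - z) \<le> 2 * R" using norm_triangle_ineq4[of y z] by linarith
        qed simp
        finally have "real i * (z \<bullet> u - y \<bullet> u) \<le> 2 * R * norm b" .
        moreover have "real N * (z \<bullet> u - k \<bullet> u) \<le> real i * (z \<bullet> u - y \<bullet> u)" using i yu lt by (intro mult_mono) auto
        moreover have "2 * R * norm b < real N * (z \<bullet> u - k \<bullet> u)" using N lt by (simp add: pos_divide_less_eq)
        ultimately show False by linarith
      qed
      then show ?thesis by (auto simp: eventually_sequentially)
    qed
    show "\<forall>\<^sub>F i in sequentially. dist (?f i) (z \<bullet> b) < e"
      using up by eventually_elim (use low in \<open>simp add: dist_real_def\<close>)
  qed
qed

lemma smax_measurable [measurable]:
  fixes P :: "'a::euclidean_space set"
  assumes "compact P" shows "(\<lambda>w. smax B P w u b) \<in> borel_measurable borel"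
proof -
  note [measurable] = hf_measurable[OF assms]
  show ?thesis by (rule borel_measurable_LIMSEQ_real[OF smax_lim[OF assms]]) measurable
qed

lemma hf_second_difference_bound:
  assumes P: "compact P" and R: "\<And>x. x \<in> P \<Longrightarrow> norm x \<le> R" "R \<ge> 0" and s: "s \<ge> 0"
  shows "\<bar>2 * hf B P w (b + s *\<^sub>R u) - hf B P w (b + (2 * s) *\<^sub>R u)\<bar> \<le> R * norm b"
proof (cases "fib B P w = {}")
  case False
  obtain x y where xy: "x \<in> fib B P w" "y \<in> fib B P w"
    "x \<bullet> b \<le> 2 * hf B P w (b + s *\<^sub>R u) - hf B P w (b + (2 * s) *\<^sub>R u)"
    "2 * hf B P w (b + s *\<^sub>R u) - hf B P w (b + (2 * s) *\<^sub>R u) \<le> y \<bullet> b" using hf_second_difference[OF P s False] by metis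
  have "\<bar>z \<bullet> b\<bar> \<le> R * norm b" if "z \<in> fib B P w" for z
    using Cauchy_Schwarz_ineq2[of z b] R(1)[of z] that mult_right_mono[of "norm z" R "norm b"] by (auto simp: fib_def)
  from this[OF xy(1)] this[OF xy(2)] xy(3,4) show ?thesis by linarith
qed (use R in \<open>simp add: hf_def\<close>)

lemma smax_integrable_lim:
  assumes B: "orthonormal B" and P: "compact P"
  shows "integrable (lam B) (\<lambda>w. smax B P w u b)"
    and "(\<lambda>i. 2 * (\<integral>w. hf B P w (b + real i *\<^sub>R u) \<partial>lam B) - (\<integral>w. hf B P w (b + (2 * real i) *\<^sub>R u) \<partial>lam B)) \<longlonglongrightarrow> (\<integral>w. smax B P w u b \<partial>lam B)"
proof -
  obtain R where R: "R > 0" "\<And>x. x \<in> P \<Longrightarrow> norm x \<le> R" using compact_imp_bounded[OF P] by (metis bounded_pos)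
  let ?f = "\<lambda>i w. 2 * hf B P w (b + real i *\<^sub>R u) - hf B P w (b + (2 * real i) *\<^sub>R u)"
  note [measurable] = hf_measurable[OF P] smax_measurable[OF P]
  have zero: "hf B P w v = 0" if "w \<notin> cball 0 R" for w v
  proof -
    have "w \<notin> pr B ` P" using that R(2) norm_pr_le[OF B] by (force intro: order_trans)
    then show ?thesis by (simp add: hf_def fib_empty_iff)
  qed
  have bd: "\<bar>?f i w\<bar> \<le> R * norm b * indicator (cball 0 R) w" for i w
    using hf_second_difference_bound[OF P R(2), of "real i" B w b u] R(1) zero[of w] by (cases "w \<in> cball 0 R") auto
  have iw: "integrable (lam B) (\<lambda>w. R * norm b * indicator (cball 0 R) w)"
    using emeasure_lam_bounded[OF B, of "cball 0 R"] by (intro integrable_mult_right integrable_real_indicator) auto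
  have m: "(\<lambda>w. smax B P w u b) \<in> borel_measurable (lam B)" "\<And>i. ?f i \<in> borel_measurable (lam B)"
    by measurable
  have l: "AE w in lam B. (\<lambda>i. ?f i w) \<longlonglongrightarrow> smax B P w u b" by (intro AE_I2 smax_lim[OF P])
  have b: "AE w in lam B. norm (?f i w) \<le> R * norm b * indicator (cball 0 R) w" for i using bd by (intro AE_I2) simp
  show "integrable (lam B) (\<lambda>w. smax B P w u b)" by (rule integrable_dominated_convergence[OF m iw l b])
  have "(\<lambda>i. \<integral>w. ?f i w \<partial>lam B) \<longlonglongrightarrow> (\<integral>w. smax B P w u b \<partial>lam B)" by (rule integral_dominated_convergence[OF m iw l b])
  then show "(\<lambda>i. 2 * (\<integral>w. hf B P w (b + real i *\<^sub>R u) \<partial>lam B) - (\<integral>w. hf B P w (b + (2 * real i) *\<^sub>R u) \<partial>lam B)) \<longlonglongrightarrow> (\<integral>w. smax B P w u b \<partial>lam B)"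
    using hf_integrable[OF B B P] by simp
qed

text \<open>Projected points over which \<open>u\<close> reaches its maximum along the whole line in
  direction \<open>b\<close>. The projected support set of \<open>u\<close> is contained in it, but
  so are points maximal on that line only.\<close>

definition Mset :: "'a::euclidean_space set \<Rightarrow> 'a set \<Rightarrow> 'a \<Rightarrow> 'a \<Rightarrow> 'a set" where
  "Mset P C u b = {y\<in>span C. \<exists>x\<in>P. pr C x = y \<and> (\<forall>x'\<in>P. \<forall>t. pr C x' = y + t *\<^sub>R b \<longrightarrow> x' \<bullet> u \<le> x \<bullet> u)}"

lemma Mset_span_cong:
  assumes "orthonormal C" "orthonormal C'" "span C = span C'"
  shows "Mset P C u b = Mset P C' u b"
  unfolding Mset_def assms(3) by (simp add: pr_span_eq[OF assms])

lemma Mset_scale: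
  assumes c: "c > 0" "d \<noteq> 0" shows "Mset P C (c *\<^sub>R u) (d *\<^sub>R b) = Mset P C u b"
proof -
  have "(\<forall>t. pr C x' = y + t *\<^sub>R (d *\<^sub>R b) \<longrightarrow> x' \<bullet> (c *\<^sub>R u) \<le> x \<bullet> (c *\<^sub>R u)) \<longleftrightarrow> (\<forall>t. pr C x' = y + t *\<^sub>R b \<longrightarrow> x' \<bullet> u \<le> x \<bullet> u)" for x x' y
  proof -
    have "(\<exists>t. pr C x' = y + t *\<^sub>R (d *\<^sub>R b)) \<longleftrightarrow> (\<exists>t. pr C x' = y + t *\<^sub>R b)"
    proof
      assume "\<exists>t. pr C x' = y + t *\<^sub>R b"
      then obtain t where "pr C x' = y + t *\<^sub>R b" by blast
      then have "pr C x' = y + (t / d) *\<^sub>R (d *\<^sub>R b)" using c by simp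
      then show "\<exists>t. pr C x' = y + t *\<^sub>R (d *\<^sub>R b)" by blast
    qed (metis scaleR_scaleR)
    then show ?thesis using c by auto
  qed
  then show ?thesis unfolding Mset_def by simp
qed

lemma closed_compact_parameter:
  assumes "compact K" "continuous_on UNIV f" "continuous_on UNIV (g :: ('k::euclidean_space \<times> 'b::euclidean_space) \<Rightarrow> real)"
  shows "closed {a. \<exists>k\<in>K. f (k, a) = (0::'c::euclidean_space) \<and> 0 \<le> g (k, a)}"
proof -
  have "closed {z. f z = 0 \<and> 0 \<le> g z}" by (intro closed_Collect_conj closed_Collect_eq closed_Collect_le assms continuous_on_const)
  from closed_compact_projection[OF assms(1) this] show ?thesis by (simp add: Bex_def)
qed

text \<open>Membership says that for rational \<open>c\<close> the fibre reaches height
  \<open>c\<close> whenever the line does. Both conditions are projections of closed sets along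
  compact ones; the bound \<open>N\<close> on the line parameter provides the compactness.\<close>

lemma Mset_graph_borel:
  fixes P :: "'a::euclidean_space set"
  assumes P: "compact P"
  shows "{a. pr C (snd (snd a)) \<in> Mset P C (fst a) (fst (snd a))} \<in> sets (borel :: ('a \<times> 'a \<times> 'a) measure)"
proof -
  let ?G = "{a. pr C (snd (snd a)) \<in> Mset P C (fst a) (fst (snd a))}"
  define D where "D = {a :: 'a \<times> 'a \<times> 'a. pr C (snd (snd a)) \<in> pr C ` P}"
  define A where "A c = {a :: 'a \<times> 'a \<times> 'a. \<exists>p\<in>P. pr C p - pr C (snd (snd a)) = 0 \<and> 0 \<le> p \<bullet> fst a - c}" for c
  define E where "E c N = {a :: 'a \<times> 'a \<times> 'a. \<exists>k\<in>{- real N..real N} \<times> P. pr C (snd k) - (pr C (snd (snd a)) + fst k *\<^sub>R fst (snd a)) = 0 \<and> 0 \<le> snd k \<bullet> fst a - c}" for c and N :: nat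
  have "closed (A c)" for c
  proof -
    have "continuous_on UNIV (\<lambda>z :: 'a \<times> 'a \<times> 'a \<times> 'a. pr C (fst z) - pr C (snd (snd (snd z))))"
      "continuous_on UNIV (\<lambda>z :: 'a \<times> 'a \<times> 'a \<times> 'a. fst z \<bullet> fst (snd z) - c)"
      by (intro continuous_intros)+
    from closed_compact_parameter[OF P this] show ?thesis unfolding A_def by (simp only: fst_conv snd_conv)
  qed
  moreover have "closed (E c N)" for c N
  proof -
    have K: "compact ({- real N..real N} \<times> P)" by (intro compact_Times P) simp
    have "continuous_on UNIV (\<lambda>z :: (real \<times> 'a) \<times> 'a \<times> 'a \<times> 'a. pr C (snd (fst z)) - (pr C (snd (snd (snd z))) + fst (fst z) *\<^sub>R fst (snd (snd z))))"
      "continuous_on UNIV (\<lambda>z :: (real \<times> 'a) \<times> 'a \<times> 'a \<times> 'a. snd (fst z) \<bullet> fst (snd z) - c)"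
      by (intro continuous_intros)+
    from closed_compact_parameter[OF K this] show ?thesis unfolding E_def by (simp only: fst_conv snd_conv)
  qed
  moreover have "closed D"
  proof -
    have eq: "D = (\<lambda>a. pr C (snd (snd a))) -` (pr C ` P)" by (auto simp: D_def)
    have "closed (pr C ` P)" by (rule compact_imp_closed, rule compact_continuous_image[OF _ P]) (intro continuous_intros)
    moreover have "continuous_on UNIV (\<lambda>a :: 'a \<times> 'a \<times> 'a. pr C (snd (snd a)))" by (intro continuous_intros)
    ultimately show ?thesis unfolding eq by (rule closed_vimage)
  qed
  ultimately have [measurable]: "A c \<in> sets borel" "E c N \<in> sets borel" "D \<in> sets borel" for c N by auto
  have "?G = D \<inter> (\<Inter>c\<in>\<rat>. A c \<union> - (\<Union>N. E c N))"
  proof (intro set_eqI iffI)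
    fix a :: "'a \<times> 'a \<times> 'a" obtain y b z where a: "a = (y, b, z)" by (cases a) auto
    {
      assume "a \<in> ?G"
      then obtain x where x: "x \<in> P" "pr C x = pr C z" "\<And>x' t. x' \<in> P \<Longrightarrow> pr C x' = pr C z + t *\<^sub>R b \<Longrightarrow> x' \<bullet> y \<le> x \<bullet> y"
        by (auto simp: a Mset_def)
      have "a \<in> D" using imageI[OF x(1), of "pr C"] x(2) by (simp add: D_def a)
      moreover have "a \<in> A c \<union> - (\<Union>N. E c N)" for c
      proof (cases "c \<le> x \<bullet> y")
        case True then have "a \<in> A c" using x(1,2) by (auto simp: A_def a)
        then show ?thesis by simp
      next
        case False
        have "a \<notin> E c N" for N
        proof
          assume "a \<in> E c N"
          then obtain t p where "p \<in> P" "pr C p - (pr C z + t *\<^sub>R b) = 0" "0 \<le> p \<bullet> y - c" unfolding E_def a by auto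
          then show False using x(3)[of p t] False by simp
        qed
        then show ?thesis by blast
      qed
      ultimately show "a \<in> D \<inter> (\<Inter>c\<in>\<rat>. A c \<union> - (\<Union>N. E c N))" by blast
    }
    {
      assume asm: "a \<in> D \<inter> (\<Inter>c\<in>\<rat>. A c \<union> - (\<Union>N. E c N))"
      then have "fib C P (pr C z) \<noteq> {}" by (auto simp: D_def a fib_def)
      then obtain x where x: "x \<in> fib C P (pr C z)" "\<And>q. q \<in> fib C P (pr C z) \<Longrightarrow> q \<bullet> y \<le> x \<bullet> y" using hf_attained[OF P] by metis
      have "x' \<bullet> y \<le> x \<bullet> y" if x': "x' \<in> P" "pr C x' = pr C z + t *\<^sub>R b" for x' t
      proof (rule ccontr)
        assume "\<not> x' \<bullet> y \<le> x \<bullet> y"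
        then obtain c where c: "c \<in> \<rat>" "x \<bullet> y < c" "c < x' \<bullet> y" using Rats_dense_in_real[of "x \<bullet> y" "x' \<bullet> y"] by auto
        obtain N :: nat where N: "\<bar>t\<bar> \<le> real N" using real_arch_simple by blast
        have "a \<in> E c N" unfolding E_def a mem_Collect_eq by (rule bexI[of _ "(t, x')"]) (use x' c N in \<open>auto simp: abs_le_iff\<close>)
        then have "a \<in> A c" using asm c by blast
        then obtain p where "p \<in> P" "pr C p = pr C z" "c \<le> p \<bullet> y" by (auto simp: A_def a)
        then show False using x(2)[of p] c by (auto simp: fib_def)
      qed
      then show "a \<in> ?G"
        using x(1) by (auto simp: a Mset_def fib_def)
    }
  qed
  also have "\<dots> \<in> sets borel"
    by (intro sets.Int sets.countable_INT'' sets.Un sets.countable_UN) (auto simp: countable_rat intro: sets.compl_sets[of _ borel, simplified])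
  finally show ?thesis .
qed

lemma Mset_borel:
  assumes "compact P" "orthonormal C" shows "Mset P C u b \<in> sets borel"
proof -
  let ?G = "(\<lambda>z. (u, b, z)) -` {a. pr C (snd (snd a)) \<in> Mset P C (fst a) (fst (snd a))}"
  have eq: "Mset P C u b = span C \<inter> ?G"
    using pr_id[OF assms(2)] by (auto simp: Mset_def)
  have "(\<lambda>z. (u, b, z)) \<in> borel_measurable borel" by (intro borel_measurable_continuous_onI continuous_intros)
  from measurable_sets_borel[OF this Mset_graph_borel[OF assms(1)]] have "?G \<in> sets borel" .
  moreover have "span C \<in> sets borel" using closed_subspace[OF subspace_span[of C]] by (rule borel_closed)
  ultimately have "span C \<inter> ?G \<in> sets borel" by (rule sets.Int[rotated])
  then show ?thesis by (simp only: eq[symmetric])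
qed

lemma Mset_slice:
  assumes X: "orthonormal (insert b X)" "b \<notin> X" and w: "w \<in> span X"
  shows "w + t *\<^sub>R b \<in> Mset P (insert b X) u b \<longleftrightarrow> t \<in> (\<lambda>x. x \<bullet> b) ` fmax X P w u"
proof -
  have fin: "finite X" using orthonormal_finite[OF X(1)] by simp
  have X': "orthonormal X" using orthonormal_subset[OF X(1)] by blast
  have b: "b \<bullet> b = 1" using orthonormal_inner[OF X(1), of b b] by simp
  have prb: "pr X b = 0" using X orthonormal_inner[OF X(1), of b] by (intro pr_eq_0) auto
  have wb: "w \<bullet> b = 0" using pr_inner_span[OF X' w, of b] prb by (simp add: inner_commute)
  have iff: "pr (insert b X) x = w + s *\<^sub>R b \<longleftrightarrow> pr X x = w \<and> x \<bullet> b = s" for x s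
  proof
    assume eq: "pr (insert b X) x = w + s *\<^sub>R b"
    have "x \<bullet> b = s" using pr_inner[OF X(1), of b x] eq wb b by (simp add: inner_add_left)
    then show "pr X x = w \<and> x \<bullet> b = s" using eq pr_insert[OF fin X(2), of x] by (simp add: add.commute)
  qed (simp add: pr_insert[OF fin X(2)] add.commute)
  have iff': "pr (insert b X) x = w + t *\<^sub>R b + s *\<^sub>R b \<longleftrightarrow> pr X x = w \<and> x \<bullet> b = t + s" for x s
    using iff[of x "t + s"] by (simp add: scaleR_add_left add.assoc)
  have sp: "w + t *\<^sub>R b \<in> span (insert b X)"
    using subsetD[OF span_mono[of X "insert b X"] w] by (intro span_add[OF _ span_scale[OF span_base]]) auto
  show ?thesis
  proof
    assume "w + t *\<^sub>R b \<in> Mset P (insert b X) u b"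
    then obtain x where x: "x \<in> P" "pr (insert b X) x = w + t *\<^sub>R b"
      "\<And>x' s. x' \<in> P \<Longrightarrow> pr (insert b X) x' = w + t *\<^sub>R b + s *\<^sub>R b \<Longrightarrow> x' \<bullet> u \<le> x \<bullet> u" by (auto simp: Mset_def)
    have "y \<bullet> u \<le> x \<bullet> u" if "y \<in> P" "pr X y = w" for y
      using x(3)[of y "y \<bullet> b - t"] iff'[of y "y \<bullet> b - t"] that by simp
    then have "x \<in> fmax X P w u" using x(1,2) iff by (auto simp: fmax_def fib_def)
    moreover have "t = x \<bullet> b" using x(2) iff by simp
    ultimately show "t \<in> (\<lambda>x. x \<bullet> b) ` fmax X P w u" by blast
  next
    assume "t \<in> (\<lambda>x. x \<bullet> b) ` fmax X P w u"
    then obtain x where x: "x \<in> fmax X P w u" "x \<bullet> b = t" by blast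
    then show "w + t *\<^sub>R b \<in> Mset P (insert b X) u b"
      using sp unfolding Mset_def fmax_def fib_def by (auto simp: iff iff')
  qed
qed

text \<open>Slices in direction \<open>b\<close> are the intervals of \<open>b\<close> values on the
  \<open>u\<close>-faces of sections; their two ends are \<open>smax\<close> at \<open>b\<close> and
  minus \<open>smax\<close> at \<open>- b\<close>.\<close>

lemma emeasure_Mset:
  assumes X: "orthonormal (insert b X)" "b \<notin> X" and P: "convex P" "compact P"
  shows "emeasure (lam (insert b X)) (Mset P (insert b X) u b) = ennreal ((\<integral>w. smax X P w u b \<partial>lam X) + (\<integral>w. smax X P w u (- b) \<partial>lam X))"
proof -
  have fin: "finite X" using orthonormal_finite[OF X(1)] by simp
  have X': "orthonormal X" using orthonormal_subset[OF X(1)] by blast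
  note [measurable] = Mset_borel[OF P(2) X(1), of u b] smax_measurable[OF P(2)]
  have slice: "emeasure lborel ((\<lambda>x. x \<bullet> b) ` fmax X P w u) = ennreal (smax X P w u b + smax X P w u (- b))
    \<and> 0 \<le> smax X P w u b + smax X P w u (- b) \<and> (\<lambda>x. x \<bullet> b) ` fmax X P w u \<in> sets borel" for w
  proof (cases "fib X P w = {}")
    case True then show ?thesis by (simp add: smax_def fmax_def)
  next
    case False
    obtain x where x: "x \<in> fmax X P w u" "smax X P w u b = x \<bullet> b" "\<And>y. y \<in> fmax X P w u \<Longrightarrow> y \<bullet> b \<le> x \<bullet> b"
      using smax_attained[OF P(2) False] by blast
    obtain z where z: "z \<in> fmax X P w u" "smax X P w u (- b) = z \<bullet> (- b)" "\<And>y. y \<in> fmax X P w u \<Longrightarrow> y \<bullet> (- b) \<le> z \<bullet> (- b)"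
      using smax_attained[OF P(2) False] by blast
    have zx: "z \<bullet> b \<le> x \<bullet> b" by (rule x(3)[OF z(1)])
    have conn: "connected ((\<lambda>x. x \<bullet> b) ` fmax X P w u)"
      by (intro connected_continuous_image convex_connected convex_fmax P continuous_intros)
    have "(\<lambda>x. x \<bullet> b) ` fmax X P w u = {z \<bullet> b..x \<bullet> b}"
    proof
      show "{z \<bullet> b..x \<bullet> b} \<subseteq> (\<lambda>x. x \<bullet> b) ` fmax X P w u" using connected_contains_Icc[OF conn] x(1) z(1) by blast
    qed (use x(3) z(3) in auto)
    then show ?thesis using zx x(2) z(2) by simp
  qed
  have "emeasure (lam (insert b X)) (Mset P (insert b X) u b) = (\<integral>\<^sup>+w. (\<integral>\<^sup>+t. indicator (Mset P (insert b X) u b) (w + t *\<^sub>R b) \<partial>lborel) \<partial>lam X)"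
    using nn_integral_lam_insert[OF fin X(2), of "indicator (Mset P (insert b X) u b)"] by simp
  also have "\<dots> = (\<integral>\<^sup>+w. ennreal (smax X P w u b + smax X P w u (- b)) \<partial>lam X)"
  proof (rule nn_integral_cong_AE)
    show "AE w in lam X. (\<integral>\<^sup>+t. indicator (Mset P (insert b X) u b) (w + t *\<^sub>R b) \<partial>lborel) = ennreal (smax X P w u b + smax X P w u (- b))"
      using AE_lam_span[of X]
    proof eventually_elim
      case (elim w)
      have "(\<integral>\<^sup>+t. indicator (Mset P (insert b X) u b) (w + t *\<^sub>R b) \<partial>lborel) = (\<integral>\<^sup>+t. indicator ((\<lambda>x. x \<bullet> b) ` fmax X P w u) t \<partial>lborel)"
        by (intro nn_integral_cong) (simp add: indicator_def Mset_slice[OF X elim])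
      then show ?case using slice[of w] by simp
    qed
  qed
  also have "\<dots> = ennreal (\<integral>w. smax X P w u b + smax X P w u (- b) \<partial>lam X)"
    using slice by (intro nn_integral_eq_integral Bochner_Integration.integrable_add smax_integrable_lim[OF X' P(2)] AE_I2) auto
  also have "\<dots> = ennreal ((\<integral>w. smax X P w u b \<partial>lam X) + (\<integral>w. smax X P w u (- b) \<partial>lam X))"
    using smax_integrable_lim(1)[OF X' P(2)] by simp
  finally show ?thesis .
qed

lemma orthonormal_basis_insert:
  assumes C: "orthonormal C" and b: "b \<in> span C" "norm b = 1"
  obtains X where "orthonormal (insert b X)" "b \<notin> X" "span (insert b X) = span C"
proof -
  define V where "V = {x\<in>span C. x \<bullet> b = 0}"
  have "subspace V" by (auto simp: V_def subspace_def span_add span_scale span_0 inner_add_left)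
  then obtain X where X: "orthonormal X" "span X = V" using orthonormal_basis_of by metis
  have bb: "b \<bullet> b = 1" using b(2) by (simp add: norm_eq_1)
  have xb: "x \<bullet> b = 0" "b \<bullet> x = 0" if "x \<in> X" for x using that X(2) span_base[of x X] by (auto simp: V_def inner_commute)
  have "b \<notin> X" using xb(1)[of b] bb by auto
  moreover have "orthonormal (insert b X)"
    using X(1) b(2) xb by (auto simp: orthonormal_def pairwise_insert orthogonal_def)
  moreover have "span (insert b X) = span C"
  proof
    show "span (insert b X) \<subseteq> span C" using b(1) X(2) span_superset[of X] by (intro span_minimal) (auto simp: V_def)
    show "span C \<subseteq> span (insert b X)"
    proof
      fix x assume "x \<in> span C"
      then have "x - (x \<bullet> b) *\<^sub>R b \<in> V" using b(1) bb by (simp add: V_def span_diff span_scale inner_diff_left)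
      then have "x - (x \<bullet> b) *\<^sub>R b \<in> span (insert b X)" using X(2) span_mono[of X "insert b X"] by auto
      from span_add[OF this span_scale[OF span_base[OF insertI1], of "x \<bullet> b"]]
      show "x \<in> span (insert b X)" by simp
    qed
  qed
  ultimately show ?thesis using that by blast
qed

context
  fixes P Q :: "'a::euclidean_space set" and B C :: "'a set"
  assumes PQ: "is_j_projection_body (card C) P Q"
    and P: "convex P" "compact P" "origin_symmetric P" and Q: "convex Q" "compact Q" "origin_symmetric Q"
    and BC: "orthonormal (B \<union> C)" "B \<inter> C = {}" "span (B \<union> C) = UNIV"
begin

text \<open>Both sides are limits of second differences of \<open>projection_body_rotation\<close>
  in \<open>\<beta>\<close>, taken for \<open>\<alpha> = 1\<close> and
  \<open>\<alpha> = - 1\<close>. The growing vector is \<open>u\<close> for \<open>P\<close> and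
  \<open>- b\<close> for \<open>Q\<close>, while the fixed one is \<open>b\<close> and
  \<open>u\<close> respectively, up to sign.\<close>

lemma emeasure_Mset_transfer:
  assumes u: "u \<in> span B" "u \<noteq> 0" and b: "b \<in> span C" "b \<noteq> 0"
  shows "emeasure (lam C) (Mset P C u b) = emeasure (lam B) (Mset Q B (- b) u)"
proof -
  have B: "orthonormal B" and C: "orthonormal C" using BC orthonormal_subset by blast+
  define b' where "b' = (1 / norm b) *\<^sub>R b"
  define u' where "u' = (1 / norm u) *\<^sub>R u"
  have b': "b' \<in> span C" "norm b' = 1" and u': "u' \<in> span B" "norm u' = 1" using u b by (auto simp: b'_def u'_def span_scale)
  obtain X where X: "orthonormal (insert b' X)" "b' \<notin> X" "span (insert b' X) = span C" using orthonormal_basis_insert[OF C b'] by blast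
  obtain Y where Y: "orthonormal (insert u' Y)" "u' \<notin> Y" "span (insert u' Y) = span B" using orthonormal_basis_insert[OF B u'] by blast
  have orth: "x \<bullet> y = 0" if "x \<in> insert b' X" "y \<in> insert u' Y" for x y
  proof -
    have "x \<in> span C" "y \<in> span B" using that X(3) Y(3) span_base by blast+
    then show ?thesis using span_orthogonal[OF BC(1,2), of y x] by (simp add: inner_commute)
  qed
  note un = orthonormal_Un[OF X(1) Y(1) orth]
  have on: "orthonormal (X \<union> {b', u'} \<union> Y)" using un(1) by (simp add: insert_commute Un_commute)
  have dis: "X \<inter> Y = {}" "b' \<notin> X" "u' \<notin> X" "b' \<notin> Y" "u' \<notin> Y" "b' \<noteq> u'" using un(2) X(2) Y(2) by auto
  have fin: "finite X" "finite Y" using orthonormal_finite[OF X(1)] orthonormal_finite[OF Y(1)] by auto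
  have cX: "card X + 1 = card C"
    using orthonormal_card[OF X(1)] orthonormal_card[OF C] X(2,3) fin by simp
  have "card B + card C = DIM('a)"
    using orthonormal_full[OF BC(1,3)] card_Un_disjoint[OF orthonormal_finite[OF B] orthonormal_finite[OF C] BC(2)] by simp
  then have cY: "card Y + 1 = DIM('a) - card C" "card C \<le> DIM('a)"
    using orthonormal_card[OF Y(1)] orthonormal_card[OF B] Y(2,3) fin by auto
  note rot = projection_body_rotation[OF PQ P Q on dis cX cY]
  have X': "orthonormal X" "orthonormal Y" using orthonormal_subset[OF X(1)] orthonormal_subset[OF Y(1)] by blast+
  have 1: "(\<integral>w. smax X P w u' b' \<partial>lam X) = (\<integral>w. smax Y Q w (- b') u' \<partial>lam Y)"
  proof -
    have "(\<integral>w. hf X P w (b' + s *\<^sub>R u') \<partial>lam X) = (\<integral>w. hf Y Q w (u' + s *\<^sub>R (- b')) \<partial>lam Y)" for s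
      using rot[of 1 s] by simp
    from smax_integrable_lim(2)[OF X'(1) P(2), of b' u', unfolded this] smax_integrable_lim(2)[OF X'(2) Q(2), of u' "- b'"]
    show ?thesis by (rule LIMSEQ_unique)
  qed
  have 2: "(\<integral>w. smax X P w u' (- b') \<partial>lam X) = (\<integral>w. smax Y Q w (- b') (- u') \<partial>lam Y)"
  proof -
    have "(\<integral>w. hf X P w (- b' + s *\<^sub>R u') \<partial>lam X) = (\<integral>w. hf Y Q w (- u' + s *\<^sub>R (- b')) \<partial>lam Y)" for s
      using rot[of "- 1" s] by simp
    from smax_integrable_lim(2)[OF X'(1) P(2), of "- b'" u', unfolded this] smax_integrable_lim(2)[OF X'(2) Q(2), of "- u'" "- b'"]
    show ?thesis by (rule LIMSEQ_unique)
  qed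
  have "emeasure (lam C) (Mset P C u b) = emeasure (lam (insert b' X)) (Mset P (insert b' X) u' b')"
    unfolding lam_span_eq[OF X(1) C X(3)] Mset_span_cong[OF X(1) C X(3)] unfolding b'_def u'_def
    using u(2) b(2) Mset_scale[of "1 / norm u" "1 / norm b" P C u b] by simp
  also have "\<dots> = emeasure (lam (insert u' Y)) (Mset Q (insert u' Y) (- b') u')"
    unfolding emeasure_Mset[OF X(1,2) P(1,2)] emeasure_Mset[OF Y(1,2) Q(1,2)] 1 2 ..
  also have "\<dots> = emeasure (lam B) (Mset Q B (- b) u)"
    unfolding lam_span_eq[OF Y(1) B Y(3)] Mset_span_cong[OF Y(1) B Y(3)] unfolding b'_def u'_def
    using u(2) b(2) Mset_scale[of "1 / norm b" "1 / norm u" Q B "- b" u] by simp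
  finally show ?thesis .
qed

end

section \<open>Almost every direction sees only global maximizers\<close>

lemma lam_hyperplane_null:
  assumes C: "orthonormal C" and l: "l \<in> span C" "l \<noteq> 0"
  shows "emeasure (lam C) {b. b \<bullet> l = 0} = 0"
proof -
  define v where "v = (1 / norm l) *\<^sub>R l"
  have v: "v \<in> span C" "norm v = 1" using l by (auto simp: v_def span_scale)
  obtain X where X: "orthonormal (insert v X)" "v \<notin> X" "span (insert v X) = span C" using orthonormal_basis_insert[OF C v] by blast
  have fin: "finite X" using orthonormal_finite[OF X(1)] by simp
  have eq: "{b. b \<bullet> l = 0} = {b. b \<bullet> v = 0}" using l(2) by (auto simp: v_def)
  have m[measurable]: "{b. b \<bullet> v = 0} \<in> sets borel" by (intro borel_closed closed_Collect_eq continuous_intros)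
  have "emeasure (lam C) {b. b \<bullet> v = 0} = (\<integral>\<^sup>+w. (\<integral>\<^sup>+t. indicator {b. b \<bullet> v = 0} (w + t *\<^sub>R v) \<partial>lborel) \<partial>lam X)"
    unfolding lam_span_eq[OF X(1) C X(3), symmetric]
    using nn_integral_lam_insert[OF fin X(2), of "indicator {b. b \<bullet> v = 0}"] by simp
  also have "\<dots> = (\<integral>\<^sup>+w. (\<integral>\<^sup>+t. indicator {- (w \<bullet> v)} t \<partial>lborel) \<partial>lam X)"
    using v(2) by (intro nn_integral_cong) (auto simp: indicator_def inner_add_left norm_eq_1)
  also have "\<dots> = 0" by simp
  finally show ?thesis unfolding eq .
qed

lemma AE_lam_nonzero:
  assumes B: "orthonormal B" "B \<noteq> {}" shows "AE x in lam B. x \<noteq> 0 \<and> x \<in> span B"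
proof -
  obtain v where v: "v \<in> B" using B(2) by blast
  then have "v \<noteq> 0" using B(1) by (auto simp: orthonormal_def)
  then have "emeasure (lam B) {b. b \<bullet> v = 0} = 0" using lam_hyperplane_null[OF B(1) span_base[OF v]] by simp
  then have "AE x in lam B. x \<notin> {b. b \<bullet> v = 0}"
    by (intro AE_not_in null_setsI) (auto intro!: borel_closed closed_Collect_eq continuous_intros)
  then show ?thesis using AE_lam_span[of B] by eventually_elim auto
qed

text \<open>The exceptional set does not depend on the \<open>B\<close> component, so its Lebesgue
  measure is a product with a nonzero factor.\<close>

lemma AE_lam_from_lborel:
  assumes BC: "orthonormal (B \<union> C)" "B \<inter> C = {}" "span (B \<union> C) = UNIV"
    and R[measurable]: "Measurable.pred borel R" and ae: "AE x in lborel. R (pr C x)"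
  shows "AE x in lam C. R x"
proof -
  have B: "orthonormal B" using BC orthonormal_subset by blast
  have N: "{w. \<not> R w} \<in> sets borel" using R by (simp add: pred_def)
  have m: "{x. \<not> R (pr C x)} \<in> sets borel"
  proof -
    have "Measurable.pred borel (\<lambda>x. \<not> R (pr C x))" by measurable
    then show ?thesis by (simp add: pred_def)
  qed
  have "emeasure (lam B) (cball 0 1) > 0" using emeasure_lam_cball[OF B, of 1] by simp
  moreover have "emeasure (lam B) (cball 0 1) \<le> emeasure (lam B) UNIV" by (intro emeasure_mono) auto
  ultimately have pos: "emeasure (lam B) UNIV \<noteq> 0" by auto
  have "emeasure (lam B) UNIV * emeasure (lam C) {w. \<not> R w} = emeasure lborel {x. \<not> R (pr C x)}"
    using emeasure_lborel_pr_prod[OF BC _ N, of UNIV] by simp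
  also have "\<dots> = 0" using ae m AE_iff_measurable[of "{x. \<not> R (pr C x)}" lborel "\<lambda>x. R (pr C x)"] by simp
  finally have "emeasure (lam C) {w. \<not> R w} = 0" using pos by simp
  then show ?thesis using N by (intro AE_I[of _ _ "{w. \<not> R w}"]) auto
qed

text \<open>A point of \<open>Mset P C y b\<close> which is not a global maximizer carries a supergradient orthogonal to \<open>b\<close>.\<close>

lemma Mset_subgrad:
  assumes C: "orthonormal C" and P: "convex P" "compact P" and y: "y \<noteq> 0" "pr C y = 0" and b: "b \<in> span C"
    and x: "x \<in> interior {x. pr C x \<in> pr C ` P}" and M: "pr C x \<in> Mset P C y b"
    and nmax: "\<not> (\<exists>p\<in>P. pr C p = pr C x \<and> (\<forall>q\<in>P. q \<bullet> y \<le> p \<bullet> y))"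
  obtains z where "z \<in> span C" "z \<noteq> 0" "b \<bullet> z = 0"
    "subgrad (\<lambda>x. - hf C P (pr C x) y) (interior {x. pr C x \<in> pr C ` P}) x z"
proof -
  let ?D = "{x. pr C x \<in> pr C ` P}"
  let ?w = "pr C x"
  obtain p0 where p0: "p0 \<in> P" "pr C p0 = ?w" "\<And>x' t. x' \<in> P \<Longrightarrow> pr C x' = ?w + t *\<^sub>R b \<Longrightarrow> x' \<bullet> y \<le> p0 \<bullet> y"
    using M by (auto simp: Mset_def)
  have H: "hf C P ?w y = p0 \<bullet> y" using p0(3)[of _ 0] p0(1,2) by (intro hf_max) (auto simp: fib_def)
  \<comment> \<open>\<open>S\<close> is the region below \<open>P\<close> in direction
    \<open>y\<close>, \<open>T\<close> the region strictly above \<open>p0\<close> over the line in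
    direction \<open>b\<close>. Maximality of \<open>p0\<close> along this line makes them
    disjoint.\<close>
  define S where "S = {x. \<exists>p\<in>P. pr C p = pr C x \<and> x \<bullet> y \<le> p \<bullet> y}"
  define T where "T = {x. \<exists>t. pr C x = ?w + t *\<^sub>R b \<and> p0 \<bullet> y < x \<bullet> y}"
  have yy: "y \<bullet> y > 0" using y by simp
  have "convex S"
  proof (rule convexI)
    fix a c and u v :: real assume "a \<in> S" "c \<in> S" and uv: "0 \<le> u" "0 \<le> v" "u + v = 1"
    then obtain p q where pq: "p \<in> P" "pr C p = pr C a" "a \<bullet> y \<le> p \<bullet> y" "q \<in> P" "pr C q = pr C c" "c \<bullet> y \<le> q \<bullet> y" by (auto simp: S_def)
    show "u *\<^sub>R a + v *\<^sub>R c \<in> S" unfolding S_def mem_Collect_eq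
    proof (intro bexI conjI)
      show "u *\<^sub>R p + v *\<^sub>R q \<in> P" using P(1) pq uv by (intro convexD) auto
      show "(u *\<^sub>R a + v *\<^sub>R c) \<bullet> y \<le> (u *\<^sub>R p + v *\<^sub>R q) \<bullet> y"
        using pq uv by (auto simp: inner_add_left intro!: add_mono mult_left_mono)
    qed (use pq in \<open>simp add: pr_add pr_scaleR\<close>)
  qed
  moreover have "convex T"
  proof (rule convexI)
    fix a c and u v :: real assume "a \<in> T" "c \<in> T" and uv: "0 \<le> u" "0 \<le> v" "u + v = 1"
    then obtain s t where st: "pr C a = ?w + s *\<^sub>R b" "p0 \<bullet> y < a \<bullet> y" "pr C c = ?w + t *\<^sub>R b" "p0 \<bullet> y < c \<bullet> y" by (auto simp: T_def)
    have "- (u * (a \<bullet> y) + v * (c \<bullet> y)) < - (p0 \<bullet> y)"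
      using convex_bound_lt[of "- (a \<bullet> y)" "- (p0 \<bullet> y)" "- (c \<bullet> y)" u v] st uv by simp
    moreover have "pr C (u *\<^sub>R a + v *\<^sub>R c) = (u + v) *\<^sub>R ?w + (u * s + v * t) *\<^sub>R b" by (simp add: pr_add pr_scaleR st algebra_simps)
    ultimately show "u *\<^sub>R a + v *\<^sub>R c \<in> T" using uv unfolding T_def by (auto simp: inner_add_left)
  qed
  moreover have "S \<noteq> {}" using p0 by (auto simp: S_def)
  moreover have Tin: "p0 + s *\<^sub>R y + t *\<^sub>R pr C b \<in> T" if "s > 0" for s t
  proof -
    have "b \<bullet> y = 0" using pr_inner_span[OF C b, of y] y(2) by (simp add: inner_commute)
    then show ?thesis using that yy y(2) p0(2) pr_id[OF C b]
      by (auto simp: T_def pr_add pr_scaleR inner_add_left intro!: exI[of _ t])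
  qed
  moreover have Tin0: "p0 + s *\<^sub>R y \<in> T" if "s > 0" for s
    using that yy y(2) p0(2) by (auto simp: T_def pr_add pr_scaleR inner_add_left intro!: exI[of _ 0])
  moreover have "S \<inter> T = {}"
  proof -
    have False if vST: "v \<in> S" "v \<in> T" for v
    proof -
      obtain p where p: "p \<in> P" "pr C p = pr C v" "v \<bullet> y \<le> p \<bullet> y" using vST(1) by (auto simp: S_def)
      obtain t where t: "pr C v = ?w + t *\<^sub>R b" "p0 \<bullet> y < v \<bullet> y" using vST(2) by (auto simp: T_def)
      show False using p0(3)[of p t] p t by simp
    qed
    then show ?thesis by blast
  qed
  ultimately obtain a c where a: "a \<noteq> 0" "\<And>v. v \<in> S \<Longrightarrow> a \<bullet> v \<le> c" "\<And>v. v \<in> T \<Longrightarrow> c \<le> a \<bullet> v"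
    using separating_hyperplane_sets[of S T] zero_less_one by (metis empty_iff)
  have lin0: "r = 0" if "\<And>t. q + t * r \<le> c" for q r :: real
  proof (rule ccontr)
    assume "r \<noteq> 0"
    then show False using that[of "(c - q + 1) / r"] by simp
  qed
  define al where "al = (a \<bullet> y) / (y \<bullet> y)"
  \<comment> \<open>The component of \<open>a\<close> orthogonal to both \<open>y\<close> and
    \<open>span C\<close>. \<open>S\<close> is invariant in such directions, so boundedness of
    \<open>a\<close> on \<open>S\<close> forces it to vanish.\<close>
  define e where "e = a - pr C a - al *\<^sub>R y"
  have ye: "e \<bullet> y = 0" and pe: "pr C e = 0"
  proof -
    have "pr C a \<bullet> y = 0" using pr_inner_span[OF C, of "pr C a" y] y(2) by (simp add: inner_commute)
    then show "e \<bullet> y = 0" using yy by (simp add: e_def al_def inner_diff_left)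
    show "pr C e = 0" using y(2) by (simp add: e_def pr_diff pr_scaleR pr_id[OF C])
  qed
  have "a \<bullet> e = 0"
  proof (rule lin0[of "a \<bullet> p0"])
    fix t
    have "p0 + t *\<^sub>R e \<in> S" using p0(1) ye pe by (auto simp: S_def pr_add pr_scaleR inner_add_left intro!: bexI[of _ p0])
    from a(2)[OF this] show "a \<bullet> p0 + t * (a \<bullet> e) \<le> c" by (simp add: inner_add_right)
  qed
  moreover have "pr C a \<bullet> e = 0" using pr_inner_span[OF C, of "pr C a" e] pe by (simp add: inner_commute)
  moreover have "e \<bullet> e = a \<bullet> e - pr C a \<bullet> e - al * (e \<bullet> y)"
    using arg_cong[OF e_def, of "\<lambda>v. v \<bullet> e"] by (simp add: inner_diff_left inner_commute[of e y])
  ultimately have "e = 0" using ye by simp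
  then have dec: "a = pr C a + al *\<^sub>R y" by (simp add: e_def algebra_simps)
  define l where "l = pr C a"
  have l: "l \<in> span C" by (simp add: l_def)
  have lv: "l \<bullet> v = l \<bullet> pr C v" for v using pr_inner_span[OF C l, of v] by (simp add: inner_commute)
  have av: "a \<bullet> v = l \<bullet> pr C v + al * (v \<bullet> y)" for v
    using arg_cong[OF dec, of "\<lambda>a. a \<bullet> v"] lv[of v] by (simp add: l_def inner_add_left inner_commute[of y v])
  have SP: "l \<bullet> pr C p + al * (p \<bullet> y) \<le> c" if "p \<in> P" for p using a(2)[of p] that av[of p] by (auto simp: S_def)
  have al0: "al \<ge> 0"
  proof (rule ccontr)
    assume n: "\<not> al \<ge> 0"
    define t where "t = (c - a \<bullet> p0 + 1) / (- al * (y \<bullet> y))"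
    have cp: "c - a \<bullet> p0 \<ge> 0" using SP[OF p0(1)] av[of p0] by simp
    have "- al * (y \<bullet> y) > 0" using n yy by (intro mult_pos_pos) auto
    then have t0: "t \<ge> 0" unfolding t_def using cp by (intro divide_nonneg_pos) auto
    have "p0 - t *\<^sub>R y \<in> S" using p0(1) y(2) t0 yy by (auto simp: S_def pr_diff pr_scaleR inner_diff_left intro!: bexI[of _ p0])
    from a(2)[OF this] have "a \<bullet> p0 - t * (al * (y \<bullet> y)) \<le> c" using av[of y] y(2) by (simp add: inner_diff_right)
    moreover have "t * (al * (y \<bullet> y)) = - (c - a \<bullet> p0 + 1)" using n yy by (simp add: t_def field_simps)
    ultimately show False by linarith
  qed
  have T0: "c \<le> l \<bullet> ?w + al * (p0 \<bullet> y)"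
  proof (rule field_le_epsilon)
    fix d :: real assume d: "d > 0"
    have s: "d / ((al + 1) * (y \<bullet> y)) > 0" using al0 d yy by (intro divide_pos_pos mult_pos_pos) auto
    have "c \<le> a \<bullet> (p0 + (d / ((al + 1) * (y \<bullet> y))) *\<^sub>R y)" by (rule a(3)[OF Tin0[OF s]])
    also have "\<dots> = l \<bullet> ?w + al * (p0 \<bullet> y) + d * (al / (al + 1))" unfolding av using y(2) p0(2) yy by (simp add: pr_add pr_scaleR inner_add_left distrib_left)
    also have "d * (al / (al + 1)) \<le> d * 1" using al0 d by (intro mult_left_mono) auto
    finally show "c \<le> l \<bullet> ?w + al * (p0 \<bullet> y) + d" by simp
  qed
  \<comment> \<open>Otherwise \<open>l\<close> alone would support the projection of
    \<open>P\<close> at \<open>pr C x\<close>, which is impossible at an interior point.\<close>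
  have alp: "al > 0"
  proof (rule ccontr)
    assume "\<not> al > 0"
    then have al: "al = 0" using al0 by simp
    then have l0: "l \<noteq> 0" using a(1) dec by (auto simp: l_def)
    obtain d where d: "d > 0" "ball x d \<subseteq> ?D" using x by (auto simp: mem_interior)
    have "x + (d / (2 * norm l)) *\<^sub>R l \<in> ball x d" using d l0 by (simp add: dist_norm)
    then obtain p where p: "p \<in> P" "pr C p = ?w + (d / (2 * norm l)) *\<^sub>R l" using d(2) pr_id[OF C l] by (force simp: pr_add pr_scaleR)
    have "l \<bullet> ?w + (d / (2 * norm l)) * (l \<bullet> l) \<le> c" using SP[OF p(1)] p(2) al by (simp add: inner_add_right)
    moreover have "(d / (2 * norm l)) * (l \<bullet> l) > 0" using d l0 by (intro mult_pos_pos) auto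
    ultimately show False using T0 al by simp
  qed
  \<comment> \<open>\<open>T\<close> contains full lines in direction \<open>b\<close>, and
    \<open>a\<close> is bounded below on it.\<close>
  have lb: "b \<bullet> l = 0"
  proof -
    have "- (l \<bullet> b) = 0"
    proof (rule lin0[of "c + c - (l \<bullet> ?w + al * (p0 \<bullet> y) + al * (y \<bullet> y))"])
      fix t
      have "c \<le> a \<bullet> (p0 + 1 *\<^sub>R y + t *\<^sub>R pr C b)" by (rule a(3)[OF Tin]) simp
      moreover have "pr C b \<bullet> y = 0" using pr_inner_span[OF C, of "pr C b" y] y(2) by (simp add: inner_commute)
      ultimately show "c + c - (l \<bullet> ?w + al * (p0 \<bullet> y) + al * (y \<bullet> y)) + t * - (l \<bullet> b) \<le> c"
        unfolding av using y(2) p0(2) pr_id[OF C b] by (simp add: pr_add pr_scaleR inner_add_left inner_add_right algebra_simps)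
    qed
    then show ?thesis by (simp add: inner_commute)
  qed
  show ?thesis
  proof (rule that[of "(1 / al) *\<^sub>R l"])
    show "(1 / al) *\<^sub>R l \<in> span C" using l by (rule span_scale)
    show "b \<bullet> (1 / al) *\<^sub>R l = 0" using lb by simp
    have key: "hf C P (pr C v) y \<le> p0 \<bullet> y - ((1 / al) *\<^sub>R l) \<bullet> (pr C v - ?w)" if "pr C v \<in> pr C ` P" for v
    proof -
      have "fib C P (pr C v) \<noteq> {}" using that by (simp add: fib_empty_iff)
      then obtain p where "p \<in> fib C P (pr C v)" and ph: "hf C P (pr C v) y = p \<bullet> y" using hf_attained[OF P(2)] by metis
      then have p: "p \<in> P" "pr C p = pr C v" by (auto simp: fib_def)
      have "l \<bullet> pr C v + al * (p \<bullet> y) \<le> l \<bullet> ?w + al * (p0 \<bullet> y)" using SP[OF p(1)] T0 p(2) by simp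
      then show ?thesis using ph alp by (simp add: inner_diff_right field_simps)
    qed
    show "subgrad (\<lambda>x. - hf C P (pr C x) y) (interior ?D) x ((1 / al) *\<^sub>R l)"
      unfolding subgrad_def
    proof (intro ballI)
      fix v assume "v \<in> interior ?D"
      then have "v \<in> ?D" using interior_subset by blast
      then have "pr C v \<in> pr C ` P" by simp
      from key[OF this] have "hf C P (pr C v) y \<le> p0 \<bullet> y - (1 / al) * (l \<bullet> (v - x))" using lv[of "v - x"] by (simp add: pr_diff)
      then show "- hf C P ?w y + ((1 / al) *\<^sub>R l) \<bullet> (v - x) \<le> - hf C P (pr C v) y" unfolding H by simp
    qed
    \<comment> \<open>A zero supergradient would make \<open>p0\<close> a global maximizer.\<close>
    show "(1 / al) *\<^sub>R l \<noteq> 0"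
    proof
      assume z: "(1 / al) *\<^sub>R l = 0"
      have "q \<bullet> y \<le> p0 \<bullet> y" if q: "q \<in> P" for q
      proof -
        have "q \<bullet> y \<le> hf C P (pr C q) y" by (rule hf_upper[OF P(2)]) (simp add: fib_def q)
        also have "\<dots> \<le> p0 \<bullet> y" using key[of q] q z by simp
        finally show ?thesis .
      qed
      then show False using nmax p0 by blast
    qed
  qed
qed

text \<open>\<open>Mset\<close> with both directions as variables, the form in which integrals over
  directions and points can be exchanged.\<close>

definition Mgraph :: "'a::euclidean_space set \<Rightarrow> 'a set \<Rightarrow> ('a \<times> 'a \<times> 'a) set" where
  "Mgraph P C = {a. pr C (snd (snd a)) \<in> Mset P C (fst a) (fst (snd a))}"

definition Sgraph :: "'a::euclidean_space set \<Rightarrow> 'a set \<Rightarrow> ('a \<times> 'a) set" where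
  "Sgraph P C = {a. \<exists>p\<in>P. pr C p = pr C (snd a) \<and> (\<forall>q\<in>P. q \<bullet> fst a \<le> p \<bullet> fst a)}"

lemma Mgraph_sets: "compact P \<Longrightarrow> Mgraph P C \<in> sets (borel \<Otimes>\<^sub>M (borel \<Otimes>\<^sub>M borel))"
  unfolding Mgraph_def borel_prod by (rule Mset_graph_borel)

lemma Sgraph_sets:
  fixes P :: "'a::euclidean_space set"
  assumes P: "compact P" shows "Sgraph P C \<in> sets (borel \<Otimes>\<^sub>M borel)"
proof -
  have "closed {z :: 'a \<times> 'a \<times> 'a. pr C (fst z) - pr C (snd (snd z)) = 0 \<and> (\<forall>q\<in>P. q \<bullet> fst (snd z) \<le> fst z \<bullet> fst (snd z))}"
    unfolding Ball_def by (intro closed_Collect_conj closed_Collect_all closed_Collect_imp open_Collect_const closed_Collect_eq closed_Collect_le continuous_intros)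
  from closed_compact_projection[OF P this] have "closed (Sgraph P C)" by (simp add: Sgraph_def Bex_def)
  then show ?thesis unfolding borel_prod by (rule borel_closed)
qed

text \<open>Over a global maximizer every \<open>b\<close> is admissible. At other points of the
  projection each admissible \<open>b\<close> is orthogonal to a nonzero supergradient; almost
  everywhere there is only one, so these \<open>b\<close> lie in one hyperplane and have measure
  0.\<close>

lemma AE_Mset_directions:
  fixes P :: "'a::euclidean_space set"
  assumes BC: "orthonormal (B \<union> C)" "B \<inter> C = {}" "span (B \<union> C) = UNIV" and P: "convex P" "compact P"
    and y: "y \<in> span B" "y \<noteq> 0" and C0: "C \<noteq> {}"
  shows "AE w in lam C. (\<integral>\<^sup>+b. indicator (cball 0 1) b * indicator (Mgraph P C) (y, b, w) \<partial>lam C) = emeasure (lam C) (cball 0 1) * indicator (Sgraph P C) (y, w)"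
proof -
  have C: "orthonormal C" using BC orthonormal_subset by blast
  interpret C: sigma_finite_measure "lam C" by (rule sigma_finite_lam[OF C])
  note [measurable] = Mgraph_sets[OF P(2)] Sgraph_sets[OF P(2)]
  have [measurable]: "cball (0::'a) 1 \<in> sets borel" by simp
  have py: "pr C y = 0" by (rule pr_pr_orth[OF BC(1,2) y(1)])
  let ?F = "\<lambda>w. \<integral>\<^sup>+b. indicator (cball 0 1) b * indicator (Mgraph P C) (y, b, w) \<partial>lam C" and ?G = "\<lambda>w. emeasure (lam C) (cball 0 1) * indicator (Sgraph P C) (y, w)"
  let ?D = "{x. pr C x \<in> pr C ` P}"
  let ?U = "interior ?D"
  let ?h = "\<lambda>x. - hf C P (pr C x) y"
  have "convex ?D"
  proof -
    have "convex (pr C ` P)" by (rule convex_linear_image[OF linear_pr P(1)])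
    from convex_linear_vimage[OF linear_pr this] show ?thesis by (simp add: vimage_def)
  qed
  then have cU: "convex ?U" and fr: "AE x in lborel. x \<notin> frontier ?D" by (auto intro: convex_interior AE_not_frontier)
  have clD: "closed ?D"
  proof -
    have "closed (pr C ` P)" by (rule compact_imp_closed, rule compact_continuous_image[OF _ P(2)]) (intro continuous_intros)
    from closed_vimage[OF this, of "pr C"] show ?thesis by (simp add: vimage_def continuous_intros)
  qed
  have "convex_on ?U ?h"
  proof (rule convex_onI[OF _ cU])
    fix t :: real and x z assume t: "0 < t" "t < 1" and xz: "x \<in> ?U" "z \<in> ?U"
    have "fib C P (pr C x) \<noteq> {}" "fib C P (pr C z) \<noteq> {}" using xz interior_subset[of ?D] by (auto simp: fib_empty_iff)
    then obtain p q where pq: "p \<in> fib C P (pr C x)" "hf C P (pr C x) y = p \<bullet> y" "q \<in> fib C P (pr C z)" "hf C P (pr C z) y = q \<bullet> y"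
      using hf_attained[OF P(2)] by metis
    have "(1 - t) *\<^sub>R p + t *\<^sub>R q \<in> fib C P (pr C ((1 - t) *\<^sub>R x + t *\<^sub>R z))"
      using pq(1,3) convexD_alt[OF P(1), of p q t] t by (auto simp: fib_def pr_add pr_scaleR)
    from hf_upper[OF P(2) this, of y] show "?h ((1 - t) *\<^sub>R x + t *\<^sub>R z) \<le> (1 - t) * ?h x + t * ?h z"
      using pq(2,4) by (simp add: inner_add_left)
  qed
  then have "continuous_on ?U ?h" by (intro convex_on_continuous) auto
  from AE_unique_subgrad[OF open_interior this] fr
  have "AE x in lborel. ?F (pr C x) = ?G (pr C x)"
  proof eventually_elim
    case (elim x)
    have idC: "pr C (pr C x) = pr C x" by (simp add: pr_id[OF C])
    consider "x \<notin> ?D" | "x \<in> ?U" "(y, pr C x) \<in> Sgraph P C" | "x \<in> ?U" "(y, pr C x) \<notin> Sgraph P C"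
      using elim(2) clD by (auto simp: frontier_def)
    then show ?case
    proof cases
      case 1
      then have "(y, b, pr C x) \<notin> Mgraph P C" "(y, pr C x) \<notin> Sgraph P C" for b
        by (auto simp: Mgraph_def Sgraph_def Mset_def idC image_iff)
      then show ?thesis by simp
    next
      case 2
      then have "(y, b, pr C x) \<in> Mgraph P C" for b
        by (fastforce simp: Mgraph_def Sgraph_def Mset_def idC)
      then show ?thesis using 2 by simp
    next
      case 3
      have nmax: "\<not> (\<exists>p\<in>P. pr C p = pr C x \<and> (\<forall>q\<in>P. q \<bullet> y \<le> p \<bullet> y))" using 3(2) by (simp add: Sgraph_def idC)
      have sg: "\<exists>z. z \<in> span C \<and> z \<noteq> 0 \<and> b \<bullet> z = 0 \<and> subgrad ?h ?U x z" if b: "b \<in> span C" "(y, b, pr C x) \<in> Mgraph P C" for b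
      proof -
        have "pr C x \<in> Mset P C y b" using b(2) by (simp add: Mgraph_def idC)
        from Mset_subgrad[OF C P y(2) py b(1) 3(1) this nmax] show ?thesis by metis
      qed
      have "\<exists>l. l \<in> span C \<and> l \<noteq> 0 \<and> (\<forall>b\<in>span C. (y, b, pr C x) \<in> Mgraph P C \<longrightarrow> b \<bullet> l = 0)"
      proof (cases "\<exists>b\<in>span C. (y, b, pr C x) \<in> Mgraph P C")
        case True
        then obtain b where "b \<in> span C" "(y, b, pr C x) \<in> Mgraph P C" by blast
        from sg[OF this] obtain l where l: "l \<in> span C" "l \<noteq> 0" "subgrad ?h ?U x l" by blast
        have "b' \<bullet> l = 0" if "b' \<in> span C" "(y, b', pr C x) \<in> Mgraph P C" for b'
          using sg[OF that] elim(1) 3(1) l(3) by blast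
        then show ?thesis using l by blast
      next
        case False
        obtain v where v: "v \<in> C" using C0 by blast
        then have "v \<noteq> 0" using C by (auto simp: orthonormal_def)
        then show ?thesis using False span_base[OF v] by blast
      qed
      then obtain l where l: "l \<in> span C" "l \<noteq> 0" "\<forall>b\<in>span C. (y, b, pr C x) \<in> Mgraph P C \<longrightarrow> b \<bullet> l = 0" by blast
      have "AE b in lam C. b \<notin> {b. b \<bullet> l = 0}" using lam_hyperplane_null[OF C l(1,2)]
        by (intro AE_not_in null_setsI) (auto intro!: borel_closed closed_Collect_eq continuous_intros)
      then have "AE b in lam C. indicator (cball 0 1) b * indicator (Mgraph P C) (y, b, pr C x) = (0::ennreal)"
        using AE_lam_span[of C] by eventually_elim (use l(3) in \<open>auto simp: indicator_def\<close>)
      from nn_integral_cong_AE[OF this] show ?thesis using 3(2) by simp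
    qed
  qed
  moreover have "?F \<in> borel_measurable borel"
    "?G \<in> borel_measurable borel" by measurable
  from borel_measurable_eq[OF this] have "Measurable.pred borel (\<lambda>w. ?F w = ?G w)"
    by (simp add: pred_def)
  ultimately show ?thesis by (intro AE_lam_from_lborel[OF BC])
qed

text \<open>Once the integrals over \<open>b\<close> and \<open>w\<close> are exchanged, the
  integral over \<open>b\<close> is either the volume of the unit ball or 0.\<close>

lemma Mgraph_average:
  fixes P :: "'a::euclidean_space set"
  assumes BC: "orthonormal (B \<union> C)" "B \<inter> C = {}" "span (B \<union> C) = UNIV" and P: "convex P" "compact P"
    and B0: "B \<noteq> {}" and C0: "C \<noteq> {}"
  shows "(\<integral>\<^sup>+y. (\<integral>\<^sup>+b. indicator (cball 0 1) y * (indicator (cball 0 1) b * (\<integral>\<^sup>+w. indicator (Mgraph P C) (y, b, w) \<partial>lam C)) \<partial>lam C) \<partial>lam B)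
    = emeasure (lam C) (cball 0 1) * emeasure lborel (suppset P B C)"
proof -
  have C: "orthonormal C" and B: "orthonormal B" using BC orthonormal_subset by blast+
  interpret C: sigma_finite_measure "lam C" by (rule sigma_finite_lam[OF C])
  interpret CC: pair_sigma_finite "lam C" "lam C" by standard
  note [measurable] = Mgraph_sets[OF P(2)] Sgraph_sets[OF P(2)]
  have [measurable]: "cball (0::'a) 1 \<in> sets borel" by simp
  have [measurable]: "suppset P B C \<in> sets borel" by (intro borel_compact compact_suppset[OF BC P(2)])
  let ?L = "\<lambda>y. \<integral>\<^sup>+b. indicator (cball 0 1) y * (indicator (cball 0 1) b * (\<integral>\<^sup>+w. indicator (Mgraph P C) (y, b, w) \<partial>lam C)) \<partial>lam C"
  let ?S = "\<lambda>y. \<integral>\<^sup>+w. indicator (suppset P B C) (y + w) \<partial>lam C"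
  let ?k = "emeasure (lam C) (cball 0 1)"
  have "?L y
    = ?k * ?S y" if y: "y \<noteq> 0 \<and> y \<in> span B" for y
  proof -
    have "?L y
      = indicator (cball 0 1) y * (\<integral>\<^sup>+b. (\<integral>\<^sup>+w. indicator (cball 0 1) b * indicator (Mgraph P C) (y, b, w) \<partial>lam C) \<partial>lam C)"
      by (subst nn_integral_cmult) (measurable, simp add: nn_integral_cmult)
    also have "(\<integral>\<^sup>+b. (\<integral>\<^sup>+w. indicator (cball 0 1) b * indicator (Mgraph P C) (y, b, w) \<partial>lam C) \<partial>lam C)
      = (\<integral>\<^sup>+w. (\<integral>\<^sup>+b. indicator (cball 0 1) b * indicator (Mgraph P C) (y, b, w) \<partial>lam C) \<partial>lam C)"
      by (rule CC.Fubini') measurable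
    also have "\<dots> = (\<integral>\<^sup>+w. ?k * indicator (Sgraph P C) (y, w) \<partial>lam C)"
      using AE_Mset_directions[OF BC P _ _ C0] y by (intro nn_integral_cong_AE) blast
    also have "\<dots> = ?k * (\<integral>\<^sup>+w. indicator (Sgraph P C) (y, w) \<partial>lam C)"
      by (rule nn_integral_cmult) measurable
    also have "indicator (cball 0 1) y * \<dots> = ?k * (\<integral>\<^sup>+w. indicator (cball 0 1) y * indicator (Sgraph P C) (y, w) \<partial>lam C)"
      by (simp add: nn_integral_cmult mult_ac)
    also have "(\<integral>\<^sup>+w. indicator (cball 0 1) y * indicator (Sgraph P C) (y, w) \<partial>lam C) = ?S y"
    proof (rule nn_integral_cong_AE)
      show "AE w in lam C. indicator (cball 0 1) y * indicator (Sgraph P C) (y, w) = (indicator (suppset P B C) (y + w) :: ennreal)"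
        using AE_lam_span[of C]
      proof eventually_elim
        case (elim w)
        have "pr B (y + w) = y" "pr C (y + w) = w" using pr_split[OF BC(1,2)] y elim by auto
        then show ?case using pr_id[OF C elim] by (auto simp: indicator_def Sgraph_def suppset_def)
      qed
    qed
    finally show ?thesis .
  qed
  then have "(\<integral>\<^sup>+y. ?L y \<partial>lam B)
    = (\<integral>\<^sup>+y. ?k * ?S y \<partial>lam B)"
    using AE_lam_nonzero[OF B B0] by (intro nn_integral_cong_AE) (auto elim: eventually_mono)
  also have "\<dots> = ?k * (\<integral>\<^sup>+y. ?S y \<partial>lam B)"
    by (rule nn_integral_cmult) measurable
  also have "\<dots> = ?k * (\<integral>\<^sup>+x. indicator (suppset P B C) x \<partial>lborel)"
    using nn_integral_lborel_split[OF BC, of "indicator (suppset P B C)"] by simp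
  finally show ?thesis by simp
qed

text \<open>Both averages run over the same pair of unit balls, and
  \<open>emeasure_Mset_transfer\<close> matches the integrands once \<open>b\<close> is replaced by
  \<open>- b\<close>. On each side one ball is absorbed into \<open>suppset\<close> and the other
  remains as a factor.\<close>

theorem suppset_projection_body:
  fixes P Q :: "'a::euclidean_space set" and B C :: "'a set"
  assumes PQ: "is_j_projection_body (card C) P Q"
    and P: "convex P" "compact P" "origin_symmetric P" and Q: "convex Q" "compact Q" "origin_symmetric Q"
    and BC: "orthonormal (B \<union> C)" "B \<inter> C = {}" "span (B \<union> C) = UNIV" and B0: "B \<noteq> {}" and C0: "C \<noteq> {}"
  shows "unit_ball_vol (real (card C)) * measure lborel (suppset P B C) = unit_ball_vol (real (card B)) * measure lborel (suppset Q C B)"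
proof -
  have C: "orthonormal C" and B: "orthonormal B" using BC orthonormal_subset by blast+
  have CB: "orthonormal (C \<union> B)" "C \<inter> B = {}" "span (C \<union> B) = UNIV" using BC by (simp_all add: Un_commute Int_commute)
  interpret C: sigma_finite_measure "lam C" by (rule sigma_finite_lam[OF C])
  interpret B: sigma_finite_measure "lam B" by (rule sigma_finite_lam[OF B])
  interpret BC: pair_sigma_finite "lam C" "lam B" by standard
  note [measurable] = Mgraph_sets[OF P(2)] Mgraph_sets[OF Q(2)]
  have [measurable]: "cball (0::'a) 1 \<in> sets borel" by simp
  have MI: "(\<integral>\<^sup>+w. indicator (Mgraph K A) (y, b, w) \<partial>lam A) = emeasure (lam A) (Mset K A y b)" if A: "orthonormal A" and K: "compact K" for K A :: "'a set" and y b
  proof -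
    have "(\<integral>\<^sup>+w. indicator (Mgraph K A) (y, b, w) \<partial>lam A) = (\<integral>\<^sup>+w. indicator (Mset K A y b) w \<partial>lam A)"
      using AE_lam_span[of A] pr_id[OF A] by (intro nn_integral_cong_AE) (auto simp: Mgraph_def indicator_def elim!: eventually_mono)
    then show ?thesis using Mset_borel[OF K A] by simp
  qed
  let ?h = "\<lambda>y b. indicator (cball 0 1) y * (indicator (cball 0 1) b * (\<integral>\<^sup>+w. indicator (Mgraph P C) (y, b, w) \<partial>lam C))"
  let ?f = "\<lambda>b y. indicator (cball 0 1) b * (indicator (cball 0 1) y * (\<integral>\<^sup>+w. indicator (Mgraph Q B) (b, y, w) \<partial>lam B)) :: ennreal"
  have f[measurable]: "(\<lambda>x. \<integral>\<^sup>+y. ?f x y \<partial>lam B) \<in> borel_measurable borel" by measurable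
  have "emeasure (lam C) (cball 0 1) * emeasure lborel (suppset P B C)
    = (\<integral>\<^sup>+y. (\<integral>\<^sup>+b. ?h y b \<partial>lam C) \<partial>lam B)"
    by (rule Mgraph_average[OF BC P(1,2) B0 C0, symmetric])
  also have "\<dots> = (\<integral>\<^sup>+y. (\<integral>\<^sup>+b. ?f (- b) y \<partial>lam C) \<partial>lam B)"
  proof (rule nn_integral_cong_AE)
    show "AE y in lam B. (\<integral>\<^sup>+b. ?h y b \<partial>lam C) = (\<integral>\<^sup>+b. ?f (- b) y \<partial>lam C)"
      using AE_lam_nonzero[OF B B0]
    proof eventually_elim
      case y: (elim y)
      show ?case
      proof (rule nn_integral_cong_AE)
        show "AE b in lam C. ?h y b = ?f (- b) y"
          using AE_lam_nonzero[OF C C0]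
        proof eventually_elim
          case (elim b)
          have "indicator (cball 0 1) (- b) = (indicator (cball 0 1) b :: ennreal)" by (simp add: indicator_def)
          then show ?case using emeasure_Mset_transfer[OF PQ P Q BC, of y b] y elim by (simp add: MI[OF C P(2)] MI[OF B Q(2)] mult_ac)
        qed
      qed
    qed
  qed
  also have "\<dots> = (\<integral>\<^sup>+b. (\<integral>\<^sup>+y. ?f (- b) y \<partial>lam B) \<partial>lam C)" by (rule BC.Fubini') measurable
  also have "\<dots> = (\<integral>\<^sup>+b. (\<integral>\<^sup>+y. ?f b y \<partial>lam B) \<partial>lam C)"
    by (rule nn_integral_lam_uminus[OF orthonormal_finite[OF C] f])
  also have "\<dots> = emeasure (lam B) (cball 0 1) * emeasure lborel (suppset Q C B)"
    by (rule Mgraph_average[OF CB Q(1,2) C0 B0])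
  finally have "emeasure (lam C) (cball 0 1) * emeasure lborel (suppset P B C) = emeasure (lam B) (cball 0 1) * emeasure lborel (suppset Q C B)" .
  moreover have "emeasure lborel (suppset P B C) = ennreal (measure lborel (suppset P B C))" "emeasure lborel (suppset Q C B) = ennreal (measure lborel (suppset Q C B))"
    using emeasure_compact_finite[OF compact_suppset[OF BC P(2)]] emeasure_compact_finite[OF compact_suppset[OF CB Q(2)]]
    by (auto intro!: emeasure_eq_ennreal_measure)
  ultimately show ?thesis by (simp add: emeasure_lam_cball[OF B] emeasure_lam_cball[OF C] ennreal_mult[symmetric] less_imp_le)
qed

section \<open>Faces of polytopes\<close>

lemma hyperplane_null: fixes a :: "'a::euclidean_space" assumes "a \<noteq> 0" shows "{x. a \<bullet> x = c} \<in> null_sets lborel"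
proof -
  have "negligible {x. a \<bullet> x = c}" using negligible_hyperplane[of a c] assms by simp
  then show ?thesis by (simp add: negligible_iff_null_sets null_sets_completion_iff borel_closed closed_hyperplane)
qed

text \<open>Each face contributes points of one hyperplane: either it extends in some direction of
  \<open>span B\<close>, which restricts the normal directions, or its directions span a proper
  subspace of \<open>span C\<close>, which restricts the \<open>C\<close> component.\<close>

lemma suppset_null_if_no_face:
  assumes BC: "orthonormal (B \<union> C)" "B \<inter> C = {}" "span (B \<union> C) = UNIV" and P: "polytope P"
    and nf: "\<not> (\<exists>G. G face_of P \<and> aff_dim G = int (card C) \<and> affine_parallel (span C) (affine hull G))"
  shows "measure lborel (suppset P B C) = 0"
proof -
  have C: "orthonormal C" and B: "orthonormal B" using BC orthonormal_subset by blast+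
  define N where "N G = {x. (\<exists>g\<in>G. pr C g = pr C x) \<and> (\<forall>g\<in>G. \<forall>g'\<in>G. g \<bullet> pr B x = g' \<bullet> pr B x)}" for G
  have N: "\<exists>a c. a \<noteq> 0 \<and> N G \<subseteq> {x. a \<bullet> x = c}" if G: "G face_of P" "G \<noteq> {}" for G
  proof (cases "\<exists>g\<in>G. \<exists>g'\<in>G. pr B (g - g') \<noteq> 0")
    case True
    then obtain g g' where g: "g \<in> G" "g' \<in> G" "pr B (g - g') \<noteq> 0" by blast
    have "pr B (g - g') \<bullet> x = 0" if x: "x \<in> N G" for x
    proof -
      have "pr B (g - g') \<bullet> x = pr B (g - g') \<bullet> pr B x" using pr_inner_span[OF B, of "pr B (g - g')" x] by (simp add: inner_commute)
      also have "\<dots> = (g - g') \<bullet> pr B x" using pr_inner_span[OF B, of "pr B x" "g - g'"] by simp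
      also have "\<dots> = 0"
      proof -
        have "g \<bullet> pr B x = g' \<bullet> pr B x" using x g(1,2) unfolding N_def by blast
        then show ?thesis by (simp add: inner_diff_left)
      qed
      finally show ?thesis .
    qed
    then show ?thesis using g(3) by blast
  next
    case False
    obtain g0 where g0: "g0 \<in> G" using G(2) by blast
    have inC: "g - g0 \<in> span C" if "g \<in> G" for g
    proof -
      have "pr B (g - g0) = 0" using False that g0 by blast
      then have "g - g0 = pr C (g - g0)" using pr_decomp[OF BC, of "g - g0"] by simp
      then show ?thesis by (metis pr_in_span)
    qed
    let ?A = "(\<lambda>g. g - g0) ` G"
    have sub: "span ?A \<subseteq> span C" using inC by (intro span_minimal) auto
    have "span ?A \<noteq> span C"
    proof
      assume eq: "span ?A = span C"
      have "affine hull G = {g0 + v |v. v \<in> span ?A}"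
      proof -
        have s: "{x - g0 |x. x \<in> G - {g0}} = ?A - {0}" by auto
        show ?thesis unfolding affine_hull_span[OF g0] s span_delete_0 ..
      qed
      then have h: "affine hull G = (\<lambda>x. g0 + x) ` span C" using eq by auto
      then have "affine_parallel (span C) (affine hull G)" by (auto simp: affine_parallel_def)
      moreover have "aff_dim G = int (card C)"
        using aff_dim_affine_hull[of G] h aff_dim_translation_eq[of g0 "span C"] orthonormal_card[OF C] by (simp add: aff_dim_subspace)
      ultimately show False using nf G(1) by blast
    qed
    then have "span ?A \<subset> span C" using sub by blast
    then obtain c where c: "c \<noteq> 0" "c \<in> span C" "\<And>y. y \<in> span ?A \<Longrightarrow> orthogonal c y"
      using orthogonal_to_subspace_exists_gen by blast
    have "c \<bullet> x = c \<bullet> g0" if x: "x \<in> N G" for x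
    proof -
      obtain g where g: "g \<in> G" "pr C g = pr C x" using x by (auto simp: N_def)
      have "c \<bullet> x = c \<bullet> g" using pr_inner_span[OF C c(2), of x] pr_inner_span[OF C c(2), of g] g(2) by (simp add: inner_commute)
      moreover have "c \<bullet> (g - g0) = 0" using c(3)[OF span_base[OF imageI[OF g(1)]]] by (simp add: orthogonal_def)
      ultimately show ?thesis by (simp add: inner_diff_right)
    qed
    then show ?thesis using c(1) by blast
  qed
  define F where "F = {G. G face_of P \<and> G \<noteq> {}}"
  have finF: "finite F" by (rule finite_subset[OF _ finite_polytope_faces[OF P]]) (auto simp: F_def)
  have "\<forall>G\<in>F. \<exists>H. H \<in> null_sets lborel \<and> N G \<subseteq> H" using N hyperplane_null unfolding F_def by fast
  then obtain H where H: "\<And>G. G \<in> F \<Longrightarrow> H G \<in> null_sets lborel" "\<And>G. G \<in> F \<Longrightarrow> N G \<subseteq> H G" by metis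
  have "suppset P B C \<subseteq> (\<Union>G\<in>F. H G)"
  proof
    fix x assume "x \<in> suppset P B C"
    then obtain p where p: "p \<in> P" "pr C p = pr C x" "\<And>q. q \<in> P \<Longrightarrow> q \<bullet> pr B x \<le> p \<bullet> pr B x" by (auto simp: suppset_def)
    define G where "G = P \<inter> {z. pr B x \<bullet> z = p \<bullet> pr B x}"
    have "G face_of P" unfolding G_def
      by (rule face_of_Int_supporting_hyperplane_le[OF polytope_imp_convex[OF P]]) (use p(3) in \<open>simp add: inner_commute\<close>)
    moreover have "p \<in> G" using p by (simp add: G_def inner_commute)
    ultimately have "G \<in> F" by (auto simp: F_def)
    moreover have "x \<in> N G"
    proof -
      have "g \<bullet> pr B x = p \<bullet> pr B x" if "g \<in> G" for g using that by (simp add: G_def inner_commute)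
      then have "\<forall>g\<in>G. \<forall>g'\<in>G. g \<bullet> pr B x = g' \<bullet> pr B x" by metis
      then show ?thesis using \<open>p \<in> G\<close> p(2) unfolding N_def by blast
    qed
    ultimately show "x \<in> (\<Union>G\<in>F. H G)" using subsetD[OF H(2)] by (intro UN_I)
  qed
  moreover have "(\<Union>G\<in>F. H G) \<in> null_sets lborel" using finF H(1) by (intro null_sets_UN') (auto intro: countable_finite)
  moreover have "suppset P B C \<in> sets lborel" using compact_suppset[OF BC polytope_imp_compact[OF P]] by (simp add: borel_compact)
  ultimately have "suppset P B C \<in> null_sets lborel" by (meson null_sets_subset)
  then show ?thesis by (simp add: measure_eq_0_null_sets)
qed

text \<open>A vector exposing \<open>G\<close> lies in \<open>span B\<close>, and small changes of
  it within \<open>span B\<close> still support \<open>P\<close> along \<open>G\<close>, because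
  only finitely many vertices matter. Since \<open>G\<close> projects to a set with interior in
  \<open>span C\<close>, a ball fits into \<open>suppset\<close>.\<close>

lemma suppset_pos_if_face:
  assumes BC: "orthonormal (B \<union> C)" "B \<inter> C = {}" "span (B \<union> C) = UNIV" and P: "polytope P"
    and G: "G face_of P" "aff_dim G = int (card C)" "affine_parallel (span C) (affine hull G)"
  shows "measure lborel (suppset P B C) > 0"
proof -
  have C: "orthonormal C" and B: "orthonormal B" using BC orthonormal_subset by blast+
  obtain V where V: "finite V" "P = convex hull V" using P by (auto simp: polytope_def)
  have "G \<noteq> {}" using G(2) aff_dim_empty[of G] by auto
  then have "rel_interior G \<noteq> {}" using rel_interior_eq_empty[OF face_of_imp_convex[OF G(1)]] by simp
  then obtain g0 where g0: "g0 \<in> rel_interior G" by blast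
  then obtain d where d: "d > 0" "ball g0 d \<inter> affine hull G \<subseteq> G" "g0 \<in> G" by (auto simp: mem_rel_interior_ball)
  obtain v where v: "affine hull G = (\<lambda>x. v + x) ` span C" using G(3) by (auto simp: affine_parallel_def)
  have dir: "g - g0 \<in> span C" if g: "g \<in> affine hull G" for g
  proof -
    have "g0 \<in> affine hull G" using d(3) by (simp add: hull_inc)
    then obtain a b where "g = v + a" "g0 = v + b" "a \<in> span C" "b \<in> span C" using g v by blast
    then show ?thesis by (simp add: span_diff)
  qed
  have dir': "g0 + c \<in> affine hull G" if "c \<in> span C" for c
  proof -
    have "g0 \<in> affine hull G" using d(3) by (simp add: hull_inc)
    then obtain b where "g0 = v + b" "b \<in> span C" using v by auto
    then show ?thesis using that v span_add[of b C c] by (auto simp: add.assoc)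
  qed
  have "G exposed_face_of P" using exposed_face_of_polyhedron[OF polytope_imp_polyhedron[OF P]] G(1) by simp
  then obtain a0 c0 where a0: "P \<subseteq> {x. a0 \<bullet> x \<le> c0}" "G = P \<inter> {x. a0 \<bullet> x = c0}" by (auto simp: exposed_face_of_def)
  \<comment> \<open>Scaled to norm at most 1/2, so that all vectors within 1/2 of \<open>a\<close>
    stay in the unit ball.\<close>
  define a where "a = (1 / (2 * (norm a0 + 1))) *\<^sub>R a0"
  define c where "c = (1 / (2 * (norm a0 + 1))) * c0"
  have pos: "1 / (2 * (norm a0 + 1)) > 0" using norm_ge_zero[of a0] by (simp add: add_nonneg_pos)
  have a: "P \<subseteq> {x. a \<bullet> x \<le> c}" "G = P \<inter> {x. a \<bullet> x = c}"
  proof -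
    show "P \<subseteq> {x. a \<bullet> x \<le> c}" using a0(1) pos by (auto simp: a_def c_def intro!: divide_right_mono)
    show "G = P \<inter> {x. a \<bullet> x = c}" unfolding a0(2) using pos by (auto simp: a_def c_def)
  qed
  have na: "norm a \<le> 1 / 2" using norm_ge_zero[of a0] unfolding a_def norm_scaleR by (simp add: divide_simps) (use norm_ge_zero[of a0] in linarith)
  have "a \<bullet> w = 0" if w: "w \<in> C" for w
  proof -
    have "w \<noteq> 0" "norm w = 1" using C w by (auto simp: orthonormal_def)
    have "g0 + (d / 2) *\<^sub>R w \<in> G" using d \<open>norm w = 1\<close> dir'[OF span_scale[OF span_base[OF w]]] by (auto simp: dist_norm)
    then have "a \<bullet> (g0 + (d / 2) *\<^sub>R w) = a \<bullet> g0" using a(2) d(3) by blast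
    then show ?thesis using d(1) by (simp add: inner_add_right)
  qed
  then have pCa: "pr C a = 0" by (rule pr_eq_0)
  then have pBa: "pr B a = a" using pr_decomp[OF BC, of a] by simp
  have "\<exists>e>0. \<forall>v\<in>V. \<forall>y. v \<notin> G \<longrightarrow> norm (y - a) < e \<longrightarrow> v \<bullet> y < g0 \<bullet> y"
  proof -
    have "\<exists>e>0. \<forall>y. v \<notin> G \<longrightarrow> norm (y - a) < e \<longrightarrow> v \<bullet> y < g0 \<bullet> y" if v: "v \<in> V" for v
    proof (cases "v \<in> G")
      case False
      have "v \<in> P" using v V(2) by (simp add: hull_inc)
      then have "a \<bullet> v < a \<bullet> g0" using False a d(3) by force
      then have lt: "(v - g0) \<bullet> a < 0" unfolding inner_commute[of _ a] inner_diff_right by simp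
      have "open {y. (v - g0) \<bullet> y < 0}" by (intro open_Collect_less continuous_intros)
      then obtain e where "e > 0" "ball a e \<subseteq> {y. (v - g0) \<bullet> y < 0}" using lt by (auto simp: open_contains_ball)
      then show ?thesis by (intro exI[of _ e]) (auto simp: dist_norm norm_minus_commute inner_diff_left subset_iff)
    qed (auto intro: exI[of _ 1])
    then obtain e where e: "\<And>v. v \<in> V \<Longrightarrow> e v > 0 \<and> (\<forall>y. v \<notin> G \<longrightarrow> norm (y - a) < e v \<longrightarrow> v \<bullet> y < g0 \<bullet> y)" by metis
    show ?thesis
    proof (intro exI[of _ "Min (insert 1 (e ` V))"] conjI ballI allI impI)
      show "Min (insert 1 (e ` V)) > 0" using e V(1) by (simp add: Min_gr_iff)
      fix v y assume "v \<in> V" "v \<notin> G" "norm (y - a) < Min (insert 1 (e ` V))"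
      then show "v \<bullet> y < g0 \<bullet> y" using e[of v] V(1) by simp
    qed
  qed
  then obtain e where e: "e > 0" "\<And>v y. v \<in> V \<Longrightarrow> v \<notin> G \<Longrightarrow> norm (y - a) < e \<Longrightarrow> v \<bullet> y < g0 \<bullet> y" by blast
  define r where "r = Min {d, e, 1 / 2}"
  have r: "r > 0" "r \<le> d" "r \<le> e" "r \<le> 1 / 2" using d(1) e(1) by (auto simp: r_def)
  have sub: "ball (a + pr C g0) r \<subseteq> suppset P B C"
  proof
    fix x assume "x \<in> ball (a + pr C g0) r"
    then have x: "norm (x - (a + pr C g0)) < r" by (simp add: dist_norm norm_minus_commute)
    have "pr B (x - (a + pr C g0)) = pr B x - a" "pr C (x - (a + pr C g0)) = pr C x - pr C g0"
      using pBa pCa pr_id[OF C, of "pr C g0"] pr_pr_orth[of C B "pr C g0"] BC by (simp_all add: pr_diff pr_add Un_commute Int_commute)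
    then have n: "norm (pr B x - a) < r" "norm (pr C x - pr C g0) < r"
      using norm_pr_le[OF B, of "x - (a + pr C g0)"] norm_pr_le[OF C, of "x - (a + pr C g0)"] x by auto
    define p where "p = g0 + (pr C x - pr C g0)"
    have sp: "pr C x - pr C g0 \<in> span C" by (simp add: span_diff)
    have "p \<in> ball g0 d" using n(2) r(2) by (simp add: p_def dist_norm norm_minus_commute)
    then have pG: "p \<in> G" using d(2) dir'[OF sp] by (auto simp: p_def)
    then have pP: "p \<in> P" using a(2) by blast
    have const: "g \<bullet> pr B x = g0 \<bullet> pr B x" if "g \<in> G" for g
      using span_orthogonal[OF BC(1,2), of "pr B x" "g - g0"] dir[OF hull_inc[OF that]] by (simp add: inner_diff_right inner_commute[of _ "pr B x"])
    have "q \<bullet> pr B x \<le> p \<bullet> pr B x" if q: "q \<in> P" for q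
    proof -
      have "v \<bullet> pr B x \<le> g0 \<bullet> pr B x" if "v \<in> V" for v
        using const[of v] e(2)[OF that, of "pr B x"] n(1) r(3) by (cases "v \<in> G") (auto intro: less_imp_le)
      then have "P \<subseteq> {z. pr B x \<bullet> z \<le> g0 \<bullet> pr B x}" unfolding V(2)
        by (intro hull_minimal convex_halfspace_le) (auto simp: inner_commute)
      then show ?thesis using q const[OF pG] by (auto simp: inner_commute)
    qed
    moreover have "pr C p = pr C x" by (simp add: p_def pr_add pr_diff pr_id[OF C])
    moreover have "norm (pr B x) \<le> 1" using n(1) r(4) na norm_triangle_sub[of "pr B x" a] by linarith
    ultimately show "x \<in> suppset P B C" using pP unfolding suppset_def by blast
  qed
  have "0 < measure lborel (ball (a + pr C g0) r)" using content_ball_pos[OF r(1)] by simp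
  also have "\<dots> \<le> measure lborel (suppset P B C)"
    using compact_suppset[OF BC polytope_imp_compact[OF P]] by (intro measure_mono_fmeasurable[OF sub]) (auto simp: fmeasurable_compact)
  finally show ?thesis .
qed

section \<open>Projection bodies of polytopes\<close>

lemma emeasure_lam_ball_pos:
  assumes Y: "orthonormal Y" and a: "a \<in> span Y" and r: "r > 0"
  shows "emeasure (lam Y) (ball a r) > 0"
proof -
  have "0 < emeasure (lam Y) (cball 0 (r / 2))" using emeasure_lam_cball[OF Y, of "r / 2"] r by simp
  also have "\<dots> \<le> emeasure (lam Y) (ball 0 r)" using r by (intro emeasure_mono) auto
  also have "ball 0 r = (\<lambda>x. x + a) -` ball a r \<inter> space (lam Y)" by (auto simp: dist_norm)
  also have "emeasure (lam Y) \<dots> = emeasure (distr (lam Y) borel (\<lambda>x. x + a)) (ball a r)" by (rule emeasure_distr[symmetric]) auto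
  finally show ?thesis by (simp add: distr_lam_translate[OF Y a])
qed

text \<open>With unique maximizers, the parameters at which a given \<open>e\<close> is maximal form
  a set both open and closed in the interval; connectedness settles the open interval and continuity
  its end points.\<close>

lemma finite_common_maximizer:
  fixes e1 e2 :: "'a::euclidean_space"
  assumes V: "finite V" "V \<noteq> {}" and eps: "eps > 0"
    and uniq: "\<And>s e e'. - eps < s \<Longrightarrow> s < eps \<Longrightarrow> e \<in> V \<Longrightarrow> e' \<in> V \<Longrightarrow>
        (\<forall>z\<in>V. z \<bullet> (s *\<^sub>R e1 - e2) \<le> e \<bullet> (s *\<^sub>R e1 - e2)) \<Longrightarrow> (\<forall>z\<in>V. z \<bullet> (s *\<^sub>R e1 - e2) \<le> e' \<bullet> (s *\<^sub>R e1 - e2)) \<Longrightarrow> e = e'"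
  obtains e where "e \<in> V" "\<And>s z. - eps \<le> s \<Longrightarrow> s \<le> eps \<Longrightarrow> z \<in> V \<Longrightarrow> z \<bullet> (s *\<^sub>R e1 - e2) \<le> e \<bullet> (s *\<^sub>R e1 - e2)"
proof -
  obtain e where e: "e \<in> V" "\<And>z. z \<in> V \<Longrightarrow> z \<bullet> (0 *\<^sub>R e1 - e2) \<le> e \<bullet> (0 *\<^sub>R e1 - e2)"
    using compact_attains_max_inner[OF finite_imp_compact[OF V(1)] V(2)] by blast
  define A where "A = {s. \<forall>z\<in>V. z \<bullet> (s *\<^sub>R e1 - e2) \<le> e \<bullet> (s *\<^sub>R e1 - e2)}"
  define U where "U = (\<Inter>z\<in>V - {e}. {s. z \<bullet> (s *\<^sub>R e1 - e2) < e \<bullet> (s *\<^sub>R e1 - e2)})"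
  have clA: "closed A"
  proof -
    have "A = (\<Inter>z\<in>V. {s. z \<bullet> (s *\<^sub>R e1 - e2) \<le> e \<bullet> (s *\<^sub>R e1 - e2)})" by (auto simp: A_def)
    then show ?thesis by (auto intro!: closed_INT closed_Collect_le continuous_intros)
  qed
  have opU: "open U" unfolding U_def using V(1) by (intro open_INT ballI open_Collect_less continuous_intros) auto
  let ?I = "{- eps<..<eps}"
  have AU: "?I \<inter> A = ?I \<inter> U"
  proof (intro set_eqI iffI)
    fix s assume s: "s \<in> ?I \<inter> A"
    have "z \<bullet> (s *\<^sub>R e1 - e2) < e \<bullet> (s *\<^sub>R e1 - e2)" if z: "z \<in> V" "z \<noteq> e" for z
    proof (rule ccontr)
      assume "\<not> z \<bullet> (s *\<^sub>R e1 - e2) < e \<bullet> (s *\<^sub>R e1 - e2)"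
      then have "\<forall>x\<in>V. x \<bullet> (s *\<^sub>R e1 - e2) \<le> z \<bullet> (s *\<^sub>R e1 - e2)" using s unfolding A_def by force
      moreover have "\<forall>x\<in>V. x \<bullet> (s *\<^sub>R e1 - e2) \<le> e \<bullet> (s *\<^sub>R e1 - e2)" using s by (simp add: A_def)
      ultimately show False using uniq[of s z e] s z e(1) by auto
    qed
    then show "s \<in> ?I \<inter> U" using s by (auto simp: U_def)
  next
    fix s assume s: "s \<in> ?I \<inter> U"
    have "z \<bullet> (s *\<^sub>R e1 - e2) \<le> e \<bullet> (s *\<^sub>R e1 - e2)" if "z \<in> V" for z
      using s that by (cases "z = e") (auto simp: U_def intro: less_imp_le)
    then show "s \<in> ?I \<inter> A" using s by (auto simp: A_def)
  qed
  have "connected ?I" by simp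
  moreover have "openin (top_of_set ?I) (?I \<inter> A)" unfolding AU using opU by (rule openin_open_Int)
  moreover have "closedin (top_of_set ?I) (?I \<inter> A)" using clA by (rule closedin_closed_Int)
  ultimately have "?I \<inter> A = {} \<or> ?I \<inter> A = ?I" unfolding connected_clopen by blast
  moreover have "0 \<in> ?I \<inter> A" using e eps by (simp add: A_def)
  ultimately have "?I \<subseteq> A" by blast
  then have "closure ?I \<subseteq> A" using clA by (rule closure_minimal)
  then have "{- eps..eps} \<subseteq> A" using eps by simp
  then show ?thesis using e(1) that[of e] by (force simp: A_def)
qed

text \<open>The planar sections of \<open>P\<close> in the directions \<open>e1\<close>, \<open>e2\<close> are polygons none of whose edge normals lies strictly between \<open>eps e1 - e2\<close> and \<open>- eps e1 - e2\<close>.\<close>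

lemma hf_additive_if_polytope:
  assumes on: "orthonormal (insert e1 (insert e2 X))" "e1 \<notin> insert e2 X" "e2 \<notin> X" and P: "compact P"
    and I: "finite I" "pr (insert e1 (insert e2 X)) ` P = {z. \<forall>(a, c)\<in>I. a \<bullet> z \<le> (c::real)}"
    and eps: "eps > 0" "\<And>a c. (a, c) \<in> I \<Longrightarrow> eps * \<bar>a \<bullet> e2\<bar> \<le> \<bar>a \<bullet> e1\<bar>"
  shows "hf X P w (eps *\<^sub>R e1 - e2) + hf X P w ((- eps) *\<^sub>R e1 - e2) = hf X P w (0 *\<^sub>R e1 - 2 *\<^sub>R e2)"
proof (cases "fib X P w = {}")
  case True then show ?thesis by (simp add: hf_def)
next
  case False
  let ?A = "insert e1 (insert e2 X)"
  let ?K = "pr ?A ` P"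
  have X: "orthonormal X" using orthonormal_subset[OF on(1)] by blast
  have fin: "finite X" by (rule orthonormal_finite[OF X])
  have ee: "e1 \<bullet> e1 = 1" "e2 \<bullet> e2 = 1" "e1 \<bullet> e2 = 0" "e2 \<bullet> e1 = 0"
    using on orthonormal_inner[OF on(1)] by auto
  have pX: "pr X e1 = 0" "pr X e2 = 0" using on orthonormal_inner[OF on(1), of e1] orthonormal_inner[OF on(1), of e2] by (auto intro!: pr_eq_0)
  have prA: "pr ?A x = (x \<bullet> e1) *\<^sub>R e1 + ((x \<bullet> e2) *\<^sub>R e2 + pr X x)" for x
    using on fin by (simp add: pr_insert)
  have prXA: "pr X (pr ?A x) = pr X x" for x unfolding prA by (simp add: pr_add pr_scaleR pX pr_id[OF X])
  have inA: "pr ?A x \<bullet> e1 = x \<bullet> e1" "pr ?A x \<bullet> e2 = x \<bullet> e2" for x using pr_inner[OF on(1)] by auto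
  define S where "S = ?K \<inter> {z. pr X z = w}"
  have "polyhedron ?K"
  proof -
    have "?K = (\<Inter>(a, c)\<in>I. {z. a \<bullet> z \<le> c})" unfolding I(2) by auto
    moreover have "polyhedron (\<Inter>(a, c)\<in>I. {z. a \<bullet> z \<le> c})"
      using I(1) polyhedron_halfspace_le by (intro polyhedron_Inter) auto
    ultimately show ?thesis by simp
  qed
  moreover have "polyhedron {z. pr X z = w}"
    by (rule affine_imp_polyhedron) (auto simp: affine_def pr_add pr_scaleR scaleR_add_left[symmetric])
  ultimately have "polyhedron S" unfolding S_def by (rule polyhedron_Int)
  moreover have "bounded S" unfolding S_def
    by (rule bounded_subset[OF compact_imp_bounded[OF compact_continuous_image[OF _ P]], of "pr ?A"]) (auto intro!: continuous_intros)
  ultimately have "polytope S" by (simp add: polytope_eq_bounded_polyhedron)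
  then obtain V where V: "finite V" "S = convex hull V" by (auto simp: polytope_def)
  have fibS: "pr ?A x \<in> S" if "x \<in> fib X P w" for x using that prXA by (auto simp: S_def fib_def)
  have "S \<noteq> {}" using False fibS by blast
  then have V0: "V \<noteq> {}" using V(2) by auto
  have maxS: "z \<bullet> v \<le> e \<bullet> v" if "\<forall>x\<in>V. x \<bullet> v \<le> e \<bullet> v" "z \<in> S" for z v e
  proof -
    have "S \<subseteq> {z. v \<bullet> z \<le> e \<bullet> v}" unfolding V(2) using that(1) by (intro hull_minimal convex_halfspace_le) (auto simp: inner_commute)
    then show ?thesis using that(2) by (auto simp: inner_commute)
  qed
  have VS: "V \<subseteq> S" unfolding V(2) by (rule hull_subset)
  have convS: "convex S" unfolding V(2) by (rule convex_convex_hull)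
  have Sdec: "z = (z \<bullet> e1) *\<^sub>R e1 + ((z \<bullet> e2) *\<^sub>R e2 + w)" if z: "z \<in> S" for z
  proof -
    obtain x where x: "z = pr ?A x" "pr X z = w" using z by (auto simp: S_def)
    then show ?thesis using inA prXA prA by metis
  qed
  \<comment> \<open>Two maximizers would lie on an edge with normal \<open>?v\<close>. Its midpoint
    cannot move in direction \<open>?v\<close>, so some inequality of \<open>I\<close> is tight
    there and hence at both \<open>e\<close> and \<open>e'\<close>; then
    \<open>a \<bullet> e1 = - (s * (a \<bullet> e2))\<close>, which the choice of \<open>eps\<close>
    excludes.\<close>
  have uniq: "e = e'" if s: "- eps < s" "s < eps" and e: "e \<in> V" "e' \<in> V"
    and m: "\<forall>z\<in>V. z \<bullet> (s *\<^sub>R e1 - e2) \<le> e \<bullet> (s *\<^sub>R e1 - e2)" "\<forall>z\<in>V. z \<bullet> (s *\<^sub>R e1 - e2) \<le> e' \<bullet> (s *\<^sub>R e1 - e2)" for s e e'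
  proof (rule ccontr)
    assume ne: "e \<noteq> e'"
    let ?v = "s *\<^sub>R e1 - e2"
    have eS: "e \<in> S" "e' \<in> S" using e VS by auto
    have eq: "e \<bullet> ?v = e' \<bullet> ?v" using m e by (meson antisym)
    define z where "z = (1 / 2) *\<^sub>R e + (1 / 2) *\<^sub>R e'"
    have zS: "z \<in> S" unfolding z_def using eS convS by (intro convexD) auto
    have zv: "z \<bullet> ?v = e \<bullet> ?v" using eq by (simp add: z_def inner_add_left)
    have vv: "?v \<bullet> ?v > 0"
    proof -
      have "?v \<bullet> e2 = -1" by (simp add: inner_diff_left ee)
      then have "?v \<noteq> 0" by auto
      then show ?thesis by simp
    qed
    have nin: "\<exists>i\<in>I. fst i \<bullet> z + (1 / real (Suc k)) * (fst i \<bullet> ?v) > snd i" for k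
    proof (rule ccontr)
      assume "\<not> ?thesis"
      then have "\<forall>(a, c)\<in>I. a \<bullet> (z + (1 / real (Suc k)) *\<^sub>R ?v) \<le> c" by (auto simp: not_less inner_add_right simp del: of_nat_Suc)
      then have "z + (1 / real (Suc k)) *\<^sub>R ?v \<in> ?K" unfolding I(2) by simp
      moreover have "pr X (z + (1 / real (Suc k)) *\<^sub>R ?v) = w" using zS pX by (simp add: S_def pr_add pr_scaleR pr_diff)
      ultimately have "z + (1 / real (Suc k)) *\<^sub>R ?v \<in> S" by (simp add: S_def)
      from maxS[OF m(1) this] have "(1 / real (Suc k)) * (?v \<bullet> ?v) \<le> 0" using zv by (simp add: inner_add_left del: of_nat_Suc)
      then show False using vv by (simp add: field_simps del: of_nat_Suc)
    qed
    then obtain f where f: "\<And>k. f k \<in> I \<and> fst (f k) \<bullet> z + (1 / real (Suc k)) * (fst (f k) \<bullet> ?v) > snd (f k)" by metis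
    \<comment> \<open>Pigeonhole: an inequality violated after arbitrarily small steps from
      \<open>z\<close> must be tight at \<open>z\<close>.\<close>
    have "\<exists>i\<in>I. infinite {k. f k = i}"
    proof (rule ccontr)
      assume "\<not> ?thesis"
      then have "finite (\<Union>i\<in>I. {k. f k = i})" using I(1) by blast
      moreover have "(\<Union>i\<in>I. {k. f k = i}) = UNIV" using f by blast
      ultimately show False by simp
    qed
    then obtain a c where i: "(a, c) \<in> I" "infinite {k. f k = (a, c)}" by auto
    have le: "a \<bullet> x \<le> c" if "x \<in> S" for x
    proof -
      have "x \<in> ?K" using that by (simp add: S_def)
      then show ?thesis unfolding I(2) using i(1) by blast
    qed
    have av: "a \<bullet> ?v > 0" and az: "a \<bullet> z = c"
    proof -
      obtain k where "f k = (a, c)" using i(2) infinite_imp_nonempty by blast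
      then have "a \<bullet> z + (1 / real (Suc k)) * (a \<bullet> ?v) > c" using f[of k] by simp
      then have "(1 / real (Suc k)) * (a \<bullet> ?v) > 0" using le[OF zS] by linarith
      then show av: "a \<bullet> ?v > 0" by (simp add: zero_less_mult_iff zero_less_divide_iff del: of_nat_Suc)
      show "a \<bullet> z = c"
      proof (rule ccontr)
        assume "a \<bullet> z \<noteq> c"
        then have lt: "c - a \<bullet> z > 0" using le[OF zS] by simp
        obtain N :: nat where N: "(a \<bullet> ?v) / (c - a \<bullet> z) < real N" using reals_Archimedean2 by blast
        obtain k where k: "k \<ge> N" "f k = (a, c)" using i(2) unfolding infinite_nat_iff_unbounded_le by blast
        have "c - a \<bullet> z < (a \<bullet> ?v) / real (Suc k)" using f[of k] k(2) by simp
        then have "real (Suc k) * (c - a \<bullet> z) < a \<bullet> ?v" by (simp add: pos_less_divide_eq mult.commute del: of_nat_Suc)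
        moreover have "a \<bullet> ?v < real N * (c - a \<bullet> z)" using N lt by (simp add: pos_divide_less_eq)
        moreover have "real N * (c - a \<bullet> z) \<le> real (Suc k) * (c - a \<bullet> z)" using k(1) lt by (intro mult_right_mono) auto
        ultimately show False by linarith
      qed
    qed
    have "a \<bullet> e = c" "a \<bullet> e' = c" using le[OF eS(1)] le[OF eS(2)] az by (auto simp: z_def inner_add_right)
    then have ad: "a \<bullet> (e - e') = 0" by (simp add: inner_diff_right)
    define p where "p = (e - e') \<bullet> e1"
    define q where "q = (e - e') \<bullet> e2"
    have dec: "e - e' = p *\<^sub>R e1 + q *\<^sub>R e2"
    proof -
      have "e - e' = ((e \<bullet> e1) *\<^sub>R e1 + ((e \<bullet> e2) *\<^sub>R e2 + w)) - ((e' \<bullet> e1) *\<^sub>R e1 + ((e' \<bullet> e2) *\<^sub>R e2 + w))"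
        by (rule arg_cong2[where f="(-)"]) (rule Sdec[OF eS(1)], rule Sdec[OF eS(2)])
      also have "\<dots> = p *\<^sub>R e1 + q *\<^sub>R e2" by (simp add: p_def q_def inner_diff_left scaleR_diff_left)
      finally show ?thesis .
    qed
    have "(e - e') \<bullet> ?v = 0" using eq by (simp add: inner_diff_left)
    then have sp: "s * p = q" by (simp add: p_def q_def inner_diff_right)
    then have p0: "p \<noteq> 0" using dec ne by auto
    have "p * (a \<bullet> e1 + s * (a \<bullet> e2)) = 0" using ad unfolding dec sp[symmetric] by (simp add: inner_add_right algebra_simps)
    then have ae: "a \<bullet> e1 = - (s * (a \<bullet> e2))" using p0 by simp
    have "a \<bullet> e2 \<noteq> 0" using av ae by (auto simp: inner_diff_right)
    then have "\<bar>s\<bar> * \<bar>a \<bullet> e2\<bar> < eps * \<bar>a \<bullet> e2\<bar>" using s by (intro mult_strict_right_mono) auto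
    then show False using eps(2)[OF i(1)] ae by (simp add: abs_mult)
  qed
  obtain e where e: "e \<in> V" "\<And>s z. - eps \<le> s \<Longrightarrow> s \<le> eps \<Longrightarrow> z \<in> V \<Longrightarrow> z \<bullet> (s *\<^sub>R e1 - e2) \<le> e \<bullet> (s *\<^sub>R e1 - e2)"
    by (rule finite_common_maximizer[OF V(1) V0 eps(1), of e1 e2]) (use uniq in blast)+
  have "e \<in> S" using e(1) VS by blast
  then obtain x where x: "x \<in> P" "e = pr ?A x" and "pr X e = w" by (auto simp: S_def)
  then have xw: "pr X x = w" using prXA by simp
  have h: "hf X P w (s *\<^sub>R e1 - e2) = x \<bullet> (s *\<^sub>R e1 - e2)" if "- eps \<le> s" "s \<le> eps" for s
  proof (rule hf_max)
    show "x \<in> fib X P w" using x xw by (simp add: fib_def)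
    fix y assume y: "y \<in> fib X P w"
    have "pr ?A y \<bullet> (s *\<^sub>R e1 - e2) \<le> e \<bullet> (s *\<^sub>R e1 - e2)" by (rule maxS[OF _ fibS[OF y]]) (use e(2) that in blast)
    then show "y \<bullet> (s *\<^sub>R e1 - e2) \<le> x \<bullet> (s *\<^sub>R e1 - e2)" using x(2) inA by (simp add: inner_diff_right)
  qed
  have "hf X P w (2 *\<^sub>R (0 *\<^sub>R e1 - e2)) = 2 * hf X P w (0 *\<^sub>R e1 - e2)" by (rule hf_scale[OF P]) simp
  also have "2 *\<^sub>R (0 *\<^sub>R e1 - e2) = 0 *\<^sub>R e1 - 2 *\<^sub>R e2" by simp
  finally show ?thesis using h[of eps] h[of "- eps"] h[of 0] eps(1) by (simp add: inner_diff_right)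
qed

lemma finite_uniform_eps:
  fixes f g :: "'i \<Rightarrow> real"
  assumes "finite I" "\<And>i. i \<in> I \<Longrightarrow> f i = 0 \<Longrightarrow> g i = 0"
  shows "\<exists>eps>0. \<forall>i\<in>I. eps * \<bar>g i\<bar> \<le> \<bar>f i\<bar>"
  using assms
proof (induction I rule: finite_induct)
  case empty
  then show ?case by (auto intro: exI[of _ 1])
next
  case (insert i I)
  then obtain d where d: "d > 0" "\<forall>i\<in>I. d * \<bar>g i\<bar> \<le> \<bar>f i\<bar>" by auto
  have "\<exists>c>0. c * \<bar>g i\<bar> \<le> \<bar>f i\<bar>"
  proof (cases "g i = 0")
    case True then show ?thesis using zero_less_one by (intro exI[of _ 1]) simp
  next
    case False
    then have "f i \<noteq> 0" using insert.prems[of i] by auto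
    then show ?thesis using False by (intro exI[of _ "\<bar>f i\<bar> / \<bar>g i\<bar>"]) (simp add: divide_pos_pos)
  qed
  then obtain c where c: "c > 0" "c * \<bar>g i\<bar> \<le> \<bar>f i\<bar>" by blast
  have "min c d * \<bar>g k\<bar> \<le> \<bar>f k\<bar>" if "k \<in> insert i I" for k
    using that c d mult_right_mono[of "min c d" c "\<bar>g k\<bar>"] mult_right_mono[of "min c d" d "\<bar>g k\<bar>"] by force
  then show ?case using c d by (intro exI[of _ "min c d"]) auto
qed

text \<open>\<open>q\<close> is a boundary point with outer normal \<open>n\<close> lying on a ball
  inside \<open>Q\<close>. The ball prevents the boundary near \<open>q\<close> from leaving its
  tangent hyperplane faster than quadratically.\<close>

definition touching :: "'a::euclidean_space set \<Rightarrow> 'a \<Rightarrow> 'a \<Rightarrow> real \<Rightarrow> bool" where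
  "touching Q n q r \<longleftrightarrow> norm n = 1 \<and> q \<in> Q \<and> r > 0 \<and> cball (q - r *\<^sub>R n) r \<subseteq> Q \<and> (\<forall>z\<in>Q. z \<bullet> n \<le> q \<bullet> n)"

text \<open>Inside the ball a step of length \<open>s\<close> along \<open>e2\<close> or
  \<open>- e2\<close> costs only \<open>k * s\<^sup>2\<close> in direction \<open>e1\<close> but
  gains \<open>eps * s\<close>. In sections near that of \<open>q\<close> the supporting hyperplane
  keeps the value of \<open>e1\<close> too small to make up for this gain.\<close>

lemma touching_hf_defect:
  assumes on: "orthonormal (insert e1 (insert e2 Y))" "e1 \<notin> insert e2 Y" "e2 \<notin> Y" and Q: "compact Q"
    and t: "touching Q n q r" and n: "n = c *\<^sub>R e1 + pr Y n" "c > 0" and eps: "eps > 0"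
  shows "\<exists>d>0. \<forall>y\<in>span Y \<inter> ball (pr Y q) d. hf Y Q y (2 *\<^sub>R e1) < hf Y Q y (e1 + eps *\<^sub>R e2) + hf Y Q y (e1 - eps *\<^sub>R e2)"
proof -
  have Y: "orthonormal Y" using orthonormal_subset[OF on(1)] by blast
  have ee: "e1 \<bullet> e1 = 1" "e2 \<bullet> e2 = 1" "e1 \<bullet> e2 = 0" "e2 \<bullet> e1 = 0"
    using on orthonormal_inner[OF on(1)] by auto
  have pY: "pr Y e1 = 0" "pr Y e2 = 0" using on orthonormal_inner[OF on(1), of e1] orthonormal_inner[OF on(1), of e2] by (auto intro!: pr_eq_0)
  have Ye: "v \<bullet> e1 = 0" "v \<bullet> e2 = 0" if "v \<in> span Y" for v
    using pr_inner_span[OF Y that, of e1] pr_inner_span[OF Y that, of e2] pY by (simp_all add: inner_commute)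
  have ne: "e1 \<bullet> n = c" "e2 \<bullet> n = 0"
  proof -
    have "e1 \<bullet> n = e1 \<bullet> (c *\<^sub>R e1 + pr Y n)" "e2 \<bullet> n = e2 \<bullet> (c *\<^sub>R e1 + pr Y n)" using n(1) by auto
    then show "e1 \<bullet> n = c" "e2 \<bullet> n = 0" using ee Ye[of "pr Y n"] by (simp_all add: inner_add_right inner_commute[of _ "pr Y n"])
  qed
  have r: "r > 0" and nn: "n \<bullet> n = 1" using t by (auto simp: touching_def norm_eq_1)
  \<comment> \<open>Chosen so that the term \<open>2 * r * (u sg \<bullet> n)\<close> equals
    \<open>- 4 * s\<^sup>2\<close> and outweighs
    \<open>u sg \<bullet> u sg \<le> 2 * s\<^sup>2\<close>; the displaced point then stays inside
    the ball.\<close>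
  define k where "k = 2 / (r * c)"
  have k: "k > 0" "k * (r * c) = 2" using r n(2) by (auto simp: k_def)
  \<comment> \<open>\<open>k * s \<le> 1\<close> bounds the length of the displacement;
    \<open>k * s \<le> eps / 2\<close> lets the linear gain exceed the quadratic loss.\<close>
  define s where "s = min (eps / 2) 1 / k"
  have s: "s > 0" "k * s \<le> eps / 2" "k * s \<le> 1" using k eps by (auto simp: s_def)
  have gap: "2 * eps * s - 2 * (k * s\<^sup>2) > 0"
  proof -
    have "(k * s) * s \<le> (eps / 2) * s" using s by (intro mult_right_mono) auto
    moreover have "eps * s > 0" using eps s by simp
    ultimately show ?thesis by (simp add: power2_eq_square mult.assoc)
  qed
  define u where "u sg = (sg * s) *\<^sub>R e2 - (k * s\<^sup>2) *\<^sub>R e1" for sg :: real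
  have u: "norm (u sg + r *\<^sub>R n) < r" if "sg\<^sup>2 = 1" for sg
  proof -
    have un: "u sg \<bullet> n = - (k * s\<^sup>2 * c)" by (simp add: u_def inner_diff_left ne)
    have "u sg \<bullet> u sg = sg\<^sup>2 * s\<^sup>2 + (k * s)\<^sup>2 * s\<^sup>2" by (simp add: u_def inner_diff_left inner_diff_right ee power2_eq_square)
    also have "(k * s)\<^sup>2 * s\<^sup>2 \<le> 1\<^sup>2 * s\<^sup>2" using s k by (intro mult_right_mono power_mono) auto
    finally have uu: "u sg \<bullet> u sg \<le> 2 * s\<^sup>2" using that by simp
    have "(norm (u sg + r *\<^sub>R n))\<^sup>2 = u sg \<bullet> u sg + 2 * r * (u sg \<bullet> n) + r\<^sup>2"
      unfolding power2_norm_eq_inner by (simp add: inner_add_left inner_add_right nn inner_commute[of n "u sg"] power2_eq_square distrib_left)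
    also have "2 * r * (u sg \<bullet> n) = - 2 * (k * (r * c)) * s\<^sup>2" unfolding un by (simp add: algebra_simps)
    also have "\<dots> = - 4 * s\<^sup>2" unfolding k(2) by simp
    finally have "(norm (u sg + r *\<^sub>R n))\<^sup>2 \<le> r\<^sup>2 - 2 * s\<^sup>2" using uu by simp
    then have "(norm (u sg + r *\<^sub>R n))\<^sup>2 < r\<^sup>2" using s(1) by (smt (verit) zero_less_power2)
    then show ?thesis using r by (simp add: power_less_imp_less_base)
  qed
  define d where "d = Min {r - norm (u 1 + r *\<^sub>R n), r - norm (u (- 1) + r *\<^sub>R n), c * (eps * s - k * s\<^sup>2)}"
  have d0: "d > 0" using u[of 1] u[of "- 1"] gap n(2) by (simp add: d_def)
  have d: "d \<le> r - norm (u 1 + r *\<^sub>R n)" "d \<le> r - norm (u (- 1) + r *\<^sub>R n)" "d \<le> c * (eps * s - k * s\<^sup>2)"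
    by (simp_all add: d_def)
  show ?thesis
  proof (intro exI[of _ d] conjI d0 ballI)
    fix y assume y: "y \<in> span Y \<inter> ball (pr Y q) d"
    define m where "m = y - pr Y q"
    have mY: "m \<in> span Y" using y by (simp add: m_def span_diff)
    have md: "norm m < d" using y by (simp add: m_def dist_norm norm_minus_commute)
    have fibz: "q + u sg + m \<in> fib Y Q y" if sg: "d \<le> r - norm (u sg + r *\<^sub>R n)" for sg
    proof -
      have "q + u sg + m - (q - r *\<^sub>R n) = (u sg + r *\<^sub>R n) + m" by simp
      then have "norm (q + u sg + m - (q - r *\<^sub>R n)) \<le> norm (u sg + r *\<^sub>R n) + norm m" using norm_triangle_ineq by metis
      then have "q + u sg + m \<in> cball (q - r *\<^sub>R n) r" using sg md by (simp add: dist_norm norm_minus_commute)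
      then have "q + u sg + m \<in> Q" using t unfolding touching_def by blast
      moreover have "pr Y (q + u sg + m) = y" using pr_id[OF Y mY] pY by (simp add: pr_add pr_diff pr_scaleR u_def m_def)
      ultimately show ?thesis by (simp add: fib_def)
    qed
    note f1 = fibz[OF d(1)] and f2 = fibz[OF d(2)]
    have "2 * (q \<bullet> e1) - 2 * (k * s\<^sup>2) + 2 * eps * s = (q + u 1 + m) \<bullet> (e1 + eps *\<^sub>R e2) + (q + u (- 1) + m) \<bullet> (e1 - eps *\<^sub>R e2)"
      using Ye[OF mY] by (simp add: u_def inner_add_left inner_diff_left inner_add_right inner_diff_right ee distrib_left right_diff_distrib)
    also have "\<dots> \<le> hf Y Q y (e1 + eps *\<^sub>R e2) + hf Y Q y (e1 - eps *\<^sub>R e2)"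
      using hf_upper[OF Q f1] hf_upper[OF Q f2] by (rule add_mono)
    finally have low: "2 * (q \<bullet> e1) - 2 * (k * s\<^sup>2) + 2 * eps * s \<le> hf Y Q y (e1 + eps *\<^sub>R e2) + hf Y Q y (e1 - eps *\<^sub>R e2)" .
    have "fib Y Q y \<noteq> {}" using f1 by blast
    then obtain z where "z \<in> fib Y Q y" and zh: "hf Y Q y (2 *\<^sub>R e1) = z \<bullet> (2 *\<^sub>R e1)" using hf_attained[OF Q] by metis
    then have z: "z \<in> Q" "pr Y z = y" by (auto simp: fib_def)
    have nv: "v \<bullet> n = c * (v \<bullet> e1) + pr Y v \<bullet> n" for v
    proof -
      have "v \<bullet> n = v \<bullet> (c *\<^sub>R e1 + pr Y n)" using n(1) by simp
      also have "\<dots> = c * (v \<bullet> e1) + v \<bullet> pr Y n" by (simp add: inner_add_right)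
      also have "v \<bullet> pr Y n = pr Y v \<bullet> pr Y n" using pr_inner_span[OF Y, of "pr Y n" v] by simp
      also have "\<dots> = pr Y v \<bullet> n" using pr_inner_span[OF Y, of "pr Y v" n] by (simp add: inner_commute)
      finally show ?thesis .
    qed
    have "z \<bullet> n \<le> q \<bullet> n" using t z(1) by (simp add: touching_def)
    then have "c * (z \<bullet> e1) + y \<bullet> n \<le> c * (q \<bullet> e1) + pr Y q \<bullet> n" using nv[of z] nv[of q] z(2) by simp
    then have "c * (z \<bullet> e1) \<le> c * (q \<bullet> e1) - m \<bullet> n" by (simp add: m_def inner_diff_left)
    moreover have "- (m \<bullet> n) \<le> norm m" using norm_cauchy_schwarz[of "- m" n] nn by (simp add: norm_eq_sqrt_inner[of n])
    ultimately have "c * (z \<bullet> e1) < c * (q \<bullet> e1 + (eps * s - k * s\<^sup>2))" using md d(3) by (simp add: distrib_left)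
    then have "z \<bullet> e1 < q \<bullet> e1 + (eps * s - k * s\<^sup>2)" using n(2) by simp
    then show "hf Y Q y (2 *\<^sub>R e1) < hf Y Q y (e1 + eps *\<^sub>R e2) + hf Y Q y (e1 - eps *\<^sub>R e2)" using low zh by simp
  qed
qed

text \<open>A largest ball is centred at \<open>c\<close>, shortly before the segment from
  \<open>x0\<close> to \<open>p\<close> leaves \<open>Q\<close> for the last time. If its tangent
  hyperplane did not cut off \<open>p\<close>, its radius would be at least
  \<open>(1 - l) * R\<close>, and the ball would contain points of the segment beyond the
  exit.\<close>

lemma touching_point_exists:
  fixes Q :: "'a::euclidean_space set"
  assumes Q: "convex Q" "compact Q" "interior Q \<noteq> {}" and p: "p \<notin> Q"
  obtains n q r where "touching Q n q r" "q \<bullet> n < p \<bullet> n"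
proof -
  obtain x0 where x0i: "x0 \<in> interior Q" using Q(3) by blast
  then obtain R where "R > 0" "cball x0 R \<subseteq> Q" by (auto simp: mem_interior_cball)
  note x0 = this x0i
  define v where "v = p - x0"
  define D where "D = norm v"
  have x0Q: "x0 \<in> Q" using x0(3) interior_subset by blast
  have D: "D > 0" using p x0Q by (auto simp: D_def v_def)
  define T where "T = {0..1} \<inter> (\<lambda>t. x0 + t *\<^sub>R v) -` Q"
  have cT: "compact T" unfolding T_def by (intro compact_Int_closed closed_vimage compact_imp_closed Q continuous_intros) auto
  have "0 \<in> T" using x0Q by (simp add: T_def)
  then have "T \<noteq> {}" by blast
  from compact_attains_sup[OF cT this] obtain b where b: "b \<in> T" "\<And>t. t \<in> T \<Longrightarrow> t \<le> b" by blast
  have b01: "0 \<le> b" "b \<le> 1" "x0 + b *\<^sub>R v \<in> Q" using b(1) by (auto simp: T_def)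
  have "b \<noteq> 1" using b01(3) p by (auto simp: v_def)
  then have b1: "b < 1" using b01 by simp
  \<comment> \<open>The distance \<open>e * b * D\<close> from \<open>c\<close> to the exit point is
    thereby less than \<open>(1 - b) * R\<close>.\<close>
  define e where "e = min 1 ((1 - b) * R / (2 * (D + 1)))"
  have e: "0 < e" "e \<le> 1" using b1 x0(1) D by (auto simp: e_def)
  have eD: "e * b * D < (1 - b) * R"
  proof -
    have "e * b * D \<le> e * D" using mult_mono[of b 1 "e * D" "e * D"] b01 e D by (simp add: mult_ac)
    also have "\<dots> \<le> (1 - b) * R / (2 * (D + 1)) * D" using D by (intro mult_right_mono) (auto simp: e_def)
    also have "\<dots> = (1 - b) * R * (D / (2 * (D + 1)))" by simp
    also have "\<dots> < (1 - b) * R * 1" using D b1 x0(1) by (intro mult_strict_left_mono) (auto simp: divide_simps)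
    finally show ?thesis by simp
  qed
  define l where "l = (1 - e) * b"
  have l: "0 \<le> l" "l \<le> b" "b - l = e * b" using e b01 mult_right_mono[of e 1 b] by (auto simp: l_def left_diff_distrib)
  define c where "c = x0 + l *\<^sub>R v"
  have cint: "c \<in> interior Q"
  proof -
    have "(x0 + b *\<^sub>R v) - e *\<^sub>R ((x0 + b *\<^sub>R v) - x0) \<in> interior Q"
      by (rule mem_interior_convex_shrink[OF Q(1) x0(3) b01(3) e])
    also have "(x0 + b *\<^sub>R v) - e *\<^sub>R ((x0 + b *\<^sub>R v) - x0) = c" by (simp add: c_def l_def algebra_simps)
    finally show ?thesis .
  qed
  have fne: "frontier Q \<noteq> {}" using x0Q p frontier_not_empty[of Q] by blast
  obtain q where q: "q \<in> frontier Q" "\<And>y. y \<in> frontier Q \<Longrightarrow> dist c q \<le> dist c y"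
    using distance_attains_inf[OF frontier_closed fne] by blast
  define r where "r = dist c q"
  have r: "r > 0" using q(1) cint by (auto simp: r_def frontier_def)
  have clQ: "closed Q" using Q(2) by (rule compact_imp_closed)
  have qQ: "q \<in> Q" using q(1) frontier_subset_closed[OF clQ] by blast
  have ballQ: "ball c r \<subseteq> Q"
  proof (rule ccontr)
    assume "\<not> ball c r \<subseteq> Q"
    moreover have "ball c r \<inter> Q \<noteq> {}" using r cint interior_subset[of Q] by force
    ultimately have "ball c r \<inter> frontier Q \<noteq> {}" by (intro connected_Int_frontier) auto
    then show False using q(2) by (force simp: r_def)
  qed
  then have cballQ: "cball c r \<subseteq> Q" using closure_minimal[OF ballQ clQ] r by simp
  have "interior Q \<inter> {q} = {}" using q(1) by (auto simp: frontier_def)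
  then obtain a \<beta> where a: "a \<noteq> 0" "\<And>x. x \<in> interior Q \<Longrightarrow> a \<bullet> x \<le> \<beta>" "\<beta> \<le> a \<bullet> q"
    using separating_hyperplane_sets[OF convex_interior[OF Q(1)] convex_singleton[of q] Q(3)] by auto
  have aQ: "a \<bullet> x \<le> a \<bullet> q" if "x \<in> Q" for x
  proof -
    have "closure (interior Q) \<subseteq> {x. a \<bullet> x \<le> a \<bullet> q}"
      using a(2,3) by (intro closure_minimal closed_halfspace_le) force
    then show ?thesis using convex_closure_interior[OF Q(1,3)] closure_subset[of Q] that by blast
  qed
  define n where "n = (1 / r) *\<^sub>R (q - c)"
  have nq: "norm (q - c) = r" by (simp add: r_def dist_norm norm_minus_commute)
  have nn: "norm n = 1" using r nq by (simp add: n_def)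
  \<comment> \<open>The hyperplane supporting \<open>Q\<close> at \<open>q\<close> also supports the
    inscribed ball, so equality holds in Cauchy-Schwarz and the two normals agree.\<close>
  have na: "n = (1 / norm a) *\<^sub>R a"
  proof -
    have "c + (r / norm a) *\<^sub>R a \<in> cball c r" using r a(1) by (simp add: dist_norm)
    then have "a \<bullet> (c + (r / norm a) *\<^sub>R a) \<le> a \<bullet> q" using aQ cballQ by blast
    then have "norm a * norm (q - c) \<le> a \<bullet> (q - c)" using a(1) nq
      by (simp add: inner_add_right inner_diff_right dot_square_norm power2_eq_square mult.commute)
    then have "a \<bullet> (q - c) = norm a * norm (q - c)" using norm_cauchy_schwarz[of a "q - c"] by linarith
    then have "norm a *\<^sub>R (q - c) = r *\<^sub>R a" using norm_cauchy_schwarz_eq[of a "q - c"] nq by simp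
    then have "(1 / (r * norm a)) *\<^sub>R (norm a *\<^sub>R (q - c)) = (1 / (r * norm a)) *\<^sub>R (r *\<^sub>R a)" by simp
    then show ?thesis using r a(1) by (simp add: n_def)
  qed
  have nQ: "z \<bullet> n \<le> q \<bullet> n" if "z \<in> Q" for z
    using aQ[OF that] a(1) by (simp add: na inner_commute[of _ a] divide_right_mono)
  have qc: "q - r *\<^sub>R n = c" using r by (simp add: n_def)
  have "touching Q n q r" unfolding touching_def qc using nn qQ r cballQ nQ by blast
  moreover have "q \<bullet> n < p \<bullet> n"
  proof (rule ccontr)
    assume "\<not> q \<bullet> n < p \<bullet> n"
    then have pn: "p \<bullet> n \<le> q \<bullet> n" by simp
    have "x0 + R *\<^sub>R n \<in> Q" using x0 nn by (intro subsetD[OF x0(2)]) (simp add: dist_norm)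
    from nQ[OF this] have xn: "x0 \<bullet> n + R \<le> q \<bullet> n" using nn by (simp add: inner_add_left norm_eq_1)
    have l1: "l < 1" using l b1 by simp
    have "c \<bullet> n = (1 - l) * (x0 \<bullet> n) + l * (p \<bullet> n)" by (simp add: c_def v_def inner_add_left inner_diff_left algebra_simps)
    also have "\<dots> \<le> (1 - l) * (q \<bullet> n - R) + l * (q \<bullet> n)" using l l1 xn pn by (intro add_mono mult_left_mono) auto
    finally have "c \<bullet> n \<le> q \<bullet> n - (1 - l) * R" by (simp add: algebra_simps)
    moreover have "q \<bullet> n - r = c \<bullet> n" using arg_cong[OF qc, of "\<lambda>z. z \<bullet> n"] nn by (simp add: inner_diff_left norm_eq_1)
    ultimately have "(1 - l) * R \<le> r" by simp
    moreover have "(1 - b) * R \<le> (1 - l) * R" using l x0(1) by (intro mult_right_mono) auto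
    ultimately have rl: "e * b * D < r" using eD by linarith
    define t where "t = min 1 (l + r / D)"
    have "e * b < r / D" using rl D by (simp add: pos_less_divide_eq)
    then have tb: "b < t" using l(3) b1 by (simp add: t_def)
    have "(t - l) * D \<le> (r / D) * D" using D by (intro mult_right_mono) (auto simp: t_def)
    then have tD: "(t - l) * D \<le> r" using D by simp
    have "c - (x0 + t *\<^sub>R v) = (l - t) *\<^sub>R v" by (simp add: c_def algebra_simps)
    then have "dist c (x0 + t *\<^sub>R v) = (t - l) * D" using tb l by (simp add: dist_norm D_def)
    then have "x0 + t *\<^sub>R v \<in> Q" using tD by (intro subsetD[OF cballQ]) simp
    then have "t \<in> T" using tb b01 by (simp add: T_def t_def)
    then show False using b(2)[of t] tb by simp
  qed
  ultimately show ?thesis using that by blast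
qed

text \<open>Induction on the dimension of \<open>R\<close>. The frame \<open>A\<close> contains two
  orthonormal vectors of \<open>R\<close>, so every single line pulls back to a proper subspace of
  \<open>R\<close>, and finitely many such subspaces contain all of \<open>N\<close> in
  \<open>R\<close>.\<close>

lemma finite_unit_vectors_if_projections:
  fixes N :: "'a::euclidean_space set"
  assumes N: "\<And>n. n \<in> N \<Longrightarrow> norm n = 1" and k: "2 \<le> k" "k \<le> DIM('a)"
    and fin: "\<And>A. orthonormal A \<Longrightarrow> card A = k \<Longrightarrow> finite {span {pr A n} |n. n \<in> N \<and> pr A n \<noteq> 0}"
  shows "subspace R \<Longrightarrow> finite (N \<inter> R)"
proof (induction "dim R" arbitrary: R rule: less_induct)
  case less
  obtain D where D: "orthonormal D" "span D = R" "card D = dim R" using orthonormal_basis_of[OF less.prems] by blast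
  show ?case
  proof (cases "dim R \<le> 1")
    case True
    have "\<exists>v. D \<subseteq> {v}"
    proof (cases "D = {}")
      case False
      then have "card D = 1" using D True orthonormal_finite[OF D(1)] card_gt_0_iff[of D] by linarith
      then show ?thesis by (metis card_1_singletonE subset_refl)
    qed auto
    then obtain v where v: "D \<subseteq> {v}" by blast
    have "N \<inter> R \<subseteq> {(1 / norm v) *\<^sub>R v, - (1 / norm v) *\<^sub>R v}"
    proof
      fix n assume n: "n \<in> N \<inter> R"
      then have "n \<in> span {v}" using D(2) span_mono[OF v] by blast
      then obtain t where t: "n = t *\<^sub>R v" by (auto simp: span_singleton)
      then have "\<bar>t\<bar> * norm v = 1" using N[of n] n by simp
      then have "\<bar>t\<bar> = 1 / norm v" by (metis mult_zero_right nonzero_eq_divide_eq zero_neq_one)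
      then have "t = 1 / norm v \<or> t = - (1 / norm v)" by linarith
      then show "n \<in> {(1 / norm v) *\<^sub>R v, - (1 / norm v) *\<^sub>R v}" using t by auto
    qed
    then show ?thesis by (rule finite_subset) simp
  next
    case False
    then obtain A0 where A0: "A0 \<subseteq> D" "card A0 = 2" "finite A0" using obtain_subset_with_card_n[of 2 D] D(3) by auto
    obtain C where C: "orthonormal (A0 \<union> C)" "A0 \<inter> C = {}" "card C = DIM('a) - card A0"
      using orthonormal_extend[OF orthonormal_subset[OF D(1) A0(1)]] by metis
    have "k - 2 \<le> card C" using C(3) A0(2) k by simp
    then obtain A1 where A1: "A1 \<subseteq> C" "card A1 = k - 2" "finite A1" using obtain_subset_with_card_n by metis
    let ?A = "A0 \<union> A1"
    have A: "orthonormal ?A" using A1(1) by (intro orthonormal_subset[OF C(1)]) auto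
    have "A0 \<inter> A1 = {}" using C(2) A1(1) by blast
    then have cA: "card ?A = k" using A0 A1 k by (simp add: card_Un_disjoint)
    obtain v1 v2 where v: "A0 = {v1, v2}" "v1 \<noteq> v2" using A0(2) by (auto simp: card_2_iff)
    have vR: "v1 \<in> R" "v2 \<in> R" using v A0(1) D(2) span_base by auto
    have vv: "v1 \<bullet> v2 = 0" "v1 \<noteq> 0" "v2 \<noteq> 0" using orthonormal_inner[OF A, of v1 v2] orthonormal_inner[OF A, of v1 v1] orthonormal_inner[OF A, of v2 v2] v by auto
    have "v1 \<in> ?A" "v2 \<in> ?A" using v(1) by auto
    then have pv: "pr ?A v1 = v1" "pr ?A v2 = v2" using pr_id[OF A span_base] by blast+
    \<comment> \<open>The zero subspace accounts for the vectors whose projection vanishes.\<close>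
    define L where "L = insert (span {0}) {span {pr ?A n} |n. n \<in> N \<and> pr ?A n \<noteq> 0}"
    have finL: "finite L" using fin[OF A cA] by (simp add: L_def)
    have "finite (N \<inter> {n\<in>R. pr ?A n \<in> l})" if "l \<in> L" for l
    proof -
      obtain u where u: "l = span {u}" using \<open>l \<in> L\<close> unfolding L_def by blast
      let ?R = "{n\<in>R. pr ?A n \<in> l}"
      have sub: "subspace ?R" using less.prems subspace_span[of "{u}"]
        by (auto simp: subspace_def u pr_add pr_scaleR)
      have "?R \<noteq> R"
      proof
        assume "?R = R"
        then have "v1 \<in> ?R" "v2 \<in> ?R" using vR by blast+
        then have "v1 \<in> span {u}" "v2 \<in> span {u}" using pv u by simp_all
        then obtain a b where "v1 = a *\<^sub>R u" "v2 = b *\<^sub>R u" by (auto simp: span_singleton)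
        then show False using vv by auto
      qed
      then have "?R \<subset> R" by blast
      then have "span ?R \<subset> span R" by (simp only: span_eq_iff[THEN iffD2, OF sub] span_eq_iff[THEN iffD2, OF less.prems])
      then have "dim ?R < dim R" by (rule dim_psubset)
      then show ?thesis using less.hyps sub by blast
    qed
    moreover have "N \<inter> R \<subseteq> (\<Union>l\<in>L. N \<inter> {n\<in>R. pr ?A n \<in> l})"
    proof
      fix n assume n: "n \<in> N \<inter> R"
      show "n \<in> (\<Union>l\<in>L. N \<inter> {n\<in>R. pr ?A n \<in> l})"
      proof (cases "pr ?A n = 0")
        case True then show ?thesis using n by (intro UN_I[of "span {0}"]) (auto simp: L_def)
      next
        case False
        then show ?thesis using n by (intro UN_I[of "span {pr ?A n}"]) (auto simp: L_def span_base)
      qed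
    qed
    ultimately show ?thesis using finL by (meson finite_UN finite_subset)
  qed
qed

lemma polyhedron_inequalities:
  assumes "polyhedron K" obtains I where "finite I" "K = {z. \<forall>(a, c)\<in>I. a \<bullet> z \<le> c}"
proof -
  obtain F where F: "finite F" "K = \<Inter> F" "\<forall>h\<in>F. \<exists>a b. a \<noteq> 0 \<and> h = {x. a \<bullet> x \<le> b}" using assms unfolding polyhedron_def by blast
  then obtain a b where ab: "\<And>h. h \<in> F \<Longrightarrow> h = {x. a h \<bullet> x \<le> b h}" by metis
  have "K = {z. \<forall>(a, c)\<in>(\<lambda>h. (a h, b h)) ` F. a \<bullet> z \<le> c}" unfolding F(2) using ab by auto
  then show ?thesis using F(1) that by blast
qed

text \<open>If the inequalities orthogonal to \<open>pr A n\<close> left a second direction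
  \<open>e2\<close> free, the section support functions of \<open>P\<close> would be additive on a
  small cone. The rotation identity would carry this to almost all sections of \<open>Q\<close>,
  against the defect caused by the touching ball.\<close>

lemma projection_body_touching_rigid:
  fixes P Q :: "'a::euclidean_space set"
  assumes PQ: "is_j_projection_body j P Q" and j: "1 \<le> j" "j < DIM('a)"
    and P: "convex P" "compact P" "origin_symmetric P" and Q: "convex Q" "compact Q" "origin_symmetric Q"
    and A: "orthonormal A" "card A = j + 1" and I: "finite I" "pr A ` P = {z. \<forall>(a, c)\<in>I. a \<bullet> z \<le> c}"
    and t: "touching Q n q r" and n0: "pr A n \<noteq> 0"
  shows "{x\<in>span A. \<forall>i\<in>I. fst i \<bullet> pr A n = 0 \<longrightarrow> fst i \<bullet> x = 0} = span {pr A n}" (is "?L = _")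
proof (intro set_eqI iffI)
  fix x assume "x \<in> span {pr A n}"
  then show "x \<in> ?L" by (auto simp: span_singleton span_scale)
next
  fix x assume x: "x \<in> ?L"
  show "x \<in> span {pr A n}"
  proof (rule ccontr)
    assume nx: "x \<notin> span {pr A n}"
    define c where "c = norm (pr A n)"
    have c: "c > 0" using n0 by (simp add: c_def)
    define e1 where "e1 = (1 / c) *\<^sub>R pr A n"
    have n1: "pr A n = c *\<^sub>R e1" using c by (simp add: e1_def)
    have e1: "e1 \<in> span A" "norm e1 = 1" using c by (auto simp: e1_def span_scale c_def)
    define x' where "x' = x - (x \<bullet> e1) *\<^sub>R e1"
    have x'0: "x' \<noteq> 0"
    proof
      assume "x' = 0"
      then have "x = ((x \<bullet> e1) / c) *\<^sub>R pr A n" by (simp add: x'_def e1_def)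
      then show False using nx by (metis span_base span_scale singletonI)
    qed
    define e2 where "e2 = (1 / norm x') *\<^sub>R x'"
    have xA: "x \<in> span A" using x by blast
    have e2: "e2 \<in> span A" "norm e2 = 1" using x'0 xA e1(1) by (auto simp: e2_def x'_def span_scale span_diff)
    have e21: "e2 \<bullet> e1 = 0" using e1(2) by (simp add: e2_def x'_def inner_diff_left norm_eq_1)
    have "snd i = snd i \<Longrightarrow> fst i \<bullet> e2 = 0" if "i \<in> I" "fst i \<bullet> e1 = 0" for i
    proof -
      have "fst i \<bullet> pr A n = 0" using that(2) n1 by simp
      then have "fst i \<bullet> x = 0" using x that(1) by blast
      then show ?thesis using that(2) by (simp add: e2_def x'_def inner_diff_right)
    qed
    \<comment> \<open>By the choice of \<open>x\<close>, every inequality normal orthogonal to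
      \<open>e1\<close> is orthogonal to \<open>e2\<close>, so finitely many quotients have a
      positive lower bound.\<close>
    then obtain eps where eps: "eps > 0" "\<forall>i\<in>I. eps * \<bar>fst i \<bullet> e2\<bar> \<le> \<bar>fst i \<bullet> e1\<bar>"
      using finite_uniform_eps[OF I(1), of "\<lambda>i. fst i \<bullet> e1" "\<lambda>i. fst i \<bullet> e2"] by blast
    obtain X1 where X1: "orthonormal (insert e1 X1)" "e1 \<notin> X1" "span (insert e1 X1) = span A" using orthonormal_basis_insert[OF A(1) e1] by blast
    have X1': "orthonormal X1" "finite X1" using orthonormal_subset[OF X1(1)] orthonormal_finite[OF X1(1)] by auto
    have "e2 = pr X1 e2"
      using pr_id[OF X1(1), of e2] e2(1) X1(3) pr_insert[OF X1'(2) X1(2), of e2] e21 by simp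
    then have "e2 \<in> span X1" by (metis pr_in_span)
    then obtain X where X: "orthonormal (insert e2 X)" "e2 \<notin> X" "span (insert e2 X) = span X1" using orthonormal_basis_insert[OF X1'(1) _ e2(2)] by blast
    have orth: "a \<bullet> b = 0" if "a \<in> {e1}" "b \<in> insert e2 X" for a b
    proof -
      have b: "b \<in> span X1" unfolding X(3)[symmetric] using that(2) by (rule span_base)
      have "pr X1 e1 = 0" using X1(2) orthonormal_inner[OF X1(1), of e1] by (intro pr_eq_0) auto
      then show ?thesis using pr_inner_span[OF X1'(1) b, of e1] that(1) by simp
    qed
    have on1: "orthonormal {e1}" using e1(2) by (simp add: orthonormal_def)
    note un = orthonormal_Un[OF on1 X(1) orth]
    have on: "orthonormal (insert e1 (insert e2 X))" "e1 \<notin> insert e2 X"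
      using un(1) un(2) unfolding insert_is_Un[of e1 "insert e2 X"] by blast+
    have sp: "span (insert e1 (insert e2 X)) = span A"
    proof -
      have "span ({e1} \<union> insert e2 X) = span ({e1} \<union> X1)" unfolding span_Un using X(3) by simp
      then show ?thesis using X1(3) by (metis insert_is_Un)
    qed
    have finX: "finite X" using orthonormal_finite[OF X(1)] by simp
    have cX: "card X + 1 = j" using orthonormal_card[OF on(1)] orthonormal_card[OF A(1)] sp A(2) on(2) X(2) finX by simp
    obtain Y where Y: "orthonormal (insert e1 (insert e2 X) \<union> Y)" "insert e1 (insert e2 X) \<inter> Y = {}" "span (insert e1 (insert e2 X) \<union> Y) = UNIV"
      "card Y = DIM('a) - card (insert e1 (insert e2 X))" using orthonormal_extend[OF on(1)] by metis
    have cY: "card Y + 1 = DIM('a) - j" using Y(4) on(2) X(2) finX cX j by simp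
    have pY: "orthonormal Y" using Y(1) orthonormal_subset by blast
    have onXY: "orthonormal (X \<union> {e1, e2} \<union> Y)" using Y(1) by (simp add: insert_commute Un_commute)
    have dis: "X \<inter> Y = {}" "e1 \<notin> X" "e2 \<notin> X" "e1 \<notin> Y" "e2 \<notin> Y" "e1 \<noteq> e2" using Y(2) on(2) X(2) by auto
    note rot = projection_body_rotation[OF PQ P Q onXY dis cX cY less_imp_le[OF j(2)]]
    have prA: "pr (insert e1 (insert e2 X)) = pr A" using pr_span_eq[OF on(1) A(1) sp] by blast
    have add: "hf X P w (eps *\<^sub>R e1 - e2) + hf X P w ((- eps) *\<^sub>R e1 - e2) = hf X P w (0 *\<^sub>R e1 - 2 *\<^sub>R e2)" for w
      using eps(2) by (intro hf_additive_if_polytope[OF on X(2) P(2) I(1) _ eps(1)]) (auto simp: prA I(2))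
    have onX: "orthonormal X" using orthonormal_subset[OF X(1)] by blast
    note iP = hf_integrable[OF onX onX P(2)] and iQ = hf_integrable[OF pY pY Q(2)]
    let ?g = "\<lambda>y. hf Y Q y (e1 + eps *\<^sub>R e2) + hf Y Q y (e1 - eps *\<^sub>R e2) - hf Y Q y (2 *\<^sub>R e1)"
    have "(\<integral>w. hf X P w (eps *\<^sub>R e1 - e2) \<partial>lam X) + (\<integral>w. hf X P w ((- eps) *\<^sub>R e1 - e2) \<partial>lam X) = (\<integral>w. hf X P w (0 *\<^sub>R e1 - 2 *\<^sub>R e2) \<partial>lam X)"
      unfolding add[symmetric] by (rule Bochner_Integration.integral_add[symmetric]) (rule iP)+
    \<comment> \<open>The rotation is used at \<open>\<beta> = -1\<close> with
      \<open>\<alpha> = eps\<close> and \<open>\<alpha> = - eps\<close>, and at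
      \<open>(0, -2)\<close>, the sum of these two parameter pairs.\<close>
    moreover have "eps *\<^sub>R e1 + (-1) *\<^sub>R e2 = eps *\<^sub>R e1 - e2" "eps *\<^sub>R e2 - (-1) *\<^sub>R e1 = e1 + eps *\<^sub>R e2"
      "(- eps) *\<^sub>R e1 + (-1) *\<^sub>R e2 = (- eps) *\<^sub>R e1 - e2" "(- eps) *\<^sub>R e2 - (-1) *\<^sub>R e1 = e1 - eps *\<^sub>R e2"
      "0 *\<^sub>R e1 + (-2) *\<^sub>R e2 = 0 *\<^sub>R e1 - 2 *\<^sub>R e2" "0 *\<^sub>R e2 - (-2) *\<^sub>R e1 = 2 *\<^sub>R e1" by simp_all
    note rot[of eps "-1", unfolded this] rot[of "- eps" "-1", unfolded this] rot[of 0 "-2", unfolded this]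
    ultimately have "(\<integral>y. hf Y Q y (e1 + eps *\<^sub>R e2) \<partial>lam Y) + (\<integral>y. hf Y Q y (e1 - eps *\<^sub>R e2) \<partial>lam Y) = (\<integral>y. hf Y Q y (2 *\<^sub>R e1) \<partial>lam Y)"
      by (simp only:)
    then have "(\<integral>y. ?g y \<partial>lam Y) = 0" by (simp add: iQ)
    moreover have "integrable (lam Y) ?g" by (intro Bochner_Integration.integrable_diff Bochner_Integration.integrable_add iQ)
    \<comment> \<open>Subadditivity of support functions: since the integral vanishes, additivity
      must hold for almost every section of \<open>Q\<close>.\<close>
    moreover have "?g y \<ge> 0" for y
    proof -
      have "(e1 + eps *\<^sub>R e2) + (e1 - eps *\<^sub>R e2) = 2 *\<^sub>R e1" by (simp add: scaleR_2)
      then show ?thesis using hf_subadd[OF Q(2), of Y y "e1 + eps *\<^sub>R e2" "e1 - eps *\<^sub>R e2"] by simp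
    qed
    ultimately have g0: "AE y in lam Y. ?g y = 0" using integral_nonneg_eq_0_iff_AE[of "lam Y" ?g] by simp
    have "n = c *\<^sub>R e1 + pr Y n" using pr_decomp[OF Y(1,2,3), of n] prA n1 by simp
    moreover have "orthonormal (insert e1 (insert e2 Y))" by (rule orthonormal_subset[OF Y(1)]) auto
    ultimately obtain d where d: "d > 0" "\<And>y. y \<in> span Y \<inter> ball (pr Y q) d \<Longrightarrow> ?g y > 0"
      using touching_hf_defect[OF _ _ _ Q(2) t _ c eps(1), of e1 e2 Y] Y(2) on(2) by (auto simp: less_diff_eq)
    have "AE y in lam Y. y \<notin> ball (pr Y q) d"
      using g0 AE_lam_span[of Y] by eventually_elim (use d(2) in force)
    then have "emeasure (lam Y) (ball (pr Y q) d) = 0" by (subst (asm) AE_iff_measurable[of "ball (pr Y q) d"]) auto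
    then show False using emeasure_lam_ball_pos[OF pY _ d(1), of "pr Y q"] by simp
  qed
qed

theorem polytope_projection_body:
  fixes P Q :: "'a::euclidean_space set"
  assumes PQ: "is_j_projection_body j P Q" and j: "1 \<le> j" "j < DIM('a)"
    and P: "polytope P" "origin_symmetric P" and Q: "convex Q" "compact Q" "origin_symmetric Q" "interior Q \<noteq> {}"
  shows "polytope Q"
proof -
  note P' = polytope_imp_convex[OF P(1)] polytope_imp_compact[OF P(1)] P(2)
  define N where "N = {n. \<exists>q r. touching Q n q r}"
  have "finite (N \<inter> UNIV)"
  proof (rule finite_unit_vectors_if_projections[of N "j + 1"])
    fix A :: "'a set" assume A: "orthonormal A" "card A = j + 1"
    have "polyhedron (pr A ` P)" by (intro polytope_imp_polyhedron polytope_linear_image linear_pr P(1))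
    then obtain I where I: "finite I" "pr A ` P = {z. \<forall>(a, c)\<in>I. a \<bullet> z \<le> c}" by (rule polyhedron_inequalities)
    \<comment> \<open>Each line is recovered from the subset of \<open>I\<close> orthogonal to it,
      so there are at most as many lines as subsets of \<open>I\<close>.\<close>
    have "span {pr A n} \<in> (\<lambda>J. {x\<in>span A. \<forall>i\<in>J. fst i \<bullet> x = 0}) ` Pow I" if n: "n \<in> N" "pr A n \<noteq> 0" for n
    proof -
      obtain q r where "touching Q n q r" using n(1) by (auto simp: N_def)
      have "span {pr A n} = {x\<in>span A. \<forall>i\<in>I. fst i \<bullet> pr A n = 0 \<longrightarrow> fst i \<bullet> x = 0}"
        by (rule projection_body_touching_rigid[OF PQ j P' Q(1-3) A I \<open>touching Q n q r\<close> n(2), symmetric])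
      also have "\<dots> = {x\<in>span A. \<forall>i\<in>{i\<in>I. fst i \<bullet> pr A n = 0}. fst i \<bullet> x = 0}" by blast
      finally show ?thesis by (rule image_eqI) auto
    qed
    then have "{span {pr A n} |n. n \<in> N \<and> pr A n \<noteq> 0} \<subseteq> (\<lambda>J. {x\<in>span A. \<forall>i\<in>J. fst i \<bullet> x = 0}) ` Pow I" by blast
    then show "finite {span {pr A n} |n. n \<in> N \<and> pr A n \<noteq> 0}" by (rule finite_subset) (simp add: I(1))
  qed (use j in \<open>auto simp: N_def touching_def\<close>)
  then have finN: "finite N" by simp
  have "\<forall>n\<in>N. \<exists>q. q \<in> Q \<and> (\<forall>z\<in>Q. z \<bullet> n \<le> q \<bullet> n)" by (auto simp: N_def touching_def)
  then obtain f where f: "\<And>n. n \<in> N \<Longrightarrow> f n \<in> Q" "\<And>n z. n \<in> N \<Longrightarrow> z \<in> Q \<Longrightarrow> z \<bullet> n \<le> f n \<bullet> n" by metis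
  let ?H = "\<Inter>n\<in>N. {z. n \<bullet> z \<le> f n \<bullet> n}"
  have "Q = ?H"
  proof
    show "Q \<subseteq> ?H" using f(2) by (auto simp: inner_commute)
    show "?H \<subseteq> Q"
    proof (rule subsetI, rule ccontr)
      fix p assume p: "p \<in> ?H" "p \<notin> Q"
      \<comment> \<open>The cut at \<open>q\<close> is the same as the cut at \<open>f n\<close>,
        because a supporting halfspace is determined by its normal.\<close>
      obtain n q r where t: "touching Q n q r" "q \<bullet> n < p \<bullet> n" using touching_point_exists[OF Q(1,2,4) p(2)] by blast
      then have nN: "n \<in> N" by (auto simp: N_def)
      have "f n \<bullet> n \<le> q \<bullet> n" using t(1) f(1)[OF nN] by (simp add: touching_def)
      moreover have "n \<bullet> p \<le> f n \<bullet> n" using p(1) nN by blast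
      ultimately show False using t(2) by (simp add: inner_commute)
    qed
  qed
  moreover have "polyhedron ?H" using finN polyhedron_halfspace_le by (intro polyhedron_Inter) auto
  ultimately have "polyhedron Q" by simp
  then show ?thesis using compact_imp_bounded[OF Q(2)] by (simp add: polytope_eq_bounded_polyhedron)
qed

section \<open>Detection of faces and comparison of constants\<close>

lemma face_iff_suppset:
  assumes BC: "orthonormal (B \<union> C)" "B \<inter> C = {}" "span (B \<union> C) = UNIV" and P: "polytope P"
  shows "(\<exists>G. G face_of P \<and> aff_dim G = int (card C) \<and> affine_parallel (span C) (affine hull G)) \<longleftrightarrow> measure lborel (suppset P B C) > 0"
  using suppset_null_if_no_face[OF BC P] suppset_pos_if_face[OF BC P] by (metis less_irrefl)

text \<open>Balances the binomials against the dimension factors with which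
  \<open>area_measure_eq\<close> equips \<open>P\<close> and \<open>Q\<close>.\<close>

lemma binomial_ratio:
  assumes "1 \<le> j" "j < n"
  shows "j * (n - 1 choose j) = (n - j) * (n - 1 choose (n - j))"
proof -
  obtain i where i: "j = Suc i" using assms by (cases j) auto
  have "Suc i * (n - 1 choose Suc i) = (n - 1 - i) * (n - 1 choose i)"
    using binomial_absorption[of i "n - 1"] binomial_absorb_comp[of "n - 1" i] by simp
  moreover have "(n - 1 choose i) = (n - 1 choose (n - 1 - i))" using assms i by (intro binomial_symmetric) simp
  ultimately show ?thesis using i by simp
qed

theorem theorem5p3:
  fixes P Q :: "'a::euclidean_space set" and j :: nat
  assumes n3: "DIM('a) \<ge> 3"
    and j1: "1 \<le> j" and j2: "j \<le> DIM('a) - 1"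
    and P: "convex_body P" "origin_symmetric P" "interior P \<noteq> {}"
    and Q: "convex_body Q" "origin_symmetric Q" "interior Q \<noteq> {}"
    and PQ: "is_j_projection_body j P Q"
  shows "(\<forall>E\<in>grassmannian (DIM('a) - j).
            area_measure j P (sphere 0 1 \<inter> E) =
              unit_ball_vol (real (DIM('a) - j)) / unit_ball_vol (real j) *
              area_measure (DIM('a) - j) Q (sphere 0 1 \<inter> orthogonal_comp E))
       \<and> (polytope P \<longrightarrow>
            polytope Q \<and>
            (\<forall>F\<in>grassmannian j.
               (\<exists>G. G face_of P \<and> aff_dim G = int j \<and> affine_parallel F (affine hull G)) \<longleftrightarrow>
               (\<exists>G. G face_of Q \<and> aff_dim G = int (DIM('a) - j) \<and>
                    affine_parallel (orthogonal_comp F) (affine hull G))))"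
proof -
  let ?n = "DIM('a)"
  have jn: "j < ?n" "?n - (?n - j) = j" using j1 j2 by auto
  have P': "convex P" "compact P" and Q': "convex Q" "compact Q" using P(1) Q(1) by (auto simp: convex_body_def)
  have n2: "?n \<ge> 2" using n3 by simp
  have transfer: "unit_ball_vol (real j) * measure lborel (suppset P B C) = unit_ball_vol (real (?n - j)) * measure lborel (suppset Q C B)"
    if BC: "orthonormal (B \<union> C)" "B \<inter> C = {}" "span (B \<union> C) = UNIV" and c: "card C = j" "card B = ?n - j" for B C
  proof -
    have "B \<noteq> {}" "C \<noteq> {}" using c j1 jn by auto
    moreover have "is_j_projection_body (card C) P Q" using PQ c by simp
    ultimately show ?thesis using suppset_projection_body[OF _ P' P(2) Q' Q(2) BC] c by simp
  qed
  have kpos: "unit_ball_vol (real j) > 0" "unit_ball_vol (real (?n - j)) > 0" by auto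
  show ?thesis
  proof (intro conjI impI ballI)
    fix E :: "'a set" assume "E \<in> grassmannian (?n - j)"
    then have E: "subspace E" "dim E = ?n - j" by (auto simp: grassmannian_def)
    obtain B where B: "orthonormal B" "span B = E" "card B = dim E" using orthonormal_basis_of[OF E(1)] by blast
    obtain C where C: "orthonormal (B \<union> C)" "B \<inter> C = {}" "span (B \<union> C) = UNIV" "span C = orthogonal_comp (span B)" "card C = ?n - card B"
      using orthonormal_extend[OF B(1)] by blast
    have c: "card C = j" "card B = ?n - j" using C(5) B(3) E(2) jn by auto
    have CB: "orthonormal (C \<union> B)" "C \<inter> B = {}" "span (C \<union> B) = UNIV" using C(1-3) by (simp_all add: Un_commute Int_commute)
    have ne: "B \<noteq> {}" "C \<noteq> {}" using c j1 jn by auto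
    \<comment> \<open>One constant for both bodies, so that it drops out of the comparison.\<close>
    obtain c0 where c0: "slabconst TYPE('a) c0" using slabconst_exists[OF n2] by blast
    have aP: "area_measure j P (sphere 0 1 \<inter> E) = c0 * real (?n - j) * measure lborel (suppset P B C) / real (?n - 1 choose j)"
      using area_measure_eq[OF n2 c0 C(1-3) P' P(3) ne(1)] c jn B(2) by simp
    have aQ: "area_measure (?n - j) Q (sphere 0 1 \<inter> orthogonal_comp E) = c0 * real j * measure lborel (suppset Q C B) / real (?n - 1 choose (?n - j))"
      using area_measure_eq[OF n2 c0 CB Q' Q(3) ne(2)] c jn B(2) C(4) by simp
    have bin: "real j * real (?n - 1 choose j) = real (?n - j) * real (?n - 1 choose (?n - j))"
      using arg_cong[OF binomial_ratio[OF j1 jn(1)], of real] by simp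
    have bpos: "real (?n - 1 choose j) > 0" "real (?n - 1 choose (?n - j)) > 0" using j1 j2 by (auto simp: zero_less_binomial_iff)
    have VP: "measure lborel (suppset P B C) = unit_ball_vol (real (?n - j)) / unit_ball_vol (real j) * measure lborel (suppset Q C B)"
    proof -
      have "measure lborel (suppset P B C) = unit_ball_vol (real j) * measure lborel (suppset P B C) / unit_ball_vol (real j)"
        using kpos(1) by (intro nonzero_mult_div_cancel_left[symmetric]) linarith
      then show ?thesis unfolding transfer[OF C(1-3) c] by simp
    qed
    have r: "real (?n - j) / real (?n - 1 choose j) = real j / real (?n - 1 choose (?n - j))"
      using bin bpos by (simp add: field_simps)
    have "area_measure j P (sphere 0 1 \<inter> E) = c0 * measure lborel (suppset P B C) * (real (?n - j) / real (?n - 1 choose j))"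
      unfolding aP by simp
    also have "\<dots> = unit_ball_vol (real (?n - j)) / unit_ball_vol (real j) * area_measure (?n - j) Q (sphere 0 1 \<inter> orthogonal_comp E)"
      unfolding aQ r VP by simp
    finally show "area_measure j P (sphere 0 1 \<inter> E) = unit_ball_vol (real (?n - j)) / unit_ball_vol (real j) * area_measure (?n - j) Q (sphere 0 1 \<inter> orthogonal_comp E)" .
  next
    assume pP: "polytope P"
    show pQ: "polytope Q" by (rule polytope_projection_body[OF PQ j1 jn(1) pP P(2) Q' Q(2,3)])
    fix F :: "'a set" assume "F \<in> grassmannian j"
    then have F: "subspace F" "dim F = j" by (auto simp: grassmannian_def)
    obtain C where C: "orthonormal C" "span C = F" "card C = dim F" using orthonormal_basis_of[OF F(1)] by blast
    obtain B where B: "orthonormal (C \<union> B)" "C \<inter> B = {}" "span (C \<union> B) = UNIV" "span B = orthogonal_comp (span C)" "card B = ?n - card C"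
      using orthonormal_extend[OF C(1)] by blast
    have c: "card C = j" "card B = ?n - j" using B(5) C(3) F(2) by auto
    have BC: "orthonormal (B \<union> C)" "B \<inter> C = {}" "span (B \<union> C) = UNIV" using B(1-3) by (simp_all add: Un_commute Int_commute)
    \<comment> \<open>Faces are detected by positivity of support volumes, which the transfer
      identity preserves.\<close>
    have "measure lborel (suppset P B C) > 0 \<longleftrightarrow> unit_ball_vol (real j) * measure lborel (suppset P B C) > 0"
      using kpos by (simp add: zero_less_mult_iff)
    also have "\<dots> \<longleftrightarrow> measure lborel (suppset Q C B) > 0"
      unfolding transfer[OF BC c] using kpos by (simp add: zero_less_mult_iff)
    finally show "(\<exists>G. G face_of P \<and> aff_dim G = int j \<and> affine_parallel F (affine hull G)) \<longleftrightarrow>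
      (\<exists>G. G face_of Q \<and> aff_dim G = int (?n - j) \<and> affine_parallel (orthogonal_comp F) (affine hull G))"
      using face_iff_suppset[OF BC pP] face_iff_suppset[OF B(1-3) pQ] c C(2) B(4) by simp
  qed
qed

end
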